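(* Let $\mu$ be a transition weight on $\mathbb{Z}^d$, $d\ge3$, and let $$G_\mu\colon\mathbb{Z}^d\to(0,\infty),\qquad G_\mu(x)=\frac{1}{(2\pi)^d}\int_{[-\pi,\pi]^d}\frac{e^{-i\langle x,\xi\rangle}}{1-\widehat{\mu}_0(\xi)}\,d\xi .$$ Then $$w_\mu\colon\mathbb{Z}^d\to[0,\infty),\qquad w_\mu(x)=\frac{\Delta_\mu G_\mu^{1/2}(x)}{G_\mu^{1/2}(x)},$$ defines a null-critical Hardy weight on $\mathbb{Z}^d$ (for the graph $b_\mu$). If additionally $\|\mu\|_{d+3}=\sum_{x\in\mathbb{Z}^d}\mu(x)|x|^{d+3}<\infty$, then as $|x|\to\infty$, $$w_\mu(x)=\frac{(d-2)^2(\det\Sigma_\mu)^{1/d}}{8|x|_\mu^2}+\mathcal{O}\big(|x|^{-4}\big).$$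
   Context: $|\cdot|$ is the Euclidean norm. A transition weight on $\mathbb{Z}^d$ is a function $\mu\colon\mathbb{Z}^d\to[0,\infty)$ whose support generates $\mathbb{Z}^d$ as an additive group, with $\mu(x)=\mu(-x)$ for all $x$, and $\sum_x\mu(x)|x|^2<\infty$. It need not be normalized. Write $\mu_0=\mu/\sum_x\mu(x)$ and $\widehat{\mu}_0(\xi)=\sum_x\mu_0(x)e^{-i\langle x,\xi\rangle}$. Covariance matrix: $\Sigma_\mu=\sum_x\mu(x)xx^T$ (symmetric positive definite). Set $x_\mu=(\det\Sigma_\mu)^{1/(2d)}\,\Sigma_\mu^{-1/2}x$ and $|x|_\mu=|x_\mu|$. Graph and Laplacian: $b_\mu(x,y)=\mu(x-y)$ for $x\ne y$, $b_\mu(x,x)=0$, over $X=\mathbb{Z}^d$. $\mathcal{F}$ is the set of $f\colon X\to\mathbb{R}$ with $\sum_y b_\mu(x,y)|f(y)|<\infty$ for all $x$; for $f\in\mathcal{F}$, $\Delta_\mu f(x)=\sum_y b_\mu(x,y)(f(x)-f(y))$. For finitely supported $\varphi$, $\mathcal{Q}(\varphi)=\frac12\sum_{x,y}b_\mu(x,y)(\varphi(x)-\varphi(y))^2$. Hardy weights: a non-trivial function $w\colon X\to[0,\infty)$ is a Hardy weight on $X$ if $\mathcal{Q}(\varphi)\ge\sum_{x\in X}w(x)\varphi(x)^2$ for all finitely supported $\varphi\colon X\to\mathbb{R}$. It is critical if every Hardy weight $w'\ge w$ satisfies $w'=w$. In this case there is a unique (up to scalar multiples) positive function $u\in\mathcal{F}$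 with $\Delta_\mu u=wu$, called the (Agmon) ground state. A critical Hardy weight is null-critical if $\sum_{x\in X}w(x)u(x)^2=\infty$ for its ground state $u$. *)

theory Defs
  imports
    "HOL-Analysis.Analysis"
    "HOL-Library.Landau_Symbols"
    "HOL-Computational_Algebra.Group_Closure"
begin

section \<open>Weighted graphs and Hardy weights\<close>

text \<open>A graph over the vertex type \<open>'a\<close> is given by its edge weight
  \<open>b :: 'a \<Rightarrow> 'a \<Rightarrow> real\<close>, always intended to be symmetric, nonnegative, zero on the diagonal,
  with summable rows. Under these assumptions, the sums in \<open>laplacian\<close> (for \<open>f\<close> in
  \<open>form_domain b\<close>) and \<open>energy\<close> (for finitely supported functions) converge absolutely,
  so the default value of \<open>infsum\<close> for non-summable families plays no role.\<close>

definition form_domain :: "('a \<Rightarrow> 'a \<Rightarrow> real) \<Rightarrow> ('a \<Rightarrow> real) set" where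
  "form_domain b = {f. \<forall>x. (\<lambda>y. b x y * \<bar>f y\<bar>) summable_on UNIV}"

definition laplacian :: "('a \<Rightarrow> 'a \<Rightarrow> real) \<Rightarrow> ('a \<Rightarrow> real) \<Rightarrow> 'a \<Rightarrow> real" where
  "laplacian b f x = (\<Sum>\<^sub>\<infinity>y. b x y * (f x - f y))"

definition energy :: "('a \<Rightarrow> 'a \<Rightarrow> real) \<Rightarrow> ('a \<Rightarrow> real) \<Rightarrow> real" where
  "energy b \<phi> = 1 / 2 * (\<Sum>\<^sub>\<infinity>(x, y). b x y * (\<phi> x - \<phi> y)\<^sup>2)"

definition hardy_weight :: "('a \<Rightarrow> 'a \<Rightarrow> real) \<Rightarrow> ('a \<Rightarrow> real) \<Rightarrow> bool" where
  "hardy_weight b w \<longleftrightarrow>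
     (\<forall>x. 0 \<le> w x) \<and> (\<exists>x. w x \<noteq> 0) \<and>
     (\<forall>\<phi>. finite {x. \<phi> x \<noteq> 0} \<longrightarrow> (\<Sum>\<^sub>\<infinity>x. w x * (\<phi> x)\<^sup>2) \<le> energy b \<phi>)"

definition critical_hardy_weight :: "('a \<Rightarrow> 'a \<Rightarrow> real) \<Rightarrow> ('a \<Rightarrow> real) \<Rightarrow> bool" where
  "critical_hardy_weight b w \<longleftrightarrow>
     hardy_weight b w \<and>
     (\<forall>w'. hardy_weight b w' \<longrightarrow> (\<forall>x. w x \<le> w' x) \<longrightarrow> w' = w)"

definition ground_state :: "('a \<Rightarrow> 'a \<Rightarrow> real) \<Rightarrow> ('a \<Rightarrow> real) \<Rightarrow> ('a \<Rightarrow> real) \<Rightarrow> bool" where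
  "ground_state b w u \<longleftrightarrow>
     u \<in> form_domain b \<and> (\<forall>x. 0 < u x) \<and> (\<forall>x. laplacian b u x = w x * u x)"

text \<open>The ground state of a critical Hardy weight exists and is unique up to scalar multiples.
  In order not to depend on this fact, the definition requires both that some ground state
  exists and that every ground state is of infinite weighted norm. As the summands are
  nonnegative, divergence to infinity is the negation of summability.\<close>

definition null_critical_hardy_weight :: "('a \<Rightarrow> 'a \<Rightarrow> real) \<Rightarrow> ('a \<Rightarrow> real) \<Rightarrow> bool" where
  "null_critical_hardy_weight b w \<longleftrightarrow>
     critical_hardy_weight b w \<and>
     (\<exists>u. ground_state b w u) \<and>
     (\<forall>u. ground_state b w u \<longrightarrow> \<not> (\<lambda>x. w x * (u x)\<^sup>2) summable_on UNIV)"

section \<open>Transition weights on the integer lattice\<close>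

definition real_vec :: "int ^ 'd \<Rightarrow> real ^ 'd" where
  "real_vec x = (\<chi> i. real_of_int (x $ i))"

definition transition_weight :: "(int ^ 'd \<Rightarrow> real) \<Rightarrow> bool" where
  "transition_weight \<mu> \<longleftrightarrow>
     (\<forall>x. 0 \<le> \<mu> x) \<and>
     group_closure {x. \<mu> x \<noteq> 0} = UNIV \<and>
     (\<forall>x. \<mu> x = \<mu> (- x)) \<and>
     (\<lambda>x. \<mu> x * (norm (real_vec x))\<^sup>2) summable_on UNIV"

definition normalized_weight :: "(int ^ 'd \<Rightarrow> real) \<Rightarrow> int ^ 'd \<Rightarrow> real" where
  "normalized_weight \<mu> x = \<mu> x / (\<Sum>\<^sub>\<infinity>y. \<mu> y)"

definition fourier :: "(int ^ 'd \<Rightarrow> real) \<Rightarrow> real ^ 'd \<Rightarrow> complex" where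
  "fourier \<nu> \<xi> = (\<Sum>\<^sub>\<infinity>x. complex_of_real (\<nu> x) * exp (- (\<i> * complex_of_real (real_vec x \<bullet> \<xi>))))"

definition weight_graph :: "(int ^ 'd \<Rightarrow> real) \<Rightarrow> int ^ 'd \<Rightarrow> int ^ 'd \<Rightarrow> real" where
  "weight_graph \<mu> x y = (if x = y then 0 else \<mu> (x - y))"

definition covariance :: "(int ^ 'd \<Rightarrow> real) \<Rightarrow> real ^ 'd ^ 'd" where
  "covariance \<mu> = (\<chi> i j. \<Sum>\<^sub>\<infinity>x. \<mu> x * real_vec x $ i * real_vec x $ j)"

text \<open>The unique positive semidefinite square root; only meaningful if \<open>A\<close> is
  symmetric and positive semidefinite.\<close>

definition psd_sqrt :: "real ^ 'd ^ 'd \<Rightarrow> real ^ 'd ^ 'd" where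
  "psd_sqrt A = (THE B. transpose B = B \<and> (\<forall>v. 0 \<le> v \<bullet> (B *v v)) \<and> B ** B = A)"

definition scaled_vec :: "(int ^ 'd \<Rightarrow> real) \<Rightarrow> real ^ 'd \<Rightarrow> real ^ 'd" where
  "scaled_vec \<mu> v =
     (det (covariance \<mu>) powr (1 / (2 * real CARD('d)))) *\<^sub>R
       (psd_sqrt (matrix_inv (covariance \<mu>)) *v v)"

definition scaled_norm :: "(int ^ 'd \<Rightarrow> real) \<Rightarrow> real ^ 'd \<Rightarrow> real" where
  "scaled_norm \<mu> v = norm (scaled_vec \<mu> v)"

section \<open>The Green function and the associated weight\<close>

text \<open>At \<open>\<xi> = 0\<close> the denominator vanishes; division by zero yields \<open>0\<close> there, on a null set.\<close>

definition green_integrand :: "(int ^ 'd \<Rightarrow> real) \<Rightarrow> int ^ 'd \<Rightarrow> real ^ 'd \<Rightarrow> complex" where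
  "green_integrand \<mu> x \<xi> =
     exp (- (\<i> * complex_of_real (real_vec x \<bullet> \<xi>))) / (1 - fourier (normalized_weight \<mu>) \<xi>)"

definition fourier_cube :: "(real ^ 'd) set" where
  "fourier_cube = cbox (\<chi> i. - pi) (\<chi> i. pi)"

definition green_complex :: "(int ^ 'd \<Rightarrow> real) \<Rightarrow> int ^ 'd \<Rightarrow> complex" where
  "green_complex \<mu> x =
     1 / (2 * complex_of_real pi) ^ CARD('d) *
       (LINT \<xi>:fourier_cube|lborel. green_integrand \<mu> x \<xi>)"

text \<open>The integral defining \<open>green_complex\<close> is real by the symmetry of the weight.\<close>

definition green :: "(int ^ 'd \<Rightarrow> real) \<Rightarrow> int ^ 'd \<Rightarrow> real" where
  "green \<mu> x = Re (green_complex \<mu> x)"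

definition green_hardy :: "(int ^ 'd \<Rightarrow> real) \<Rightarrow> int ^ 'd \<Rightarrow> real" where
  "green_hardy \<mu> x =
     laplacian (weight_graph \<mu>) (\<lambda>y. sqrt (green \<mu> y)) x / sqrt (green \<mu> x)"

end

theory Submission
  imports Defs "HOL-Probability.Characteristic_Functions"
begin

text \<open>
  Let \<open>G\<close> be a positive function that vanishes at infinity and whose Laplacian is a positive
  multiple of the unit mass at one vertex, and let \<open>u\<close> be its square root. From \<open>u\<^sup>2 = G\<close> one
  gets \<open>2 u \<Delta>u = \<Delta>G + \<Sum>\<^sub>y b(x,y) (u x - u y)\<^sup>2\<close>, so that \<open>w = \<Delta>u / u\<close> is nonnegative, and \<open>u\<close>
  is a positive solution of \<open>\<Delta>u = w u\<close>. By the ground state transform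
  (\<open>ground_state_transform\<close>) the deficit in the Hardy inequality is a sum of squares of
  differences of \<open>\<phi> / u\<close>, weighted with \<open>b(x,y) u x u y\<close>. For \<open>\<phi> = u \<psi>\<close> with a cutoff \<open>\<psi>\<close> that
  is linear in \<open>ln G\<close> over an interval of length \<open>L\<close>, the inequality between the geometric and the
  logarithmic mean bounds this sum by \<open>1/L\<close> times the mixed Dirichlet form of \<open>\<psi>\<close> and \<open>G\<close>, which
  the Green formula evaluates. Hence there is a null sequence (\<open>null_sequence\<close>), from which
  criticality (\<open>critical_w\<close>) and the uniqueness of the ground state
  (\<open>ground_state_proportional\<close>) follow. If \<open>w u\<^sup>2\<close> were summable, then \<open>u\<close> would have finite
  energy, and a linear cutoff of \<open>u\<close> at low levels would have arbitrarily small mixed Dirichlet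
  form with \<open>G\<close>, whereas the Green formula gives a positive constant
  (\<open>u_not_square_summable\<close>).

  For the lattice, the Green function is up to a factor the Fourier coefficient of \<open>1 / Psi\<close>,
  where \<open>Psi\<close> is the characteristic exponent. Since the support of the weight generates the
  lattice, \<open>Psi\<close> is bounded below by a multiple of \<open>|\<xi>|\<^sup>2\<close> on the torus (\<open>Psi_elliptic\<close>), and
  \<open>1 / Psi\<close> is integrable in dimension at least three. Bessel's inequality then shows that the
  Green function vanishes at infinity (\<open>torus_riemann_lebesgue\<close>), multiplication by \<open>Psi\<close> on the
  Fourier side computes its Laplacian (\<open>potential_laplacian\<close>), and the strong minimum principle
  (\<open>superharmonic_positive\<close>) makes it positive.

  For the asymptotics, \<open>1 / Psi\<close> is compared with \<open>exp (- q) / q\<close> on the whole space, where \<open>q\<close>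
  is the quadratic form of the covariance matrix, divided by two. The Fourier transform of this
  kernel is an integral of Gaussians and agrees with a multiple of the Newtonian kernel up to
  terms of arbitrarily high order (\<open>regular_kernel_asymptotics\<close>). The difference of the two
  singularities is a symbol of order \<open>0\<close> with \<open>d + 2\<close> derivatives, for which the moment of order
  \<open>d + 3\<close> is used (\<open>singularity_symbol\<close>). Instead of integrating by parts, one translates by
  the step that flips the sign of the oscillating factor (\<open>integral_kernel_fdiff\<close>). This yields a
  decay of the error like \<open>|x|\<^sup>-\<^sup>d\<close> and of its first differences like \<open>|x|\<^sup>-\<^sup>d\<^sup>-\<^sup>1\<close>
  (\<open>oscillatory_decay\<close>, \<open>error_bound\<close>, \<open>error_difference_bound\<close>). This is all that the formula
  \<open>2 w = \<Sum>\<^sub>y b(x,y) (1 - u y / u x)\<^sup>2\<close>, valid away from the origin, requires, as it contains first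
  differences of \<open>u\<close> only. Expanding the square, the leading term is
  of second order in \<open>|y - x| / |x|\<close> and its sum is a second moment of the weight; the
  term of third order is odd in \<open>y - x\<close> and cancels by symmetry; the rest is of fourth order
  (\<open>increment_expansion\<close>, \<open>weight_expansion\<close>).
\<close>

section \<open>The ground state transform\<close>

locale weighted_graph =
  fixes b :: "'a \<Rightarrow> 'a \<Rightarrow> real"
  assumes b_nonneg: "0 \<le> b x y"
    and b_sym: "b x y = b y x"
    and b_row: "(\<lambda>y. b x y) summable_on UNIV"
begin

lemma laplacian_has_sum:
  assumes "f \<in> form_domain b"
  shows "((\<lambda>y. b x y * (f x - f y)) has_sum laplacian b f x) UNIV"
proof -
  have "(\<lambda>y. b x y * \<bar>f y\<bar>) summable_on UNIV"
    using assms by (simp add: form_domain_def)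
  then have 1: "(\<lambda>y. b x y * f y) summable_on UNIV"
    by (subst summable_on_iff_abs_summable_on_real) (simp add: abs_mult b_nonneg)
  have "(\<lambda>y. b x y * f x - b x y * f y) summable_on UNIV"
    using summable_on_add[OF summable_on_cmult_left[OF b_row, of x "f x"] summable_on_uminus[THEN iffD2, OF 1]]
    by simp
  then show ?thesis
    unfolding laplacian_def by (simp add: algebra_simps)
qed

lemma bounded_in_form_domain:
  assumes "\<And>x. \<bar>f x\<bar> \<le> C"
  shows "f \<in> form_domain b"
proof -
  have "(\<lambda>y. b x y * \<bar>f y\<bar>) summable_on UNIV" for x
    by (rule summable_on_comparison_test[OF summable_on_cmult_left[OF b_row, of x C]])
      (simp_all add: mult_left_mono b_nonneg assms)
  then show ?thesis by (simp add: form_domain_def)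
qed

lemma finite_support_in_form_domain:
  assumes "finite A" "\<And>x. x \<notin> A \<Longrightarrow> f x = 0"
  shows "f \<in> form_domain b"
proof -
  have "(\<lambda>y. b x y * \<bar>f y\<bar>) summable_on UNIV" for x
    by (rule finite_nonzero_values_imp_summable_on[OF finite_subset[OF _ assms(1)]])
      (use assms(2) in force)
  then show ?thesis by (simp add: form_domain_def)
qed

text \<open>Each of the two halves of the double sum lives on finitely many rows (or columns), so
  summation by parts is legitimate although neither \<open>f\<close> nor the edge weight has finite support.\<close>

lemma green_formula:
  assumes A: "finite A" "\<And>x. x \<notin> A \<Longrightarrow> \<phi> x = 0" and f: "f \<in> form_domain b"
  shows "((\<lambda>(x, y). b x y * (\<phi> x - \<phi> y) * (f x - f y)) has_sum
           2 * (\<Sum>x\<in>A. \<phi> x * laplacian b f x)) UNIV"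
proof -
  let ?S = "\<Sum>x\<in>A. \<phi> x * laplacian b f x"
  have row: "((\<lambda>(x, y). b x y * \<phi> x * (f x - f y)) has_sum (\<phi> a * laplacian b f a)) ({a} \<times> UNIV)" for a
  proof -
    have "((\<lambda>y. \<phi> a * (b a y * (f a - f y))) has_sum (\<phi> a * laplacian b f a)) UNIV"
      by (intro has_sum_cmult_right laplacian_has_sum f)
    then have "((\<lambda>p. \<phi> a * (b a (snd p) * (f a - f (snd p)))) has_sum (\<phi> a * laplacian b f a)) ({a} \<times> UNIV)"
      by (subst has_sum_reindex_bij_witness[where i="\<lambda>y. (a, y)" and j=snd and T=UNIV
            and h="\<lambda>y. \<phi> a * (b a y * (f a - f y))"]) auto
    then show ?thesis
      by (rule has_sum_cong[THEN iffD1, rotated]) auto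
  qed
  have "((\<lambda>(x, y). b x y * \<phi> x * (f x - f y)) has_sum ?S) (\<Union>a\<in>A. {a} \<times> UNIV)"
    by (rule sum_has_sum[OF A(1) row]) auto
  then have 1: "((\<lambda>(x, y). b x y * \<phi> x * (f x - f y)) has_sum ?S) (UNIV \<times> UNIV)"
    by (rule has_sum_cong_neutral[THEN iffD1, rotated -1]) (use A(2) in auto)
  from 1[THEN has_sum_swap[THEN iffD1]]
  have 2: "((\<lambda>(x, y). b y x * \<phi> y * (f y - f x)) has_sum ?S) (UNIV \<times> UNIV)"
    by (simp add: case_prod_unfold)
  from has_sum_add[OF 1 2]
  have "((\<lambda>p. b (fst p) (snd p) * (\<phi> (fst p) - \<phi> (snd p)) * (f (fst p) - f (snd p))) has_sum 2 * ?S) UNIV"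
    unfolding UNIV_Times_UNIV mult_2
    by (rule has_sum_cong[THEN iffD1, rotated])
      (use b_sym in \<open>auto simp: case_prod_unfold algebra_simps\<close>)
  then show ?thesis by (simp add: case_prod_unfold)
qed

lemma energy_has_sum:
  assumes "finite {x. \<phi> x \<noteq> 0}"
  shows "((\<lambda>(x, y). b x y * (\<phi> x - \<phi> y)\<^sup>2) has_sum 2 * energy b \<phi>) UNIV"
proof -
  have "((\<lambda>(x, y). b x y * (\<phi> x - \<phi> y) * (\<phi> x - \<phi> y)) has_sum
           2 * (\<Sum>x\<in>{x. \<phi> x \<noteq> 0}. \<phi> x * laplacian b \<phi> x)) UNIV"
    by (rule green_formula) (use assms in \<open>auto intro: finite_support_in_form_domain\<close>)
  then have "(\<lambda>(x, y). b x y * (\<phi> x - \<phi> y)\<^sup>2) summable_on UNIV"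
    by (auto dest!: has_sum_imp_summable simp: power2_eq_square mult.assoc)
  then show ?thesis
    by (simp add: energy_def)
qed

text \<open>The ground state transform: the Hardy deficit becomes a form without potential, in
  which one inserts cutoff functions \<open>\<phi> / v\<close>. It is the Green formula for \<open>v\<close> against
  \<open>\<phi>\<^sup>2 / v\<close>, subtracted from the energy of \<open>\<phi>\<close>.\<close>

lemma ground_state_transform:
  assumes v: "v \<in> form_domain b" "\<And>x. 0 < v x" "\<And>x. laplacian b v x = w x * v x"
    and fin: "finite {x. \<phi> x \<noteq> 0}"
  shows "((\<lambda>(x, y). b x y * v x * v y * (\<phi> x / v x - \<phi> y / v y)\<^sup>2) has_sum
           2 * (energy b \<phi> - (\<Sum>\<^sub>\<infinity>x. w x * (\<phi> x)\<^sup>2))) UNIV"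
proof -
  let ?A = "{x. \<phi> x \<noteq> 0}"
  have nz: "v x \<noteq> 0" for x using v(2)[of x] by simp
  have "(\<Sum>\<^sub>\<infinity>x. w x * (\<phi> x)\<^sup>2) = (\<Sum>\<^sub>\<infinity>x\<in>?A. w x * (\<phi> x)\<^sup>2)"
    by (rule infsum_cong_neutral) auto
  also have "\<dots> = (\<Sum>x\<in>?A. w x * (\<phi> x)\<^sup>2)"
    using fin by simp
  also have "\<dots> = (\<Sum>x\<in>?A. (\<phi> x)\<^sup>2 / v x * laplacian b v x)"
    by (rule sum.cong) (use nz in \<open>auto simp: v(3)\<close>)
  finally have e: "(\<Sum>\<^sub>\<infinity>x. w x * (\<phi> x)\<^sup>2) = (\<Sum>x\<in>?A. (\<phi> x)\<^sup>2 / v x * laplacian b v x)" .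
  have 1: "((\<lambda>(x, y). b x y * ((\<phi> x)\<^sup>2 / v x - (\<phi> y)\<^sup>2 / v y) * (v x - v y)) has_sum
           2 * (\<Sum>\<^sub>\<infinity>x. w x * (\<phi> x)\<^sup>2)) UNIV"
    unfolding e by (rule green_formula) (use fin v in auto)
  have alg: "s * (p - q)\<^sup>2 - s * (p\<^sup>2 / c - q\<^sup>2 / d) * (c - d) = s * c * d * (p / c - q / d)\<^sup>2"
    if "c \<noteq> 0" "d \<noteq> 0" for s p q c d :: real
    using that by (simp add: field_simps power2_eq_square)
  from has_sum_add[OF energy_has_sum[OF fin] has_sum_uminusI[OF 1]]
  have "((\<lambda>p. b (fst p) (snd p) * v (fst p) * v (snd p) *
      (\<phi> (fst p) / v (fst p) - \<phi> (snd p) / v (snd p))\<^sup>2) has_sum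
      2 * energy b \<phi> + - (2 * (\<Sum>\<^sub>\<infinity>x. w x * (\<phi> x)\<^sup>2))) UNIV"
    by (rule has_sum_cong[THEN iffD1, rotated]) (simp add: case_prod_unfold alg[OF nz nz, symmetric])
  then show ?thesis by (simp add: case_prod_unfold algebra_simps)
qed

end

section \<open>Square roots of Green functions\<close>

lemma two_mult_le_exp_diff:
  fixes t :: real
  assumes "0 \<le> t"
  shows "2 * t \<le> exp t - exp (- t)"
proof -
  have "exp 0 - exp (- 0) - 2 * 0 \<le> exp t - exp (- t) - 2 * t"
  proof (rule DERIV_nonneg_imp_nondecreasing[OF assms])
    fix x :: real
    have "0 \<le> (exp (x / 2) - exp (- x / 2))\<^sup>2" by simp
    also have "\<dots> = exp x + exp (- x) - 2"
      by (simp add: power2_eq_square algebra_simps flip: exp_add)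
    finally show "\<exists>y. ((\<lambda>a. exp a - exp (- a) - 2 * a) has_real_derivative y) (at x) \<and> 0 \<le> y"
      by (intro exI[of _ "exp x + exp (- x) - 2"]) (auto intro!: derivative_eq_intros)
  qed
  then show ?thesis by simp
qed

text \<open>The inequality between the geometric and the logarithmic mean of \<open>a\<close> and \<open>c\<close>. With
  \<open>a / c = exp (2 t)\<close> it becomes \<open>t \<le> sinh t\<close>.\<close>

lemma sqrt_mult_ln_le:
  fixes a c :: real
  assumes "0 < c" "c \<le> a"
  shows "sqrt (a * c) * (ln a - ln c) \<le> a - c"
proof -
  define t where "t = (ln a - ln c) / 2"
  have t: "0 \<le> t" using assms by (simp add: t_def)
  have et: "exp t = sqrt (a / c)"
  proof -
    have "0 < a / c" using assms by simp
    moreover have "t = ln (a / c) / 2" using assms by (simp add: t_def ln_div)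
    ultimately show ?thesis by (simp flip: ln_sqrt)
  qed
  have ga: "sqrt (a * c) * sqrt (a / c) = a" "sqrt (a * c) / sqrt (a / c) = c"
  proof -
    have "sqrt (a * c) * sqrt (a / c) = sqrt (a\<^sup>2)" "sqrt (a * c) / sqrt (a / c) = sqrt (c\<^sup>2)"
      using assms unfolding real_sqrt_mult[symmetric] real_sqrt_divide[symmetric]
      by (auto simp: power2_eq_square intro!: arg_cong[where f=sqrt])
    then show "sqrt (a * c) * sqrt (a / c) = a" "sqrt (a * c) / sqrt (a / c) = c"
      using assms by simp_all
  qed
  have "sqrt (a * c) * (2 * t) \<le> sqrt (a * c) * (exp t - exp (- t))"
    using assms by (intro mult_left_mono two_mult_le_exp_diff t) auto
  also have "\<dots> = sqrt (a * c) * sqrt (a / c) - sqrt (a * c) / sqrt (a / c)"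
    unfolding exp_minus et by (simp only: right_diff_distrib divide_inverse)
  also have "\<dots> = a - c" unfolding ga ..
  also have "2 * t = ln a - ln c" by (simp add: t_def)
  finally show ?thesis .
qed

text \<open>The vertex \<open>o\<^sub>0\<close> is the pole of the Green function \<open>G\<close>; vanishing at infinity is
  expressed by finiteness of the superlevel sets.\<close>

locale green_potential = weighted_graph b for b :: "'a \<Rightarrow> 'a \<Rightarrow> real" +
  fixes G :: "'a \<Rightarrow> real" and m :: real and o\<^sub>0 :: 'a
  assumes G_pos: "0 < G x"
    and G_vanishes: "0 < \<epsilon> \<Longrightarrow> finite {x. \<epsilon> \<le> G x}"
    and m_pos: "0 < m"
    and laplacian_G: "laplacian b G x = (if x = o\<^sub>0 then m else 0)"
    and connected: "(\<lambda>x y. 0 < b x y)\<^sup>*\<^sup>* x y"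
begin

definition u :: "'a \<Rightarrow> real" where
  "u x = sqrt (G x)"

definition w :: "'a \<Rightarrow> real" where
  "w x = laplacian b u x / u x"

lemma u_pos: "0 < u x"
  by (simp add: u_def G_pos)

lemma u_square: "(u x)\<^sup>2 = G x"
  using G_pos[of x] by (simp add: u_def)

lemma G_bounded: "\<exists>C. \<forall>x. G x \<le> C"
proof -
  let ?A = "{x. 1 \<le> G x}"
  have "G x \<le> 1 + sum G ?A" for x
  proof (cases "x \<in> ?A")
    case True
    then have "G x \<le> sum G ?A"
      by (intro member_le_sum) (auto intro: less_imp_le G_pos G_vanishes)
    then show ?thesis by simp
  next
    case False
    moreover have "0 \<le> sum G ?A" by (intro sum_nonneg less_imp_le G_pos)
    ultimately show ?thesis by simp
  qed
  then show ?thesis by blast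
qed

lemma G_form_domain: "G \<in> form_domain b"
  using G_bounded G_pos by (metis bounded_in_form_domain abs_of_pos)

lemma u_form_domain: "u \<in> form_domain b"
proof -
  obtain C where C: "\<And>x. G x \<le> C" using G_bounded by blast
  have "\<bar>u x\<bar> \<le> sqrt C" for x using C[of x] u_pos[of x] by (simp add: u_def)
  then show ?thesis by (rule bounded_in_form_domain)
qed

lemma laplacian_u: "laplacian b u x = w x * u x"
  using u_pos[of x] by (simp add: w_def)

text \<open>Squaring is not linear, and the defect \<open>\<Delta>(u\<^sup>2) - 2 u \<Delta>u\<close> is minus the squared
  gradient. For \<open>G = u\<^sup>2\<close> this expresses \<open>w\<close> by first differences of \<open>u\<close> only.\<close>

lemma gradient_has_sum:
  "((\<lambda>y. b x y * (u x - u y)\<^sup>2) has_sum (2 * w x * G x - laplacian b G x)) UNIV"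
proof -
  have "((\<lambda>y. 2 * u x * (b x y * (u x - u y)) + - (b x y * (G x - G y)))
      has_sum (2 * u x * laplacian b u x + - laplacian b G x)) UNIV"
    by (rule has_sum_add[OF has_sum_cmult_right[OF laplacian_has_sum[OF u_form_domain]]
          has_sum_uminusI[OF laplacian_has_sum[OF G_form_domain]]])
  moreover have "2 * u x * (b x y * (u x - u y)) + - (b x y * (G x - G y)) = b x y * (u x - u y)\<^sup>2" for y
    using u_square[of x, symmetric] u_square[of y, symmetric]
    by (simp add: power2_eq_square algebra_simps)
  moreover have "2 * u x * laplacian b u x + - laplacian b G x = 2 * w x * G x - laplacian b G x"
    unfolding u_square[of x, symmetric] laplacian_u by (simp add: power2_eq_square)
  ultimately show ?thesis by (simp only:)
qed

lemma w_times_G: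
  "w x * G x = ((if x = o\<^sub>0 then m else 0) + (\<Sum>\<^sub>\<infinity>y. b x y * (u x - u y)\<^sup>2)) / 2"
  using infsumI[OF gradient_has_sum[of x]] by (simp add: laplacian_G)

lemma w_nonneg: "0 \<le> w x"
proof -
  have "0 \<le> w x * G x"
    unfolding w_times_G using m_pos by (auto intro!: add_nonneg_nonneg infsum_nonneg mult_nonneg_nonneg b_nonneg)
  then show ?thesis using G_pos[of x] by (simp add: zero_le_mult_iff)
qed

lemma w_origin_pos: "0 < w o\<^sub>0"
proof -
  have "0 < w o\<^sub>0 * G o\<^sub>0"
    unfolding w_times_G using m_pos by (auto intro!: add_pos_nonneg infsum_nonneg mult_nonneg_nonneg b_nonneg)
  then show ?thesis using G_pos[of o\<^sub>0] by (simp add: zero_less_mult_iff)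
qed

text \<open>Since \<open>u\<close> is a positive solution for the potential \<open>w\<close>, the transformed deficit is a sum of
  squares.\<close>

lemma hardy_weight_w: "hardy_weight b w"
  unfolding hardy_weight_def
proof (intro conjI allI impI)
  show "\<exists>x. w x \<noteq> 0" using w_origin_pos by (metis less_irrefl)
  fix \<phi> :: "'a \<Rightarrow> real" assume fin: "finite {x. \<phi> x \<noteq> 0}"
  have "0 \<le> 2 * (energy b \<phi> - (\<Sum>\<^sub>\<infinity>x. w x * (\<phi> x)\<^sup>2))"
    by (rule has_sum_nonneg[OF ground_state_transform[OF u_form_domain u_pos laplacian_u fin]])
      (auto intro!: mult_nonneg_nonneg b_nonneg less_imp_le[OF u_pos])
  then show "(\<Sum>\<^sub>\<infinity>x. w x * (\<phi> x)\<^sup>2) \<le> energy b \<phi>" by simp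
qed (rule w_nonneg)

text \<open>The cutoff is linear in \<open>ln G\<close> while this runs from \<open>- 2 L\<close> to \<open>- L\<close>. The weight
  \<open>u x * u y\<close> of the transformed energy, which is the geometric mean of \<open>G x\<close> and \<open>G y\<close>, then
  turns one of the two differences of the cutoff into a difference of \<open>G\<close>.\<close>

definition cutoff :: "real \<Rightarrow> 'a \<Rightarrow> real" where
  "cutoff L x = max 0 (min 1 (2 + ln (G x) / L))"

lemma cutoff_finite:
  assumes "0 < L"
  shows "finite {x. cutoff L x \<noteq> 0}"
proof (rule finite_subset)
  show "{x. cutoff L x \<noteq> 0} \<subseteq> {x. exp (- 2 * L) \<le> G x}"
  proof
    fix x assume "x \<in> {x. cutoff L x \<noteq> 0}"
    then have "0 < 2 + ln (G x) / L" by (auto simp: cutoff_def max_def min_def split: if_splits)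
    then have "- 2 * L < ln (G x)" using assms by (simp add: field_simps)
    then have "exp (- 2 * L) < G x" using G_pos[of x] by (metis exp_less_cancel_iff exp_ln)
    then show "x \<in> {x. exp (- 2 * L) \<le> G x}" by simp
  qed
qed (rule G_vanishes, simp)

lemma cutoff_eq_1: "0 < L \<Longrightarrow> - L \<le> ln (G x) \<Longrightarrow> cutoff L x = 1"
  by (simp add: cutoff_def field_simps)

lemma cutoff_le_1: "cutoff L x \<le> 1"
  by (simp add: cutoff_def)

lemma cutoff_square_le:
  assumes "0 < L"
  shows "u x * u y * (cutoff L x - cutoff L y)\<^sup>2 \<le> (cutoff L x - cutoff L y) * (G x - G y) / L"
proof -
  have main: "u x * u y * (cutoff L x - cutoff L y)\<^sup>2 \<le> (cutoff L x - cutoff L y) * (G x - G y) / L"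
    if le: "G y \<le> G x" for x y
  proof -
    have "ln (G y) \<le> ln (G x)" using le G_pos by simp
    then have d: "ln (G y) / L \<le> ln (G x) / L" using assms by (simp add: divide_right_mono)
    then have 0: "0 \<le> cutoff L x - cutoff L y" by (auto simp: cutoff_def)
    have "cutoff L x - cutoff L y \<le> ln (G x) / L - ln (G y) / L"
      using d unfolding cutoff_def by (auto simp: max_def min_def)
    then have "u x * u y * (cutoff L x - cutoff L y) \<le> u x * u y * ((ln (G x) - ln (G y)) / L)"
      using less_imp_le[OF u_pos] by (intro mult_left_mono mult_nonneg_nonneg) (auto simp: diff_divide_distrib)
    also have "\<dots> = sqrt (G x * G y) * (ln (G x) - ln (G y)) / L"
      by (simp add: u_def real_sqrt_mult)
    also have "\<dots> \<le> (G x - G y) / L"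
      using assms by (intro divide_right_mono sqrt_mult_ln_le G_pos le) auto
    finally have "u x * u y * (cutoff L x - cutoff L y) * (cutoff L x - cutoff L y)
        \<le> (G x - G y) / L * (cutoff L x - cutoff L y)"
      using 0 by (rule mult_right_mono)
    then show ?thesis by (simp add: power2_eq_square mult_ac)
  qed
  show ?thesis
  proof (cases "G y \<le> G x")
    case True then show ?thesis by (rule main)
  next
    case False
    then have "G x \<le> G y" by simp
    from main[OF this] show ?thesis by (simp add: power2_commute[of "cutoff L x"] algebra_simps)
  qed
qed

text \<open>The functions \<open>u \<cdot> cutoff L\<close> form a null sequence as \<open>L \<rightarrow> \<infinity>\<close>. After
  \<open>cutoff_square_le\<close>, the transformed energy is a mixed Dirichlet form with \<open>G\<close>, whose
  Laplacian is concentrated at one vertex.\<close>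

lemma null_sequence:
  assumes "0 < L"
  shows "finite {x. u x * cutoff L x \<noteq> 0}"
    and "energy b (\<lambda>x. u x * cutoff L x) - (\<Sum>\<^sub>\<infinity>x. w x * (u x * cutoff L x)\<^sup>2) \<le> m / L"
proof -
  let ?A = "{x. cutoff L x \<noteq> 0}"
  show fin: "finite {x. u x * cutoff L x \<noteq> 0}"
    by (rule finite_subset[OF _ cutoff_finite[OF assms]]) auto
  have 1: "((\<lambda>(x, y). b x y * u x * u y * (cutoff L x - cutoff L y)\<^sup>2) has_sum
     2 * (energy b (\<lambda>x. u x * cutoff L x) - (\<Sum>\<^sub>\<infinity>x. w x * (u x * cutoff L x)\<^sup>2))) UNIV"
    using ground_state_transform[OF u_form_domain u_pos laplacian_u fin] u_pos
    by (simp add: less_imp_neq[symmetric])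
  have "((\<lambda>(x, y). b x y * (cutoff L x - cutoff L y) * (G x - G y)) has_sum
      2 * (\<Sum>x\<in>?A. cutoff L x * laplacian b G x)) UNIV"
    by (rule green_formula[OF cutoff_finite[OF assms] _ G_form_domain]) auto
  also have "(\<Sum>x\<in>?A. cutoff L x * laplacian b G x) = (\<Sum>x\<in>?A. if x = o\<^sub>0 then cutoff L x * m else 0)"
    by (rule sum.cong) (auto simp: laplacian_G)
  also have "\<dots> = cutoff L o\<^sub>0 * m"
    using cutoff_finite[OF assms] by simp
  finally have "((\<lambda>(x, y). b x y * (cutoff L x - cutoff L y) * (G x - G y)) has_sum
      2 * (cutoff L o\<^sub>0 * m)) UNIV" .
  from has_sum_cmult_right[OF this, of "1 / L"]
  have 2: "((\<lambda>(x, y). b x y * ((cutoff L x - cutoff L y) * (G x - G y) / L)) has_sum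
      2 * (cutoff L o\<^sub>0 * m) / L) UNIV"
    by (simp add: case_prod_unfold mult_ac)
  have "2 * (energy b (\<lambda>x. u x * cutoff L x) - (\<Sum>\<^sub>\<infinity>x. w x * (u x * cutoff L x)\<^sup>2))
     \<le> 2 * (cutoff L o\<^sub>0 * m) / L"
    by (rule has_sum_mono[OF 1 2])
      (use mult_left_mono[OF cutoff_square_le[OF assms] b_nonneg] in \<open>auto simp: mult_ac\<close>)
  also have "\<dots> \<le> 2 * (1 * m) / L"
    using assms m_pos by (intro divide_right_mono mult_left_mono mult_right_mono cutoff_le_1) auto
  finally show "energy b (\<lambda>x. u x * cutoff L x) - (\<Sum>\<^sub>\<infinity>x. w x * (u x * cutoff L x)\<^sup>2) \<le> m / L"
    by simp
qed

lemma small_if_le_div: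
  fixes c K :: real
  assumes "\<And>L. L\<^sub>0 \<le> L \<Longrightarrow> 0 < L \<Longrightarrow> c \<le> K / L"
  shows "c \<le> 0"
proof (rule tendsto_lowerbound[of "\<lambda>L. K / L" 0 at_top])
  show "((\<lambda>L. K / L) \<longlongrightarrow> 0) at_top"
    by (rule tendsto_divide_0[OF tendsto_const]) (simp add: filterlim_at_top_imp_at_infinity filterlim_ident)
  show "\<forall>\<^sub>F L in at_top. c \<le> K / L"
    using eventually_ge_at_top[of L\<^sub>0] eventually_gt_at_top[of 0] by eventually_elim (rule assms)
qed simp

text \<open>A larger Hardy weight \<open>w'\<close> is tested with the null sequence: the excess \<open>w' - w\<close> at a vertex
  where the cutoff is already \<open>1\<close> is bounded by the deficit.\<close>

theorem critical_w: "critical_hardy_weight b w"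
  unfolding critical_hardy_weight_def
proof (intro conjI allI impI ext hardy_weight_w)
  fix w' x assume w': "hardy_weight b w'" and ge: "\<forall>x. w x \<le> w' x"
  have "(w' x - w x) * G x \<le> m / L" if L: "- ln (G x) \<le> L" "0 < L" for L
  proof -
    let ?\<phi> = "\<lambda>x. u x * cutoff L x"
    let ?A = "{x. ?\<phi> x \<noteq> 0}"
    note null = null_sequence[OF L(2)]
    have inf: "(\<Sum>\<^sub>\<infinity>x. v x * (?\<phi> x)\<^sup>2) = (\<Sum>x\<in>?A. v x * (?\<phi> x)\<^sup>2)" for v :: "'a \<Rightarrow> real"
    proof -
      have "(\<Sum>\<^sub>\<infinity>x. v x * (?\<phi> x)\<^sup>2) = (\<Sum>\<^sub>\<infinity>x\<in>?A. v x * (?\<phi> x)\<^sup>2)"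
        by (rule infsum_cong_neutral) auto
      then show ?thesis using null(1) by simp
    qed
    have c1: "cutoff L x = 1" using L by (intro cutoff_eq_1) auto
    then have x: "x \<in> ?A" using u_pos[of x] by simp
    have "(w' x - w x) * (?\<phi> x)\<^sup>2 \<le> (\<Sum>x\<in>?A. (w' x - w x) * (?\<phi> x)\<^sup>2)"
      using ge by (intro member_le_sum[OF x _ null(1)]) auto
    also have "\<dots> = (\<Sum>\<^sub>\<infinity>x. w' x * (?\<phi> x)\<^sup>2) - (\<Sum>\<^sub>\<infinity>x. w x * (?\<phi> x)\<^sup>2)"
      by (simp only: inf left_diff_distrib sum_subtractf)
    also have "\<dots> \<le> energy b ?\<phi> - (\<Sum>\<^sub>\<infinity>x. w x * (?\<phi> x)\<^sup>2)"
      using w' null(1) by (simp add: hardy_weight_def)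
    also have "\<dots> \<le> m / L" by (rule null(2))
    finally show ?thesis by (simp add: c1 u_square)
  qed
  then have "(w' x - w x) * G x \<le> 0" by (rule small_if_le_div)
  then have "w' x \<le> w x" using G_pos[of x] by (simp add: mult_le_0_iff)
  then show "w' x = w x" using ge by (simp add: antisym)
qed

text \<open>After the transform with respect to another ground state \<open>v\<close>, the null sequence forces the
  difference of \<open>u / v\<close> across every edge to vanish, and the graph is connected.\<close>

lemma ground_state_proportional:
  assumes v: "ground_state b w v"
  shows "\<exists>c>0. \<forall>x. v x = c * u x"
proof -
  have v': "v \<in> form_domain b" "\<And>x. 0 < v x" "\<And>x. laplacian b v x = w x * v x"
    using v by (auto simp: ground_state_def)
  have edge: "u x / v x = u y / v y" if bxy: "0 < b x y" for x y
  proof -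
    let ?c = "b x y * v x * v y * (u x / v x - u y / v y)\<^sup>2"
    have "?c \<le> (2 * m) / L" if L: "max (- ln (G x)) (- ln (G y)) \<le> L" "0 < L" for L
    proof -
      let ?\<phi> = "\<lambda>x. u x * cutoff L x"
      note null = null_sequence[OF L(2)]
      let ?F = "\<lambda>(x, y). b x y * v x * v y * (?\<phi> x / v x - ?\<phi> y / v y)\<^sup>2"
      note hs = ground_state_transform[OF v' null(1)]
      have "sum ?F {(x, y)} \<le> 2 * (energy b ?\<phi> - (\<Sum>\<^sub>\<infinity>x. w x * (?\<phi> x)\<^sup>2))"
        by (rule finite_sum_le_has_sum[OF hs])
          (auto intro!: mult_nonneg_nonneg b_nonneg less_imp_le[OF v'(2)])
      moreover have "cutoff L x = 1" "cutoff L y = 1" using L by (auto intro!: cutoff_eq_1)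
      ultimately show ?thesis using null(2) by simp
    qed
    then have "?c \<le> 0" by (rule small_if_le_div)
    moreover have "0 < b x y * v x * v y" using bxy v'(2) by simp
    ultimately have "(u x / v x - u y / v y)\<^sup>2 \<le> 0"
      by (meson mult_le_cancel_left_pos[where b=0, simplified] mult_pos_pos not_le)
    then show ?thesis by simp
  qed
  have const: "u x / v x = u y / v y" for x y
    using connected[of x y] by (induction rule: rtranclp_induct) (auto simp: edge)
  define c where "c = v o\<^sub>0 / u o\<^sub>0"
  have "v x = c * u x" for x
    using const[of x o\<^sub>0] u_pos[of x] u_pos[of o\<^sub>0] v'(2)[of x] v'(2)[of o\<^sub>0]
    by (simp add: c_def field_simps)
  moreover have "0 < c" using v'(2) u_pos by (simp add: c_def)
  ultimately show ?thesis by blast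
qed

text \<open>A linear cutoff of \<open>u\<close> between the levels \<open>\<epsilon>\<close> and \<open>2\<epsilon>\<close> is estimated
  by the energy of \<open>u\<close> alone, even across edges on which \<open>u\<close> jumps by a large factor.\<close>

lemma linear_cutoff_le:
  fixes a c \<epsilon> :: real
  assumes "0 < \<epsilon>" "0 < a" "0 < c"
  defines "f \<equiv> \<lambda>s. max 0 (min 1 (s / \<epsilon> - 1))"
  shows "(f a - f c) * (a\<^sup>2 - c\<^sup>2) \<le> (if 2 * \<epsilon> \<le> a \<and> 2 * \<epsilon> \<le> c then 0 else 8 * (a - c)\<^sup>2)"
proof -
  have main: "(f a - f c) * (a\<^sup>2 - c\<^sup>2) \<le> (if 2 * \<epsilon> \<le> a \<and> 2 * \<epsilon> \<le> c then 0 else 8 * (a - c)\<^sup>2)"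
    if ca: "c \<le> a" "0 < c" for a c
  proof (cases "2 * \<epsilon> \<le> c")
    case True
    then have "1 \<le> c / \<epsilon> - 1" "1 \<le> a / \<epsilon> - 1"
      using assms(1) ca by (simp_all add: field_simps)
    then have "f a = 1" "f c = 1" by (simp_all add: f_def)
    then show ?thesis using True ca by simp
  next
    case False
    have fact: "a\<^sup>2 - c\<^sup>2 = (a + c) * (a - c)" by (simp add: power2_eq_square algebra_simps)
    have f01: "0 \<le> f s" "f s \<le> 1" for s by (auto simp: f_def)
    have "(f a - f c) * (a + c) \<le> 8 * (a - c)"
    proof (cases "a \<le> 4 * \<epsilon>")
      case True
      have "c / \<epsilon> \<le> a / \<epsilon>" using ca assms(1) by (simp add: divide_right_mono)
      then have "f a - f c \<le> a / \<epsilon> - c / \<epsilon>" by (auto simp: f_def)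
      also have "\<dots> = (a - c) / \<epsilon>" by (simp add: diff_divide_distrib)
      finally have "(f a - f c) * (a + c) \<le> (a - c) / \<epsilon> * (8 * \<epsilon>)"
        using True ca assms(1) by (intro mult_mono) auto
      then show ?thesis using assms(1) by simp
    next
      case False
      \<comment> \<open>a jump from below \<open>2 \<epsilon>\<close> to above \<open>4 \<epsilon>\<close>: the sum \<open>a + c\<close> is itself a multiple of \<open>a - c\<close>\<close>
      have "(f a - f c) * (a + c) \<le> 1 * (a + c)"
        using f01[of a] f01[of c] ca by (intro mult_right_mono) auto
      also have "\<dots> \<le> 8 * (a - c)" 
      proof -
        have "4 * \<epsilon> < a" "c < 2 * \<epsilon>" using False \<open>\<not> 2 * \<epsilon> \<le> c\<close> by simp_all
        then show ?thesis using assms(1) by (simp add: algebra_simps)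
      qed
      finally show ?thesis .
    qed
    then have "(f a - f c) * (a + c) * (a - c) \<le> 8 * (a - c) * (a - c)"
      using ca by (intro mult_right_mono) auto
    then have "(f a - f c) * (a\<^sup>2 - c\<^sup>2) \<le> 8 * (a - c)\<^sup>2"
      unfolding fact by (simp only: power2_eq_square mult.assoc)
    then show ?thesis using False by simp
  qed
  show ?thesis
  proof (cases "c \<le> a")
    case True with main[OF True] assms show ?thesis by simp
  next
    case False
    with main[of a c] assms main[of c a] show ?thesis
      by (simp add: power2_commute[of a c] algebra_simps conj_commute split: if_splits)
  qed
qed

text \<open>If the sum were finite, so would be the energy of \<open>u\<close>, by \<open>gradient_has_sum\<close>. The Green
  formula for \<open>G\<close> and the linear cutoff of \<open>u\<close> gives \<open>2 m\<close> at every low level, but the mixed form is at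
  most eight times the part of the energy on edges with an end at a low level, which is at
  most \<open>m / 8\<close> if the level is low enough.\<close>

lemma u_not_square_summable: "\<not> (\<lambda>x. w x * (u x)\<^sup>2) summable_on UNIV"
proof
  assume "(\<lambda>x. w x * (u x)\<^sup>2) summable_on UNIV"
  then have wG: "(\<lambda>x. w x * G x) summable_on UNIV" by (simp add: u_square)
  let ?F = "\<lambda>(x, y). b x y * (u x - u y)\<^sup>2"
  have F_nonneg: "0 \<le> ?F p" for p by (auto simp: b_nonneg split: prod.splits)
  have "?F summable_on UNIV \<times> UNIV"
  proof (rule summable_on_SigmaI)
    show "((\<lambda>y. ?F (x, y)) has_sum (2 * w x * G x - laplacian b G x)) UNIV" for x
      using gradient_has_sum[of x] by simp
    show "(\<lambda>x. 2 * w x * G x - laplacian b G x) summable_on UNIV"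
    proof (rule summable_on_comparison_test[OF summable_on_cmult_right[OF wG, of 2]])
      show "2 * w x * G x - laplacian b G x \<le> 2 * (w x * G x)" for x
        using m_pos by (simp add: laplacian_G)
      show "0 \<le> 2 * w x * G x - laplacian b G x" for x
        by (rule has_sum_nonneg[OF gradient_has_sum]) (simp add: b_nonneg)
    qed
  qed (use F_nonneg in auto)
  then obtain S where S: "(?F has_sum S) UNIV" by (auto simp: summable_on_def)
  from has_sum_finite_approximation[OF S, of "m / 8"] m_pos
  obtain X where X: "finite X" "dist (sum ?F X) S \<le> m / 8" by auto
  \<comment> \<open>the edges in the finite set \<open>X\<close> carry all but \<open>m / 8\<close> of the energy, and the level is chosen so low that the cutoff is \<open>1\<close> at their ends\<close>
  have "\<exists>\<epsilon>>0. \<epsilon>\<^sup>2 \<le> G o\<^sub>0 / 4 \<and> (\<forall>(x, y)\<in>X. 2 * \<epsilon> \<le> u x \<and> 2 * \<epsilon> \<le> u y)"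
  proof -
    let ?V = "insert o\<^sub>0 (fst ` X \<union> snd ` X)"
    define \<epsilon> where "\<epsilon> = Min (u ` ?V) / 2"
    have min: "2 * \<epsilon> \<le> u x" if "x \<in> ?V" for x
      unfolding \<epsilon>_def using X(1) that by (simp del: image_insert)
    have pos: "0 < \<epsilon>" unfolding \<epsilon>_def using X(1) u_pos by simp
    have "(2 * \<epsilon>)\<^sup>2 \<le> (u o\<^sub>0)\<^sup>2" using min[of o\<^sub>0] pos by (intro power_mono) auto
    then have "\<epsilon>\<^sup>2 \<le> G o\<^sub>0 / 4" by (simp add: u_square power_mult_distrib)
    moreover have "2 * \<epsilon> \<le> u x \<and> 2 * \<epsilon> \<le> u y" if "(x, y) \<in> X" for x y
      using imageI[OF that, of fst] imageI[OF that, of snd] by (auto intro!: min)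
    ultimately show ?thesis using pos by (intro exI[of _ \<epsilon>]) auto
  qed
  then obtain \<epsilon> where \<epsilon>: "0 < \<epsilon>" "\<epsilon>\<^sup>2 \<le> G o\<^sub>0 / 4"
    "\<And>x y. (x, y) \<in> X \<Longrightarrow> 2 * \<epsilon> \<le> u x \<and> 2 * \<epsilon> \<le> u y" by blast
  define f where "f = (\<lambda>x. max 0 (min 1 (u x / \<epsilon> - 1)))"
  have "finite {x. f x \<noteq> 0}"
  proof (rule finite_subset)
    show "{x. f x \<noteq> 0} \<subseteq> {x. \<epsilon>\<^sup>2 \<le> G x}"
    proof
      fix x assume "x \<in> {x. f x \<noteq> 0}"
      then have "f x \<noteq> 0" by simp
      then have "0 < u x / \<epsilon> - 1" by (rule contrapos_np) (simp add: f_def)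
      then have "\<epsilon> \<le> u x" using \<epsilon>(1) by (simp add: field_simps)
      then have "\<epsilon>\<^sup>2 \<le> (u x)\<^sup>2" using \<epsilon>(1) by (intro power_mono) auto
      then show "x \<in> {x. \<epsilon>\<^sup>2 \<le> G x}" by (simp add: u_square)
    qed
  qed (use \<epsilon>(1) in \<open>auto intro: G_vanishes\<close>)
  note fin = this
  have f0: "f o\<^sub>0 = 1"
  proof -
    have "(2 * \<epsilon>)\<^sup>2 \<le> (u o\<^sub>0)\<^sup>2" using \<epsilon>(2) by (simp add: u_square power_mult_distrib)
    then have "2 * \<epsilon> \<le> u o\<^sub>0" using u_pos[of o\<^sub>0] by (rule power2_le_imp_le[OF _ less_imp_le])
    then have "1 \<le> u o\<^sub>0 / \<epsilon> - 1" using \<epsilon>(1) by (simp add: field_simps)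
    then show ?thesis by (simp add: f_def)
  qed
  have "((\<lambda>(x, y). b x y * (f x - f y) * (G x - G y)) has_sum
      2 * (\<Sum>x\<in>{x. f x \<noteq> 0}. f x * laplacian b G x)) UNIV"
    by (rule green_formula[OF fin _ G_form_domain]) auto
  also have "(\<Sum>x\<in>{x. f x \<noteq> 0}. f x * laplacian b G x) = (\<Sum>x\<in>{x. f x \<noteq> 0}. if x = o\<^sub>0 then f x * m else 0)"
    by (rule sum.cong) (auto simp: laplacian_G)
  also have "\<dots> = m" using fin f0 by simp
  finally have 1: "((\<lambda>(x, y). b x y * (f x - f y) * (G x - G y)) has_sum 2 * m) UNIV" .
  have Xsum: "(?F has_sum sum ?F X) X" using X(1) by simp
  have "(?F has_sum (S - sum ?F X)) (UNIV - X)"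
    using has_sum_Diff[OF S Xsum] by simp
  then have 2: "((\<lambda>p. if p \<in> X then 0 else 8 * ?F p) has_sum 8 * (S - sum ?F X)) UNIV"
    by (subst has_sum_cong_neutral[where T="UNIV - X" and g="\<lambda>p. 8 * ?F p"])
      (auto intro: has_sum_cmult_right simp del: right_diff_distrib_numeral)
  have "2 * m \<le> 8 * (S - sum ?F X)"
  proof (rule has_sum_mono[OF 1 2])
    fix p :: "'a \<times> 'a"
    obtain x y where p: "p = (x, y)" by (cases p)
    have "(f x - f y) * (G x - G y) \<le> (if 2 * \<epsilon> \<le> u x \<and> 2 * \<epsilon> \<le> u y then 0 else 8 * (u x - u y)\<^sup>2)"
      using linear_cutoff_le[OF \<epsilon>(1) u_pos[of x] u_pos[of y]] unfolding f_def u_square .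
    also have "\<dots> \<le> (if p \<in> X then 0 else 8 * (u x - u y)\<^sup>2)"
      using \<epsilon>(3)[of x y] p by simp
    finally have "b x y * ((f x - f y) * (G x - G y)) \<le> b x y * (if p \<in> X then 0 else 8 * (u x - u y)\<^sup>2)"
      by (rule mult_left_mono[OF _ b_nonneg])
    then show "(case p of (x, y) \<Rightarrow> b x y * (f x - f y) * (G x - G y)) \<le> (if p \<in> X then 0 else 8 * ?F p)"
      by (cases "p \<in> X") (simp_all add: p mult.assoc mult.left_commute)
  qed
  also have "\<dots> \<le> m" using X(2) unfolding dist_real_def by argo
  finally show False using m_pos by simp
qed

theorem null_critical_w: "null_critical_hardy_weight b w"
  unfolding null_critical_hardy_weight_def
proof (intro conjI allI impI critical_w)
  show "\<exists>v. ground_state b w v"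
    using u_form_domain u_pos laplacian_u by (auto simp: ground_state_def)
  fix v assume "ground_state b w v"
  then obtain c where c: "0 < c" "\<And>x. v x = c * u x" using ground_state_proportional by blast
  then have "(\<lambda>x. w x * (v x)\<^sup>2) = (\<lambda>x. c\<^sup>2 * (w x * (u x)\<^sup>2))"
    by (auto simp: power_mult_distrib)
  moreover have "\<not> (\<lambda>x. c\<^sup>2 * (w x * (u x)\<^sup>2)) summable_on UNIV"
    using u_not_square_summable c(1) by (subst summable_on_cmult_right') auto
  ultimately show "\<not> (\<lambda>x. w x * (v x)\<^sup>2) summable_on UNIV" by metis
qed

end

section \<open>Square roots of positive definite matrices\<close>

text \<open>A maximiser \<open>v\<close> of the Rayleigh quotient, with maximum \<open>l\<close>, is an eigenvector: otherwise the
  residual \<open>f v - l v\<close> would be a direction of first order increase.\<close>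

lemma self_adjoint_eigenvector:
  fixes f :: "'a::euclidean_space \<Rightarrow> 'a"
  assumes lin: "linear f" and adj: "\<And>x y. x \<bullet> f y = f x \<bullet> y"
    and S: "subspace S" "\<And>x. x \<in> S \<Longrightarrow> f x \<in> S" and ne: "S \<noteq> {0}"
  shows "\<exists>v l. v \<in> S \<and> norm v = 1 \<and> f v = l *\<^sub>R v"
proof -
  let ?K = "S \<inter> sphere 0 1"
  have "compact ?K"
    by (intro closed_Int_compact closed_subspace S compact_sphere)
  moreover obtain x where x: "x \<in> S" "x \<noteq> 0" using ne subspace_0[OF S(1)] by blast
  then have "x /\<^sub>R norm x \<in> ?K" by (simp add: subspace_scale[OF S(1)])
  then have "?K \<noteq> {}" by blast
  moreover have "continuous_on ?K (\<lambda>x. x \<bullet> f x)"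
    using lin by (intro continuous_intros linear_continuous_on linear_conv_bounded_linear[THEN iffD1])
  ultimately obtain v where v: "v \<in> ?K" and max: "\<And>y. y \<in> ?K \<Longrightarrow> y \<bullet> f y \<le> v \<bullet> f v"
    using continuous_attains_sup[of ?K "\<lambda>x. x \<bullet> f x"] by blast
  define l where "l = v \<bullet> f v"
  define g where "g = (\<lambda>y. l * (y \<bullet> y) - y \<bullet> f y)"
  have g_nonneg: "0 \<le> g y" if y: "y \<in> S" for y
  proof (cases "y = 0")
    case True then show ?thesis by (simp add: g_def)
  next
    case False
    then have "y /\<^sub>R norm y \<in> ?K" using y by (simp add: subspace_scale[OF S(1)])
    from max[OF this] have "(y \<bullet> f y) / (norm y)\<^sup>2 \<le> l"
      by (simp add: l_def linear_scale[OF lin] power2_eq_square field_simps)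
    then show ?thesis using False
      by (simp add: g_def dot_square_norm field_simps)
  qed
  define z where "z = f v - l *\<^sub>R v"
  have vS: "v \<in> S" and vv: "v \<bullet> v = 1" using v by (auto simp: dot_square_norm)
  have zS: "z \<in> S" unfolding z_def by (intro subspace_diff subspace_scale S vS)
  have "z = 0"
  proof (rule ccontr)
    assume "z \<noteq> 0"
    define a where "a = z \<bullet> z"
    \<comment> \<open>so small that the quadratic term \<open>t\<^sup>2 * g z\<close> does not make up for the linear term \<open>- 2 * t * a\<close>\<close>
    define t where "t = a / (g z + 1)"
    have a: "0 < a" using \<open>z \<noteq> 0\<close> by (simp add: a_def)
    have gz: "0 \<le> g z" by (rule g_nonneg[OF zS])
    have fz: "v \<bullet> f z = f v \<bullet> z" by (rule adj)
    have "f v = z + l *\<^sub>R v" by (simp add: z_def)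
    then have fvz: "f v \<bullet> z = a + l * (v \<bullet> z)" by (simp add: a_def inner_add_left)
    have gv: "l * (v \<bullet> v) - v \<bullet> f v = 0" by (simp add: l_def vv)
    have "g (v + t *\<^sub>R z) = (l * (v \<bullet> v) - v \<bullet> f v) + 2 * t * (l * (v \<bullet> z) - f v \<bullet> z) + t\<^sup>2 * g z"
      unfolding g_def linear_add[OF lin] linear_scale[OF lin]
      by (simp add: inner_add_left inner_add_right fz inner_commute[of z v] inner_commute[of z "f v"] power2_eq_square algebra_simps)
    also have "\<dots> = t * (t * g z - 2 * a)"
      by (simp add: gv fvz power2_eq_square algebra_simps)
    finally have g_eq: "g (v + t *\<^sub>R z) = t * (t * g z - 2 * a)" .
    have "t * g z - 2 * a < 0"
    proof -
      have "t * g z \<le> a" using a gz by (simp add: t_def field_simps)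
      then show ?thesis using a by simp
    qed
    moreover have "0 < t" using a gz by (simp add: t_def)
    ultimately have "g (v + t *\<^sub>R z) < 0" unfolding g_eq by (simp add: mult_pos_neg)
    moreover have "v + t *\<^sub>R z \<in> S" by (intro subspace_add subspace_scale S vS zS)
    ultimately show False using g_nonneg by force
  qed
  then have "f v = l *\<^sub>R v" by (simp add: z_def)
  then show ?thesis using vS v by auto
qed

text \<open>The orthogonal complement of an eigenvector is again invariant, and of smaller dimension.\<close>

lemma self_adjoint_eigenbasis:
  fixes f :: "'a::euclidean_space \<Rightarrow> 'a"
  assumes lin: "linear f" and adj: "\<And>x y. x \<bullet> f y = f x \<bullet> y"
    and S: "subspace S" "\<And>x. x \<in> S \<Longrightarrow> f x \<in> S"
  shows "\<exists>B. finite B \<and> B \<subseteq> S \<and> span B = S \<and> pairwise orthogonal B \<and>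
           (\<forall>b\<in>B. norm b = 1 \<and> (\<exists>l. f b = l *\<^sub>R b))"
  using S
proof (induction "dim S" arbitrary: S rule: less_induct)
  case less
  show ?case
  proof (cases "S = {0}")
    case True
    then show ?thesis by (intro exI[of _ "{}"]) auto
  next
    case False
    obtain v l where v: "v \<in> S" "norm v = 1" "f v = l *\<^sub>R v"
      using self_adjoint_eigenvector[OF lin adj less.prems False] by blast
    let ?T = "{y \<in> S. y \<bullet> v = 0}"
    have T: "subspace ?T" using less.prems(1)
      by (auto simp: subspace_def inner_add_left)
    have inv: "f y \<in> ?T" if "y \<in> ?T" for y
    proof -
      have "f y \<bullet> v = y \<bullet> f v" by (rule adj[symmetric])
      then show ?thesis using that v less.prems(2) by simp
    qed
    have dim: "dim ?T < dim S"
    proof (rule dim_psubset)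
      have "v \<notin> ?T" using v(2) by (auto simp: dot_square_norm)
      then have "?T \<subset> S" using v(1) by blast
      then show "span ?T \<subset> span S"
        by (simp only: span_eq_iff[THEN iffD2, OF T] span_eq_iff[THEN iffD2, OF less.prems(1)])
    qed
    from less.hyps[OF dim T inv] obtain B where B: "finite B" "B \<subseteq> ?T" "span B = ?T" "pairwise orthogonal B"
       "\<forall>b\<in>B. norm b = 1 \<and> (\<exists>l. f b = l *\<^sub>R b)"
      by blast
    have "span (insert v B) = S"
    proof
      show "span (insert v B) \<subseteq> S"
        using v(1) B(2) less.prems(1) by (intro span_minimal) auto
      show "S \<subseteq> span (insert v B)"
      proof
        fix x assume x: "x \<in> S"
        have "x - (x \<bullet> v) *\<^sub>R v \<in> S"
          by (intro subspace_diff subspace_scale x v less.prems(1))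
        moreover have "(x - (x \<bullet> v) *\<^sub>R v) \<bullet> v = 0"
          using v(2) by (simp add: inner_diff_left dot_square_norm)
        ultimately have "x - (x \<bullet> v) *\<^sub>R v \<in> span B" unfolding B(3) by blast
        then show "x \<in> span (insert v B)" unfolding span_insert by blast
      qed
    qed
    moreover have "pairwise orthogonal (insert v B)"
      using B(2,4) by (force simp: pairwise_insert orthogonal_def inner_commute[of v])
    ultimately show ?thesis
      using B v by (intro exI[of _ "insert v B"]) auto
  qed
qed

lemma symmetric_matrix_inner:
  fixes A :: "real ^ 'n ^ 'n"
  assumes "transpose A = A"
  shows "x \<bullet> (A *v y) = (A *v x) \<bullet> y"
  by (metis assms dot_lmul_matrix transpose_matrix_vector)

text \<open>The square root is diagonal in an orthonormal eigenbasis of \<open>A\<close>. For uniqueness, let \<open>A b = l b\<close>: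
  then \<open>z = B b - sqrt l b\<close> satisfies \<open>B z = - sqrt l z\<close>, so \<open>z = 0\<close> because \<open>B\<close> is positive
  semidefinite.\<close>

lemma psd_sqrt_exists:
  fixes A :: "real ^ 'n ^ 'n"
  assumes sym: "transpose A = A" and psd: "\<And>v. 0 \<le> v \<bullet> (A *v v)"
  shows "\<exists>!B. transpose B = B \<and> (\<forall>v. 0 \<le> v \<bullet> (B *v v)) \<and> B ** B = A"
proof -
  obtain E where E: "finite E" "span E = UNIV" "pairwise orthogonal E"
    "\<And>b. b \<in> E \<Longrightarrow> norm b = 1" "\<And>b. b \<in> E \<Longrightarrow> \<exists>l. A *v b = l *\<^sub>R b"
    using self_adjoint_eigenbasis[of "(*v) A" UNIV] symmetric_matrix_inner[OF sym] by auto
  then obtain l where l: "\<And>b. b \<in> E \<Longrightarrow> A *v b = l b *\<^sub>R b" by metis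
  have ip: "b \<bullet> c = (if b = c then 1 else 0)" if "b \<in> E" "c \<in> E" for b c
    using E(3,4) that by (auto simp: pairwise_def orthogonal_def dot_square_norm)
  have l_nonneg: "0 \<le> l b" if "b \<in> E" for b
    using psd[of b] l[OF that] ip[OF that that] by simp
  have expand: "x = (\<Sum>b\<in>E. (x \<bullet> b) *\<^sub>R b)" for x
    using orthonormal_basis_expand[OF E(3,4) _ E(1), of x] E(2) by simp
  define R where "R x = (\<Sum>b\<in>E. (sqrt (l b) * (x \<bullet> b)) *\<^sub>R b)" for x
  have linR: "linear R"
    by (auto simp: R_def linear_iff inner_add_left algebra_simps sum.distrib scaleR_right.sum scaleR_add_left)
  have Rip: "R x \<bullet> c = sqrt (l c) * (x \<bullet> c)" if "c \<in> E" for x c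
  proof -
    have "R x \<bullet> c = (\<Sum>b\<in>E. if b = c then sqrt (l b) * (x \<bullet> b) else 0)"
      unfolding R_def inner_sum_left by (rule sum.cong) (auto simp: ip that)
    then show ?thesis using that E(1) by simp
  qed
  have adjR: "x \<bullet> R y = R x \<bullet> y" for x y
    unfolding R_def by (simp add: inner_sum_left inner_sum_right inner_commute mult_ac)
  have RR: "R (R x) = A *v x" for x
  proof -
    have "R (R x) = (\<Sum>b\<in>E. (l b * (x \<bullet> b)) *\<^sub>R b)"
      unfolding R_def[of "R x"] by (rule sum.cong) (auto simp: Rip l_nonneg mult.assoc[symmetric])
    also have "\<dots> = (\<Sum>b\<in>E. A *v ((x \<bullet> b) *\<^sub>R b))"
      by (rule sum.cong) (auto simp: l matrix_vector_mult_scaleR mult_ac)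
    also have "\<dots> = A *v (\<Sum>b\<in>E. (x \<bullet> b) *\<^sub>R b)"
      by (simp add: linear_sum[OF matrix_vector_mul_linear])
    finally show ?thesis using expand[of x] by simp
  qed
  show ?thesis
  proof (rule ex1I[of _ "matrix R"], intro conjI allI)
    have mR: "matrix R *v x = R x" for x by (simp add: matrix_works linR)
    show "transpose (matrix R) = matrix R"
    proof -
      have "x \<bullet> (transpose (matrix R) *v y) = x \<bullet> (matrix R *v y)" for x y
        by (metis mR adjR dot_lmul_matrix inner_commute transpose_matrix_vector transpose_transpose)
      then show ?thesis by (metis matrix_eq vector_eq_ldot)
    qed
    show "0 \<le> v \<bullet> (matrix R *v v)" for v
      unfolding mR R_def inner_sum_right
      by (intro sum_nonneg) (simp add: l_nonneg mult.assoc power2_eq_square[symmetric])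
    show "matrix R ** matrix R = A"
      by (simp add: matrix_eq matrix_vector_mul_assoc[symmetric] mR RR)
    fix B assume B: "transpose B = B \<and> (\<forall>v. 0 \<le> v \<bullet> (B *v v)) \<and> B ** B = A"
    have Bb: "B *v b = sqrt (l b) *\<^sub>R b" if b: "b \<in> E" for b
    proof -
      let ?s = "sqrt (l b)"
      define z where "z = B *v b - ?s *\<^sub>R b"
      have BB: "B *v (B *v b) = l b *\<^sub>R b" using B l[OF b] by (simp add: matrix_vector_mul_assoc)
      have Bz: "B *v z = - ?s *\<^sub>R z"
        unfolding z_def matrix_vector_mult_diff_distrib BB matrix_vector_mult_scaleR
        using l_nonneg[OF b] by (simp add: scaleR_diff_right)
      have "z = 0"
      proof (cases "?s = 0")
        case True
        then have "l b = 0" by simp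
        have "(B *v b) \<bullet> (B *v b) = b \<bullet> (B *v (B *v b))"
          using B by (simp add: symmetric_matrix_inner)
        then show ?thesis using \<open>l b = 0\<close> by (simp add: BB z_def)
      next
        case False
        then have s: "0 < ?s" using l_nonneg[OF b] by simp
        have "0 \<le> z \<bullet> (B *v z)" using B by blast
        then have "?s * (z \<bullet> z) \<le> 0" by (simp add: Bz)
        then show ?thesis using s by (metis inner_ge_zero inner_eq_zero_iff mult_le_0_iff not_le order_antisym)
      qed
      then show ?thesis by (simp add: z_def)
    qed
    have "B *v x = R x" for x
    proof -
      have "B *v x = B *v (\<Sum>b\<in>E. (x \<bullet> b) *\<^sub>R b)" using expand[of x] by simp
      also have "\<dots> = (\<Sum>b\<in>E. (x \<bullet> b) *\<^sub>R (B *v b))"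
        by (simp add: linear_sum[OF matrix_vector_mul_linear] matrix_vector_mult_scaleR)
      also have "\<dots> = R x" unfolding R_def by (rule sum.cong) (auto simp: Bb mult_ac)
      finally show ?thesis .
    qed
    then show "B = matrix R" by (simp add: matrix_eq mR)
  qed
qed

lemma psd_sqrt:
  fixes A :: "real ^ 'n ^ 'n"
  assumes "transpose A = A" and "\<And>v. 0 \<le> v \<bullet> (A *v v)"
  shows "transpose (psd_sqrt A) = psd_sqrt A" "psd_sqrt A ** psd_sqrt A = A"
  using theI'[OF psd_sqrt_exists[OF assms]] unfolding psd_sqrt_def by blast+

section \<open>Symbols and finite differences in one direction\<close>

primrec fdiff :: "nat \<Rightarrow> 'v::real_vector \<Rightarrow> ('v \<Rightarrow> real) \<Rightarrow> 'v \<Rightarrow> real" where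
  "fdiff 0 h f \<xi> = f \<xi>"
| "fdiff (Suc k) h f \<xi> = fdiff k h f (\<xi> + h) - fdiff k h f \<xi>"

text \<open>Symbols as in the theory of pseudodifferential operators, with derivatives in the single
  direction \<open>e\<close> only and finitely many of them: a function of order \<open>a\<close> on \<open>U\<close> is bounded by
  \<open>|\<xi>|\<^sup>a\<close>, and each derivative lowers the order by one. One direction is enough because decay in
  \<open>x\<close> is extracted from the largest coordinate of \<open>x\<close> alone.\<close>

primrec symbol :: "'v::real_normed_vector \<Rightarrow> 'v set \<Rightarrow> nat \<Rightarrow> real \<Rightarrow> ('v \<Rightarrow> real) \<Rightarrow> bool" where
  "symbol e U 0 a f = (\<exists>C. \<forall>\<xi>\<in>U. \<bar>f \<xi>\<bar> \<le> C * norm \<xi> powr a)"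
| "symbol e U (Suc k) a f =
     ((\<exists>C. \<forall>\<xi>\<in>U. \<bar>f \<xi>\<bar> \<le> C * norm \<xi> powr a) \<and>
      (\<exists>g. (\<forall>\<xi>\<in>U. ((\<lambda>t. f (\<xi> + t *\<^sub>R e)) has_real_derivative g \<xi>) (at 0)) \<and> symbol e U k (a - 1) g))"

lemma symbol_bound: "symbol e U k a f \<Longrightarrow> \<exists>C. \<forall>\<xi>\<in>U. \<bar>f \<xi>\<bar> \<le> C * norm \<xi> powr a"
  by (cases k) auto

lemma symbol_Suc_intro:
  assumes "\<exists>C. \<forall>\<xi>\<in>U. \<bar>f \<xi>\<bar> \<le> C * norm \<xi> powr a"
    and "\<forall>\<xi>\<in>U. ((\<lambda>t. f (\<xi> + t *\<^sub>R e)) has_real_derivative g \<xi>) (at 0)"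
    and "symbol e U k (a - 1) g"
  shows "symbol e U (Suc k) a f"
  using assms by auto

lemma symbol_SucI:
  assumes "\<And>\<xi>. \<xi> \<in> U \<Longrightarrow> \<bar>f \<xi>\<bar> \<le> C * norm \<xi> powr a"
    and "\<And>\<xi>. \<xi> \<in> U \<Longrightarrow> ((\<lambda>t. f (\<xi> + t *\<^sub>R e)) has_real_derivative g \<xi>) (at 0)"
    and "symbol e U k (a - 1) g"
  shows "symbol e U (Suc k) a f"
  using assms by auto

lemma symbol_Suc_imp: "symbol e U (Suc k) a f \<Longrightarrow> symbol e U k a f"
proof (induction k arbitrary: a f)
  case (Suc k)
  from Suc.prems obtain g where
    b: "\<exists>C. \<forall>\<xi>\<in>U. \<bar>f \<xi>\<bar> \<le> C * norm \<xi> powr a"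
    and d: "\<forall>\<xi>\<in>U. ((\<lambda>t. f (\<xi> + t *\<^sub>R e)) has_real_derivative g \<xi>) (at 0)"
    and g: "symbol e U (Suc k) (a - 1) g"
    unfolding symbol.simps(2)[of e U "Suc k"] by blast
  show ?case unfolding symbol.simps(2)[of e U k] using b d Suc.IH[OF g] by blast
qed auto

lemma symbol_cong:
  assumes "symbol e U k a f" "\<And>\<xi> . f \<xi> = g \<xi>"
  shows "symbol e U k a g"
proof -
  have "f = g" using assms(2) by blast
  then show ?thesis using assms(1) by simp
qed

lemma symbol_add:
  "symbol e U k a f \<Longrightarrow> symbol e U k a g \<Longrightarrow> symbol e U k a (\<lambda>\<xi>. f \<xi> + g \<xi>)"
proof (induction k arbitrary: a f g)
  have bd: "\<exists>C. \<forall>\<xi>\<in>U. \<bar>f \<xi> + g \<xi>\<bar> \<le> C * norm \<xi> powr a"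
    if f: "\<exists>C. \<forall>\<xi>\<in>U. \<bar>f \<xi>\<bar> \<le> C * norm \<xi> powr a"
      and g: "\<exists>C. \<forall>\<xi>\<in>U. \<bar>g \<xi>\<bar> \<le> C * norm \<xi> powr a" for a and f g :: "'a \<Rightarrow> real"
  proof -
    obtain C D where "\<forall>\<xi>\<in>U. \<bar>f \<xi>\<bar> \<le> C * norm \<xi> powr a" "\<forall>\<xi>\<in>U. \<bar>g \<xi>\<bar> \<le> D * norm \<xi> powr a"
      using f g by blast
    then have "\<forall>\<xi>\<in>U. \<bar>f \<xi> + g \<xi>\<bar> \<le> (C + D) * norm \<xi> powr a"
      by (auto simp: distrib_right intro!: order_trans[OF abs_triangle_ineq] add_mono)
    then show ?thesis by blast
  qed
  {
    case 0 then show ?case using bd[of f a g] by simp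
  next
    case (Suc k)
    from Suc.prems obtain f' g' where
      f: "\<forall>\<xi>\<in>U. ((\<lambda>t. f (\<xi> + t *\<^sub>R e)) has_real_derivative f' \<xi>) (at 0)" "symbol e U k (a - 1) f'"
      and g: "\<forall>\<xi>\<in>U. ((\<lambda>t. g (\<xi> + t *\<^sub>R e)) has_real_derivative g' \<xi>) (at 0)" "symbol e U k (a - 1) g'"
      by auto
    have "\<exists>C. \<forall>\<xi>\<in>U. \<bar>f \<xi> + g \<xi>\<bar> \<le> C * norm \<xi> powr a"
      using Suc.prems by (intro bd) auto
    moreover have "\<forall>\<xi>\<in>U. ((\<lambda>t. f (\<xi> + t *\<^sub>R e) + g (\<xi> + t *\<^sub>R e)) has_real_derivative f' \<xi> + g' \<xi>) (at 0)"
      using f(1) g(1) by (auto intro: DERIV_add)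
    ultimately show ?case
      by (rule symbol_Suc_intro) (rule Suc.IH[OF f(2) g(2)])
  }
qed

text \<open>The Leibniz rule.\<close>

lemma symbol_mult:
  assumes "symbol e U k a f" "symbol e U k c g"
  shows "symbol e U k (a + c) (\<lambda>\<xi>. f \<xi> * g \<xi>)"
  using assms
proof (induction k arbitrary: a c f g)
  have bd: "\<exists>C. \<forall>\<xi>\<in>U. \<bar>f \<xi> * g \<xi>\<bar> \<le> C * norm \<xi> powr (a + c)"
    if f: "\<exists>C. \<forall>\<xi>\<in>U. \<bar>f \<xi>\<bar> \<le> C * norm \<xi> powr a"
      and g: "\<exists>C. \<forall>\<xi>\<in>U. \<bar>g \<xi>\<bar> \<le> C * norm \<xi> powr c" for a c and f g :: "'a \<Rightarrow> real"
  proof -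
    obtain C D where C: "\<forall>\<xi>\<in>U. \<bar>f \<xi>\<bar> \<le> C * norm \<xi> powr a" and D: "\<forall>\<xi>\<in>U. \<bar>g \<xi>\<bar> \<le> D * norm \<xi> powr c"
      using f g by blast
    have "\<bar>f \<xi> * g \<xi>\<bar> \<le> (C * D) * norm \<xi> powr (a + c)" if "\<xi> \<in> U" for \<xi>
    proof -
      have "\<bar>f \<xi> * g \<xi>\<bar> \<le> (C * norm \<xi> powr a) * (D * norm \<xi> powr c)"
        unfolding abs_mult using C D that by (intro mult_mono) (auto intro: order_trans[OF abs_ge_zero])
      then show ?thesis by (simp add: powr_add mult_ac)
    qed
    then show ?thesis by blast
  qed
  {
    case 0 then show ?case using bd[of f a g c] by simp
  next
    case (Suc k)
    from Suc.prems obtain f' g' where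
      f: "\<forall>\<xi>\<in>U. ((\<lambda>t. f (\<xi> + t *\<^sub>R e)) has_real_derivative f' \<xi>) (at 0)" "symbol e U k (a - 1) f'"
      and g: "\<forall>\<xi>\<in>U. ((\<lambda>t. g (\<xi> + t *\<^sub>R e)) has_real_derivative g' \<xi>) (at 0)" "symbol e U k (c - 1) g'"
      by auto
    have b: "\<exists>C. \<forall>\<xi>\<in>U. \<bar>f \<xi> * g \<xi>\<bar> \<le> C * norm \<xi> powr (a + c)"
      using Suc.prems by (intro bd) auto
    have d: "\<forall>\<xi>\<in>U. ((\<lambda>t. f (\<xi> + t *\<^sub>R e) * g (\<xi> + t *\<^sub>R e)) has_real_derivative
        f' \<xi> * g \<xi> + g' \<xi> * f \<xi>) (at 0)"
    proof
      fix \<xi> assume "\<xi> \<in> U"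
      then show "((\<lambda>t. f (\<xi> + t *\<^sub>R e) * g (\<xi> + t *\<^sub>R e)) has_real_derivative
          f' \<xi> * g \<xi> + g' \<xi> * f \<xi>) (at 0)"
        using DERIV_mult[OF f(1)[rule_format] g(1)[rule_format], of \<xi> \<xi>] by simp
    qed
    have "symbol e U k (a - 1 + c) (\<lambda>\<xi>. f' \<xi> * g \<xi>)"
      by (rule Suc.IH[OF f(2) symbol_Suc_imp[OF Suc.prems(2)]])
    moreover have "symbol e U k (c - 1 + a) (\<lambda>\<xi>. g' \<xi> * f \<xi>)"
      by (rule Suc.IH[OF g(2) symbol_Suc_imp[OF Suc.prems(1)]])
    ultimately have "symbol e U k (a + c - 1) (\<lambda>\<xi>. f' \<xi> * g \<xi> + g' \<xi> * f \<xi>)"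
      by (intro symbol_add) (simp_all add: algebra_simps)
    with b d show ?case by (rule symbol_Suc_intro)
  }
qed

text \<open>The exponent may be changed whenever the quotient of the two powers is bounded on the
  region: lowered on bounded regions, raised away from the origin.\<close>

lemma symbol_weaken:
  assumes "symbol e U k a f" and U: "\<And>\<xi>. \<xi> \<in> U \<Longrightarrow> norm \<xi> powr (a - c) \<le> D"
  shows "symbol e U k c f"
  using assms
proof (induction k arbitrary: a c f)
  have bd: "\<exists>C. \<forall>\<xi>\<in>U. \<bar>f \<xi>\<bar> \<le> C * norm \<xi> powr c"
    if f: "\<exists>C. \<forall>\<xi>\<in>U. \<bar>f \<xi>\<bar> \<le> C * norm \<xi> powr a" and D: "\<And>\<xi>. \<xi> \<in> U \<Longrightarrow> norm \<xi> powr (a - c) \<le> D"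
    for a c and f :: "'a \<Rightarrow> real"
  proof -
    obtain C where C: "\<forall>\<xi>\<in>U. \<bar>f \<xi>\<bar> \<le> C * norm \<xi> powr a" using f by blast
    have "\<bar>f \<xi>\<bar> \<le> (\<bar>C\<bar> * D) * norm \<xi> powr c" if "\<xi> \<in> U" for \<xi>
    proof -
      have "\<bar>f \<xi>\<bar> \<le> \<bar>C\<bar> * norm \<xi> powr a"
        using C that by (meson abs_ge_self mult_right_mono order_trans powr_ge_zero)
      also have "norm \<xi> powr a = norm \<xi> powr (a - c) * norm \<xi> powr c"
        by (simp flip: powr_add)
      also have "\<bar>C\<bar> * (norm \<xi> powr (a - c) * norm \<xi> powr c) \<le> \<bar>C\<bar> * (D * norm \<xi> powr c)"
        using D[OF that] by (intro mult_left_mono mult_right_mono) auto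
      finally show ?thesis by simp
    qed
    then show ?thesis by blast
  qed
  {
    case 0 then show ?case using bd[of f a c] by simp
  next
    case (Suc k)
    from Suc.prems obtain g where
      d: "\<forall>\<xi>\<in>U. ((\<lambda>t. f (\<xi> + t *\<^sub>R e)) has_real_derivative g \<xi>) (at 0)" and g: "symbol e U k (a - 1) g"
      by auto
    have "symbol e U k (c - 1) g" by (rule Suc.IH[OF g]) (use Suc.prems(2) in simp)
    then show ?case using d Suc.prems by (intro symbol_Suc_intro[OF bd]) auto
  }
qed

lemma symbol_zero: "symbol e U k a (\<lambda>_. 0)"
proof (induction k arbitrary: a)
  case 0
  show ?case by (auto intro: exI[of _ 0])
next
  case (Suc k)
  show ?case by (rule symbol_SucI[where C=0 and g="\<lambda>_. 0"]) (use Suc in auto)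
qed

lemma symbol_const:
  assumes "0 \<notin> U"
  shows "symbol e U k 0 (\<lambda>_. c)"
proof (cases k)
  case 0
  have "\<bar>c\<bar> \<le> \<bar>c\<bar> * norm \<xi> powr 0" if "\<xi> \<in> U" for \<xi> using that assms by auto
  then show ?thesis unfolding 0 symbol.simps by blast
next
  case (Suc l)
  show ?thesis unfolding Suc
  proof (rule symbol_SucI[where C="\<bar>c\<bar>" and g="\<lambda>_. 0"])
    show "\<bar>c\<bar> \<le> \<bar>c\<bar> * norm \<xi> powr 0" if "\<xi> \<in> U" for \<xi> using that assms by auto
  qed (auto intro: symbol_zero)
qed

lemma symbol_cmult:
  assumes "symbol e U k a f" "0 \<notin> U"
  shows "symbol e U k a (\<lambda>\<xi>. c * f \<xi>)"
  using symbol_mult[OF symbol_const[OF assms(2)] assms(1)] by simp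

lemma symbol_diff:
  assumes "symbol e U k a f" "symbol e U k a g" "0 \<notin> U"
  shows "symbol e U k a (\<lambda>\<xi>. f \<xi> - g \<xi>)"
  using symbol_add[OF assms(1) symbol_cmult[OF assms(2,3), of "-1"]] by simp

lemma symbol_inverse:
  assumes f: "symbol e U k a f" and U: "0 \<notin> U" and c: "0 < c"
    and ell: "\<And>\<xi>. \<xi> \<in> U \<Longrightarrow> c * norm \<xi> powr a \<le> \<bar>f \<xi>\<bar>"
  shows "symbol e U k (- a) (\<lambda>\<xi>. 1 / f \<xi>)"
proof -
  have nz: "f \<xi> \<noteq> 0" if "\<xi> \<in> U" for \<xi>
  proof -
    have "\<xi> \<noteq> 0" using U that by blast
    then have "0 < c * norm \<xi> powr a" using c by simp
    then show ?thesis using ell[OF that] by auto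
  qed
  have bd: "\<bar>1 / f \<xi>\<bar> \<le> (1 / c) * norm \<xi> powr (- a)" if "\<xi> \<in> U" for \<xi>
  proof -
    have "\<xi> \<noteq> 0" using U that by blast
    then have p: "0 < c * norm \<xi> powr a" using c by simp
    have "\<bar>1 / f \<xi>\<bar> = 1 / \<bar>f \<xi>\<bar>" by (simp add: abs_divide)
    also have "\<dots> \<le> 1 / (c * norm \<xi> powr a)" by (rule divide_left_mono) (use ell[OF that] p nz[OF that] in auto)
    finally show ?thesis by (simp add: powr_minus_divide)
  qed
  show ?thesis using f
  proof (induction k)
    case 0 then show ?case using bd unfolding symbol.simps by blast
  next
    case (Suc k)
    from Suc.prems obtain g where
      d: "\<forall>\<xi>\<in>U. ((\<lambda>t. f (\<xi> + t *\<^sub>R e)) has_real_derivative g \<xi>) (at 0)" and g: "symbol e U k (a - 1) g"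
      by auto
    note inv = Suc.IH[OF symbol_Suc_imp[OF Suc.prems]]
    show ?case
    proof (rule symbol_SucI[OF bd])
      fix \<xi> assume \<xi>: "\<xi> \<in> U"
      have "((\<lambda>t. inverse (f (\<xi> + t *\<^sub>R e))) has_real_derivative
          - (inverse (f (\<xi> + 0 *\<^sub>R e)) * g \<xi> * inverse (f (\<xi> + 0 *\<^sub>R e)))) (at 0)"
        by (rule DERIV_inverse'[OF d[rule_format, OF \<xi>]]) (use nz[OF \<xi>] in simp)
      then show "((\<lambda>t. 1 / f (\<xi> + t *\<^sub>R e)) has_real_derivative (-1) * (g \<xi> * (1 / f \<xi> * (1 / f \<xi>)))) (at 0)"
        by (simp add: inverse_eq_divide mult_ac)
    next
      have "symbol e U k (a - 1 + (- a + - a)) (\<lambda>\<xi>. g \<xi> * (1 / f \<xi> * (1 / f \<xi>)))"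
        by (intro symbol_mult g inv)
      moreover have "a - 1 + (- a + - a) = - a - 1" by simp
      ultimately show "symbol e U k (- a - 1) (\<lambda>\<xi>. (-1) * (g \<xi> * (1 / f \<xi> * (1 / f \<xi>))))"
        using symbol_cmult[OF _ U] by metis
    qed
  qed
qed

lemma symbol_inner:
  fixes e :: "'v::real_inner"
  assumes "0 \<notin> U"
  shows "symbol e U k 1 (\<lambda>\<xi>. \<xi> \<bullet> v)"
proof (cases k)
  case 0
  have "\<bar>\<xi> \<bullet> v\<bar> \<le> norm v * norm \<xi> powr 1" for \<xi>
    using Cauchy_Schwarz_ineq2[of \<xi> v] by (cases "\<xi> = 0") (auto simp: mult.commute)
  then show ?thesis using 0 by auto
next
  case (Suc l)
  show ?thesis unfolding Suc
  proof (rule symbol_SucI[where C="norm v" and g="\<lambda>_. e \<bullet> v"])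
    show "\<bar>\<xi> \<bullet> v\<bar> \<le> norm v * norm \<xi> powr 1" for \<xi>
      using Cauchy_Schwarz_ineq2[of \<xi> v] by (cases "\<xi> = 0") (auto simp: mult.commute)
    show "((\<lambda>t. (\<xi> + t *\<^sub>R e) \<bullet> v) has_real_derivative e \<bullet> v) (at 0)" for \<xi>
      by (auto simp: inner_add_left intro!: derivative_eq_intros)
  qed (use symbol_const[OF assms] in simp)
qed

text \<open>Both functions vanish at the origin to first order at least, and on a bounded region bounded
  derivatives satisfy the conditions of all nonpositive orders.\<close>

lemma symbol_trig_bounded:
  fixes e :: "'v::real_inner"
  assumes U: "0 \<notin> U" and R: "\<And>\<xi>. \<xi> \<in> U \<Longrightarrow> norm \<xi> \<le> R"
  shows "symbol e U k 1 (\<lambda>\<xi>. sin (\<xi> \<bullet> v))" "symbol e U k 1 (\<lambda>\<xi>. cos (\<xi> \<bullet> v) - 1)"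
proof -
  have d: "((\<lambda>t. sin ((\<xi> + t *\<^sub>R e) \<bullet> v)) has_real_derivative (e \<bullet> v) * cos (\<xi> \<bullet> v)) (at 0)"
     "((\<lambda>t. cos ((\<xi> + t *\<^sub>R e) \<bullet> v)) has_real_derivative - (e \<bullet> v) * sin (\<xi> \<bullet> v)) (at 0)" 
     "((\<lambda>t. cos ((\<xi> + t *\<^sub>R e) \<bullet> v) - 1) has_real_derivative - (e \<bullet> v) * sin (\<xi> \<bullet> v)) (at 0)" for \<xi>
    by (auto simp: inner_add_left intro!: derivative_eq_intros)
  have weak: "symbol e U k 0 f \<Longrightarrow> symbol e U k (- 1) f" for k f
    by (erule symbol_weaken[where D=R]) (use U R in \<open>auto simp: powr_one\<close>)
  have 0: "symbol e U k 0 (\<lambda>\<xi>. sin (\<xi> \<bullet> v)) \<and> symbol e U k 0 (\<lambda>\<xi>. cos (\<xi> \<bullet> v))" for k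
  proof (induction k)
    case 0
    have "\<bar>sin (\<xi> \<bullet> v)\<bar> \<le> 1 * norm \<xi> powr 0" "\<bar>cos (\<xi> \<bullet> v)\<bar> \<le> 1 * norm \<xi> powr 0" if "\<xi> \<in> U" for \<xi>
      using that U by auto
    then show ?case unfolding symbol.simps by blast
  next
    case (Suc k)
    have "symbol e U (Suc k) 0 (\<lambda>\<xi>. sin (\<xi> \<bullet> v))"
      by (rule symbol_SucI[where C=1, OF _ d(1)])
        (use U Suc in \<open>auto intro!: symbol_cmult weak\<close>)
    moreover have "symbol e U (Suc k) 0 (\<lambda>\<xi>. cos (\<xi> \<bullet> v))"
      by (rule symbol_SucI[where C=1, OF _ d(2)])
        (use U Suc symbol_cmult[OF weak, of k "\<lambda>\<xi>. sin (\<xi> \<bullet> v)" "- (e \<bullet> v)"] in auto)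
    ultimately show ?case ..
  qed
  have b1: "\<bar>sin (\<xi> \<bullet> v)\<bar> \<le> norm v * norm \<xi> powr 1" if "\<xi> \<in> U" for \<xi>
  proof -
    have "\<bar>sin (\<xi> \<bullet> v)\<bar> \<le> \<bar>\<xi> \<bullet> v\<bar>" by (rule abs_sin_x_le_abs_x)
    also have "\<dots> \<le> norm v * norm \<xi> powr 1"
      using Cauchy_Schwarz_ineq2[of \<xi> v] U that by (auto simp: mult.commute powr_one)
    finally show ?thesis .
  qed
  have b2: "\<bar>cos (\<xi> \<bullet> v) - 1\<bar> \<le> norm v * norm \<xi> powr 1" if "\<xi> \<in> U" for \<xi>
  proof -
    have "1 - cos (\<xi> \<bullet> v) = 2 * (sin ((\<xi> \<bullet> v) / 2))\<^sup>2"
      using cos_double_sin[of "(\<xi> \<bullet> v) / 2"] by simp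
    moreover have "(sin ((\<xi> \<bullet> v) / 2))\<^sup>2 \<le> \<bar>sin ((\<xi> \<bullet> v) / 2)\<bar>"
    proof -
      have "\<bar>sin ((\<xi> \<bullet> v) / 2)\<bar> * \<bar>sin ((\<xi> \<bullet> v) / 2)\<bar> \<le> \<bar>sin ((\<xi> \<bullet> v) / 2)\<bar> * 1"
        by (intro mult_left_mono) auto
      then show ?thesis by (simp add: power2_eq_square)
    qed
    moreover have "\<bar>sin ((\<xi> \<bullet> v) / 2)\<bar> \<le> \<bar>(\<xi> \<bullet> v) / 2\<bar>" by (rule abs_sin_x_le_abs_x)
    ultimately have "\<bar>cos (\<xi> \<bullet> v) - 1\<bar> \<le> \<bar>\<xi> \<bullet> v\<bar>" using cos_le_one[of "\<xi> \<bullet> v"] by simp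
    also have "\<dots> \<le> norm v * norm \<xi> powr 1"
      using Cauchy_Schwarz_ineq2[of \<xi> v] U that by (auto simp: mult.commute powr_one)
    finally show ?thesis .
  qed
  show "symbol e U k 1 (\<lambda>\<xi>. sin (\<xi> \<bullet> v))"
    by (rule symbol_Suc_imp, rule symbol_SucI[OF b1 d(1)])
      (use 0 U in \<open>auto intro!: symbol_cmult\<close>)
  show "symbol e U k 1 (\<lambda>\<xi>. cos (\<xi> \<bullet> v) - 1)"
    by (rule symbol_Suc_imp, rule symbol_SucI[OF b2 d(3)])
      (use 0 U symbol_cmult[of e U k 0 "\<lambda>\<xi>. sin (\<xi> \<bullet> v)" "- (e \<bullet> v)"] in auto)
qed

text \<open>Away from the origin, bounded oscillation does not decay, but it is a symbol of an
  order that grows with the number of derivatives; this is harmless next to a Gaussian.\<close>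

lemma symbol_trig_far:
  fixes e :: "'v::real_inner"
  assumes U: "\<And>\<xi>. \<xi> \<in> U \<Longrightarrow> 1 \<le> norm \<xi>"
  shows "symbol e U k (real k) (\<lambda>\<xi>. sin (\<xi> \<bullet> v))" "symbol e U k (real k) (\<lambda>\<xi>. cos (\<xi> \<bullet> v) - 1)"
proof -
  have U0: "0 \<notin> U" using U by force
  have ge1: "1 \<le> norm \<xi> powr real k" if "\<xi> \<in> U" for \<xi> k
    using U[OF that] by (simp add: ge_one_powr_ge_zero)
  have d: "((\<lambda>t. sin ((\<xi> + t *\<^sub>R e) \<bullet> v)) has_real_derivative (e \<bullet> v) * cos (\<xi> \<bullet> v)) (at 0)"
     "((\<lambda>t. cos ((\<xi> + t *\<^sub>R e) \<bullet> v)) has_real_derivative - (e \<bullet> v) * sin (\<xi> \<bullet> v)) (at 0)" for \<xi>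
    by (auto simp: inner_add_left intro!: derivative_eq_intros)
  have b: "\<bar>sin (\<xi> \<bullet> v)\<bar> \<le> 1 * norm \<xi> powr real k" "\<bar>cos (\<xi> \<bullet> v)\<bar> \<le> 1 * norm \<xi> powr real k"
    if "\<xi> \<in> U" for \<xi> k
    using ge1[OF that, of k] abs_sin_le_one[of "\<xi> \<bullet> v"] abs_cos_le_one[of "\<xi> \<bullet> v"] by linarith+
  have both: "symbol e U k (real k) (\<lambda>\<xi>. sin (\<xi> \<bullet> v)) \<and> symbol e U k (real k) (\<lambda>\<xi>. cos (\<xi> \<bullet> v))" for k
  proof (induction k)
    case 0
    show ?case unfolding symbol.simps using b[of _ 0] by blast
  next
    case (Suc k)
    have "symbol e U (Suc k) (real (Suc k)) (\<lambda>\<xi>. sin (\<xi> \<bullet> v))"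
      by (rule symbol_SucI[OF b(1) d(1)]) (use Suc U0 in \<open>auto intro!: symbol_cmult\<close>)
    moreover have "symbol e U (Suc k) (real (Suc k)) (\<lambda>\<xi>. cos (\<xi> \<bullet> v))"
      by (rule symbol_SucI[OF b(2) d(2)])
        (use Suc U0 symbol_cmult[of e U k "real k" "\<lambda>\<xi>. sin (\<xi> \<bullet> v)" "- (e \<bullet> v)"] in auto)
    ultimately show ?case ..
  qed
  show "symbol e U k (real k) (\<lambda>\<xi>. sin (\<xi> \<bullet> v))" using both by blast
  have "symbol e U k (real k) (\<lambda>_. 1)"
    by (rule symbol_weaken[OF symbol_const[OF U0], where D=1])
      (use U0 ge1[of _ k] in \<open>auto simp: powr_minus_divide divide_le_eq_1\<close>)
  then show "symbol e U k (real k) (\<lambda>\<xi>. cos (\<xi> \<bullet> v) - 1)"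
    using both U0 by (intro symbol_diff) auto
qed

text \<open>The derivative \<open>- q' exp (- q)\<close> should have order \<open>a - 1\<close>; as \<open>q'\<close> has order \<open>1\<close>, this requires
  \<open>exp (- q)\<close> to be of order \<open>a - 2\<close> as well. Hence the set \<open>A\<close> of admissible orders is closed
  under \<open>a \<mapsto> a - 2\<close>; it is \<open>{..0}\<close> on bounded regions and everything away from the origin.\<close>

lemma symbol_exp:
  assumes U: "0 \<notin> U"
    and d: "\<And>\<xi>. \<xi> \<in> U \<Longrightarrow> ((\<lambda>t. q (\<xi> + t *\<^sub>R e)) has_real_derivative q' \<xi>) (at 0)"
    and q': "\<And>k. symbol e U k 1 q'"
    and A: "\<And>a. a \<in> A \<Longrightarrow> a - 2 \<in> A"
    and b: "\<And>a. a \<in> A \<Longrightarrow> \<exists>C. \<forall>\<xi>\<in>U. exp (- q \<xi>) \<le> C * norm \<xi> powr a"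
  shows "a \<in> A \<Longrightarrow> symbol e U k a (\<lambda>\<xi>. exp (- q \<xi>))"
proof (induction k arbitrary: a)
  case 0
  then show ?case using b by simp
next
  case (Suc k)
  obtain C where C: "\<And>\<xi>. \<xi> \<in> U \<Longrightarrow> exp (- q \<xi>) \<le> C * norm \<xi> powr a" using b[OF Suc.prems] by blast
  show ?case
  proof (rule symbol_SucI)
    show "\<bar>exp (- q \<xi>)\<bar> \<le> C * norm \<xi> powr a" if "\<xi> \<in> U" for \<xi> using C[OF that] by simp
    show "((\<lambda>t. exp (- q (\<xi> + t *\<^sub>R e))) has_real_derivative (-1) * (q' \<xi> * exp (- q \<xi>))) (at 0)"
      if "\<xi> \<in> U" for \<xi>
      using d[OF that] by (auto intro!: derivative_eq_intros)
    have "symbol e U k (1 + (a - 2)) (\<lambda>\<xi>. q' \<xi> * exp (- q \<xi>))"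
      by (intro symbol_mult q' Suc.IH A Suc.prems)
    from symbol_cmult[OF this U, of "-1"]
    show "symbol e U k (a - 1) (\<lambda>\<xi>. (-1) * (q' \<xi> * exp (- q \<xi>)))" by simp
  qed
qed

lemma fdiff_has_real_derivative:
  assumes "\<And>i. i \<le> k \<Longrightarrow> ((\<lambda>t. f (\<xi> + real i *\<^sub>R h + t *\<^sub>R e)) has_real_derivative g (\<xi> + real i *\<^sub>R h)) (at 0)"
  shows "((\<lambda>t. fdiff k h f (\<xi> + t *\<^sub>R e)) has_real_derivative fdiff k h g \<xi>) (at 0)"
  using assms
proof (induction k arbitrary: \<xi>)
  case 0
  then show ?case by (simp add: algebra_simps)
next
  case (Suc k)
  have 1: "((\<lambda>t. fdiff k h f ((\<xi> + h) + t *\<^sub>R e)) has_real_derivative fdiff k h g (\<xi> + h)) (at 0)"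
  proof (rule Suc.IH)
    fix i assume "i \<le> k"
    then show "((\<lambda>t. f (\<xi> + h + real i *\<^sub>R h + t *\<^sub>R e)) has_real_derivative g (\<xi> + h + real i *\<^sub>R h)) (at 0)"
      using Suc.prems[of "Suc i"] by (simp add: algebra_simps)
  qed
  have 2: "((\<lambda>t. fdiff k h f (\<xi> + t *\<^sub>R e)) has_real_derivative fdiff k h g \<xi>) (at 0)"
    by (rule Suc.IH) (use Suc.prems in auto)
  show ?case using DERIV_diff[OF 1 2] by (simp add: algebra_simps)
qed

text \<open>A \<open>k\<close>-th difference is \<open>h\<^sup>k\<close> times a \<open>k\<close>-th derivative at an intermediate point, by
  the mean value theorem applied \<open>k\<close> times.\<close>

lemma symbol_fdiff_segment:
  assumes "symbol e U k a f"
  shows "\<exists>C\<ge>0. \<forall>\<xi> h M. 0 \<le> h \<longrightarrow>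
    (\<forall>s\<in>{0..real k * h}. \<xi> + s *\<^sub>R e \<in> U \<and> norm (\<xi> + s *\<^sub>R e) powr (a - real k) \<le> M) \<longrightarrow>
    \<bar>fdiff k (h *\<^sub>R e) f \<xi>\<bar> \<le> h ^ k * C * M"
  using assms
proof (induction k arbitrary: a f)
  case 0
  then obtain C where C: "\<forall>\<xi>\<in>U. \<bar>f \<xi>\<bar> \<le> C * norm \<xi> powr a" by auto
  show ?case
  proof (intro exI[of _ "\<bar>C\<bar>"] conjI allI impI)
    fix \<xi> h M assume s: "\<forall>s\<in>{0..real 0 * h}. \<xi> + s *\<^sub>R e \<in> U \<and> norm (\<xi> + s *\<^sub>R e) powr (a - real 0) \<le> M"
    then have "\<xi> \<in> U" "norm \<xi> powr a \<le> M" by auto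
    then have "\<bar>f \<xi>\<bar> \<le> C * norm \<xi> powr a" using C by blast
    also have "\<dots> \<le> \<bar>C\<bar> * M" using \<open>norm \<xi> powr a \<le> M\<close> by (intro mult_mono) auto
    finally show "\<bar>fdiff 0 (h *\<^sub>R e) f \<xi>\<bar> \<le> h ^ 0 * \<bar>C\<bar> * M" by simp
  qed simp
next
  case (Suc k)
  from Suc.prems obtain g where
    d: "\<And>\<xi>. \<xi> \<in> U \<Longrightarrow> ((\<lambda>t. f (\<xi> + t *\<^sub>R e)) has_real_derivative g \<xi>) (at 0)"
    and g: "symbol e U k (a - 1) g"
    by auto
  from Suc.IH[OF g] obtain C where "0 \<le> C" and C: "\<And>\<xi> h M. 0 \<le> h \<Longrightarrow>
    (\<forall>s\<in>{0..real k * h}. \<xi> + s *\<^sub>R e \<in> U \<and> norm (\<xi> + s *\<^sub>R e) powr (a - 1 - real k) \<le> M) \<Longrightarrow>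
    \<bar>fdiff k (h *\<^sub>R e) g \<xi>\<bar> \<le> h ^ k * C * M" by blast
  show ?case
  proof (intro exI[of _ C] conjI allI impI \<open>0 \<le> C\<close>)
    fix \<xi> h M assume h: "0 \<le> h"
      and s: "\<forall>s\<in>{0..real (Suc k) * h}. \<xi> + s *\<^sub>R e \<in> U \<and> norm (\<xi> + s *\<^sub>R e) powr (a - real (Suc k)) \<le> M"
    let ?\<phi> = "\<lambda>t. fdiff k (h *\<^sub>R e) f (\<xi> + t *\<^sub>R e)"
    let ?\<phi>' = "\<lambda>t. fdiff k (h *\<^sub>R e) g (\<xi> + t *\<^sub>R e)"
    have der: "(?\<phi> has_real_derivative ?\<phi>' t) (at t)" if t: "0 \<le> t" "t \<le> h" for t
    proof -
      have "((\<lambda>r. fdiff k (h *\<^sub>R e) f ((\<xi> + t *\<^sub>R e) + r *\<^sub>R e)) has_real_derivative ?\<phi>' t) (at 0)"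
      proof (rule fdiff_has_real_derivative)
        fix i assume i: "i \<le> k"
        have "real i * h \<le> real k * h" using i h by (intro mult_right_mono) auto
        then have "t + real i * h \<in> {0..real (Suc k) * h}" using t h by (auto simp: algebra_simps)
        then have "\<xi> + (t + real i * h) *\<^sub>R e \<in> U" using s by blast
        from d[OF this]
        show "((\<lambda>r. f (\<xi> + t *\<^sub>R e + real i *\<^sub>R h *\<^sub>R e + r *\<^sub>R e)) has_real_derivative
               g (\<xi> + t *\<^sub>R e + real i *\<^sub>R h *\<^sub>R e)) (at 0)"
          by (simp add: algebra_simps)
      qed
      then show ?thesis
        using DERIV_shift[of ?\<phi> "?\<phi>' t" 0 t] by (simp add: algebra_simps)
    qed
    show "\<bar>fdiff (Suc k) (h *\<^sub>R e) f \<xi>\<bar> \<le> h ^ Suc k * C * M"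
    proof (cases "h = 0")
      case True
      then show ?thesis by simp
    next
      case False
      then have "0 < h" using h by simp
      from MVT2[OF this, of ?\<phi> ?\<phi>'] der obtain z where z: "0 < z" "z < h" "?\<phi> h - ?\<phi> 0 = (h - 0) * ?\<phi>' z"
        by blast
      have "\<bar>?\<phi>' z\<bar> \<le> h ^ k * C * M"
      proof (rule C[OF h], rule ballI)
        fix r assume "r \<in> {0..real k * h}"
        then have "z + r \<in> {0..real (Suc k) * h}" using z by (auto simp: algebra_simps)
        then show "\<xi> + z *\<^sub>R e + r *\<^sub>R e \<in> U \<and> norm (\<xi> + z *\<^sub>R e + r *\<^sub>R e) powr (a - 1 - real k) \<le> M"
          using s by (auto simp: algebra_simps dest!: bspec)
      qed
      then have "h * \<bar>?\<phi>' z\<bar> \<le> h * (h ^ k * C * M)" using h by (intro mult_left_mono)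
      moreover have "fdiff (Suc k) (h *\<^sub>R e) f \<xi> = h * ?\<phi>' z" using z(3) by simp
      ultimately show ?thesis using h by (simp add: abs_mult mult_ac)
    qed
  qed
qed

text \<open>If the total step is at most half the distance to the origin, all points of the segment have
  norms comparable to the norm of \<open>\<xi>\<close>.\<close>

lemma symbol_fdiff:
  assumes "symbol e U k a f" and e: "norm e = 1" and ak: "a \<le> real k"
  shows "\<exists>C\<ge>0. \<forall>\<xi> h. 0 \<le> h \<longrightarrow> 2 * real k * h \<le> norm \<xi> \<longrightarrow> \<xi> \<noteq> 0 \<longrightarrow>
    (\<forall>s\<in>{0..real k * h}. \<xi> + s *\<^sub>R e \<in> U) \<longrightarrow>
    \<bar>fdiff k (h *\<^sub>R e) f \<xi>\<bar> \<le> C * h ^ k * norm \<xi> powr (a - real k)"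
proof -
  from symbol_fdiff_segment[OF assms(1)] obtain C where "0 \<le> C" and C: "\<And>\<xi> h M. 0 \<le> h \<Longrightarrow>
    (\<forall>s\<in>{0..real k * h}. \<xi> + s *\<^sub>R e \<in> U \<and> norm (\<xi> + s *\<^sub>R e) powr (a - real k) \<le> M) \<Longrightarrow>
    \<bar>fdiff k (h *\<^sub>R e) f \<xi>\<bar> \<le> h ^ k * C * M" by blast
  show ?thesis
  proof (intro exI[of _ "C * (1 / 2) powr (a - real k)"] conjI allI impI)
    fix \<xi> h assume h: "0 \<le> h" "2 * real k * h \<le> norm \<xi>" "\<xi> \<noteq> 0" and s: "\<forall>s\<in>{0..real k * h}. \<xi> + s *\<^sub>R e \<in> U"
    have "\<bar>fdiff k (h *\<^sub>R e) f \<xi>\<bar> \<le> h ^ k * C * ((1 / 2) powr (a - real k) * norm \<xi> powr (a - real k))"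
    proof (rule C[OF h(1)], intro ballI conjI)
      fix r assume r: "r \<in> {0..real k * h}"
      then show "\<xi> + r *\<^sub>R e \<in> U" using s by blast
      have "norm \<xi> \<le> norm (\<xi> + r *\<^sub>R e) + norm (r *\<^sub>R e)"
        by (metis add_diff_cancel norm_triangle_ineq4)
      then have "norm \<xi> / 2 \<le> norm (\<xi> + r *\<^sub>R e)" using r e h(2) by simp
      then have "norm (\<xi> + r *\<^sub>R e) powr (a - real k) \<le> (norm \<xi> / 2) powr (a - real k)"
        using ak h(3) by (intro powr_mono2') auto
      also have "\<dots> = (1 / 2) powr (a - real k) * norm \<xi> powr (a - real k)"
        by (simp flip: powr_mult)
      finally show "norm (\<xi> + r *\<^sub>R e) powr (a - real k) \<le> (1 / 2) powr (a - real k) * norm \<xi> powr (a - real k)" .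
    qed
    then show "\<bar>fdiff k (h *\<^sub>R e) f \<xi>\<bar> \<le> C * (1 / 2) powr (a - real k) * h ^ k * norm \<xi> powr (a - real k)"
      by (simp add: mult_ac)
  qed (use \<open>0 \<le> C\<close> in simp)
qed

section \<open>Decay of oscillatory integrals\<close>

lemma nn_integral_inverse_power_finite:
  fixes s :: real
  assumes s: "1 < s"
  shows "(\<integral>\<^sup>+t. ennreal ((1 + \<bar>t\<bar>) powr (- s)) \<partial>lborel) < \<infinity>"
proof -
  let ?f = "\<lambda>t::real. ennreal ((1 + \<bar>t\<bar>) powr (- s))"
  let ?F = "\<lambda>t::real. (1 + t) powr (1 - s) / (1 - s)"
  have lim: "(?F \<longlongrightarrow> 0) at_top"
  proof -
    have "((\<lambda>t::real. (1 + t) powr (1 - s)) \<longlongrightarrow> 0) at_top"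
      using s by (intro tendsto_neg_powr filterlim_tendsto_add_at_top[OF tendsto_const] filterlim_ident) auto
    from tendsto_divide[OF this tendsto_const, of "1 - s"] show ?thesis using s by simp
  qed
  have "(\<integral>\<^sup>+t. ennreal ((1 + \<bar>t\<bar>) powr (- s)) * indicator {0..} t \<partial>lborel) = ennreal (0 - ?F 0)"
  proof (rule nn_integral_FTC_atLeast[OF _ _ _ lim])
    fix t :: real assume "0 \<le> t"
    then have "((\<lambda>t. (1 + t) powr (1 - s)) has_real_derivative (1 - s) * (1 + t) powr (1 - s - 1)) (at t)"
      by (auto intro!: derivative_eq_intros)
    from DERIV_cdivide[OF this, of "1 - s"]
    show "(?F has_real_derivative (1 + \<bar>t\<bar>) powr (- s)) (at t)"
      using s \<open>0 \<le> t\<close> by simp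
  qed auto
  then have half: "(\<integral>\<^sup>+t. ?f t * indicator {0..} t \<partial>lborel) < \<infinity>" by simp
  have half': "(\<integral>\<^sup>+t. ?f t * indicator {..0} t \<partial>lborel) < \<infinity>"
  proof -
    have "(\<integral>\<^sup>+t. ?f t * indicator {..0} t \<partial>lborel)
        = \<bar>-1::real\<bar> * (\<integral>\<^sup>+t. ?f (0 + (-1) * t) * indicator {..0} (0 + (-1) * t) \<partial>lborel)"
      by (rule nn_integral_real_affine) auto
    also have "\<dots> = (\<integral>\<^sup>+t. ?f t * indicator {0..} t \<partial>lborel)"
      by (auto intro!: nn_integral_cong split: split_indicator)
    finally show ?thesis using half by simp
  qed
  have "(\<integral>\<^sup>+t. ?f t \<partial>lborel) \<le> (\<integral>\<^sup>+t. ?f t * indicator {0..} t + ?f t * indicator {..0} t \<partial>lborel)"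
    by (intro nn_integral_mono) (auto split: split_indicator)
  also have "\<dots> = (\<integral>\<^sup>+t. ?f t * indicator {0..} t \<partial>lborel) + (\<integral>\<^sup>+t. ?f t * indicator {..0} t \<partial>lborel)"
    by (intro nn_integral_add) auto
  also have "\<dots> < \<infinity>" using half half' by simp
  finally show ?thesis .
qed

text \<open>Every coordinate is dominated by the norm, so a negative power of the norm is dominated by
  a product of negative powers of the coordinates, each integrable on the line. The dependence
  on the radius is scaling.\<close>

lemma nn_integral_norm_powr_outside:
  fixes p :: real
  assumes p: "real DIM('a::euclidean_space) < p"
  shows "\<exists>C\<ge>0. \<forall>r>0. (\<integral>\<^sup>+x. ennreal (norm x powr (- p)) * indicator {x. r \<le> norm x} x \<partial>(lborel :: 'a measure))
           \<le> ennreal (C * r powr (real DIM('a) - p))"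
proof -
  define s where "s = p / real DIM('a)"
  have s: "1 < s" using p by (simp add: s_def field_simps)
  let ?I = "\<lambda>r. \<integral>\<^sup>+x. ennreal (norm x powr (- p)) * indicator {x. r \<le> norm x} x \<partial>(lborel :: 'a measure)"
  have le: "ennreal (norm x powr (- p)) * indicator {x. 1 \<le> norm x} x
      \<le> ennreal (2 powr p) * (\<Prod>b\<in>Basis. ennreal ((1 + \<bar>x \<bullet> b\<bar>) powr (- s)))" for x :: 'a
  proof (cases "1 \<le> norm x")
    case True
    have "2 powr (- p) * norm x powr (- p) = (\<Prod>b\<in>(Basis :: 'a set). (2 * norm x) powr (- s))"
    proof -
      have "(\<Prod>b\<in>(Basis :: 'a set). (2 * norm x) powr (- s)) = ((2 * norm x) powr (- s)) powr real DIM('a)"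
        using True by (subst powr_realpow) (auto simp: prod_constant)
      also have "\<dots> = (2 * norm x) powr (- p)" by (simp add: powr_powr s_def)
      finally show ?thesis by (simp add: powr_mult)
    qed
    also have "\<dots> \<le> (\<Prod>b\<in>Basis. (1 + \<bar>x \<bullet> b\<bar>) powr (- s))"
    proof (intro prod_mono conjI)
      fix b :: 'a assume "b \<in> Basis"
      then have "1 + \<bar>x \<bullet> b\<bar> \<le> 2 * norm x" using True Basis_le_norm[of b x] by simp
      then show "(2 * norm x) powr (- s) \<le> (1 + \<bar>x \<bullet> b\<bar>) powr (- s)"
        using s by (intro powr_mono2') auto
    qed auto
    finally have "2 powr p * (2 powr (- p) * norm x powr (- p)) \<le> 2 powr p * (\<Prod>b\<in>Basis. (1 + \<bar>x \<bullet> b\<bar>) powr (- s))"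
      by (intro mult_left_mono) auto
    also have "2 powr p * (2 powr (- p) * norm x powr (- p)) = norm x powr (- p)"
    proof -
      have "2 powr p * 2 powr (- p) = (1 :: real)" by (simp flip: powr_add)
      then show ?thesis by (metis mult.assoc mult_1)
    qed
    finally have "ennreal (norm x powr (- p)) \<le> ennreal (2 powr p) * ennreal (\<Prod>b\<in>Basis. (1 + \<bar>x \<bullet> b\<bar>) powr (- s))"
      by (subst ennreal_mult[symmetric]) (auto intro!: prod_nonneg ennreal_leI)
    then show ?thesis using True by (simp add: prod_ennreal)
  qed simp
  have "?I 1 \<le> (\<integral>\<^sup>+x. ennreal (2 powr p) * (\<Prod>b\<in>Basis. ennreal ((1 + \<bar>x \<bullet> b\<bar>) powr (- s))) \<partial>(lborel :: 'a measure))"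
    by (intro nn_integral_mono le)
  also have "\<dots> = ennreal (2 powr p) * (\<integral>\<^sup>+x. (\<Prod>b\<in>Basis. ennreal ((1 + \<bar>x \<bullet> b\<bar>) powr (- s))) \<partial>(lborel :: 'a measure))"
    by (intro nn_integral_cmult) auto
  also have "(\<integral>\<^sup>+x. (\<Prod>b\<in>Basis. ennreal ((1 + \<bar>x \<bullet> b\<bar>) powr (- s))) \<partial>(lborel :: 'a measure))
      = (\<Prod>b\<in>(Basis :: 'a set). (\<integral>\<^sup>+t. ennreal ((1 + \<bar>t\<bar>) powr (- s)) \<partial>lborel))"
    by (intro nn_integral_lborel_prod) auto
  also have "ennreal (2 powr p) * \<dots> < \<infinity>"
    using nn_integral_inverse_power_finite[OF s] by (simp add: ennreal_mult_less_top ennreal_prod_eq_top power_less_top_ennreal)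
  finally have fin: "?I 1 < \<infinity>" .
  have scale: "?I r = ennreal (r powr (real DIM('a) - p)) * ?I 1" if r: "0 < r" for r
  proof -
    have "?I r = (\<integral>\<^sup>+x. ennreal (norm x powr (- p)) * indicator {x. r \<le> norm x} x
        \<partial>(density (distr lborel borel (\<lambda>x::'a. 0 + r *\<^sub>R x)) (\<lambda>_. ennreal (\<bar>r\<bar> ^ DIM('a)))))"
      using r by (subst lborel_affine[of r 0]) auto
    also have "\<dots> = (\<integral>\<^sup>+x. ennreal (\<bar>r\<bar> ^ DIM('a)) * (ennreal (norm (r *\<^sub>R x) powr (- p)) * indicator {x. r \<le> norm x} (r *\<^sub>R x))
        \<partial>(lborel :: 'a measure))"
      by (simp add: nn_integral_density nn_integral_distr)
    also have "\<dots> = (\<integral>\<^sup>+x. ennreal (r powr (real DIM('a) - p)) *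
        (ennreal (norm x powr (- p)) * indicator {x. 1 \<le> norm x} x) \<partial>(lborel :: 'a measure))"
    proof (intro nn_integral_cong)
      fix x :: 'a
      have "\<bar>r\<bar> ^ DIM('a) * norm (r *\<^sub>R x) powr (- p) = r powr (real DIM('a) - p) * norm x powr (- p)"
      proof -
        have "r powr (real DIM('a) - p) = r powr real DIM('a) * r powr (- p)" by (simp flip: powr_add)
        also have "r powr real DIM('a) = \<bar>r\<bar> ^ DIM('a)" using r powr_realpow[OF r] by simp
        finally show ?thesis using r by (simp add: powr_mult)
      qed
      then have "ennreal (\<bar>r\<bar> ^ DIM('a)) * ennreal (norm (r *\<^sub>R x) powr (- p))
          = ennreal (r powr (real DIM('a) - p)) * ennreal (norm x powr (- p))"
        by (subst (1 2) ennreal_mult[symmetric]) auto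
      moreover have "indicator {x. r \<le> norm x} (r *\<^sub>R x) = (indicator {x. 1 \<le> norm x} x :: ennreal)"
        using r by (auto split: split_indicator)
      ultimately show "ennreal (\<bar>r\<bar> ^ DIM('a)) * (ennreal (norm (r *\<^sub>R x) powr (- p)) * indicator {x. r \<le> norm x} (r *\<^sub>R x))
        = ennreal (r powr (real DIM('a) - p)) * (ennreal (norm x powr (- p)) * indicator {x. 1 \<le> norm x} x)"
        unfolding mult.assoc[symmetric] by simp
    qed
    also have "\<dots> = ennreal (r powr (real DIM('a) - p)) * ?I 1" by (intro nn_integral_cmult) auto
    finally show ?thesis .
  qed
  show ?thesis
  proof (intro exI[of _ "enn2real (?I 1)"] conjI allI impI)
    fix r :: real assume "0 < r"
    have e: "ennreal (enn2real (?I 1)) = ?I 1" using fin by simp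
    have "ennreal (enn2real (?I 1) * r powr (real DIM('a) - p)) = ?I 1 * ennreal (r powr (real DIM('a) - p))"
      by (subst ennreal_mult) (simp_all only: e enn2real_nonneg powr_ge_zero)
    then show "?I r \<le> ennreal (enn2real (?I 1) * r powr (real DIM('a) - p))"
      unfolding scale[OF \<open>0 < r\<close>] by (simp only: mult.commute order_refl)
  qed simp
qed

lemma norm_powr_outside:
  fixes p :: real
  assumes p: "real DIM('a::euclidean_space) < p"
  shows "\<exists>C\<ge>0. \<forall>r>0. integrable lborel (\<lambda>x::'a. norm x powr (- p) * indicator {x. r \<le> norm x} x) \<and>
           (LINT x|lborel. norm x powr (- p) * indicator {x::'a. r \<le> norm x} x) \<le> C * r powr (real DIM('a) - p)"
proof -
  obtain C where C: "0 \<le> C" "\<And>r. 0 < r \<Longrightarrow>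
    (\<integral>\<^sup>+x. ennreal (norm x powr (- p)) * indicator {x. r \<le> norm x} x \<partial>(lborel :: 'a measure))
           \<le> ennreal (C * r powr (real DIM('a) - p))"
    using nn_integral_norm_powr_outside[OF p] by blast
  have e: "(\<integral>\<^sup>+x. ennreal (norm x powr (- p) * indicator {x. r \<le> norm x} x) \<partial>(lborel :: 'a measure))
      = (\<integral>\<^sup>+x. ennreal (norm x powr (- p)) * indicator {x. r \<le> norm x} x \<partial>(lborel :: 'a measure))" for r
    by (intro nn_integral_cong) (auto split: split_indicator)
  have int: "integrable lborel (\<lambda>x::'a. norm x powr (- p) * indicator {x. r \<le> norm x} x)" if "0 < r" for r
  proof (rule integrableI_nonneg)
    show "(\<integral>\<^sup>+x. ennreal (norm x powr (- p) * indicator {x. r \<le> norm x} x) \<partial>(lborel :: 'a measure)) < \<infinity>"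
      unfolding e using C(2)[OF that] by (rule le_less_trans) simp
  qed auto
  show ?thesis
  proof (intro exI[of _ C] conjI allI impI C(1) int)
    fix r :: real assume r: "0 < r"
    have "ennreal (LINT x|lborel. norm x powr (- p) * indicator {x::'a. r \<le> norm x} x)
        = (\<integral>\<^sup>+x. ennreal (norm x powr (- p) * indicator {x. r \<le> norm x} x) \<partial>(lborel :: 'a measure))"
      by (rule nn_integral_eq_integral[symmetric, OF int[OF r]]) auto
    also have "\<dots> \<le> ennreal (C * r powr (real DIM('a) - p))"
      unfolding e by (rule C(2)[OF r])
    finally show "(LINT x|lborel. norm x powr (- p) * indicator {x::'a. r \<le> norm x} x) \<le> C * r powr (real DIM('a) - p)"
      using C(1) by (subst (asm) ennreal_le_iff) auto
  qed
qed

lemma lborel_translate: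
  fixes f :: "'a::euclidean_space \<Rightarrow> real"
  assumes "integrable lborel f"
  shows "integrable lborel (\<lambda>x. f (x + v))" "(LINT x|lborel. f (x + v)) = (LINT x|lborel. f x)"
proof -
  have m: "f \<in> borel_measurable borel" using assms by auto
  have d: "lborel = distr lborel borel (\<lambda>x::'a. x + v)"
  proof -
    have "(\<lambda>x. x + v) = (+) v" by (auto simp: add.commute)
    then show ?thesis using lborel_distr_plus[of v] by simp
  qed
  have "integrable (distr lborel borel (\<lambda>x. x + v)) f" using assms d by simp
  then show "integrable lborel (\<lambda>x. f (x + v))" using m by (subst (asm) integrable_distr_eq) auto
  have "(LINT x|lborel. f x) = (LINT x|distr lborel borel (\<lambda>x. x + v). f x)" using d by simp
  also have "\<dots> = (LINT x|lborel. f (x + v))" using m by (intro integral_distr) auto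
  finally show "(LINT x|lborel. f (x + v)) = (LINT x|lborel. f x)" ..
qed

text \<open>A fundamental domain of the torus, without double points. Integrals of periodic functions over
  it are exactly invariant under translations.\<close>

definition torus :: "(real ^ 'n) set" where
  "torus = {\<xi>. \<forall>i. - pi < \<xi> $ i \<and> \<xi> $ i \<le> pi}"

lemma halfspace_component_measurable:
  "{\<xi> :: real ^ 'n. a < \<xi> $ i} \<in> sets borel" "{\<xi> :: real ^ 'n. \<xi> $ i \<le> a} \<in> sets borel"
  by (auto intro!: borel_open borel_closed open_halfspace_component_gt closed_halfspace_component_le)

lemma torus_measurable [measurable]: "torus \<in> sets borel"
proof -
  have "torus = (\<Inter>i. {\<xi> :: real ^ 'n. - pi < \<xi> $ i} \<inter> {\<xi>. \<xi> $ i \<le> pi})" by (auto simp: torus_def)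
  also have "\<dots> \<in> sets borel"
    by (intro sets.countable_INT'' sets.Int halfspace_component_measurable) auto
  finally show ?thesis .
qed

text \<open>The slab that leaves the cube under the translation is brought back by one period.\<close>

lemma torus_translate:
  fixes p :: "real ^ 'n \<Rightarrow> real"
  assumes per: "\<And>\<xi>. p (\<xi> + (2 * pi) *\<^sub>R axis j 1) = p \<xi>"
    and int: "set_integrable lborel torus p" and s: "0 \<le> s" "s \<le> 2 * pi"
  shows "set_integrable lborel torus (\<lambda>\<xi>. p (\<xi> + s *\<^sub>R axis j 1))"
    and "(LINT \<xi>:torus|lborel. p (\<xi> + s *\<^sub>R axis j 1)) = (LINT \<xi>:torus|lborel. p \<xi>)"
proof -
  let ?e = "axis j 1 :: real ^ 'n"
  define S where "S a c = {\<xi> :: real ^ 'n. (\<forall>i. i \<noteq> j \<longrightarrow> - pi < \<xi> $ i \<and> \<xi> $ i \<le> pi) \<and> a < \<xi> $ j \<and> \<xi> $ j \<le> c}" for a c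
  have Sm [measurable]: "S a c \<in> sets borel" for a c
  proof -
    have "S a c = (\<Inter>i. {\<xi>. (if i = j then a else - pi) < \<xi> $ i} \<inter> {\<xi>. \<xi> $ i \<le> (if i = j then c else pi)})"
      unfolding S_def by (auto split: if_splits)
    also have "\<dots> \<in> sets borel"
      by (intro sets.countable_INT'' sets.Int halfspace_component_measurable) auto
    finally show ?thesis .
  qed
  have T: "indicator torus \<xi> = (indicator (S (- pi) (- pi + s)) \<xi> + indicator (S (- pi + s) pi) \<xi> :: real)" for \<xi>
  proof -
    have "torus = S (- pi) pi" unfolding torus_def S_def by (intro Collect_cong) metis
    moreover have "\<xi> \<in> S (- pi) pi \<longleftrightarrow> \<xi> \<in> S (- pi) (- pi + s) \<or> \<xi> \<in> S (- pi + s) pi"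
      using s by (auto simp: S_def)
    moreover have "\<not> (\<xi> \<in> S (- pi) (- pi + s) \<and> \<xi> \<in> S (- pi + s) pi)" by (auto simp: S_def)
    ultimately show ?thesis by (auto split: split_indicator)
  qed
  have T': "indicator torus (\<xi> + (- s) *\<^sub>R ?e) = (indicator (S (- pi + s) pi) \<xi> + indicator (S pi (pi + s)) \<xi> :: real)" for \<xi>
  proof -
    have "\<xi> + (- s) *\<^sub>R ?e \<in> torus \<longleftrightarrow> \<xi> \<in> S (- pi + s) (pi + s)"
    proof -
      have "(\<xi> + (- s) *\<^sub>R ?e) $ i = (if i = j then \<xi> $ j - s else \<xi> $ i)" for i
        by (simp add: axis_def)
      then show ?thesis by (auto simp: torus_def S_def split: if_splits)
    qed
    moreover have "\<xi> \<in> S (- pi + s) (pi + s) \<longleftrightarrow> \<xi> \<in> S (- pi + s) pi \<or> \<xi> \<in> S pi (pi + s)"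
      using s by (auto simp: S_def)
    moreover have "\<not> (\<xi> \<in> S (- pi + s) pi \<and> \<xi> \<in> S pi (pi + s))" by (auto simp: S_def)
    ultimately show ?thesis by (auto split: split_indicator)
  qed
  have B: "indicator (S pi (pi + s)) (\<xi> + (2 * pi) *\<^sub>R ?e) = (indicator (S (- pi) (- pi + s)) \<xi> :: real)" for \<xi>
    by (auto simp: S_def axis_def split: split_indicator)
  have sub: "integrable lborel (\<lambda>\<xi>. indicator A \<xi> * p \<xi>)" if "A \<subseteq> torus" "A \<in> sets borel" for A
    using set_integrable_subset[OF int, of A] that by (simp add: set_integrable_def)
  have i1: "integrable lborel (\<lambda>\<xi>. indicator (S (- pi) (- pi + s)) \<xi> * p \<xi>)"
    and i2: "integrable lborel (\<lambda>\<xi>. indicator (S (- pi + s) pi) \<xi> * p \<xi>)"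
    by (intro sub; use s in \<open>force simp: torus_def S_def\<close>)+
  have eq3: "indicator (S pi (pi + s)) \<xi> * p \<xi> =
      indicator (S (- pi) (- pi + s)) (\<xi> + (- 2 * pi) *\<^sub>R ?e) * p (\<xi> + (- 2 * pi) *\<^sub>R ?e)" for \<xi>
    using B[of "\<xi> + (- 2 * pi) *\<^sub>R ?e"] per[of "\<xi> + (- 2 * pi) *\<^sub>R ?e"]
    by (simp add: add.assoc flip: scaleR_add_left)
  have i3: "integrable lborel (\<lambda>\<xi>. indicator (S pi (pi + s)) \<xi> * p \<xi>)"
    unfolding eq3 by (rule lborel_translate(1)[OF i1])
  have v3: "(LINT \<xi>|lborel. indicator (S pi (pi + s)) \<xi> * p \<xi>) = (LINT \<xi>|lborel. indicator (S (- pi) (- pi + s)) \<xi> * p \<xi>)"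
    unfolding eq3 by (rule lborel_translate(2)[OF i1])
  have i4: "integrable lborel (\<lambda>\<xi>. indicator torus (\<xi> + (- s) *\<^sub>R ?e) * p \<xi>)"
    unfolding T' distrib_right by (intro Bochner_Integration.integrable_add i2 i3)
  have eq5: "indicator torus \<xi> * p (\<xi> + s *\<^sub>R ?e) = indicator torus ((\<xi> + s *\<^sub>R ?e) + (- s) *\<^sub>R ?e) * p (\<xi> + s *\<^sub>R ?e)" for \<xi>
    by simp
  show "set_integrable lborel torus (\<lambda>\<xi>. p (\<xi> + s *\<^sub>R ?e))"
    unfolding set_integrable_def real_scaleR_def eq5 by (rule lborel_translate(1)[OF i4])
  have "(LINT \<xi>:torus|lborel. p (\<xi> + s *\<^sub>R ?e)) = (LINT \<xi>|lborel. indicator torus (\<xi> + (- s) *\<^sub>R ?e) * p \<xi>)"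
    unfolding set_lebesgue_integral_def real_scaleR_def eq5 by (rule lborel_translate(2)[OF i4])
  also have "\<dots> = (LINT \<xi>|lborel. indicator (S (- pi + s) pi) \<xi> * p \<xi>) + (LINT \<xi>|lborel. indicator (S (- pi) (- pi + s)) \<xi> * p \<xi>)"
    unfolding T' distrib_right v3[symmetric] by (intro Bochner_Integration.integral_add i2 i3)
  also have "\<dots> = (LINT \<xi>:torus|lborel. p \<xi>)"
    unfolding set_lebesgue_integral_def real_scaleR_def T distrib_right
    by (subst Bochner_Integration.integral_add[OF i1 i2]) simp
  finally show "(LINT \<xi>:torus|lborel. p (\<xi> + s *\<^sub>R ?e)) = (LINT \<xi>:torus|lborel. p \<xi>)" .
qed

text \<open>Against a kernel that changes sign under the translation by \<open>h\<close>, a difference of step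
  \<open>h\<close> reproduces the integrand up to the factor \<open>-2\<close>. This replaces integration by parts. The set
  \<open>A\<close> is either the torus with a period \<open>v\<close>, or the whole space with \<open>v = 0\<close>.\<close>

lemma integral_kernel_fdiff:
  fixes f \<kappa> :: "'a::euclidean_space \<Rightarrow> real"
  assumes shift: "\<And>f :: 'a \<Rightarrow> real. (\<And>\<xi>. f (\<xi> + v) = f \<xi>) \<Longrightarrow> set_integrable lborel A f \<Longrightarrow>
        set_integrable lborel A (\<lambda>\<xi>. f (\<xi> + h)) \<and> (LINT \<xi>:A|lborel. f (\<xi> + h)) = (LINT \<xi>:A|lborel. f \<xi>)"
    and [measurable]: "\<kappa> \<in> borel_measurable borel" and \<kappa>: "\<And>\<xi>. \<bar>\<kappa> \<xi>\<bar> \<le> 1" "\<And>\<xi>. \<kappa> (\<xi> + h) = - \<kappa> \<xi>" "\<And>\<xi>. \<kappa> (\<xi> + v) = \<kappa> \<xi>"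
    and f: "\<And>\<xi>. f (\<xi> + v) = f \<xi>" "set_integrable lborel A f"
  shows "set_integrable lborel A (fdiff k h f)"
    and "(LINT \<xi>:A|lborel. \<kappa> \<xi> * fdiff k h f \<xi>) = (- 2) ^ k * (LINT \<xi>:A|lborel. \<kappa> \<xi> * f \<xi>)"
proof -
  have int\<kappa>: "set_integrable lborel A (\<lambda>\<xi>. \<kappa> \<xi> * f \<xi>)" if "set_integrable lborel A f" for f
  proof -
    have "integrable lborel (\<lambda>\<xi>. \<kappa> \<xi> * (indicator A \<xi> * f \<xi>))"
      by (rule Bochner_Integration.integrable_bound[OF that[unfolded set_integrable_def]])
        (use \<kappa>(1) that[unfolded set_integrable_def] in \<open>auto simp: abs_mult mult_left_le_one_le\<close>)
    then show ?thesis by (simp add: set_integrable_def mult_ac)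
  qed
  have "(\<forall>\<xi>. fdiff k h f (\<xi> + v) = fdiff k h f \<xi>) \<and> set_integrable lborel A (fdiff k h f) \<and>
     (LINT \<xi>:A|lborel. \<kappa> \<xi> * fdiff k h f \<xi>) = (- 2) ^ k * (LINT \<xi>:A|lborel. \<kappa> \<xi> * f \<xi>)"
  proof (induction k)
    case 0
    then show ?case using f by simp
  next
    case (Suc k)
    let ?g = "fdiff k h f"
    have per: "?g (\<xi> + v) = ?g \<xi>" for \<xi> using Suc by blast
    have g: "set_integrable lborel A ?g" using Suc by blast
    have gh: "set_integrable lborel A (\<lambda>\<xi>. ?g (\<xi> + h))" using shift[OF per g] by blast
    have k: "(LINT \<xi>:A|lborel. \<kappa> (\<xi> + h) * ?g (\<xi> + h)) = (LINT \<xi>:A|lborel. \<kappa> \<xi> * ?g \<xi>)"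
      using shift[of "\<lambda>\<xi>. \<kappa> \<xi> * ?g \<xi>"] int\<kappa>[OF g] per \<kappa>(3) by auto
    have "(LINT \<xi>:A|lborel. \<kappa> \<xi> * fdiff (Suc k) h f \<xi>) =
       (LINT \<xi>:A|lborel. \<kappa> \<xi> * ?g (\<xi> + h) - \<kappa> \<xi> * ?g \<xi>)" by (simp add: right_diff_distrib)
    also have "\<dots> = (LINT \<xi>:A|lborel. \<kappa> \<xi> * ?g (\<xi> + h)) - (LINT \<xi>:A|lborel. \<kappa> \<xi> * ?g \<xi>)"
      by (intro set_integral_diff int\<kappa> g gh)
    also have "(LINT \<xi>:A|lborel. \<kappa> \<xi> * ?g (\<xi> + h)) = - (LINT \<xi>:A|lborel. \<kappa> (\<xi> + h) * ?g (\<xi> + h))"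
      by (simp add: \<kappa>(2) set_lebesgue_integral_def)
    finally have "(LINT \<xi>:A|lborel. \<kappa> \<xi> * fdiff (Suc k) h f \<xi>) = - 2 * (LINT \<xi>:A|lborel. \<kappa> \<xi> * ?g \<xi>)"
      unfolding k by simp
    moreover have "\<forall>\<xi>. fdiff (Suc k) h f (\<xi> + v) = fdiff (Suc k) h f \<xi>"
    proof
      fix \<xi>
      have "\<xi> + v + h = \<xi> + h + v" by (simp add: ac_simps)
      then show "fdiff (Suc k) h f (\<xi> + v) = fdiff (Suc k) h f \<xi>"
        by (simp only: fdiff.simps per)
    qed
    moreover have "set_integrable lborel A (fdiff (Suc k) h f)"
    proof -
      have "fdiff (Suc k) h f = (\<lambda>\<xi>. ?g (\<xi> + h) - ?g \<xi>)" by (rule ext) simp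
      then show ?thesis using set_integral_diff(1)[OF gh g] by simp
    qed
    ultimately show ?case using Suc by (simp del: fdiff.simps)
  qed
  then show "set_integrable lborel A (fdiff k h f)"
    "(LINT \<xi>:A|lborel. \<kappa> \<xi> * fdiff k h f \<xi>) = (- 2) ^ k * (LINT \<xi>:A|lborel. \<kappa> \<xi> * f \<xi>)" by auto
qed

lemma fdiff_diff: "fdiff k h (\<lambda>\<xi>. f \<xi> - g \<xi>) \<xi> = fdiff k h f \<xi> - fdiff k h g \<xi>"
  by (induction k arbitrary: \<xi>) auto

lemma fdiff_le:
  assumes "\<And>i. i \<le> k \<Longrightarrow> \<bar>f (\<xi> + real i *\<^sub>R h)\<bar> \<le> M"
  shows "\<bar>fdiff k h f \<xi>\<bar> \<le> 2 ^ k * M"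
  using assms
proof (induction k arbitrary: \<xi>)
  case 0
  then show ?case using "0"[of 0] by simp
next
  case (Suc k)
  have "\<bar>fdiff k h f (\<xi> + h)\<bar> \<le> 2 ^ k * M"
  proof (rule Suc.IH)
    fix i assume "i \<le> k"
    then show "\<bar>f (\<xi> + h + real i *\<^sub>R h)\<bar> \<le> M" using Suc.prems[of "Suc i"] by (simp add: algebra_simps)
  qed
  moreover have "\<bar>fdiff k h f \<xi>\<bar> \<le> 2 ^ k * M" by (rule Suc.IH) (use Suc.prems in auto)
  ultimately show ?case by simp
qed

text \<open>The decay estimate. On the torus, \<open>f\<close> is compared with a function \<open>g\<close> on the whole space
  that has the same singularity at the origin up to an error of order \<open>a\<close>. The integral of the
  \<open>k\<close>-th difference of the error is split into three regions: within distance of order \<open>h\<close> of the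
  origin only the size of the error matters; in the rest of the torus the difference is \<open>h\<^sup>k\<close> times
  a derivative, which is integrable there since \<open>a + n < k\<close>; outside of the torus only \<open>g\<close> is
  present, which is a symbol there. The bounds on the three regions are \<open>\<beta>1\<close>, \<open>\<beta>2\<close>, \<open>\<beta>3\<close>. The cube
  \<open>U\<close> exceeds the torus by \<open>1\<close> in each direction, to contain the points used by a
  difference whose total step \<open>k h\<close> is at most \<open>1\<close>.\<close>

lemma oscillatory_decay:
  fixes f g :: "real ^ 'n \<Rightarrow> real" and j :: 'n and a c :: real and k :: nat
  defines "e \<equiv> axis j 1 :: real ^ 'n"
    and "U \<equiv> {\<xi> :: real ^ 'n. \<xi> \<noteq> 0 \<and> (\<forall>i. \<bar>\<xi> $ i\<bar> \<le> pi + 1)}"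
    and "V \<equiv> {\<xi> :: real ^ 'n. 1 \<le> norm \<xi>}"
  assumes f: "\<And>\<xi>. f (\<xi> + (2 * pi) *\<^sub>R e) = f \<xi>" "set_integrable lborel torus f"
    and g: "integrable lborel g"
    and F: "symbol e U k a (\<lambda>\<xi>. f \<xi> - g \<xi>)" and a: "0 \<le> a" "a + real CARD('n) < real k"
    and gV: "symbol e V k c g" and c: "c + real CARD('n) < real k"
  shows "\<exists>C. \<forall>h \<kappa>. 0 < h \<longrightarrow> real k * h \<le> 1 \<longrightarrow> \<kappa> \<in> borel_measurable borel \<longrightarrow> (\<forall>\<xi>. \<bar>\<kappa> \<xi>\<bar> \<le> 1) \<longrightarrow>
     (\<forall>\<xi>. \<kappa> (\<xi> + h *\<^sub>R e) = - \<kappa> \<xi>) \<longrightarrow> (\<forall>\<xi>. \<kappa> (\<xi> + (2 * pi) *\<^sub>R e) = \<kappa> \<xi>) \<longrightarrow>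
     \<bar>(LINT \<xi>:torus|lborel. \<kappa> \<xi> * f \<xi>) - (LINT \<xi>|lborel. \<kappa> \<xi> * g \<xi>)\<bar> \<le> C * h powr (a + real CARD('n))"
proof -
  let ?n = "CARD('n)"
  have e1: "norm e = 1" by (simp add: e_def)
  have k1: "1 \<le> real k"
  proof -
    have "0 < real k" using a by linarith
    then show ?thesis by simp
  qed
  obtain C0 where C0: "\<And>\<xi>. \<xi> \<in> U \<Longrightarrow> \<bar>f \<xi> - g \<xi>\<bar> \<le> C0 * norm \<xi> powr a"
    using symbol_bound[OF F] by blast
  obtain C1 where C1: "0 \<le> C1" "\<And>\<xi> h. 0 \<le> h \<Longrightarrow> 2 * real k * h \<le> norm \<xi> \<Longrightarrow> \<xi> \<noteq> 0 \<Longrightarrow>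
    (\<And>s. s \<in> {0..real k * h} \<Longrightarrow> \<xi> + s *\<^sub>R e \<in> U) \<Longrightarrow>
    \<bar>fdiff k (h *\<^sub>R e) (\<lambda>\<xi>. f \<xi> - g \<xi>) \<xi>\<bar> \<le> C1 * h ^ k * norm \<xi> powr (a - real k)"
    using symbol_fdiff[OF F e1] a by auto
  obtain C2 where C2: "0 \<le> C2" "\<And>\<xi> h. 0 \<le> h \<Longrightarrow> 2 * real k * h \<le> norm \<xi> \<Longrightarrow> \<xi> \<noteq> 0 \<Longrightarrow>
    (\<And>s. s \<in> {0..real k * h} \<Longrightarrow> \<xi> + s *\<^sub>R e \<in> V) \<Longrightarrow>
    \<bar>fdiff k (h *\<^sub>R e) g \<xi>\<bar> \<le> C2 * h ^ k * norm \<xi> powr (c - real k)"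
    using symbol_fdiff[OF gV e1] c by auto
  have "real DIM(real ^ 'n) < real k - a" "real DIM(real ^ 'n) < real k - c" using a c by auto
  note out = this[THEN norm_powr_outside]
  obtain R1 where R1: "0 \<le> R1" "\<And>r. 0 < r \<Longrightarrow> integrable lborel (\<lambda>x::real ^ 'n. norm x powr (- (real k - a)) * indicator {x. r \<le> norm x} x)"
     "\<And>r. 0 < r \<Longrightarrow> (LINT x|lborel. norm x powr (- (real k - a)) * indicator {x::real ^ 'n. r \<le> norm x} x) \<le> R1 * r powr (real ?n - (real k - a))"
    using out(1) by auto
  obtain R2 where R2: "0 \<le> R2" "integrable lborel (\<lambda>x::real ^ 'n. norm x powr (- (real k - c)) * indicator {x. 1 \<le> norm x} x)"
     "(LINT x|lborel. norm x powr (- (real k - c)) * indicator {x::real ^ 'n. 1 \<le> norm x} x) \<le> R2"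
  proof -
    obtain R where "0 \<le> R" "\<And>r. 0 < r \<Longrightarrow> integrable lborel (\<lambda>x::real ^ 'n. norm x powr (- (real k - c)) * indicator {x. r \<le> norm x} x)"
     "\<And>r. 0 < r \<Longrightarrow> (LINT x|lborel. norm x powr (- (real k - c)) * indicator {x::real ^ 'n. r \<le> norm x} x) \<le> R * r powr (real ?n - (real k - c))"
      using out(2) by auto
    from this(1) this(2,3)[of 1] show ?thesis by (intro that[of R]) auto
  qed
  define W where "W = unit_ball_vol (real ?n)"
  have W: "0 \<le> W" by (simp add: W_def)
  define B1 where "B1 = 2 ^ k * \<bar>C0\<bar> * (3 * real k) powr a * W * (2 * real k) ^ ?n"
  define B2 where "B2 = C1 * R1 * (2 * real k) powr (real ?n - (real k - a))"
  define B3 where "B3 = C2 * R2"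
  show ?thesis
  proof (intro exI[of _ "(B1 + B2 + B3) / 2 ^ k"] allI impI)
    fix h :: real and \<kappa> :: "real ^ 'n \<Rightarrow> real"
    assume h: "0 < h" "real k * h \<le> 1" and \<kappa>m [measurable]: "\<kappa> \<in> borel_measurable borel" and \<kappa>b: "\<forall>\<xi>. \<bar>\<kappa> \<xi>\<bar> \<le> 1"
      and \<kappa>h: "\<forall>\<xi>. \<kappa> (\<xi> + h *\<^sub>R e) = - \<kappa> \<xi>" and \<kappa>p: "\<forall>\<xi>. \<kappa> (\<xi> + (2 * pi) *\<^sub>R e) = \<kappa> \<xi>"
    have h1: "h \<le> 1"
    proof -
      have "1 * h \<le> real k * h" using k1 h by (intro mult_right_mono) auto
      then show ?thesis using h(2) by (simp only: mult_1)
    qed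
    let ?Df = "fdiff k (h *\<^sub>R e) f" and ?Dg = "fdiff k (h *\<^sub>R e) g"
    have Df: "set_integrable lborel torus ?Df"
      "(LINT \<xi>:torus|lborel. \<kappa> \<xi> * ?Df \<xi>) = (- 2) ^ k * (LINT \<xi>:torus|lborel. \<kappa> \<xi> * f \<xi>)"
    proof -
      have "set_integrable lborel torus (\<lambda>\<xi>. p (\<xi> + h *\<^sub>R e)) \<and> (LINT \<xi>:torus|lborel. p (\<xi> + h *\<^sub>R e)) = (LINT \<xi>:torus|lborel. p \<xi>)"
        if "\<And>\<xi>. p (\<xi> + (2 * pi) *\<^sub>R e) = p \<xi>" "set_integrable lborel torus p" for p :: "real ^ 'n \<Rightarrow> real"
        using torus_translate[of p j h] that h(1) h1 pi_gt3 by (auto simp: e_def)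
      from integral_kernel_fdiff[OF this \<kappa>m, where f=f and k=k] \<kappa>b \<kappa>h \<kappa>p f
      show "set_integrable lborel torus ?Df"
        "(LINT \<xi>:torus|lborel. \<kappa> \<xi> * ?Df \<xi>) = (- 2) ^ k * (LINT \<xi>:torus|lborel. \<kappa> \<xi> * f \<xi>)" by auto
    qed
    have Dg: "integrable lborel ?Dg" "(LINT \<xi>|lborel. \<kappa> \<xi> * ?Dg \<xi>) = (- 2) ^ k * (LINT \<xi>|lborel. \<kappa> \<xi> * g \<xi>)"
    proof -
      have "set_integrable lborel UNIV (\<lambda>\<xi>. p (\<xi> + h *\<^sub>R e)) \<and> (LINT \<xi>:UNIV|lborel. p (\<xi> + h *\<^sub>R e)) = (LINT \<xi>:UNIV|lborel. p \<xi>)"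
        if "\<And>\<xi>. p (\<xi> + 0) = p \<xi>" "set_integrable lborel UNIV p" for p :: "real ^ 'n \<Rightarrow> real"
        using lborel_translate[of p "h *\<^sub>R e"] that(2) by (auto simp: set_integrable_def set_lebesgue_integral_def)
      from integral_kernel_fdiff[OF this \<kappa>m, where f=g and k=k and v=0] \<kappa>b \<kappa>h g
      show "integrable lborel ?Dg" "(LINT \<xi>|lborel. \<kappa> \<xi> * ?Dg \<xi>) = (- 2) ^ k * (LINT \<xi>|lborel. \<kappa> \<xi> * g \<xi>)"
        by (auto simp: set_integrable_def set_lebesgue_integral_def)
    qed
    define \<beta>1 where "\<beta>1 = (\<lambda>\<xi> :: real ^ 'n. (2 ^ k * (\<bar>C0\<bar> * (3 * real k * h) powr a)) * indicator (ball 0 (2 * real k * h)) \<xi>)"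
    define \<beta>2 where "\<beta>2 = (\<lambda>\<xi> :: real ^ 'n. C1 * h ^ k * (norm \<xi> powr (- (real k - a)) * indicator {\<xi>. 2 * real k * h \<le> norm \<xi>} \<xi>))"
    define \<beta>3 where "\<beta>3 = (\<lambda>\<xi> :: real ^ 'n. C2 * h ^ k * (norm \<xi> powr (- (real k - c)) * indicator {\<xi>. 1 \<le> norm \<xi>} \<xi>))"
    have \<beta>_nonneg: "0 \<le> \<beta>1 \<xi>" "0 \<le> \<beta>2 \<xi>" "0 \<le> \<beta>3 \<xi>" for \<xi>
      using C1(1) C2(1) h(1) by (auto simp: \<beta>1_def \<beta>2_def \<beta>3_def)
    have kh: "0 < 2 * real k * h" using k1 h by simp
    have i1: "integrable lborel \<beta>1" unfolding \<beta>1_def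
      by (intro integrable_mult_right integrable_real_indicator) (use emeasure_lborel_ball_finite[of "0 :: real ^ 'n" "2 * real k * h"] in auto)
    have i2: "integrable lborel \<beta>2" unfolding \<beta>2_def by (intro integrable_mult_right R1(2) kh)
    have i3: "integrable lborel \<beta>3" unfolding \<beta>3_def by (intro integrable_mult_right R2(2))
    have v1: "(LINT \<xi>|lborel. \<beta>1 \<xi>) \<le> B1 * h powr (a + real ?n)"
    proof -
      have "(LINT \<xi>|lborel. \<beta>1 \<xi>) = (2 ^ k * (\<bar>C0\<bar> * (3 * real k * h) powr a)) * (W * (2 * real k * h) ^ ?n)"
        unfolding \<beta>1_def W_def using kh content_ball[of "2 * real k * h" "0 :: real ^ 'n"] by simp
      also have "\<dots> = B1 * h powr (a + real ?n)"
        unfolding B1_def powr_add powr_mult power_mult_distrib powr_realpow[OF h(1)] by (simp only: mult_ac)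
      finally show ?thesis by simp
    qed
    have v2: "(LINT \<xi>|lborel. \<beta>2 \<xi>) \<le> B2 * h powr (a + real ?n)"
    proof -
      have "(LINT \<xi>|lborel. \<beta>2 \<xi>) = C1 * h ^ k * (LINT \<xi>|lborel. norm \<xi> powr (- (real k - a)) * indicator {\<xi> :: real ^ 'n. 2 * real k * h \<le> norm \<xi>} \<xi>)"
        unfolding \<beta>2_def by simp
      also have "\<dots> \<le> C1 * h ^ k * (R1 * (2 * real k * h) powr (real ?n - (real k - a)))"
        using C1(1) h(1) by (intro mult_left_mono R1(3) kh) auto
      also have "\<dots> = B2 * (h powr real k * h powr (real ?n - (real k - a)))"
        unfolding B2_def powr_mult[of "2 * real k" h] powr_realpow[OF h(1)] by (simp only: mult_ac)
      also have "h powr real k * h powr (real ?n - (real k - a)) = h powr (a + real ?n)"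
        unfolding powr_add[symmetric] by (simp add: algebra_simps)
      finally show ?thesis .
    qed
    have v3: "(LINT \<xi>|lborel. \<beta>3 \<xi>) \<le> B3 * h powr (a + real ?n)"
    proof -
      have "(LINT \<xi>|lborel. \<beta>3 \<xi>) = C2 * h ^ k * (LINT \<xi>|lborel. norm \<xi> powr (- (real k - c)) * indicator {\<xi> :: real ^ 'n. 1 \<le> norm \<xi>} \<xi>)"
        unfolding \<beta>3_def by simp
      also have "\<dots> \<le> C2 * h ^ k * R2"
        using C2(1) h(1) by (intro mult_left_mono R2(3)) auto
      also have "\<dots> = B3 * h powr real k" unfolding B3_def powr_realpow[OF h(1)] by (simp only: mult_ac)
      also have "\<dots> \<le> B3 * h powr (a + real ?n)"
        using C2(1) R2(1) h(1) h1 a unfolding B3_def by (intro mult_left_mono powr_mono') auto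
      finally show ?thesis .
    qed
    \<comment> \<open>the excluded points are those from which a step of the difference hits the origin, where \<open>f - g\<close> is not controlled; they form a null set\<close>
    have pw: "\<bar>indicator torus \<xi> * ?Df \<xi> - ?Dg \<xi>\<bar> \<le> \<beta>1 \<xi> + \<beta>2 \<xi> + \<beta>3 \<xi>"
      if ne: "\<xi> \<notin> (\<lambda>i. - (real i * h) *\<^sub>R e) ` {..k}" for \<xi>
    proof (cases "\<xi> \<in> torus")
      case True
      have seg: "\<xi> + s *\<^sub>R e \<in> U" if "s \<in> {0..real k * h}" "\<xi> + s *\<^sub>R e \<noteq> 0" for s
      proof -
        have "\<bar>(\<xi> + s *\<^sub>R e) $ i\<bar> \<le> pi + 1" for i
        proof -
          have "\<bar>\<xi> $ i\<bar> \<le> pi" using True by (auto simp: torus_def abs_le_iff dest: spec[of _ i])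
          moreover have "\<bar>(s *\<^sub>R e) $ i\<bar> \<le> 1" using that h by (auto simp: e_def axis_def)
          ultimately show ?thesis by (simp only: vector_add_component)
        qed
        then show ?thesis using that by (simp add: U_def)
      qed
      have D: "indicator torus \<xi> * ?Df \<xi> - ?Dg \<xi> = fdiff k (h *\<^sub>R e) (\<lambda>\<xi>. f \<xi> - g \<xi>) \<xi>"
        using True by (simp add: fdiff_diff)
      show ?thesis
      proof (cases "norm \<xi> < 2 * real k * h")
        case near: True
        have "\<bar>fdiff k (h *\<^sub>R e) (\<lambda>\<xi>. f \<xi> - g \<xi>) \<xi>\<bar> \<le> 2 ^ k * (\<bar>C0\<bar> * (3 * real k * h) powr a)"
        proof (rule fdiff_le)
          fix i assume i: "i \<le> k"
          have ih: "0 \<le> real i * h" "real i * h \<le> real k * h" using i h(1) by auto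
          let ?x = "\<xi> + real i *\<^sub>R h *\<^sub>R e"
          have "?x \<noteq> 0"
          proof
            assume "?x = 0"
            then have "\<xi> = - (real i * h) *\<^sub>R e" by (simp add: eq_neg_iff_add_eq_0)
            then show False using ne i by blast
          qed
          then have "?x \<in> U" using seg[of "real i * h"] ih by simp
          then have "\<bar>f ?x - g ?x\<bar> \<le> C0 * norm ?x powr a" by (rule C0)
          also have "\<dots> \<le> \<bar>C0\<bar> * (3 * real k * h) powr a"
          proof (intro mult_mono powr_mono2 a(1))
            have "norm ?x \<le> norm \<xi> + norm (real i *\<^sub>R h *\<^sub>R e)" by (rule norm_triangle_ineq)
            also have "norm (real i *\<^sub>R h *\<^sub>R e) = real i * h" using h(1) by (simp add: e1)
            finally show "norm ?x \<le> 3 * real k * h" using near ih(2) by linarith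
          qed auto
          finally show "\<bar>f ?x - g ?x\<bar> \<le> \<bar>C0\<bar> * (3 * real k * h) powr a" .
        qed
        also have "\<dots> = \<beta>1 \<xi>" using near by (simp add: \<beta>1_def)
        finally show ?thesis unfolding D using \<beta>_nonneg[of \<xi>] by linarith
      next
        case far: False
        have "\<bar>fdiff k (h *\<^sub>R e) (\<lambda>\<xi>. f \<xi> - g \<xi>) \<xi>\<bar> \<le> C1 * h ^ k * norm \<xi> powr (a - real k)"
        proof (rule C1(2))
          show "\<xi> \<noteq> 0" using far kh by auto
          fix s assume s: "s \<in> {0..real k * h}"
          have "norm \<xi> \<le> norm (\<xi> + s *\<^sub>R e) + norm (s *\<^sub>R e)"
            by (metis add_diff_cancel norm_triangle_ineq4)
          moreover have "norm (s *\<^sub>R e) = s" using s by (simp add: e1)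
          ultimately have "0 < norm (\<xi> + s *\<^sub>R e)" using s far kh unfolding atLeastAtMost_iff by linarith
          then show "\<xi> + s *\<^sub>R e \<in> U" by (intro seg s) simp
        qed (use far h in auto)
        also have "\<dots> = \<beta>2 \<xi>" using far by (simp add: \<beta>2_def)
        finally show ?thesis unfolding D using \<beta>_nonneg[of \<xi>] by linarith
      qed
    next
      case False
      then obtain i where "\<not> (- pi < \<xi> $ i \<and> \<xi> $ i \<le> pi)" by (auto simp: torus_def)
      then have "pi \<le> \<bar>\<xi> $ i\<bar>" by auto
      then have n3: "3 \<le> norm \<xi>" using component_le_norm_cart[of \<xi> i] pi_gt3 by linarith
      have "\<bar>?Dg \<xi>\<bar> \<le> C2 * h ^ k * norm \<xi> powr (c - real k)"
      proof (rule C2(2))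
        show "\<xi> \<noteq> 0" using n3 by auto
        fix s assume s: "s \<in> {0..real k * h}"
        have "norm \<xi> \<le> norm (\<xi> + s *\<^sub>R e) + norm (s *\<^sub>R e)"
          by (metis add_diff_cancel norm_triangle_ineq4)
        then have "1 \<le> norm (\<xi> + s *\<^sub>R e)" using s h n3 by (simp add: e1)
        then show "\<xi> + s *\<^sub>R e \<in> V" by (simp add: V_def)
      qed (use h n3 in auto)
      also have "\<dots> = \<beta>3 \<xi>" using n3 by (simp add: \<beta>3_def)
      finally show ?thesis using False \<beta>_nonneg[of \<xi>] by simp
    qed
    have int\<kappa>: "integrable lborel (\<lambda>\<xi>. \<kappa> \<xi> * p \<xi>)" if "integrable lborel p" for p
      by (rule Bochner_Integration.integrable_bound[OF that])
        (use \<kappa>b that in \<open>auto simp: abs_mult mult_left_le_one_le\<close>)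
    have iT: "integrable lborel (\<lambda>\<xi>. indicator torus \<xi> * ?Df \<xi>)"
      using Df(1) by (simp add: set_integrable_def)
    have "2 ^ k * \<bar>(LINT \<xi>:torus|lborel. \<kappa> \<xi> * f \<xi>) - (LINT \<xi>|lborel. \<kappa> \<xi> * g \<xi>)\<bar>
        = \<bar>(LINT \<xi>:torus|lborel. \<kappa> \<xi> * ?Df \<xi>) - (LINT \<xi>|lborel. \<kappa> \<xi> * ?Dg \<xi>)\<bar>"
      unfolding Df(2) Dg(2) right_diff_distrib[symmetric] abs_mult by (simp add: power_abs)
    also have "(LINT \<xi>:torus|lborel. \<kappa> \<xi> * ?Df \<xi>) = (LINT \<xi>|lborel. \<kappa> \<xi> * (indicator torus \<xi> * ?Df \<xi>))"
      by (simp add: set_lebesgue_integral_def mult_ac)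
    also have "(LINT \<xi>|lborel. \<kappa> \<xi> * (indicator torus \<xi> * ?Df \<xi>)) - (LINT \<xi>|lborel. \<kappa> \<xi> * ?Dg \<xi>)
        = (LINT \<xi>|lborel. \<kappa> \<xi> * (indicator torus \<xi> * ?Df \<xi> - ?Dg \<xi>))"
      unfolding right_diff_distrib by (intro Bochner_Integration.integral_diff[symmetric] int\<kappa> iT Dg(1))
    also have "\<bar>\<dots>\<bar> \<le> (LINT \<xi>|lborel. \<beta>1 \<xi> + \<beta>2 \<xi> + \<beta>3 \<xi>)"
    proof (rule order_trans[OF integral_abs_bound], rule integral_mono_AE)
      show "integrable lborel (\<lambda>\<xi>. \<bar>\<kappa> \<xi> * (indicator torus \<xi> * ?Df \<xi> - ?Dg \<xi>)\<bar>)"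
        by (intro integrable_abs int\<kappa> Bochner_Integration.integrable_diff iT Dg(1))
      show "integrable lborel (\<lambda>\<xi>. \<beta>1 \<xi> + \<beta>2 \<xi> + \<beta>3 \<xi>)"
        by (intro Bochner_Integration.integrable_add i1 i2 i3)
      have "AE \<xi> in lborel. \<xi> \<notin> (\<lambda>i. - (real i * h) *\<^sub>R e) ` {..k}"
        by (rule AE_not_in) (auto intro!: finite_imp_null_set_lborel)
      then show "AE \<xi> in lborel. \<bar>\<kappa> \<xi> * (indicator torus \<xi> * ?Df \<xi> - ?Dg \<xi>)\<bar> \<le> \<beta>1 \<xi> + \<beta>2 \<xi> + \<beta>3 \<xi>"
      proof eventually_elim
        case (elim \<xi>)
        have "\<bar>\<kappa> \<xi> * (indicator torus \<xi> * ?Df \<xi> - ?Dg \<xi>)\<bar> \<le> 1 * \<bar>indicator torus \<xi> * ?Df \<xi> - ?Dg \<xi>\<bar>"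
          unfolding abs_mult using \<kappa>b by (intro mult_right_mono) auto
        also have "\<dots> \<le> \<beta>1 \<xi> + \<beta>2 \<xi> + \<beta>3 \<xi>" using pw[OF elim] by (simp only: mult_1)
        finally show ?case .
      qed
    qed
    also have "\<dots> = (LINT \<xi>|lborel. \<beta>1 \<xi>) + (LINT \<xi>|lborel. \<beta>2 \<xi>) + (LINT \<xi>|lborel. \<beta>3 \<xi>)"
      by (simp add: i1 i2 i3)
    also have "\<dots> \<le> (B1 + B2 + B3) * h powr (a + real ?n)"
      using v1 v2 v3 by (simp add: distrib_right)
    finally show "\<bar>(LINT \<xi>:torus|lborel. \<kappa> \<xi> * f \<xi>) - (LINT \<xi>|lborel. \<kappa> \<xi> * g \<xi>)\<bar>
        \<le> (B1 + B2 + B3) / 2 ^ k * h powr (a + real ?n)"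
      by (simp add: field_simps)
  qed
qed

section \<open>Gaussian integrals\<close>

text \<open>Uniqueness of Haar measure up to a factor, for the image of Lebesgue measure under a linear
  isomorphism. Integrating \<open>f (T x) g y\<close> in both orders, with the translations
  \<open>x \<mapsto> x + T\<^sup>-\<^sup>1 y\<close> and \<open>y \<mapsto> y - T x\<close> in between, moves \<open>f\<close> off \<open>T\<close>.\<close>

lemma nn_integral_linear_image:
  fixes T :: "'a::euclidean_space \<Rightarrow> 'a"
  assumes T: "linear T" "bij T"
  shows "\<exists>c>0. \<forall>f. f \<in> borel_measurable borel \<longrightarrow>
    (\<integral>\<^sup>+x. f (T x) \<partial>lborel) = ennreal c * (\<integral>\<^sup>+x. f x \<partial>lborel)"
proof -
  define T' where "T' = inv T"
  have T': "linear T'" "T (T' y) = y" "T' (T x) = x" for x y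
    using T linear_injective_left_inverse[of T] unfolding T'_def
    by (auto simp: bij_is_surj surj_f_inv_f bij_is_inj inv_f_f intro: inj_linear_imp_inv_linear)
  have cont: "continuous_on UNIV T" "continuous_on UNIV T'"
    using T(1) T'(1) by (auto intro: linear_continuous_on simp: linear_conv_bounded_linear)
  note [measurable] = borel_measurable_continuous_onI[OF cont(1)] borel_measurable_continuous_onI[OF cont(2)]
  have trans: "(\<integral>\<^sup>+x. F (x + v) \<partial>lborel) = (\<integral>\<^sup>+x. F x \<partial>lborel)"
    if [measurable]: "F \<in> borel_measurable borel" for F :: "'a \<Rightarrow> ennreal" and v
  proof -
    have "(\<lambda>x. x + v) = (+) v" by (auto simp: add.commute)
    then have "lborel = distr lborel borel (\<lambda>x::'a. x + v)" using lborel_distr_plus[of v] by simp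
    then have "(\<integral>\<^sup>+x. F x \<partial>lborel) = (\<integral>\<^sup>+x. F x \<partial>distr lborel borel (\<lambda>x::'a. x + v))" by simp
    also have "\<dots> = (\<integral>\<^sup>+x. F (x + v) \<partial>lborel)" by (rule nn_integral_distr) auto
    finally show ?thesis ..
  qed
  define g :: "'a \<Rightarrow> ennreal" where "g = indicator (cbox 0 One)"
  have g [measurable]: "g \<in> borel_measurable borel" by (simp add: g_def)
  have g1: "(\<integral>\<^sup>+y. g y \<partial>lborel) = 1" by (simp add: g_def)
  define c where "c = (\<integral>\<^sup>+x. g (- T x) \<partial>lborel)"
  have main: "(\<integral>\<^sup>+x. f (T x) \<partial>lborel) = c * (\<integral>\<^sup>+x. f x \<partial>lborel)"
    if f [measurable]: "f \<in> borel_measurable borel" for f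
  proof -
    have "(\<integral>\<^sup>+x. f (T x) \<partial>lborel) = (\<integral>\<^sup>+y. (\<integral>\<^sup>+x. f (T x) \<partial>lborel) * g y \<partial>lborel)"
      by (simp add: nn_integral_cmult g1)
    also have "\<dots> = (\<integral>\<^sup>+y. (\<integral>\<^sup>+x. f (T x + y) * g y \<partial>lborel) \<partial>lborel)"
    proof (rule nn_integral_cong)
      fix y :: 'a
      have "(\<integral>\<^sup>+x. f (T (x + T' y)) \<partial>lborel) = (\<integral>\<^sup>+x. f (T x) \<partial>lborel)"
        by (rule trans) simp
      then show "(\<integral>\<^sup>+x. f (T x) \<partial>lborel) * g y = (\<integral>\<^sup>+x. f (T x + y) * g y \<partial>lborel)"
        by (simp add: nn_integral_multc linear_add[OF T(1)] T'(2))
    qed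
    also have "\<dots> = (\<integral>\<^sup>+x. (\<integral>\<^sup>+y. f (T x + y) * g y \<partial>lborel) \<partial>lborel)"
      by (rule lborel_pair.Fubini') measurable
    also have "\<dots> = (\<integral>\<^sup>+x. (\<integral>\<^sup>+y. f y * g (y - T x) \<partial>lborel) \<partial>lborel)"
    proof (rule nn_integral_cong)
      fix x :: 'a
      have "(\<integral>\<^sup>+y. f (y + T x) * g ((y + T x) - T x) \<partial>lborel) = (\<integral>\<^sup>+y. f y * g (y - T x) \<partial>lborel)"
        by (rule trans) simp
      then show "(\<integral>\<^sup>+y. f (T x + y) * g y \<partial>lborel) = (\<integral>\<^sup>+y. f y * g (y - T x) \<partial>lborel)"
        by (simp add: add.commute)
    qed
    also have "\<dots> = (\<integral>\<^sup>+y. (\<integral>\<^sup>+x. f y * g (y - T x) \<partial>lborel) \<partial>lborel)"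
      by (rule lborel_pair.Fubini') measurable
    also have "\<dots> = (\<integral>\<^sup>+y. f y * c \<partial>lborel)"
    proof (rule nn_integral_cong)
      fix y :: 'a
      have "(\<integral>\<^sup>+x. g (y - T (x + T' y)) \<partial>lborel) = (\<integral>\<^sup>+x. g (y - T x) \<partial>lborel)"
        by (rule trans) simp
      then show "(\<integral>\<^sup>+x. f y * g (y - T x) \<partial>lborel) = f y * c"
        by (simp add: nn_integral_cmult linear_add[OF T(1)] T'(2) c_def)
    qed
    also have "\<dots> = (\<integral>\<^sup>+y. f y \<partial>lborel) * c" by (rule nn_integral_multc) simp
    finally show ?thesis by (simp only: mult.commute)
  qed
  \<comment> \<open>the factor is neither \<open>0\<close> nor \<open>\<infinity>\<close>, as the preimage of the unit ball is open, nonempty and bounded\<close>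
  define V where "V = T -` ball 0 1"
  have V: "open V" "0 \<in> V" "bounded V"
  proof -
    show "open V" unfolding V_def using cont(1) by (intro open_vimage) auto
    show "0 \<in> V" by (simp add: V_def linear_0[OF T(1)])
    have "x \<in> T' ` ball 0 1" if "x \<in> V" for x
      using imageI[of "T x" "ball 0 1" T'] that T'(3)[of x] by (simp add: V_def)
    then have "V = T' ` ball 0 1" using T'(2) by (auto simp: V_def)
    then show "bounded V" using T'(1) by (simp add: bounded_linear_image linear_conv_bounded_linear)
  qed
  have Vm: "emeasure lborel V = c * emeasure lborel (ball 0 1 :: 'a set)"
  proof -
    have "(\<integral>\<^sup>+x. indicator (ball 0 1) (T x) \<partial>lborel) = c * (\<integral>\<^sup>+x. indicator (ball 0 1) x \<partial>(lborel :: 'a measure))"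
      by (rule main[of "indicator (ball 0 1)"], rule borel_measurable_indicator) simp
    moreover have "(\<integral>\<^sup>+x. indicator (ball 0 1) (T x) \<partial>lborel) = (\<integral>\<^sup>+x. indicator V x \<partial>(lborel :: 'a measure))"
      by (rule nn_integral_cong) (auto simp: V_def split: split_indicator)
    moreover have "V \<in> sets lborel" using V(1) by simp
    ultimately show ?thesis by simp
  qed
  have Vpos: "0 < emeasure lborel V"
  proof (rule ccontr)
    assume "\<not> 0 < emeasure lborel V"
    then have "V \<in> null_sets lborel" using V(1) by (simp add: null_sets_def)
    then have "negligible V" by (simp add: null_sets_completionI negligible_iff_null_sets)
    then show False using open_not_negligible[OF V(1)] V(2) by blast
  qed
  have Vfin: "emeasure lborel V < \<infinity>" using emeasure_bounded_finite[OF V(3)] .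
  have Bpos: "emeasure lborel (ball 0 1 :: 'a set) \<noteq> 0"
  proof
    assume "emeasure lborel (ball 0 1 :: 'a set) = 0"
    with Vm Vpos show False by simp
  qed
  have "c \<noteq> 0" using Vm Vpos by auto
  moreover have "c \<noteq> \<infinity>" using Vm Vfin Bpos by (auto simp: ennreal_top_mult)
  ultimately have "ennreal (enn2real c) = c" "0 < enn2real c"
    by (simp_all add: less_top enn2real_positive_iff zero_less_iff_neq_zero)
  then show ?thesis using main by (intro exI[of _ "enn2real c"]) auto
qed

lemma lborel_linear_image:
  fixes T :: "'a::euclidean_space \<Rightarrow> 'a"
  assumes T: "linear T" "bij T"
  shows "\<exists>c>0. \<forall>f :: 'a \<Rightarrow> real. f \<in> borel_measurable borel \<longrightarrow>
    (integrable lborel (\<lambda>x. f (T x)) \<longleftrightarrow> integrable lborel f) \<and>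
    (LINT x|lborel. f (T x)) = c * (LINT x|lborel. f x)"
proof -
  obtain c where c: "0 < c" "\<And>f. f \<in> borel_measurable borel \<Longrightarrow>
    (\<integral>\<^sup>+x. f (T x) \<partial>lborel) = ennreal c * (\<integral>\<^sup>+x. f x \<partial>lborel)"
    using nn_integral_linear_image[OF T] by blast
  have [measurable]: "T \<in> borel_measurable borel"
    using T(1) by (intro borel_measurable_continuous_onI linear_continuous_on) (simp add: linear_conv_bounded_linear)
  have eq: "distr lborel borel T = density lborel (\<lambda>_. ennreal c)"
  proof (rule measure_eqI)
    fix A assume "A \<in> sets (distr lborel borel T)"
    then have [measurable]: "A \<in> sets borel" by simp
    have "emeasure (distr lborel borel T) A = (\<integral>\<^sup>+x. indicator A x \<partial>distr lborel borel T)" by simp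
    also have "\<dots> = (\<integral>\<^sup>+x. indicator A (T x) \<partial>lborel)" by (rule nn_integral_distr) auto
    also have "\<dots> = ennreal c * (\<integral>\<^sup>+x. indicator A x \<partial>lborel)" by (rule c(2)) simp
    also have "\<dots> = emeasure (density lborel (\<lambda>_. ennreal c)) A"
      by (simp add: emeasure_density nn_integral_cmult)
    finally show "emeasure (distr lborel borel T) A = emeasure (density lborel (\<lambda>_. ennreal c)) A" .
  qed simp
  show ?thesis
  proof (intro exI[of _ c] conjI allI impI c(1))
    fix f :: "'a \<Rightarrow> real" assume [measurable]: "f \<in> borel_measurable borel"
    have "integrable lborel (\<lambda>x. f (T x)) \<longleftrightarrow> integrable (density lborel (\<lambda>_. ennreal c)) f"
      unfolding eq[symmetric] by (rule integrable_distr_eq[symmetric]) auto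
    also have "\<dots> \<longleftrightarrow> integrable lborel f"
      using c(1) by (subst integrable_density) auto
    finally show "integrable lborel (\<lambda>x. f (T x)) \<longleftrightarrow> integrable lborel f" .
    have "(LINT x|lborel. f (T x)) = (LINT x|density lborel (\<lambda>_. ennreal c). f x)"
      unfolding eq[symmetric] by (rule integral_distr[symmetric]) auto
    also have "\<dots> = c * (LINT x|lborel. f x)"
      using c(1) by (subst integral_density) auto
    finally show "(LINT x|lborel. f (T x)) = c * (LINT x|lborel. f x)" .
  qed
qed

lemma lborel_product:
  fixes f :: "'a::euclidean_space \<Rightarrow> real \<Rightarrow> complex"
  assumes f: "\<And>b. b \<in> Basis \<Longrightarrow> integrable lborel (f b)"
  shows "integrable lborel (\<lambda>x::'a. \<Prod>b\<in>Basis. f b (x \<bullet> b))"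
    and "(LINT x|lborel. (\<Prod>b\<in>Basis. f b ((x::'a) \<bullet> b))) = (\<Prod>b\<in>Basis. LINT t|lborel. f b t)"
proof -
  interpret product_sigma_finite "\<lambda>_ :: 'a. lborel :: real measure"
    by standard
  let ?P = "Pi\<^sub>M (Basis :: 'a set) (\<lambda>_. lborel :: real measure)"
  have [measurable]: "f b \<in> borel_measurable borel" if "b \<in> Basis" for b
    using f[OF that] by auto
  have ip: "(\<Sum>b\<in>Basis. \<phi> b *\<^sub>R b) \<bullet> c = \<phi> c" if "c \<in> Basis" for c :: 'a and \<phi>
    using that by (simp add: inner_sum_left inner_Basis if_distrib cong: if_cong)
  have pr: "(\<Prod>b\<in>Basis. f b ((\<Sum>b\<in>Basis. \<phi> b *\<^sub>R b) \<bullet> b)) = (\<Prod>b\<in>Basis. f b (\<phi> b))" for \<phi>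
    by (rule prod.cong) (auto simp: ip)
  have m: "(\<lambda>x::'a. \<Prod>b\<in>Basis. f b (x \<bullet> b)) \<in> borel_measurable borel" by measurable
  have mS: "(\<lambda>\<phi>. \<Sum>b\<in>Basis. \<phi> b *\<^sub>R b :: 'a) \<in> measurable ?P borel" by measurable
  have "integrable ?P (\<lambda>\<phi>. \<Prod>b\<in>Basis. f b (\<phi> b))"
    by (rule product_integrable_prod) (auto intro: f)
  then have "integrable (distr ?P borel (\<lambda>\<phi>. \<Sum>b\<in>Basis. \<phi> b *\<^sub>R b)) (\<lambda>x::'a. \<Prod>b\<in>Basis. f b (x \<bullet> b))"
    by (subst integrable_distr_eq[OF mS]) (auto simp: pr)
  then show "integrable lborel (\<lambda>x::'a. \<Prod>b\<in>Basis. f b (x \<bullet> b))"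
    by (subst lborel_eq)
  have "(LINT x|lborel. (\<Prod>b\<in>Basis. f b ((x::'a) \<bullet> b)))
      = (LINT x|distr ?P borel (\<lambda>\<phi>. \<Sum>b\<in>Basis. \<phi> b *\<^sub>R b). (\<Prod>b\<in>Basis. f b ((x::'a) \<bullet> b)))"
    by (subst lborel_eq) simp
  also have "\<dots> = (LINT \<phi>|?P. (\<Prod>b\<in>Basis. f b (\<phi> b)))"
    by (subst integral_distr[OF mS]) (auto simp: pr)
  also have "\<dots> = (\<Prod>b\<in>Basis. LINT t|lborel. f b t)"
    by (rule product_integral_prod) (auto intro: f)
  finally show "(LINT x|lborel. (\<Prod>b\<in>Basis. f b ((x::'a) \<bullet> b))) = (\<Prod>b\<in>Basis. LINT t|lborel. f b t)" .
qed

text \<open>The characteristic function of the standard normal distribution, rescaled.\<close>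

lemma gaussian_fourier_line:
  assumes t: "0 < t"
  shows "integrable lborel (\<lambda>\<eta>. complex_of_real (exp (- t * \<eta>\<^sup>2 / 2)) * iexp (z * \<eta>))"
    and "(LINT \<eta>|lborel. complex_of_real (exp (- t * \<eta>\<^sup>2 / 2)) * iexp (z * \<eta>))
           = complex_of_real (sqrt (2 * pi / t) * exp (- z\<^sup>2 / (2 * t)))"
proof -
  let ?f = "\<lambda>y x. complex_of_real (exp (- x\<^sup>2 / 2)) * iexp (y * x)"
  have std: "complex_of_real (std_normal_density x) * iexp (y * x) = (1 / sqrt (2 * pi)) * ?f y x" for x y
    by (simp add: std_normal_density_def)
  have int: "integrable lborel (?f y)" for y
  proof (rule Bochner_Integration.integrable_bound)
    have "integrable lborel (\<lambda>x. sqrt (2 * pi) * std_normal_density x)"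
      using integrable_std_normal_moment[of 0] by simp
    then show "integrable lborel (\<lambda>x :: real. exp (- x\<^sup>2 / 2) :: real)"
      by (simp add: std_normal_density_def)
  qed (auto simp: norm_mult)
  have val: "(LINT x|lborel. ?f y x) = complex_of_real (sqrt (2 * pi) * exp (- y\<^sup>2 / 2))" for y
  proof -
    have "complex_of_real (exp (- y\<^sup>2 / 2)) = (LINT x|std_normal_distribution. iexp (y * x))"
      using char_std_normal_distribution by (simp add: char_def fun_eq_iff)
    also have "\<dots> = (LINT x|lborel. std_normal_density x *\<^sub>R iexp (y * x))"
      by (rule integral_density) (auto simp: normal_density_nonneg)
    also have "\<dots> = (1 / sqrt (2 * pi)) * (LINT x|lborel. ?f y x)"
      unfolding scaleR_conv_of_real std by simp
    finally show ?thesis by (simp add: field_simps)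
  qed
  have sc: "?f (z / sqrt t) (0 + sqrt t * \<eta>) = complex_of_real (exp (- t * \<eta>\<^sup>2 / 2)) * iexp (z * \<eta>)" for \<eta>
    using t by (simp add: power_mult_distrib)
  have st: "sqrt t \<noteq> 0" using t by simp
  show "integrable lborel (\<lambda>\<eta>. complex_of_real (exp (- t * \<eta>\<^sup>2 / 2)) * iexp (z * \<eta>))"
    using lborel_integrable_real_affine[OF int[of "z / sqrt t"] st, of 0] unfolding sc .
  have "complex_of_real (sqrt (2 * pi) * exp (- (z / sqrt t)\<^sup>2 / 2)) = \<bar>sqrt t\<bar> *\<^sub>R
      (LINT \<eta>|lborel. complex_of_real (exp (- t * \<eta>\<^sup>2 / 2)) * iexp (z * \<eta>))"
    using lborel_integral_real_affine[OF st, of "?f (z / sqrt t)" 0] unfolding sc val .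
  then show "(LINT \<eta>|lborel. complex_of_real (exp (- t * \<eta>\<^sup>2 / 2)) * iexp (z * \<eta>))
           = complex_of_real (sqrt (2 * pi / t) * exp (- z\<^sup>2 / (2 * t)))"
    using t by (simp add: scaleR_conv_of_real power_divide real_sqrt_divide field_simps)
qed

lemma gaussian_fourier:
  fixes z :: "'a::euclidean_space"
  assumes t: "0 < t"
  shows "integrable lborel (\<lambda>\<eta>::'a. exp (- t * (norm \<eta>)\<^sup>2 / 2) * cos (z \<bullet> \<eta>))"
    and "(LINT \<eta>|lborel. exp (- t * (norm \<eta>)\<^sup>2 / 2) * cos (z \<bullet> \<eta>))
           = (2 * pi / t) powr (real DIM('a) / 2) * exp (- (norm z)\<^sup>2 / (2 * t))"
proof -
  let ?f = "\<lambda>b s. complex_of_real (exp (- t * s\<^sup>2 / 2)) * iexp ((z \<bullet> b) * s)"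
  have ns: "(norm x)\<^sup>2 = (\<Sum>b\<in>Basis. (x \<bullet> b)\<^sup>2)" for x :: 'a
    by (subst power2_norm_eq_inner, subst euclidean_inner) (simp add: power2_eq_square)
  have prod: "(\<Prod>b\<in>Basis. ?f b (\<eta> \<bullet> b)) = complex_of_real (exp (- t * (norm \<eta>)\<^sup>2 / 2)) * iexp (z \<bullet> \<eta>)" for \<eta> :: 'a
  proof -
    have "(\<Prod>b\<in>(Basis :: 'a set). exp (- t * (\<eta> \<bullet> b)\<^sup>2 / 2)) = exp (- t * (norm \<eta>)\<^sup>2 / 2)"
      unfolding ns by (simp add: exp_sum[symmetric] sum_distrib_left sum_divide_distrib sum_negf)
    moreover have "(\<Prod>b\<in>(Basis :: 'a set). iexp ((z \<bullet> b) * (\<eta> \<bullet> b))) = iexp (z \<bullet> \<eta>)"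
      by (subst euclidean_inner) (simp add: exp_sum[symmetric] sum_distrib_left)
    ultimately show ?thesis by (simp add: prod.distrib flip: of_real_prod)
  qed
  note P = lborel_product[of ?f, OF gaussian_fourier_line(1)[OF t], unfolded prod gaussian_fourier_line(2)[OF t]]
  have Re: "Re (complex_of_real (exp (- t * (norm \<eta>)\<^sup>2 / 2)) * iexp (z \<bullet> \<eta>)) = exp (- t * (norm \<eta>)\<^sup>2 / 2) * cos (z \<bullet> \<eta>)" for \<eta> :: 'a
    by (simp add: Re_exp)
  show "integrable lborel (\<lambda>\<eta>::'a. exp (- t * (norm \<eta>)\<^sup>2 / 2) * cos (z \<bullet> \<eta>))"
    using integrable_Re[OF P(1)] unfolding Re .
  have "(LINT \<eta>|lborel. exp (- t * (norm \<eta>)\<^sup>2 / 2) * cos (z \<bullet> \<eta>))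
      = (\<Prod>b\<in>(Basis :: 'a set). sqrt (2 * pi / t) * exp (- (z \<bullet> b)\<^sup>2 / (2 * t)))"
    using integral_Re[OF P(1)] unfolding Re P(2) of_real_prod[symmetric] Re_complex_of_real .
  also have "\<dots> = sqrt (2 * pi / t) ^ DIM('a) * exp (- (norm z)\<^sup>2 / (2 * t))"
    unfolding prod.distrib ns by (simp add: exp_sum[symmetric] sum_divide_distrib sum_negf)
  also have "sqrt (2 * pi / t) ^ DIM('a) = (2 * pi / t) powr (real DIM('a) / 2)"
  proof -
    have "0 < 2 * pi / t" using t by simp
    then have "sqrt (2 * pi / t) ^ DIM('a) = ((2 * pi / t) powr (1 / 2)) powr real DIM('a)"
      by (subst powr_realpow) (auto simp: powr_half_sqrt)
    then show ?thesis by (simp add: powr_powr)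
  qed
  finally show "(LINT \<eta>|lborel. exp (- t * (norm \<eta>)\<^sup>2 / 2) * cos (z \<bullet> \<eta>))
           = (2 * pi / t) powr (real DIM('a) / 2) * exp (- (norm z)\<^sup>2 / (2 * t))" .
qed

lemma exp_neg_le_inverse_power:
  fixes v :: real
  assumes "0 < v"
  shows "exp (- v) \<le> fact k / v ^ k"
proof -
  have "v ^ k / fact k \<le> exp v"
  proof -
    have "v ^ k / fact k = (\<Sum>i\<in>{k}. v ^ i / fact i)" by simp
    also have "\<dots> \<le> (\<Sum>i. v ^ i / fact i)"
      using assms summable_exp[of v] by (intro sum_le_suminf) (auto simp: divide_inverse mult.commute)
    also have "\<dots> = exp v" by (simp add: exp_def divide_inverse scaleR_conv_of_real mult.commute)
    finally show ?thesis .
  qed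
  then show ?thesis using assms by (simp add: exp_minus field_simps)
qed

locale pos_def_form =
  fixes A :: "real ^ 'n ^ 'n"
  assumes A_sym: "transpose A = A"
    and A_pos: "v \<noteq> 0 \<Longrightarrow> 0 < v \<bullet> (A *v v)"
begin

definition q :: "real ^ 'n \<Rightarrow> real" where
  "q \<xi> = \<xi> \<bullet> (A *v \<xi>) / 2"

definition dual_form :: "real ^ 'n \<Rightarrow> real" where
  "dual_form x = x \<bullet> (matrix_inv A *v x)"

definition S :: "real ^ 'n ^ 'n" where
  "S = psd_sqrt (matrix_inv A)"

lemma A_invertible: "invertible A"
proof -
  have "v = 0" if "A *v v = 0" for v
    using A_pos[of v] that by (cases "v = 0") auto
  then show ?thesis
    using matrix_left_invertible_ker invertible_left_inverse by blast
qed

lemma matrix_inv_A: "A ** matrix_inv A = mat 1" "matrix_inv A ** A = mat 1"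
  using someI_ex[OF A_invertible[unfolded invertible_def]] by (simp_all add: matrix_inv_def)

lemma inv_A: "A *v (matrix_inv A *v x) = x" "matrix_inv A *v (A *v x) = x"
  by (simp_all add: matrix_vector_mul_assoc matrix_inv_A)

lemma inv_A_sym: "transpose (matrix_inv A) = matrix_inv A"
proof -
  have "x \<bullet> (matrix_inv A *v y) = (matrix_inv A *v x) \<bullet> y" for x y
    using symmetric_matrix_inner[OF A_sym, of "matrix_inv A *v x" "matrix_inv A *v y"] by (simp add: inv_A)
  then have "x \<bullet> (transpose (matrix_inv A) *v y) = x \<bullet> (matrix_inv A *v y)" for x y
    by (metis dot_lmul_matrix inner_commute transpose_matrix_vector transpose_transpose)
  then show ?thesis by (metis matrix_eq vector_eq_ldot)
qed

lemma inv_A_nonneg: "0 \<le> v \<bullet> (matrix_inv A *v v)"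
proof -
  let ?y = "matrix_inv A *v v"
  have "v \<bullet> ?y = ?y \<bullet> (A *v ?y)" by (simp add: inv_A inner_commute)
  then show ?thesis using A_pos[of ?y] by (cases "?y = 0") auto
qed

lemma S_sym: "transpose S = S" and S_square: "S ** S = matrix_inv A"
  unfolding S_def using psd_sqrt[OF inv_A_sym inv_A_nonneg] by auto

lemma S_inner: "x \<bullet> (S *v y) = (S *v x) \<bullet> y"
  by (rule symmetric_matrix_inner[OF S_sym])

lemma SAS: "S *v (A *v (S *v x)) = x"
proof -
  have "S ** (S ** A) = mat 1"
    by (simp add: matrix_mul_assoc S_square matrix_inv_A)
  then have "(S ** A) ** S = mat 1" by (simp add: matrix_left_right_inverse)
  then show ?thesis by (simp add: matrix_vector_mul_assoc matrix_mul_assoc)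
qed

lemma S_bij: "bij ((*v) S)"
proof -
  have "inj ((*v) S)" by (metis SAS injI)
  then show ?thesis
    by (simp add: bij_def linear_injective_imp_surjective matrix_vector_mul_linear)
qed

lemma q_S: "q (S *v \<eta>) = (norm \<eta>)\<^sup>2 / 2"
proof -
  have "(S *v \<eta>) \<bullet> (A *v (S *v \<eta>)) = \<eta> \<bullet> (S *v (A *v (S *v \<eta>)))" by (rule S_inner[symmetric])
  then show ?thesis by (simp add: q_def SAS dot_square_norm)
qed

lemma norm_S: "(norm (S *v x))\<^sup>2 = dual_form x"
proof -
  have "(S *v x) \<bullet> (S *v x) = x \<bullet> (S *v (S *v x))" by (rule S_inner[symmetric])
  then show ?thesis by (simp add: dot_square_norm matrix_vector_mul_assoc S_square dual_form_def)
qed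

lemma matrix_bound: "\<exists>K>0. \<forall>x. norm (M *v x) \<le> K * norm x" for M :: "real ^ 'n ^ 'n"
  using bounded_linear.pos_bounded[OF matrix_vector_mul_bounded_linear[of M]] by (metis mult.commute)

lemma q_bounds: "\<exists>c>0. \<forall>\<xi>. c * (norm \<xi>)\<^sup>2 \<le> q \<xi>" "\<exists>C>0. \<forall>\<xi>. q \<xi> \<le> C * (norm \<xi>)\<^sup>2"
proof -
  obtain K where K: "0 < K" "\<And>x. norm (S *v x) \<le> K * norm x" using matrix_bound by blast
  have "1 / (2 * K\<^sup>2) * (norm \<xi>)\<^sup>2 \<le> q \<xi>" for \<xi>
  proof -
    obtain \<eta> where \<eta>: "\<xi> = S *v \<eta>" using S_bij by (metis bij_pointE)
    have "(norm \<xi>)\<^sup>2 \<le> (K * norm \<eta>)\<^sup>2" unfolding \<eta> by (intro power_mono K) auto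
    then show ?thesis unfolding \<eta> q_S using K(1) by (simp add: power_mult_distrib field_simps)
  qed
  then show "\<exists>c>0. \<forall>\<xi>. c * (norm \<xi>)\<^sup>2 \<le> q \<xi>" using K(1) by (intro exI[of _ "1 / (2 * K\<^sup>2)"]) auto
  obtain L where L: "0 < L" "\<And>x. norm (A *v x) \<le> L * norm x" using matrix_bound by blast
  have "q \<xi> \<le> L * (norm \<xi>)\<^sup>2" for \<xi>
  proof -
    have "\<xi> \<bullet> (A *v \<xi>) \<le> norm \<xi> * norm (A *v \<xi>)" by (rule norm_cauchy_schwarz)
    also have "\<dots> \<le> norm \<xi> * (L * norm \<xi>)" by (intro mult_left_mono L) auto
    finally have "q \<xi> \<le> L * (norm \<xi>)\<^sup>2 / 2" by (simp add: q_def power2_eq_square mult.left_commute)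
    also have "\<dots> \<le> L * (norm \<xi>)\<^sup>2" using L(1) by simp
    finally show ?thesis .
  qed
  then show "\<exists>C>0. \<forall>\<xi>. q \<xi> \<le> C * (norm \<xi>)\<^sup>2" using L(1) by blast
qed

lemma q_pos: "\<xi> \<noteq> 0 \<Longrightarrow> 0 < q \<xi>"
  using A_pos by (simp add: q_def)

lemma dual_form_bounds: "\<exists>c>0. \<forall>x. c * (norm x)\<^sup>2 \<le> dual_form x" "\<exists>C>0. \<forall>x. dual_form x \<le> C * (norm x)\<^sup>2"
proof -
  obtain K where K: "0 < K" "\<And>x. norm (S *v x) \<le> K * norm x" using matrix_bound by blast
  have "dual_form x \<le> K\<^sup>2 * (norm x)\<^sup>2" for x
    unfolding norm_S[symmetric] power_mult_distrib[symmetric] by (intro power_mono K) auto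
  then show "\<exists>C>0. \<forall>x. dual_form x \<le> C * (norm x)\<^sup>2" using K(1) by (intro exI[of _ "K\<^sup>2"]) auto
  obtain L where L: "0 < L" "\<And>x. norm ((S ** A) *v x) \<le> L * norm x" using matrix_bound by blast
  have "1 / L\<^sup>2 * (norm x)\<^sup>2 \<le> dual_form x" for x
  proof -
    have "norm x \<le> L * norm (S *v x)" using L(2)[of "S *v x"] by (simp add: matrix_vector_mul_assoc[symmetric] SAS)
    then have "(norm x)\<^sup>2 \<le> (L * norm (S *v x))\<^sup>2" by (intro power_mono) auto
    then show ?thesis unfolding norm_S[symmetric] using L(1) by (simp add: power_mult_distrib field_simps)
  qed
  then show "\<exists>c>0. \<forall>x. c * (norm x)\<^sup>2 \<le> dual_form x" using L(1) by (intro exI[of _ "1 / L\<^sup>2"]) auto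
qed

lemma q_measurable [measurable]: "q \<in> borel_measurable borel"
  unfolding q_def
  by (intro borel_measurable_continuous_onI continuous_intros linear_continuous_on matrix_vector_mul_bounded_linear) auto

text \<open>The substitution \<open>\<xi> = S \<eta>\<close> with the square root \<open>S\<close> of the inverse matrix turns \<open>q\<close> into
  half of the squared norm. The Jacobian enters the constant only.\<close>

lemma form_gaussian_fourier:
  "\<exists>c>0. \<forall>t>0. \<forall>x. integrable lborel (\<lambda>\<xi>. exp (- t * q \<xi>) * cos (x \<bullet> \<xi>)) \<and>
     (LINT \<xi>|lborel. exp (- t * q \<xi>) * cos (x \<bullet> \<xi>)) = c * t powr (- real CARD('n) / 2) * exp (- dual_form x / (2 * t))"
proof -
  obtain c where c: "0 < c" "\<And>f :: real ^ 'n \<Rightarrow> real. f \<in> borel_measurable borel \<Longrightarrow>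
    (integrable lborel (\<lambda>x. f (S *v x)) \<longleftrightarrow> integrable lborel f) \<and>
    (LINT x|lborel. f (S *v x)) = c * (LINT x|lborel. f x)"
    using lborel_linear_image[OF matrix_vector_mul_linear S_bij] by blast
  show ?thesis
  proof (intro exI[of _ "(2 * pi) powr (real CARD('n) / 2) / c"] conjI allI impI)
    show "0 < (2 * pi) powr (real CARD('n) / 2) / c" using c(1) by simp
    fix t :: real and x :: "real ^ 'n" assume t: "0 < t"
    let ?f = "\<lambda>\<xi>. exp (- t * q \<xi>) * cos (x \<bullet> \<xi>)"
    have m: "?f \<in> borel_measurable borel" by measurable
    have fS: "?f (S *v \<eta>) = exp (- t * (norm \<eta>)\<^sup>2 / 2) * cos ((S *v x) \<bullet> \<eta>)" for \<eta>
      by (simp add: q_S S_inner)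
    note C = c(2)[OF m, unfolded fS]
    show "integrable lborel ?f" using C gaussian_fourier(1)[OF t, of "S *v x"] by blast
    have "c * (LINT \<xi>|lborel. ?f \<xi>) = (2 * pi / t) powr (real DIM(real ^ 'n) / 2) * exp (- (norm (S *v x))\<^sup>2 / (2 * t))"
      using C gaussian_fourier(2)[OF t, of "S *v x"] by simp
    also have "\<dots> = (2 * pi) powr (real CARD('n) / 2) * t powr (- real CARD('n) / 2) * exp (- dual_form x / (2 * t))"
      using t by (simp add: norm_S powr_divide powr_minus_divide)
    finally show "(LINT \<xi>|lborel. ?f \<xi>) = (2 * pi) powr (real CARD('n) / 2) / c * t powr (- real CARD('n) / 2) * exp (- dual_form x / (2 * t))"
      using c(1) by (simp add: field_simps)
  qed
qed

text \<open>A model for the singularity of \<open>1 / q\<close> at the origin that is integrable at infinity.\<close>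

definition regular_kernel :: "real ^ 'n \<Rightarrow> real" where
  "regular_kernel \<xi> = exp (- q \<xi>) / q \<xi>"

lemma exp_integral_tail:
  fixes s :: real
  assumes s: "0 < s"
  shows "has_bochner_integral lborel (\<lambda>t. indicator {1..} t * exp (- t * s)) (exp (- s) / s)"
proof (rule has_bochner_integral_nn_integral)
  have "((\<lambda>t. - exp (- t * s) / s) \<longlongrightarrow> - 0 / s) at_top"
  proof (intro tendsto_intros)
    have "filterlim (\<lambda>t. - (t * s)) at_bot at_top"
      using s by (simp add: filterlim_uminus_at_bot filterlim_at_top_mult_tendsto_pos[OF tendsto_const] filterlim_ident)
    then show "((\<lambda>t. exp (- t * s)) \<longlongrightarrow> 0) at_top"
      using filterlim_compose[OF exp_at_bot] by simp
  qed (use s in simp)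
  then have lim: "((\<lambda>t. - exp (- t * s) / s) \<longlongrightarrow> 0) at_top" by simp
  have "(\<integral>\<^sup>+t. ennreal (exp (- t * s)) * indicator {1..} t \<partial>lborel) = ennreal (0 - (- exp (- 1 * s) / s))"
    by (rule nn_integral_FTC_atLeast[OF _ _ _ lim]) (use s in \<open>auto intro!: derivative_eq_intros\<close>)
  moreover have "(\<integral>\<^sup>+t. ennreal (indicator {1..} t * exp (- t * s)) \<partial>lborel)
      = (\<integral>\<^sup>+t. ennreal (exp (- t * s)) * indicator {1..} t \<partial>lborel)"
    by (intro nn_integral_cong) (auto split: split_indicator)
  ultimately show "(\<integral>\<^sup>+t. ennreal (indicator {1..} t * exp (- t * s)) \<partial>lborel) = ennreal (exp (- s) / s)"
    by simp
qed (use s in auto)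

lemma powr_tail_integrable:
  fixes p :: real
  assumes "1 < p"
  shows "integrable lborel (\<lambda>t. indicator {1..} t * t powr (- p))"
proof -
  have "integrable lborel (\<lambda>t::real. norm t powr (- p) * indicator {x. 1 \<le> norm x} t)"
    using norm_powr_outside[where 'a=real, of p] assms by auto
  then show ?thesis
    by (rule Bochner_Integration.integrable_bound) (auto split: split_indicator)
qed

text \<open>Writing \<open>exp (- q) / q\<close> as the integral of \<open>exp (- t q)\<close> over \<open>t \<ge> 1\<close> turns its Fourier
  transform into an integral of Gaussians over the same range.\<close>

lemma regular_kernel_fourier:
  assumes n: "3 \<le> CARD('n)"
  shows "integrable lborel regular_kernel"
    and "\<exists>c>0. \<forall>x. (LINT \<xi>|lborel. cos (x \<bullet> \<xi>) * regular_kernel \<xi>) =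
      c * (LINT t|lborel. indicator {1..} t * (t powr (- real CARD('n) / 2) * exp (- dual_form x / (2 * t))))"
proof -
  let ?p = "real CARD('n) / 2"
  obtain c where c: "0 < c" "\<And>t x. 0 < t \<Longrightarrow> integrable lborel (\<lambda>\<xi>. exp (- t * q \<xi>) * cos (x \<bullet> \<xi>))"
    "\<And>t x. 0 < t \<Longrightarrow> (LINT \<xi>|lborel. exp (- t * q \<xi>) * cos (x \<bullet> \<xi>)) = c * t powr (- real CARD('n) / 2) * exp (- dual_form x / (2 * t))"
    using form_gaussian_fourier by blast
  let ?F = "\<lambda>x t \<xi>. indicator {1..} t * (exp (- t * q \<xi>) * cos (x \<bullet> \<xi>)) :: real"
  have m [measurable]: "(\<lambda>(t, \<xi>). ?F x t \<xi>) \<in> borel_measurable (lborel \<Otimes>\<^sub>M lborel)" for x by measurable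
  have inner: "(LINT \<xi>|lborel. ?F x t \<xi>) = c * (indicator {1..} t * (t powr (- real CARD('n) / 2) * exp (- dual_form x / (2 * t))))" for x t
    using c(3)[of t x] by (cases "1 \<le> t") auto
  have int0: "integrable (lborel \<Otimes>\<^sub>M lborel) (\<lambda>(t, \<xi>). ?F 0 t \<xi>)"
  proof (rule lborel_pair.Fubini_integrable[OF m])
    have "(LINT \<xi>|lborel. norm (case (t, \<xi>) of (t, \<xi>) \<Rightarrow> ?F 0 t \<xi>)) = c * (indicator {1..} t * t powr (- ?p))" for t
    proof -
      have "(LINT \<xi>|lborel. norm (case (t, \<xi>) of (t, \<xi>) \<Rightarrow> ?F 0 t \<xi>)) = (LINT \<xi>|lborel. ?F 0 t \<xi>)"
        by (intro Bochner_Integration.integral_cong) auto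
      then show ?thesis unfolding inner by (simp add: dual_form_def)
    qed
    note e = this
    show "integrable lborel (\<lambda>t. LINT \<xi>|lborel. norm (case (t, \<xi>) of (t, \<xi>) \<Rightarrow> ?F 0 t \<xi>))"
      unfolding e by (intro integrable_mult_right powr_tail_integrable) (use n in simp)
    show "AE t in lborel. integrable lborel (\<lambda>\<xi>. case (t, \<xi>) of (t, \<xi>) \<Rightarrow> ?F 0 t \<xi>)"
    proof (intro always_eventually allI)
      fix t :: real
      show "integrable lborel (\<lambda>\<xi>. case (t, \<xi>) of (t, \<xi>) \<Rightarrow> ?F 0 t \<xi>)"
        using c(2)[of t 0] by (cases "1 \<le> t") auto
    qed
  qed
  have int: "integrable (lborel \<Otimes>\<^sub>M lborel) (\<lambda>(t, \<xi>). ?F x t \<xi>)" for x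
    by (rule Bochner_Integration.integrable_bound[OF int0 m])
      (auto simp: abs_mult mult_left_le split: split_indicator)
  have outer: "AE \<xi> in lborel. (LINT t|lborel. ?F x t \<xi>) = cos (x \<bullet> \<xi>) * regular_kernel \<xi>" for x
    using AE_lborel_singleton[of "0 :: real ^ 'n"]
  proof eventually_elim
    case (elim \<xi>)
    from has_bochner_integral_integral_eq[OF exp_integral_tail[OF q_pos[OF elim]]]
    have e: "(LINT t|lborel. indicator {1..} t * exp (- t * q \<xi>)) = regular_kernel \<xi>" by (simp add: regular_kernel_def)
    have "(LINT t|lborel. ?F x t \<xi>) = (LINT t|lborel. (indicator {1..} t * exp (- t * q \<xi>)) * cos (x \<bullet> \<xi>))"
      by (simp only: mult.assoc)
    also have "\<dots> = (LINT t|lborel. indicator {1..} t * exp (- t * q \<xi>)) * cos (x \<bullet> \<xi>)" by simp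
    finally show ?case unfolding e by (simp only: mult.commute)
  qed
  have rm [measurable]: "regular_kernel \<in> borel_measurable borel" unfolding regular_kernel_def by measurable
  have "integrable lborel (\<lambda>\<xi>. LINT t|lborel. ?F 0 t \<xi>)"
    by (rule lborel_pair.integrable_snd[OF int])
  then show "integrable lborel regular_kernel"
    by (rule integrable_cong_AE_imp) (use outer[of 0] in \<open>auto elim!: eventually_mono\<close>)
  have "(LINT \<xi>|lborel. cos (x \<bullet> \<xi>) * regular_kernel \<xi>) =
      c * (LINT t|lborel. indicator {1..} t * (t powr (- real CARD('n) / 2) * exp (- dual_form x / (2 * t))))" for x
  proof -
    have "(LINT \<xi>|lborel. cos (x \<bullet> \<xi>) * regular_kernel \<xi>) = (LINT \<xi>|lborel. LINT t|lborel. ?F x t \<xi>)"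
      by (rule integral_cong_AE) (use outer[of x] borel_measurable_integrable[OF lborel_pair.integrable_snd[OF int[of x]]] in \<open>auto elim!: eventually_mono\<close>)
    also have "\<dots> = (LINT t|lborel. LINT \<xi>|lborel. ?F x t \<xi>)"
      using lborel_pair.integral_snd[OF int[of x]] lborel_pair.integral_fst[OF int[of x]] by simp
    finally show ?thesis unfolding inner by simp
  qed
  then show "\<exists>c>0. \<forall>x. (LINT \<xi>|lborel. cos (x \<bullet> \<xi>) * regular_kernel \<xi>) =
      c * (LINT t|lborel. indicator {1..} t * (t powr (- real CARD('n) / 2) * exp (- dual_form x / (2 * t))))"
    using c(1) by blast
qed

text \<open>The full integral over \<open>t > 0\<close> is homogeneous by scaling and gives the Newtonian
  potential; the piece \<open>0 < t < 1\<close> decays faster than any power.\<close>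

lemma newtonian_split:
  fixes p :: real
  assumes p: "1 < p" "p \<le> real k"
  shows "\<exists>J>0. \<exists>C. \<forall>\<rho>>0.
    \<bar>(LINT t|lborel. indicator {1..} t * (t powr (- p) * exp (- \<rho> / (2 * t)))) - J * \<rho> powr (1 - p)\<bar> \<le> C / \<rho> ^ k"
proof -
  define \<phi> where "\<phi> \<rho> t = t powr (- p) * exp (- \<rho> / (2 * t))" for \<rho> t :: real
  have \<phi>m [measurable]: "\<phi> \<rho> \<in> borel_measurable borel" for \<rho> unfolding \<phi>_def by measurable
  define C :: real where "C = fact k * 2 ^ k"
  have small: "\<phi> \<rho> t \<le> C / \<rho> ^ k" if t: "0 < t" "t < 1" and \<rho>: "0 < \<rho>" for t \<rho>
  proof -
    have "exp (- (\<rho> / (2 * t))) \<le> fact k / (\<rho> / (2 * t)) ^ k"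
      by (rule exp_neg_le_inverse_power) (use t \<rho> in simp)
    also have "\<dots> = C / \<rho> ^ k * t ^ k"
      using t \<rho> by (simp add: C_def power_divide power_mult_distrib field_simps)
    finally have "\<phi> \<rho> t \<le> t powr (- p) * (C / \<rho> ^ k * t ^ k)"
      unfolding \<phi>_def by (intro mult_left_mono) auto
    also have "\<dots> = C / \<rho> ^ k * t powr (real k - p)"
      using t by (simp add: powr_diff powr_minus_divide powr_realpow)
    also have "\<dots> \<le> C / \<rho> ^ k * 1"
      using t p \<rho> by (intro mult_left_mono powr_le1) (auto simp: C_def)
    finally show ?thesis by simp
  qed
  have nn: "0 \<le> \<phi> \<rho> t" for \<rho> t by (simp add: \<phi>_def)
  have i1: "integrable lborel (\<lambda>t. indicator {1..} t * \<phi> \<rho> t)" if "0 < \<rho>" for \<rho>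
  proof (rule Bochner_Integration.integrable_bound[OF powr_tail_integrable[OF p(1)]])
    show "AE t in lborel. norm (indicator {1..} t * \<phi> \<rho> t) \<le> norm (indicator {1..} t * t powr (- p))"
      using that by (intro always_eventually) (auto simp: \<phi>_def abs_mult mult_left_le split: split_indicator)
  qed simp
  have i0: "integrable lborel (\<lambda>t. indicator {0<..<1} t * \<phi> \<rho> t)" if "0 < \<rho>" for \<rho>
  proof (rule Bochner_Integration.integrable_bound[of _ "\<lambda>t. C / \<rho> ^ k * indicator {0<..<1} t"])
    show "AE t in lborel. norm (indicator {0<..<1} t * \<phi> \<rho> t) \<le> norm (C / \<rho> ^ k * indicator {0<..<1} t)"
      using that small[OF _ _ that] nn by (intro always_eventually) (auto simp: C_def split: split_indicator)
  qed auto
  have spl: "indicator {0<..} t * \<phi> \<rho> t = indicator {0<..<1} t * \<phi> \<rho> t + indicator {1..} t * \<phi> \<rho> t" for t \<rho>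
    by (auto split: split_indicator)
  have i: "integrable lborel (\<lambda>t. indicator {0<..} t * \<phi> \<rho> t)" if "0 < \<rho>" for \<rho>
    unfolding spl by (intro Bochner_Integration.integrable_add i0 i1 that)
  define J where "J = (LINT t|lborel. indicator {0<..} t * \<phi> 1 t)"
  have J: "0 < J"
  proof -
    let ?m = "2 powr (- p) * exp (- 1 / 2)"
    have "(LINT t|lborel. ?m * indicator {1..2::real} t) \<le> J"
      unfolding J_def
    proof (rule integral_mono[OF _ i])
      show "?m * indicator {1..2} t \<le> indicator {0<..} t * \<phi> 1 t" for t :: real
      proof (cases "t \<in> {1..2}")
        case True
        then have "?m \<le> \<phi> 1 t" unfolding \<phi>_def using p
          by (intro mult_mono powr_mono2') (auto simp: field_simps)
        then show ?thesis using True by simp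
      qed (use nn in simp)
    qed auto
    moreover have "(LINT t|lborel. ?m * indicator {1..2::real} t) = ?m" by simp
    ultimately show ?thesis by (smt (verit) exp_gt_zero mult_pos_pos powr_gt_zero)
  qed
  have scale: "(LINT t|lborel. indicator {0<..} t * \<phi> \<rho> t) = J * \<rho> powr (1 - p)" if \<rho>: "0 < \<rho>" for \<rho>
  proof -
    have "(LINT t|lborel. indicator {0<..} t * \<phi> \<rho> t) = \<bar>\<rho>\<bar> *\<^sub>R (LINT t|lborel. indicator {0<..} (0 + \<rho> * t) * \<phi> \<rho> (0 + \<rho> * t))"
      by (rule lborel_integral_real_affine) (use \<rho> in simp)
    also have "(\<lambda>t. indicator {0<..} (0 + \<rho> * t) * \<phi> \<rho> (0 + \<rho> * t)) = (\<lambda>t. \<rho> powr (- p) * (indicator {0<..} t * \<phi> 1 t))"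
      using \<rho> by (auto simp: fun_eq_iff \<phi>_def powr_mult zero_less_mult_iff split: split_indicator)
    also have "\<bar>\<rho>\<bar> *\<^sub>R (LINT t|lborel. \<rho> powr (- p) * (indicator {0<..} t * \<phi> 1 t)) = \<rho> * \<rho> powr (- p) * J"
      using \<rho> by (simp add: J_def)
    also have "\<rho> * \<rho> powr (- p) = \<rho> powr (1 - p)" using \<rho> by (simp add: powr_diff powr_minus_divide)
    finally show ?thesis by (simp only: mult.commute)
  qed
  show ?thesis
  proof (rule exI[of _ J], intro exI[of _ C] conjI allI impI J)
    fix \<rho> :: real assume \<rho>: "0 < \<rho>"
    have "J * \<rho> powr (1 - p) = (LINT t|lborel. indicator {0<..<1} t * \<phi> \<rho> t) + (LINT t|lborel. indicator {1..} t * \<phi> \<rho> t)"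
      unfolding scale[OF \<rho>, symmetric] spl by (intro Bochner_Integration.integral_add i0 i1 \<rho>)
    moreover have "(LINT t|lborel. indicator {0<..<1} t * \<phi> \<rho> t) \<le> (LINT t|lborel. C / \<rho> ^ k * indicator {0<..<1::real} t)"
      by (rule integral_mono[OF i0[OF \<rho>]]) (use small \<rho> in \<open>auto split: split_indicator\<close>)
    moreover have "0 \<le> (LINT t|lborel. indicator {0<..<1} t * \<phi> \<rho> t)"
      by (rule integral_nonneg_AE) (use nn in auto)
    ultimately show "\<bar>(LINT t|lborel. indicator {1..} t * (t powr (- p) * exp (- \<rho> / (2 * t)))) - J * \<rho> powr (1 - p)\<bar> \<le> C / \<rho> ^ k"
      unfolding \<phi>_def[symmetric] by simp
  qed
qed

lemma regular_kernel_asymptotics: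
  assumes n: "3 \<le> CARD('n)" and k: "CARD('n) \<le> k"
  shows "\<exists>J>0. \<exists>C. \<forall>x. x \<noteq> 0 \<longrightarrow>
    \<bar>(LINT \<xi>|lborel. cos (x \<bullet> \<xi>) * regular_kernel \<xi>) - J * dual_form x powr (1 - real CARD('n) / 2)\<bar>
      \<le> C / dual_form x ^ k"
proof -
  obtain c where c: "0 < c" "\<And>x. (LINT \<xi>|lborel. cos (x \<bullet> \<xi>) * regular_kernel \<xi>) =
      c * (LINT t|lborel. indicator {1..} t * (t powr (- (real CARD('n) / 2)) * exp (- dual_form x / (2 * t))))"
    using regular_kernel_fourier(2)[OF n] by auto
  have p: "1 < real CARD('n) / 2" "real CARD('n) / 2 \<le> real k" using n k by simp_all
  obtain J C where J: "0 < J" "\<And>\<rho>. 0 < \<rho> \<Longrightarrow>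
    \<bar>(LINT t|lborel. indicator {1..} t * (t powr (- (real CARD('n) / 2)) * exp (- \<rho> / (2 * t)))) - J * \<rho> powr (1 - real CARD('n) / 2)\<bar> \<le> C / \<rho> ^ k"
    using newtonian_split[OF p] by blast
  obtain c0 where c0: "0 < c0" "\<And>x. c0 * (norm x)\<^sup>2 \<le> dual_form x" using dual_form_bounds(1) by blast
  show ?thesis
  proof (rule exI[of _ "c * J"], intro exI[of _ "c * C"] conjI allI impI)
    fix x :: "real ^ 'n" assume "x \<noteq> 0"
    then have "0 < dual_form x" using c0(2)[of x] c0(1) by (smt (verit) mult_pos_pos zero_less_norm_iff zero_less_power)
    from mult_left_mono[OF J(2)[OF this] less_imp_le[OF c(1)]]
    show "\<bar>(LINT \<xi>|lborel. cos (x \<bullet> \<xi>) * regular_kernel \<xi>) - c * J * dual_form x powr (1 - real CARD('n) / 2)\<bar>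
      \<le> c * C / dual_form x ^ k"
      unfolding c(2) using c(1) by (simp add: abs_mult_pos' right_diff_distrib mult.assoc)
  qed (use c(1) J(1) in simp)
qed

lemma q_deriv: "((\<lambda>t. q (\<xi> + t *\<^sub>R e)) has_real_derivative \<xi> \<bullet> (A *v e)) (at 0)"
proof -
  have eq: "q (\<xi> + t *\<^sub>R e) = q \<xi> + t * (\<xi> \<bullet> (A *v e)) + t\<^sup>2 * q e" for t
    using symmetric_matrix_inner[OF A_sym, of \<xi> e]
    by (simp add: q_def matrix_vector_right_distrib matrix_vector_mult_scaleR inner_add_left inner_add_right
        inner_commute[of e "A *v \<xi>"] power2_eq_square field_simps)
  show ?thesis unfolding eq by (auto intro!: derivative_eq_intros)
qed

lemma symbol_q:
  assumes "0 \<notin> U"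
  shows "symbol e U k 2 q"
proof -
  obtain C where C: "\<And>\<xi>. q \<xi> \<le> C * (norm \<xi>)\<^sup>2" using q_bounds(2) by blast
  show ?thesis
  proof (rule symbol_Suc_imp, rule symbol_SucI[OF _ q_deriv])
  show "\<bar>q \<xi>\<bar> \<le> C * norm \<xi> powr 2" if "\<xi> \<in> U" for \<xi>
  proof -
    have "\<xi> \<noteq> 0" using that assms by blast
    then show ?thesis using C[of \<xi>] q_pos[of \<xi>] by simp
  qed
  show "symbol e U k (2 - 1) (\<lambda>\<xi>. \<xi> \<bullet> (A *v e))" using symbol_inner[OF assms] by simp
  qed
qed

lemma symbol_inverse_q:
  assumes "0 \<notin> U"
  shows "symbol e U k (- 2) (\<lambda>\<xi>. 1 / q \<xi>)"
proof -
  obtain c where c: "0 < c" "\<And>\<xi>. c * (norm \<xi>)\<^sup>2 \<le> q \<xi>" using q_bounds(1) by blast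
  show ?thesis
  proof (rule symbol_inverse[OF symbol_q[OF assms] assms c(1)])
    show "c * norm \<xi> powr 2 \<le> \<bar>q \<xi>\<bar>" if "\<xi> \<in> U" for \<xi>
    proof -
      have "\<xi> \<noteq> 0" using that assms by blast
      then show ?thesis using c(2)[of \<xi>] q_pos[of \<xi>] by simp
    qed
  qed
qed

lemma symbol_exp_q_bounded:
  assumes U: "0 \<notin> U" "\<And>\<xi>. \<xi> \<in> U \<Longrightarrow> norm \<xi> \<le> R" and a: "a \<le> 0"
  shows "symbol e U k a (\<lambda>\<xi>. exp (- q \<xi>))"
proof (rule symbol_exp[where A="{..0}" and q'="\<lambda>\<xi>. \<xi> \<bullet> (A *v e)", OF U(1) q_deriv symbol_inner[OF U(1)]])
  fix b :: real assume b: "b \<in> {..0}"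
  have "exp (- q \<xi>) \<le> R powr (- b) * norm \<xi> powr b" if "\<xi> \<in> U" for \<xi>
  proof -
    have nz: "\<xi> \<noteq> 0" using that U by blast
    then have "exp (- q \<xi>) \<le> 1" using q_pos[of \<xi>] by simp
    also have "1 = norm \<xi> powr (- b) * norm \<xi> powr b" using nz by (simp flip: powr_add)
    also have "\<dots> \<le> R powr (- b) * norm \<xi> powr b"
      using U(2)[OF that] b by (intro mult_right_mono powr_mono2) auto
    finally show ?thesis .
  qed
  then show "\<exists>C. \<forall>\<xi>\<in>U. exp (- q \<xi>) \<le> C * norm \<xi> powr b" by blast
qed (use a in auto)

text \<open>The function \<open>1 - exp (- q)\<close> vanishes to second order at the origin, which compensates for the
  division by \<open>q\<close>.\<close>

lemma symbol_regularisation: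
  assumes U: "0 \<notin> U" "\<And>\<xi>. \<xi> \<in> U \<Longrightarrow> norm \<xi> \<le> R"
  shows "symbol e U k 0 (\<lambda>\<xi>. (1 - exp (- q \<xi>)) / q \<xi>)"
proof -
  obtain C where C: "\<And>\<xi>. q \<xi> \<le> C * (norm \<xi>)\<^sup>2" using q_bounds(2) by blast
  have "symbol e U k 2 (\<lambda>\<xi>. 1 - exp (- q \<xi>))"
  proof (rule symbol_Suc_imp, rule symbol_SucI)
    show "\<bar>1 - exp (- q \<xi>)\<bar> \<le> C * norm \<xi> powr 2" if "\<xi> \<in> U" for \<xi>
    proof -
      have nz: "\<xi> \<noteq> 0" using that U by blast
      then have "\<bar>1 - exp (- q \<xi>)\<bar> = 1 - exp (- q \<xi>)" using q_pos[of \<xi>] by simp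
      also have "\<dots> \<le> q \<xi>" using exp_ge_add_one_self[of "- q \<xi>"] by linarith
      finally show ?thesis using C[of \<xi>] nz by simp
    qed
    show "((\<lambda>t. 1 - exp (- q (\<xi> + t *\<^sub>R e))) has_real_derivative \<xi> \<bullet> (A *v e) * exp (- q \<xi>)) (at 0)" for \<xi>
      using q_deriv[of \<xi> e] by (auto intro!: derivative_eq_intros)
    show "symbol e U k (2 - 1) (\<lambda>\<xi>. \<xi> \<bullet> (A *v e) * exp (- q \<xi>))"
      using symbol_mult[OF symbol_inner[OF U(1)] symbol_exp_q_bounded[OF U, where a=0]] by simp
  qed
  from symbol_mult[OF this symbol_inverse_q[OF U(1)]] show ?thesis by simp
qed

text \<open>Away from the origin the Gaussian factor is a symbol of every order.\<close>

lemma symbol_regular_kernel_far: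
  assumes U: "\<And>\<xi>. \<xi> \<in> U \<Longrightarrow> 1 \<le> norm \<xi>"
  shows "symbol e U k a regular_kernel"
proof -
  have U0: "0 \<notin> U" using U by force
  obtain c where c: "0 < c" "\<And>\<xi>. c * (norm \<xi>)\<^sup>2 \<le> q \<xi>" using q_bounds(1) by blast
  have "symbol e U k (a + 2) (\<lambda>\<xi>. exp (- q \<xi>))"
  proof (rule symbol_exp[where A=UNIV and q'="\<lambda>\<xi>. \<xi> \<bullet> (A *v e)", OF U0 q_deriv symbol_inner[OF U0]])
    fix b :: real
    define m where "m = nat \<lceil>\<bar>b\<bar>\<rceil>"
    have m: "- b \<le> 2 * real m" unfolding m_def by linarith
    have "exp (- q \<xi>) \<le> (fact m / c ^ m) * norm \<xi> powr b" if "\<xi> \<in> U" for \<xi>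
    proof -
      have n1: "1 \<le> norm \<xi>" by (rule U[OF that])
      then have nz: "\<xi> \<noteq> 0" by auto
      have "exp (- q \<xi>) \<le> exp (- (c * (norm \<xi>)\<^sup>2))" using c(2)[of \<xi>] by simp
      also have "\<dots> \<le> fact m / (c * (norm \<xi>)\<^sup>2) ^ m"
        by (rule exp_neg_le_inverse_power) (use c(1) nz in simp)
      also have "\<dots> = (fact m / c ^ m) * (1 / norm \<xi> ^ (2 * m))"
        by (simp add: power_mult_distrib power_mult)
      also have "1 / norm \<xi> ^ (2 * m) = norm \<xi> powr (- (2 * real m))"
        using nz powr_realpow[of "norm \<xi>" "2 * m"] by (simp add: powr_minus_divide)
      also have "(fact m / c ^ m) * norm \<xi> powr (- (2 * real m)) \<le> (fact m / c ^ m) * norm \<xi> powr b"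
        using n1 m c(1) by (intro mult_left_mono powr_mono) auto
      finally show ?thesis .
    qed
    then show "\<exists>C. \<forall>\<xi>\<in>U. exp (- q \<xi>) \<le> C * norm \<xi> powr b" by blast
  qed auto
  from symbol_mult[OF this symbol_inverse_q[OF U0]]
  have "symbol e U k a (\<lambda>\<xi>. exp (- q \<xi>) * (1 / q \<xi>))" by simp
  then show ?thesis by (rule symbol_cong) (simp add: regular_kernel_def)
qed

end

section \<open>The characteristic exponent of a transition weight\<close>

lemma real_vec_component [simp]: "real_vec x $ i = real_of_int (x $ i)"
  by (simp add: real_vec_def)

lemma real_vec_simps [simp]:
  "real_vec 0 = 0" "real_vec (x + y) = real_vec x + real_vec y" "real_vec (- x) = - real_vec x"
  "real_vec (x - y) = real_vec x - real_vec y"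
  by (simp_all add: vec_eq_iff)

lemma real_vec_eq_0_iff [simp]: "real_vec x = 0 \<longleftrightarrow> x = 0"
  by (simp add: vec_eq_iff)

lemma norm_real_vec_ge_1:
  assumes "x \<noteq> 0"
  shows "1 \<le> norm (real_vec x)"
proof -
  obtain i where "x $ i \<noteq> 0" using assms by (auto simp: vec_eq_iff)
  then have "1 \<le> \<bar>real_vec x $ i\<bar>" by simp
  then show ?thesis using component_le_norm_cart[of "real_vec x" i] by linarith
qed

lemma abs_le_power_Suc_if_deriv:
  fixes f :: "real \<Rightarrow> real"
  assumes f0: "f 0 = 0" and d: "\<And>s. (f has_real_derivative f' s) (at s)" and b: "\<And>s. \<bar>f' s\<bar> \<le> \<bar>s\<bar> ^ m"
  shows "\<bar>f t\<bar> \<le> \<bar>t\<bar> ^ Suc m"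
proof (cases "t = 0")
  case False
  obtain s where s: "\<bar>s\<bar> \<le> \<bar>t\<bar>" "f t = t * f' s"
  proof (cases "0 < t")
    case True
    from MVT2[OF this, of f f'] d obtain z where "0 < z" "z < t" "f t - f 0 = (t - 0) * f' z" by blast
    then show ?thesis using f0 by (intro that[of z]) auto
  next
    case neg: False
    then have "t < 0" using False by simp
    from MVT2[OF this, of f f'] d obtain z where "t < z" "z < 0" "f 0 - f t = (0 - t) * f' z" by blast
    then show ?thesis using f0 by (intro that[of z]) auto
  qed
  have "\<bar>f' s\<bar> \<le> \<bar>t\<bar> ^ m" using b[of s] power_mono[OF s(1), of m] by simp
  then show ?thesis unfolding s(2) by (simp add: abs_mult mult_left_mono)
qed (use f0 in simp)

text \<open>The second order Taylor remainder of the cosine and its derivatives. From the third on, they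
  are the shifts of the sine by multiples of \<open>\<pi> / 2\<close>.\<close>

fun cos_remainder :: "nat \<Rightarrow> real \<Rightarrow> real" where
  "cos_remainder 0 t = t\<^sup>2 / 2 - 1 + cos t"
| "cos_remainder (Suc 0) t = t - sin t"
| "cos_remainder (Suc (Suc 0)) t = 1 - cos t"
| "cos_remainder (Suc (Suc (Suc k))) t = sin (t + real k * (pi / 2))"

lemma cos_remainder_deriv: "(cos_remainder k has_real_derivative cos_remainder (Suc k) t) (at t)"
proof -
  consider "k = 0" | "k = 1" | "k = 2" | l where "k = Suc (Suc (Suc l))"
    by (metis One_nat_def Suc_1 not0_implies_Suc)
  then show ?thesis
  proof cases
    case 1
    have "cos_remainder 0 = (\<lambda>t. t\<^sup>2 / 2 - 1 + cos t)" by (rule ext) simp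
    then show ?thesis using 1 by (auto intro!: derivative_eq_intros)
  next
    case 2
    have "cos_remainder (Suc 0) = (\<lambda>t. t - sin t)" by (rule ext) simp
    then show ?thesis using 2 by (auto intro!: derivative_eq_intros)
  next
    case 3
    have "cos_remainder (Suc (Suc 0)) = (\<lambda>t. 1 - cos t)" by (rule ext) simp
    then show ?thesis using 3 by (auto simp: numeral_2_eq_2 intro!: derivative_eq_intros)
  next
    case 4
    have "cos_remainder (Suc (Suc (Suc l))) = (\<lambda>t. sin (t + real l * (pi / 2)))" by (rule ext) simp
    moreover have "sin (t + real (Suc l) * (pi / 2)) = cos (t + real l * (pi / 2))"
    proof -
      have e: "t + real (Suc l) * (pi / 2) = (t + real l * (pi / 2)) + pi / 2" by (simp add: field_simps)
      show ?thesis unfolding e sin_add by simp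
    qed
    ultimately show ?thesis using 4 by (auto intro!: derivative_eq_intros)
  qed
qed

lemma cos_remainder_le_1: "3 \<le> k \<Longrightarrow> \<bar>cos_remainder k t\<bar> \<le> 1"
proof -
  assume "3 \<le> k"
  then obtain l where "k = 3 + l" using le_Suc_ex by blast
  then have "k = Suc (Suc (Suc l))" by simp
  then show ?thesis by simp
qed

lemma cos_remainder_bound_small: "\<bar>cos_remainder 3 t\<bar> \<le> \<bar>t\<bar> ^ 1" "\<bar>cos_remainder 2 t\<bar> \<le> \<bar>t\<bar> ^ 2"
    "\<bar>cos_remainder 1 t\<bar> \<le> \<bar>t\<bar> ^ 3" "\<bar>cos_remainder 0 t\<bar> \<le> \<bar>t\<bar> ^ 4"
proof -
  have 3: "\<bar>cos_remainder 3 t\<bar> \<le> \<bar>t\<bar> ^ 1" for t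
    using abs_sin_x_le_abs_x[of t] by (simp add: numeral_3_eq_3)
  have 2: "\<bar>cos_remainder 2 t\<bar> \<le> \<bar>t\<bar> ^ 2" for t
    using abs_le_power_Suc_if_deriv[of "cos_remainder 2" "cos_remainder 3" 1 t] cos_remainder_deriv[of 2] 3
    by (simp add: numeral_3_eq_3 numeral_2_eq_2)
  have 1: "\<bar>cos_remainder 1 t\<bar> \<le> \<bar>t\<bar> ^ 3" for t
    using abs_le_power_Suc_if_deriv[of "cos_remainder 1" "cos_remainder 2" 2 t] cos_remainder_deriv[of 1] 2
    by (simp add: numeral_3_eq_3 numeral_2_eq_2)
  have 0: "\<bar>cos_remainder 0 t\<bar> \<le> \<bar>t\<bar> ^ 4" for t
    using abs_le_power_Suc_if_deriv[of "cos_remainder 0" "cos_remainder 1" 3 t] cos_remainder_deriv[of 0] 1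
    by (simp add: eval_nat_numeral)
  show "\<bar>cos_remainder 3 t\<bar> \<le> \<bar>t\<bar> ^ 1" "\<bar>cos_remainder 2 t\<bar> \<le> \<bar>t\<bar> ^ 2"
    "\<bar>cos_remainder 1 t\<bar> \<le> \<bar>t\<bar> ^ 3" "\<bar>cos_remainder 0 t\<bar> \<le> \<bar>t\<bar> ^ 4" by (rule 3 2 1 0)+
qed

lemma cos_remainder_bound:
  assumes "k \<le> 4"
  shows "\<bar>cos_remainder k t\<bar> \<le> \<bar>t\<bar> ^ (4 - k)"
proof -
  consider "k = 0" | "k = 1" | "k = 2" | "k = 3" | "k = 4" using assms by linarith
  then show ?thesis
    using cos_remainder_bound_small[of t] cos_remainder_le_1[of 4 t] by cases auto
qed

text \<open>\<open>1 - cos t\<close> is twice the square of \<open>sin (t / 2)\<close>, and \<open>|sin|\<close> is subadditive.\<close>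

lemma one_minus_cos_add_le:
  fixes a b :: real
  shows "1 - cos (a + b) \<le> 2 * (1 - cos a) + 2 * (1 - cos b)"
proof -
  have sq: "1 - cos v = 2 * (sin (v / 2))\<^sup>2" for v :: real
    using cos_double_sin[of "v / 2"] by simp
  have "\<bar>sin (a / 2 + b / 2)\<bar> \<le> \<bar>sin (a / 2)\<bar> + \<bar>sin (b / 2)\<bar>"
  proof -
    have "\<bar>sin (a / 2 + b / 2)\<bar> \<le> \<bar>sin (a / 2)\<bar> * \<bar>cos (b / 2)\<bar> + \<bar>cos (a / 2)\<bar> * \<bar>sin (b / 2)\<bar>"
      unfolding sin_add by (rule order_trans[OF abs_triangle_ineq]) (simp add: abs_mult)
    also have "\<dots> \<le> \<bar>sin (a / 2)\<bar> * 1 + 1 * \<bar>sin (b / 2)\<bar>"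
      by (intro add_mono mult_mono) auto
    finally show ?thesis by simp
  qed
  then have "(sin ((a + b) / 2))\<^sup>2 \<le> (\<bar>sin (a / 2)\<bar> + \<bar>sin (b / 2)\<bar>)\<^sup>2"
    by (subst power2_abs[symmetric], intro power_mono) (auto simp: add_divide_distrib)
  also have "\<dots> \<le> 2 * (sin (a / 2))\<^sup>2 + 2 * (sin (b / 2))\<^sup>2"
    using sum_squares_bound[of "\<bar>sin (a / 2)\<bar>" "\<bar>sin (b / 2)\<bar>"] by (simp add: power2_sum)
  finally show ?thesis unfolding sq by simp
qed

text \<open>Near the origin by the Taylor expansion, elsewhere by compactness. The bound reaches beyond
  \<open>[-\<pi>, \<pi>]\<close> because finite differences on the torus leave the cube by at most \<open>1\<close>.\<close>

lemma one_minus_cos_ge: "\<exists>c>0. \<forall>t::real. \<bar>t\<bar> \<le> pi + 1 \<longrightarrow> c * t\<^sup>2 \<le> 1 - cos t"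
proof -
  let ?K = "{1 / 2 .. pi + 1 :: real}"
  have "?K \<noteq> {}" using pi_gt3 by simp
  have "\<exists>m\<in>?K. \<forall>t\<in>?K. 1 - cos m \<le> 1 - cos t"
    by (rule continuous_attains_inf) (use \<open>?K \<noteq> {}\<close> in \<open>auto intro!: continuous_intros simp: add_pos_pos\<close>)
  then obtain m where m: "m \<in> ?K" "\<And>t. t \<in> ?K \<Longrightarrow> 1 - cos m \<le> 1 - cos t" by blast
  have m': "0 < 1 - cos m"
  proof -
    have sq: "1 - cos m = 2 * (sin (m / 2))\<^sup>2"
      using cos_double_sin[of "m / 2"] by simp
    have "0 < sin (m / 2)" using m(1) pi_gt3 by (intro sin_gt_zero) auto
    then show ?thesis unfolding sq by simp
  qed
  define c where "c = min (1 / 4) ((1 - cos m) / (pi + 1)\<^sup>2)"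
  have pi1: "0 < (pi + 1)\<^sup>2" using pi_gt3 by (intro zero_less_power) simp
  have c: "0 < c" using m' pi1 by (simp add: c_def)
  have "c * t\<^sup>2 \<le> 1 - cos t" if t: "0 \<le> t" "t \<le> pi + 1" for t
  proof (cases "t \<le> 1 / 2")
    case True
    have "\<bar>t\<^sup>2 / 2 - 1 + cos t\<bar> \<le> t ^ 4" using cos_remainder_bound_small(4)[of t] by simp
    moreover have "t ^ 4 \<le> (1 / 4) * t\<^sup>2"
    proof -
      have "t\<^sup>2 \<le> (1 / 2)\<^sup>2" using True t by (intro power_mono) auto
      then have "t\<^sup>2 * t\<^sup>2 \<le> (1 / 4) * t\<^sup>2" by (intro mult_right_mono) (auto simp: power2_eq_square)
      then show ?thesis by (simp flip: power_add)
    qed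
    moreover have "c * t\<^sup>2 \<le> (1 / 4) * t\<^sup>2" unfolding c_def by (intro mult_right_mono min.cobounded1) simp
    ultimately show ?thesis by linarith
  next
    case False
    have "c * t\<^sup>2 \<le> (1 - cos m) / (pi + 1)\<^sup>2 * (pi + 1)\<^sup>2"
      using t c m' by (intro mult_mono power_mono) (auto simp: c_def)
    also have "\<dots> = 1 - cos m" using pi1 by simp
    also have "\<dots> \<le> 1 - cos t" using False t by (intro m) auto
    finally show ?thesis .
  qed
  from this[of "\<bar>t\<bar>" for t] have "c * t\<^sup>2 \<le> 1 - cos t" if "\<bar>t\<bar> \<le> pi + 1" for t
    using that by simp
  then show ?thesis using c by blast
qed

lemma has_sum_finite_sum:
  fixes f :: "'i \<Rightarrow> 'a \<Rightarrow> real"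
  assumes "\<And>i. i \<in> I \<Longrightarrow> (f i has_sum s i) A"
  shows "((\<lambda>x. \<Sum>i\<in>I. f i x) has_sum (\<Sum>i\<in>I. s i)) A"
  using assms by (induction I rule: infinite_finite_induct) (auto intro: has_sum_add)

lemma group_closure_induct_sum:
  assumes x: "x \<in> group_closure S"
    and 0: "P 0" and base: "\<And>s. s \<in> S \<Longrightarrow> P s" and diff: "\<And>s t. P s \<Longrightarrow> P t \<Longrightarrow> P (s - t)"
  shows "P x"
  using x by (induction rule: group_closure.induct) (auto intro: 0 base diff)

text \<open>The strong minimum principle. A function vanishing at infinity attains a negative infimum. At a
  minimum the Laplacian is a sum of nonpositive terms, so the minimal value spreads along edges
  to the whole graph; a negative constant does not vanish at infinity, and the constant \<open>0\<close>
  contradicts the positive Laplacian at \<open>o'\<close>.\<close>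

lemma (in weighted_graph) superharmonic_positive:
  assumes f: "f \<in> form_domain b" and vanish: "\<And>\<epsilon>. 0 < \<epsilon> \<Longrightarrow> finite {x. \<epsilon> \<le> \<bar>f x\<bar>}"
    and sup: "\<And>x. 0 \<le> laplacian b f x" and pos: "0 < laplacian b f o'"
    and conn: "\<And>x y. (\<lambda>x y. 0 < b x y)\<^sup>*\<^sup>* x y" and inf: "infinite (UNIV :: 'a set)"
  shows "0 < f x"
proof -
  have spread: "f y = f x" if min: "\<And>y. f x \<le> f y" for x y
  proof -
    have step: "f y = f x'" if "f x' = f x" and bxy: "0 < b x' y" for x' y
    proof -
      have le: "b x' y * (f x' - f y) \<le> 0" for y
        using min[of y] b_nonneg[of x' y] \<open>f x' = f x\<close> by (simp add: mult_nonneg_nonpos)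
      have hs: "((\<lambda>y. - (b x' y * (f x' - f y))) has_sum - laplacian b f x') UNIV"
        by (rule has_sum_uminusI[OF laplacian_has_sum[OF f]])
      have "sum (\<lambda>y. - (b x' y * (f x' - f y))) {y} \<le> - laplacian b f x'"
        by (rule finite_sum_le_has_sum[OF hs]) (use le in auto)
      then have "0 \<le> b x' y * (f x' - f y)" using sup[of x'] by simp
      then have "f y \<le> f x'" using bxy by (simp add: zero_le_mult_iff)
      then show ?thesis using min[of y] \<open>f x' = f x\<close> by simp
    qed
    show ?thesis using conn[of x y]
    proof (induction rule: rtranclp_induct)
      case (step y z)
      then show ?case using \<open>\<And>x' y. f x' = f x \<Longrightarrow> 0 < b x' y \<Longrightarrow> f y = f x'\<close>[of y z] by simp
    qed simp
  qed
  have nonneg: "0 \<le> f x" for x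
  proof (rule ccontr)
    assume "\<not> 0 \<le> f x"
    define \<epsilon> where "\<epsilon> = - f x"
    have \<epsilon>: "0 < \<epsilon>" using \<open>\<not> 0 \<le> f x\<close> by (simp add: \<epsilon>_def)
    let ?A = "{y. f y \<le> - \<epsilon>}"
    have A: "finite ?A" by (rule finite_subset[OF _ vanish[OF \<epsilon>]]) (use \<epsilon> in auto)
    have "x \<in> ?A" by (simp add: \<epsilon>_def)
    then obtain x1 where x1: "x1 \<in> ?A" "\<And>y. y \<in> ?A \<Longrightarrow> f x1 \<le> f y"
      using arg_min_if_finite[OF A, of f] by (metis empty_iff not_le)
    have "f x1 \<le> f y" for y using x1 by (cases "y \<in> ?A") auto
    then have "f y = f x1" for y by (rule spread)
    then have "f y \<le> - \<epsilon>" for y using x1(1) by (metis mem_Collect_eq)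
    then have "?A = UNIV" by auto
    then show False using A inf by simp
  qed
  have "f x \<noteq> 0" for x
  proof
    assume "f x = 0"
    then have "f y = f x" for y using nonneg by (intro spread) simp
    then have "f y = 0" for y using \<open>f x = 0\<close> by simp
    then have "laplacian b f o' = 0" by (simp add: laplacian_def)
    then show False using pos by simp
  qed
  then show ?thesis using nonneg[of x] by (simp add: less_le)
qed

lemma kernel_periodic:
  fixes x :: "int ^ 'd"
  shows "cos (real_vec x \<bullet> (\<xi> + (2 * pi) *\<^sub>R axis j 1)) = cos (real_vec x \<bullet> \<xi>)"
    and "sin (real_vec x \<bullet> (\<xi> + (2 * pi) *\<^sub>R axis j 1)) = sin (real_vec x \<bullet> \<xi>)"
proof -
  have e: "real_vec x \<bullet> (\<xi> + (2 * pi) *\<^sub>R axis j 1) = real_vec x \<bullet> \<xi> + 2 * pi * real_of_int (x $ j)"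
    by (simp add: inner_add_right inner_axis)
  show "cos (real_vec x \<bullet> (\<xi> + (2 * pi) *\<^sub>R axis j 1)) = cos (real_vec x \<bullet> \<xi>)"
    "sin (real_vec x \<bullet> (\<xi> + (2 * pi) *\<^sub>R axis j 1)) = sin (real_vec x \<bullet> \<xi>)"
    unfolding e cos_add sin_add using cos_int_2pin[of "x $ j"] sin_int_2pin[of "x $ j"] by simp_all
qed

locale lattice_weight =
  fixes \<mu> :: "int ^ 'd \<Rightarrow> real"
  assumes tw: "transition_weight \<mu>"
begin

lemma mu_nonneg: "0 \<le> \<mu> x" and mu_sym: "\<mu> (- x) = \<mu> x"
  and mu_generates: "group_closure {x. \<mu> x \<noteq> 0} = UNIV"
  and mu_second_moment: "(\<lambda>x. \<mu> x * (norm (real_vec x))\<^sup>2) summable_on UNIV"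
  using tw by (auto simp: transition_weight_def)

lemma norm_le_square: "norm (real_vec x) \<le> (norm (real_vec x))\<^sup>2"
  using norm_real_vec_ge_1[of x] by (cases "x = 0") (auto simp: power2_eq_square)

lemma mu_first_moment: "(\<lambda>x. \<mu> x * norm (real_vec x)) summable_on UNIV"
  by (rule summable_on_comparison_test[OF mu_second_moment]) (auto intro!: mult_left_mono mult_nonneg_nonneg norm_le_square mu_nonneg)

lemma mu_summable: "\<mu> summable_on UNIV"
proof -
  have "(\<lambda>x. \<mu> x * (norm (real_vec x))\<^sup>2 + (if x = 0 then \<mu> 0 else 0)) summable_on UNIV"
    by (intro summable_on_add mu_second_moment finite_nonzero_values_imp_summable_on)
      (auto intro: finite_subset[of _ "{0}"])
  then show ?thesis
  proof (rule summable_on_comparison_test)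
    fix x :: "int ^ 'd"
    show "\<mu> x \<le> \<mu> x * (norm (real_vec x))\<^sup>2 + (if x = 0 then \<mu> 0 else 0)"
    proof (cases "x = 0")
      case False
      have "1 \<le> (norm (real_vec x))\<^sup>2" using norm_real_vec_ge_1[OF False] by (rule one_le_power)
      then have "\<mu> x * 1 \<le> \<mu> x * (norm (real_vec x))\<^sup>2" by (intro mult_left_mono mu_nonneg)
      then show ?thesis using False by simp
    qed simp
  qed (rule mu_nonneg)
qed

definition M :: real where "M = (\<Sum>\<^sub>\<infinity>x. \<mu> x)"

lemma M_has_sum: "(\<mu> has_sum M) UNIV"
  using mu_summable by (simp add: M_def)

lemma support_nonempty: "\<exists>x. 0 < \<mu> x"
proof (rule ccontr)
  assume "\<not> (\<exists>x. 0 < \<mu> x)"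
  then have "{x. \<mu> x \<noteq> 0} = {}" using mu_nonneg by (metis (mono_tags, lifting) Collect_empty_eq less_le)
  then have "(UNIV :: (int ^ 'd) set) = {0}" using mu_generates by (simp only: group_closure_empty)
  then have "(1 :: int ^ 'd) = 0" by blast
  then show False by (simp add: vec_eq_iff)
qed

lemma M_pos: "0 < M"
proof -
  obtain x where x: "0 < \<mu> x" using support_nonempty by blast
  have "sum \<mu> {x} \<le> M" by (rule finite_sum_le_has_sum[OF M_has_sum]) (auto intro: mu_nonneg)
  then show ?thesis using x by simp
qed

text \<open>The characteristic exponent. Being real, it contains the cosine instead of the complex
  exponential, which is justified by the symmetry of the weight.\<close>

definition Psi :: "real ^ 'd \<Rightarrow> real" where
  "Psi \<xi> = (\<Sum>\<^sub>\<infinity>x. \<mu> x * (1 - cos (real_vec x \<bullet> \<xi>)))"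

lemma Psi_has_sum: "((\<lambda>x. \<mu> x * (1 - cos (real_vec x \<bullet> \<xi>))) has_sum Psi \<xi>) UNIV"
proof -
  have "(\<lambda>x. \<mu> x * (1 - cos (real_vec x \<bullet> \<xi>))) summable_on UNIV"
  proof (rule summable_on_comparison_test[OF summable_on_cmult_right[OF mu_summable, of 2]])
    show "\<mu> x * (1 - cos (real_vec x \<bullet> \<xi>)) \<le> 2 * \<mu> x" for x
      using mult_left_mono[of "1 - cos (real_vec x \<bullet> \<xi>)" 2 "\<mu> x"] mu_nonneg[of x] cos_ge_minus_one[of "real_vec x \<bullet> \<xi>"]
      by (simp add: mult.commute)
  qed (auto intro!: mult_nonneg_nonneg mu_nonneg)
  then show ?thesis by (simp add: Psi_def)
qed

lemma Psi_nonneg: "0 \<le> Psi \<xi>"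
  by (rule has_sum_nonneg[OF Psi_has_sum]) (auto intro!: mult_nonneg_nonneg mu_nonneg)

lemma cos_has_sum: "((\<lambda>x. \<mu> x * cos (real_vec x \<bullet> \<xi>)) has_sum (M - Psi \<xi>)) UNIV"
  using has_sum_add[OF M_has_sum has_sum_uminusI[OF Psi_has_sum[of \<xi>]]] by (simp add: algebra_simps)

lemma sin_has_sum: "((\<lambda>x. \<mu> x * sin (real_vec x \<bullet> \<xi>)) has_sum 0) UNIV"
proof -
  have "(\<lambda>x. \<mu> x * sin (real_vec x \<bullet> \<xi>)) summable_on UNIV"
  proof (rule abs_summable_summable, rule Infinite_Sum.abs_summable_on_comparison_test')
    show "norm (\<mu> x * sin (real_vec x \<bullet> \<xi>)) \<le> \<mu> x" for x
      using mu_nonneg[of x] abs_sin_le_one[of "real_vec x \<bullet> \<xi>"] by (simp add: abs_mult mult_left_le)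
  qed (rule mu_summable)
  then obtain s where s: "((\<lambda>x. \<mu> x * sin (real_vec x \<bullet> \<xi>)) has_sum s) UNIV" by (auto simp: summable_on_def)
  have "((\<lambda>x. \<mu> (- x) * sin (real_vec (- x) \<bullet> \<xi>)) has_sum s) UNIV"
    using s by (subst has_sum_reindex_bij_witness[where i=uminus and j=uminus and T=UNIV and h="\<lambda>x. \<mu> x * sin (real_vec x \<bullet> \<xi>)"]) auto
  then have "((\<lambda>x. - (\<mu> x * sin (real_vec x \<bullet> \<xi>))) has_sum s) UNIV"
    by (simp add: mu_sym)
  from has_sum_unique[OF this has_sum_uminusI[OF s]] have "s = 0" by simp
  then show ?thesis using s by simp
qed

lemma fourier_normalized: "fourier (normalized_weight \<mu>) \<xi> = complex_of_real (1 - Psi \<xi> / M)"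
proof -
  have e: "complex_of_real (normalized_weight \<mu> x) * exp (- (\<i> * complex_of_real (real_vec x \<bullet> \<xi>))) =
      (1 / M) * complex_of_real (\<mu> x * cos (real_vec x \<bullet> \<xi>)) +
      (- \<i> / M) * complex_of_real (\<mu> x * sin (real_vec x \<bullet> \<xi>))" for x
  proof -
    have "exp (- (\<i> * complex_of_real t)) = complex_of_real (cos t) - \<i> * complex_of_real (sin t)" for t
      using exp_Euler[of "- complex_of_real t"] by (simp add: cos_of_real sin_of_real)
    from this[of "real_vec x \<bullet> \<xi>"] show ?thesis
      using M_pos by (simp only: normalized_weight_def M_def[symmetric]) (simp add: field_simps)
  qed
  have "((\<lambda>x. complex_of_real (normalized_weight \<mu> x) * exp (- (\<i> * complex_of_real (real_vec x \<bullet> \<xi>)))) has_sum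
      ((1 / M) * complex_of_real (M - Psi \<xi>) + (- \<i> / M) * complex_of_real 0)) UNIV"
    unfolding e by (intro has_sum_add has_sum_cmult_right has_sum_of_real cos_has_sum sin_has_sum)
  then have "fourier (normalized_weight \<mu>) \<xi> = (1 / M) * complex_of_real (M - Psi \<xi>) + (- \<i> / M) * complex_of_real 0"
    unfolding fourier_def by (rule infsumI)
  also have "\<dots> = complex_of_real (1 - Psi \<xi> / M)" using M_pos by (simp add: field_simps)
  finally show ?thesis .
qed

lemma Psi_continuous: "continuous_on UNIV Psi"
proof -
  define L where "L = (\<Sum>\<^sub>\<infinity>x. \<mu> x * norm (real_vec x))"
  have L: "((\<lambda>x. \<mu> x * norm (real_vec x)) has_sum L) UNIV" using mu_first_moment by (simp add: L_def)
  have L0: "0 \<le> L" by (rule has_sum_nonneg[OF L]) (simp add: mu_nonneg)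
  have cl: "cos a - cos b \<le> \<bar>a - b\<bar>" for a b :: real
  proof -
    have "cos a - cos b = 2 * (sin ((a + b) / 2) * sin ((b - a) / 2))" by (simp add: cos_diff_cos)
    also have "\<dots> \<le> 2 * (1 * \<bar>(b - a) / 2\<bar>)"
    proof (intro mult_left_mono)
      have "sin ((a + b) / 2) * sin ((b - a) / 2) \<le> \<bar>sin ((a + b) / 2)\<bar> * \<bar>sin ((b - a) / 2)\<bar>"
        by (metis abs_ge_self abs_mult)
      also have "\<dots> \<le> 1 * \<bar>(b - a) / 2\<bar>" by (intro mult_mono abs_sin_x_le_abs_x) auto
      finally show "sin ((a + b) / 2) * sin ((b - a) / 2) \<le> 1 * \<bar>(b - a) / 2\<bar>" .
    qed simp
    finally show ?thesis by simp
  qed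
  have le: "Psi \<xi> - Psi \<eta> \<le> L * dist \<xi> \<eta>" for \<xi> \<eta>
  proof (rule has_sum_mono)
    show "((\<lambda>x. \<mu> x * (1 - cos (real_vec x \<bullet> \<xi>)) + - (\<mu> x * (1 - cos (real_vec x \<bullet> \<eta>)))) has_sum Psi \<xi> - Psi \<eta>) UNIV"
      using has_sum_add[OF Psi_has_sum[of \<xi>] has_sum_uminusI[OF Psi_has_sum[of \<eta>]]] by simp
    show "((\<lambda>x. \<mu> x * norm (real_vec x) * dist \<xi> \<eta>) has_sum L * dist \<xi> \<eta>) UNIV"
      by (intro has_sum_cmult_left L)
    fix x :: "int ^ 'd"
    have "cos (real_vec x \<bullet> \<eta>) - cos (real_vec x \<bullet> \<xi>) \<le> \<bar>real_vec x \<bullet> (\<eta> - \<xi>)\<bar>"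
      using cl[of "real_vec x \<bullet> \<eta>" "real_vec x \<bullet> \<xi>"] by (simp add: inner_diff_right)
    also have "\<dots> \<le> norm (real_vec x) * dist \<xi> \<eta>"
      using Cauchy_Schwarz_ineq2[of "real_vec x" "\<eta> - \<xi>"] by (simp add: dist_norm norm_minus_commute)
    finally have "\<mu> x * (cos (real_vec x \<bullet> \<eta>) - cos (real_vec x \<bullet> \<xi>)) \<le> \<mu> x * (norm (real_vec x) * dist \<xi> \<eta>)"
      by (rule mult_left_mono[OF _ mu_nonneg])
    then show "\<mu> x * (1 - cos (real_vec x \<bullet> \<xi>)) + - (\<mu> x * (1 - cos (real_vec x \<bullet> \<eta>))) \<le> \<mu> x * norm (real_vec x) * dist \<xi> \<eta>"
      by (simp add: algebra_simps)
  qed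
  have "L-lipschitz_on UNIV Psi"
  proof (rule lipschitz_onI[OF _ L0])
    show "dist (Psi \<xi>) (Psi \<eta>) \<le> L * dist \<xi> \<eta>" for \<xi> \<eta>
      using le[of \<xi> \<eta>] le[of \<eta> \<xi>] by (simp add: dist_real_def abs_le_iff dist_commute)
  qed
  then show ?thesis by (rule lipschitz_on_continuous_on)
qed

lemma Psi_measurable [measurable]: "Psi \<in> borel_measurable borel"
  by (rule borel_measurable_continuous_onI[OF Psi_continuous])

lemma Psi_minus: "Psi (- \<xi>) = Psi \<xi>"
  by (simp add: Psi_def)

lemma Psi_periodic: "Psi (\<xi> + (2 * pi) *\<^sub>R axis j 1) = Psi \<xi>"
  by (simp add: Psi_def kernel_periodic)

text \<open>The points \<open>x\<close> for which such a constant exists form a subgroup by \<open>one_minus_cos_add_le\<close>, and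
  it contains the support of the weight because \<open>Psi\<close> is a sum of nonnegative terms.\<close>

lemma one_minus_cos_le_Psi: "\<exists>C\<ge>0. \<forall>\<xi>. 1 - cos (real_vec x \<bullet> \<xi>) \<le> C * Psi \<xi>"
proof (rule group_closure_induct_sum[of x "{x. \<mu> x \<noteq> 0}"])
  show "x \<in> group_closure {x. \<mu> x \<noteq> 0}" by (simp add: mu_generates)
  show "\<exists>C\<ge>0. \<forall>\<xi>. 1 - cos (real_vec (0 :: int ^ 'd) \<bullet> \<xi>) \<le> C * Psi \<xi>"
    by (intro exI[of _ 0]) simp
  fix s assume "s \<in> {x. \<mu> x \<noteq> 0}"
  then have s: "0 < \<mu> s" using mu_nonneg[of s] by simp
  have "sum (\<lambda>x. \<mu> x * (1 - cos (real_vec x \<bullet> \<xi>))) {s} \<le> Psi \<xi>" for \<xi>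
    by (rule finite_sum_le_has_sum[OF Psi_has_sum]) (auto intro!: mult_nonneg_nonneg mu_nonneg)
  then have "1 - cos (real_vec s \<bullet> \<xi>) \<le> (1 / \<mu> s) * Psi \<xi>" for \<xi>
    using s by (simp add: field_simps)
  then show "\<exists>C\<ge>0. \<forall>\<xi>. 1 - cos (real_vec s \<bullet> \<xi>) \<le> C * Psi \<xi>"
    using s by (intro exI[of _ "1 / \<mu> s"]) auto
next
  fix s t :: "int ^ 'd"
  assume "\<exists>C\<ge>0. \<forall>\<xi>. 1 - cos (real_vec s \<bullet> \<xi>) \<le> C * Psi \<xi>" "\<exists>C\<ge>0. \<forall>\<xi>. 1 - cos (real_vec t \<bullet> \<xi>) \<le> C * Psi \<xi>"
  then obtain C D where C: "0 \<le> C" "\<And>\<xi>. 1 - cos (real_vec s \<bullet> \<xi>) \<le> C * Psi \<xi>"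
    and D: "0 \<le> D" "\<And>\<xi>. 1 - cos (real_vec t \<bullet> \<xi>) \<le> D * Psi \<xi>" by blast
  have "1 - cos (real_vec (s - t) \<bullet> \<xi>) \<le> (2 * C + 2 * D) * Psi \<xi>" for \<xi>
  proof -
    have "1 - cos (real_vec (s - t) \<bullet> \<xi>) \<le> 2 * (1 - cos (real_vec s \<bullet> \<xi>)) + 2 * (1 - cos (real_vec t \<bullet> \<xi>))"
      using one_minus_cos_add_le[of "real_vec s \<bullet> \<xi>" "- (real_vec t \<bullet> \<xi>)"] by (simp add: inner_diff_left)
    then show ?thesis using C(2)[of \<xi>] D(2)[of \<xi>] by argo
  qed
  then show "\<exists>C\<ge>0. \<forall>\<xi>. 1 - cos (real_vec (s - t) \<bullet> \<xi>) \<le> C * Psi \<xi>"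
    using C(1) D(1) by (intro exI[of _ "2 * C + 2 * D"]) auto
qed

text \<open>The standard unit vectors are among the lattice points to which \<open>one_minus_cos_le_Psi\<close>
  applies.\<close>

lemma Psi_elliptic: "\<exists>c>0. \<forall>\<xi>. (\<forall>i. \<bar>\<xi> $ i\<bar> \<le> pi + 1) \<longrightarrow> c * (norm \<xi>)\<^sup>2 \<le> Psi \<xi>"
proof -
  obtain c where c: "0 < c" "\<And>t. \<bar>t\<bar> \<le> pi + 1 \<Longrightarrow> c * t\<^sup>2 \<le> 1 - cos t" using one_minus_cos_ge by blast
  have "\<forall>i. \<exists>C\<ge>0. \<forall>\<xi>. 1 - cos (\<xi> $ i) \<le> C * Psi \<xi>"
  proof
    fix i :: 'd
    have "real_vec (axis i 1) \<bullet> \<xi> = \<xi> $ i" for \<xi> :: "real ^ 'd"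
    proof -
      have "real_vec (axis i 1) = axis i 1" by (simp add: vec_eq_iff axis_def)
      then show ?thesis by (simp add: inner_axis')
    qed
    then show "\<exists>C\<ge>0. \<forall>\<xi>. 1 - cos (\<xi> $ i) \<le> C * Psi \<xi>" using one_minus_cos_le_Psi[of "axis i 1"] by simp
  qed
  then obtain C where C: "\<And>i. 0 \<le> C i" "\<And>i \<xi>. 1 - cos (\<xi> $ i) \<le> C i * Psi \<xi>" by metis
  define K where "K = 1 + (\<Sum>i\<in>UNIV. C i)"
  have K: "0 < K" using sum_nonneg[of UNIV C] C(1) by (simp add: K_def)
  have "c / K * (norm \<xi>)\<^sup>2 \<le> Psi \<xi>" if \<xi>: "\<forall>i. \<bar>\<xi> $ i\<bar> \<le> pi + 1" for \<xi>
  proof -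
    have "(norm \<xi>)\<^sup>2 = (\<Sum>i\<in>UNIV. (\<xi> $ i)\<^sup>2)"
      unfolding power2_norm_eq_inner inner_vec_def by (simp add: power2_eq_square)
    then have "c * (norm \<xi>)\<^sup>2 = (\<Sum>i\<in>UNIV. c * (\<xi> $ i)\<^sup>2)" by (simp add: sum_distrib_left)
    also have "\<dots> \<le> (\<Sum>i\<in>UNIV. C i * Psi \<xi>)"
      using c(2) C(2) \<xi> by (intro sum_mono) (meson order_trans)
    also have "\<dots> \<le> K * Psi \<xi>"
      using Psi_nonneg[of \<xi>] by (simp add: K_def distrib_right flip: sum_distrib_right)
    finally show ?thesis using K by (simp add: field_simps)
  qed
  then show ?thesis using c(1) K by (intro exI[of _ "c / K"]) auto
qed

lemma covariance_entry_has_sum: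
  "((\<lambda>x. \<mu> x * real_vec x $ i * real_vec x $ j) has_sum covariance \<mu> $ i $ j) UNIV"
proof -
  have "(\<lambda>x. \<mu> x * real_vec x $ i * real_vec x $ j) summable_on UNIV"
  proof (rule abs_summable_summable, rule Infinite_Sum.abs_summable_on_comparison_test'[OF mu_second_moment])
    fix x :: "int ^ 'd"
    have "\<bar>real_vec x $ i\<bar> * \<bar>real_vec x $ j\<bar> \<le> (norm (real_vec x))\<^sup>2"
      unfolding power2_eq_square by (intro mult_mono component_le_norm_cart) auto
    then have "\<mu> x * (\<bar>real_vec x $ i\<bar> * \<bar>real_vec x $ j\<bar>) \<le> \<mu> x * (norm (real_vec x))\<^sup>2"
      by (rule mult_left_mono[OF _ mu_nonneg])
    then show "norm (\<mu> x * real_vec x $ i * real_vec x $ j) \<le> \<mu> x * (norm (real_vec x))\<^sup>2"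
      using mu_nonneg[of x] by (simp add: abs_mult mult.assoc del: real_vec_component)
  qed
  then show ?thesis by (simp add: covariance_def)
qed

lemma covariance_bilinear_has_sum:
  "((\<lambda>x. \<mu> x * (real_vec x \<bullet> v) * (real_vec x \<bullet> w)) has_sum v \<bullet> (covariance \<mu> *v w)) UNIV"
proof -
  have "((\<lambda>x. \<Sum>i\<in>UNIV. \<Sum>j\<in>UNIV. (v $ i * w $ j) * (\<mu> x * real_vec x $ i * real_vec x $ j)) has_sum
      (\<Sum>i\<in>UNIV. \<Sum>j\<in>UNIV. (v $ i * w $ j) * covariance \<mu> $ i $ j)) UNIV"
    by (intro has_sum_finite_sum has_sum_cmult_right covariance_entry_has_sum)
  moreover have "(\<Sum>i\<in>UNIV. \<Sum>j\<in>UNIV. (v $ i * w $ j) * covariance \<mu> $ i $ j) = v \<bullet> (covariance \<mu> *v w)"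
    by (simp add: inner_vec_def matrix_vector_mult_def sum_distrib_left mult_ac)
  moreover have "(\<Sum>i\<in>UNIV. \<Sum>j\<in>UNIV. (v $ i * w $ j) * (\<mu> x * real_vec x $ i * real_vec x $ j)) =
      \<mu> x * (real_vec x \<bullet> v) * (real_vec x \<bullet> w)" for x
  proof -
    have "(real_vec x \<bullet> v) * (real_vec x \<bullet> w) = (\<Sum>i\<in>UNIV. \<Sum>j\<in>UNIV. (real_vec x $ i * v $ i) * (real_vec x $ j * w $ j))"
      by (simp add: inner_vec_def sum_product del: real_vec_component)
    then show ?thesis by (simp add: sum_distrib_left mult.assoc mult_ac del: real_vec_component)
  qed
  ultimately show ?thesis by simp
qed

text \<open>If the form vanished at \<open>v\<close>, the support would lie in the subgroup of all lattice points
  orthogonal to \<open>v\<close>.\<close>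

lemma covariance_positive:
  assumes v: "v \<noteq> 0"
  shows "0 < v \<bullet> (covariance \<mu> *v v)"
proof -
  let ?Q = "v \<bullet> (covariance \<mu> *v v)"
  note hs = covariance_bilinear_has_sum[of v v]
  have nn: "0 \<le> \<mu> x * (real_vec x \<bullet> v) * (real_vec x \<bullet> v)" for x
    unfolding mult.assoc by (intro mult_nonneg_nonneg mu_nonneg zero_le_square)
  have "0 \<le> ?Q" by (rule has_sum_nonneg[OF hs nn])
  moreover have "?Q \<noteq> 0"
  proof
    assume "?Q = 0"
    then have zero: "\<mu> x * (real_vec x \<bullet> v) * (real_vec x \<bullet> v) = 0" for x
      using nonneg_has_sum_le_0D[OF hs] nn by auto
    have "real_vec x \<bullet> v = 0" for x :: "int ^ 'd"
    proof (rule group_closure_induct_sum[of x "{x. \<mu> x \<noteq> 0}"])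
      show "x \<in> group_closure {x. \<mu> x \<noteq> 0}" by (simp add: mu_generates)
    qed (use zero in \<open>auto simp: inner_diff_left\<close>)
    then have "v $ i = 0" for i
    proof -
      have "real_vec (axis i 1) = axis i 1" by (simp add: vec_eq_iff axis_def)
      then show ?thesis using \<open>\<And>x. real_vec x \<bullet> v = 0\<close>[of "axis i 1"] by (simp add: inner_axis')
    qed
    then show False using v by (simp add: vec_eq_iff)
  qed
  ultimately show ?thesis by simp
qed

lemma covariance_symmetric: "transpose (covariance \<mu>) = covariance \<mu>"
  by (simp add: transpose_def covariance_def vec_eq_iff mult_ac)

sublocale pos_def_form "covariance \<mu>"
  by unfold_locales (rule covariance_symmetric covariance_positive)+

end

section \<open>Fourier coefficients on the torus\<close>

lemma AE_torus_cube: "AE \<xi> :: real ^ 'd in lborel. \<xi> \<in> torus \<longleftrightarrow> \<xi> \<in> fourier_cube"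
proof -
  let ?a = "(\<chi> i. - pi) :: real ^ 'd" and ?b = "(\<chi> i. pi) :: real ^ 'd"
  have le: "?a \<bullet> b \<le> ?b \<bullet> b" if "b \<in> Basis" for b
    using that by (auto simp: Basis_vec_def inner_axis)
  have "emeasure lborel (cbox ?a ?b - box ?a ?b) = emeasure lborel (cbox ?a ?b) - emeasure lborel (box ?a ?b)"
    by (rule emeasure_Diff) (auto simp: box_subset_cbox emeasure_lborel_box_finite emeasure_lborel_box_eq)
  also have "\<dots> = 0" using le by (simp add: emeasure_lborel_box_eq emeasure_lborel_cbox_eq)
  finally have "cbox ?a ?b - box ?a ?b \<in> null_sets lborel" by (auto simp: null_sets_def)
  from AE_not_in[OF this] show ?thesis
  proof eventually_elim
    case (elim \<xi>)
    have "\<xi> \<in> torus" if "\<xi> \<in> box ?a ?b" using that by (auto simp: mem_box_cart torus_def intro: less_imp_le)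
    moreover have "\<xi> \<in> cbox ?a ?b" if "\<xi> \<in> torus" using that by (auto simp: mem_box_cart torus_def intro: less_imp_le)
    ultimately show ?case using elim box_subset_cbox[of ?a ?b] by (auto simp: fourier_cube_def)
  qed
qed

text \<open>The argument only determines the dimension.\<close>

definition torus_volume :: "'d::finite itself \<Rightarrow> real" where
  "torus_volume _ = (2 * pi) ^ CARD('d)"

lemma torus_volume_pos: "0 < torus_volume TYPE('d::finite)"
  by (simp add: torus_volume_def)

lemma emeasure_torus: "emeasure lborel (torus :: (real ^ 'd) set) = ennreal (torus_volume TYPE('d))"
proof -
  let ?a = "(\<chi> i. - pi) :: real ^ 'd" and ?b = "(\<chi> i. pi) :: real ^ 'd"
  have le: "?a \<bullet> b \<le> ?b \<bullet> b" if "b \<in> Basis" for b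
    using that by (auto simp: Basis_vec_def inner_axis)
  have "emeasure lborel (torus :: (real ^ 'd) set) = emeasure lborel (cbox ?a ?b)"
    by (rule emeasure_eq_AE) (use AE_torus_cube[where 'd='d] in \<open>auto simp: fourier_cube_def\<close>)
  also have "\<dots> = ennreal (\<Prod>b\<in>Basis. (?b - ?a) \<bullet> b)" using le by simp
  also have "(\<Prod>b\<in>Basis. (?b - ?a) \<bullet> b) = (\<Prod>b\<in>(Basis :: (real ^ 'd) set). 2 * pi)"
    by (rule prod.cong) (auto simp: Basis_vec_def inner_axis)
  finally show ?thesis by (simp add: torus_volume_def)
qed

lemma torus_bounded_integrable:
  fixes f :: "real ^ 'd \<Rightarrow> real"
  assumes [measurable]: "f \<in> borel_measurable borel" and b: "\<And>\<xi>. \<bar>f \<xi>\<bar> \<le> B"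
  shows "set_integrable lborel torus f"
  unfolding set_integrable_def
proof (rule Bochner_Integration.integrable_bound)
  show "integrable lborel (\<lambda>\<xi> :: real ^ 'd. B * indicator torus \<xi> :: real)"
    by (intro integrable_mult_right integrable_real_indicator) (auto simp: emeasure_torus)
  show "AE \<xi> in lborel. norm (indicator torus \<xi> *\<^sub>R f \<xi>) \<le> norm (B * indicator torus \<xi> :: real)"
    using b order_trans[OF b abs_ge_self] by (intro always_eventually) (auto split: split_indicator)
qed measurable

lemma kernel_measurable [measurable]:
  "(\<lambda>\<xi> :: real ^ 'd. cos (v \<bullet> \<xi>)) \<in> borel_measurable borel"
  "(\<lambda>\<xi> :: real ^ 'd. sin (v \<bullet> \<xi>)) \<in> borel_measurable borel"
  by measurable

lemma kernel_antiperiodic: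
  fixes x :: "int ^ 'd"
  assumes "x $ j \<noteq> 0"
  shows "cos (real_vec x \<bullet> (\<xi> + (pi / \<bar>real_of_int (x $ j)\<bar>) *\<^sub>R axis j 1)) = - cos (real_vec x \<bullet> \<xi>)"
    and "sin (real_vec x \<bullet> (\<xi> + (pi / \<bar>real_of_int (x $ j)\<bar>) *\<^sub>R axis j 1)) = - sin (real_vec x \<bullet> \<xi>)"
proof -
  have e: "real_vec x \<bullet> (\<xi> + (pi / \<bar>real_of_int (x $ j)\<bar>) *\<^sub>R axis j 1) = real_vec x \<bullet> \<xi> + sgn (real_of_int (x $ j)) * pi"
    using assms by (simp add: inner_add_right inner_axis sgn_if)
  show "cos (real_vec x \<bullet> (\<xi> + (pi / \<bar>real_of_int (x $ j)\<bar>) *\<^sub>R axis j 1)) = - cos (real_vec x \<bullet> \<xi>)"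
    and "sin (real_vec x \<bullet> (\<xi> + (pi / \<bar>real_of_int (x $ j)\<bar>) *\<^sub>R axis j 1)) = - sin (real_vec x \<bullet> \<xi>)"
    unfolding e using assms by (auto simp: sgn_if cos_add sin_add)
qed

text \<open>For \<open>x \<noteq> 0\<close> the integrand changes sign under the translation by \<open>\<pi> / |x\<^sub>j|\<close> in a direction
  with \<open>x\<^sub>j \<noteq> 0\<close>.\<close>

lemma torus_cos:
  fixes x :: "int ^ 'd"
  shows "(LINT \<xi>:torus|lborel. cos (real_vec x \<bullet> \<xi>)) = (if x = 0 then torus_volume TYPE('d) else 0)"
proof (cases "x = 0")
  case True
  have "measure lborel (torus :: (real ^ 'd) set) = torus_volume TYPE('d)"
    using torus_volume_pos[where 'd='d] by (simp add: measure_def emeasure_torus)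
  then show ?thesis using True by (simp add: set_lebesgue_integral_def)
next
  case False
  then obtain j where j: "x $ j \<noteq> 0" by (auto simp: vec_eq_iff)
  let ?h = "pi / \<bar>real_of_int (x $ j)\<bar>"
  have "1 \<le> \<bar>real_of_int (x $ j)\<bar>" using j by linarith
  then have "?h \<le> pi / 1" by (intro divide_left_mono) auto
  then have h: "0 \<le> ?h" "?h \<le> 2 * pi" by (auto intro: order_trans)
  have int: "set_integrable lborel torus (\<lambda>\<xi> :: real ^ 'd. cos (real_vec x \<bullet> \<xi>))"
    by (rule torus_bounded_integrable[where B=1]) auto
  have "(LINT \<xi>:torus|lborel. cos (real_vec x \<bullet> \<xi>)) = (LINT \<xi>:torus|lborel. cos (real_vec x \<bullet> (\<xi> + ?h *\<^sub>R axis j 1)))"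
    by (rule torus_translate(2)[OF _ int h, symmetric]) (rule kernel_periodic)
  also have "\<dots> = - (LINT \<xi>:torus|lborel. cos (real_vec x \<bullet> \<xi>))"
    unfolding kernel_antiperiodic[OF j] by (simp add: set_lebesgue_integral_def)
  finally show ?thesis using False by simp
qed

lemma torus_cos_cos:
  fixes x y :: "int ^ 'd"
  shows "(LINT \<xi>:torus|lborel. cos (real_vec x \<bullet> \<xi>) * cos (real_vec y \<bullet> \<xi>)) =
    torus_volume TYPE('d) / 2 * ((if x = y then 1 else 0) + (if x = - y then 1 else 0))"
proof -
  have e: "cos (real_vec x \<bullet> \<xi>) * cos (real_vec y \<bullet> \<xi>) =
      (1 / 2) * cos (real_vec (x - y) \<bullet> \<xi>) + (1 / 2) * cos (real_vec (x + y) \<bullet> \<xi>)" for \<xi>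
    by (simp add: inner_add_left inner_diff_left cos_add cos_diff field_simps)
  have i: "set_integrable lborel torus (\<lambda>\<xi> :: real ^ 'd. (1 / 2) * cos (real_vec z \<bullet> \<xi>))" for z :: "int ^ 'd"
  proof (rule torus_bounded_integrable[where B=1])
    show "\<bar>(1 / 2) * cos (real_vec z \<bullet> \<xi>)\<bar> \<le> 1" for \<xi>
      unfolding abs_mult using abs_cos_le_one[of "real_vec z \<bullet> \<xi>"] by linarith
  qed measurable
  have "(LINT \<xi>:torus|lborel. cos (real_vec x \<bullet> \<xi>) * cos (real_vec y \<bullet> \<xi>)) =
    (1 / 2) * (LINT \<xi>:torus|lborel. cos (real_vec (x - y) \<bullet> \<xi>)) + (1 / 2) * (LINT \<xi>:torus|lborel. cos (real_vec (x + y) \<bullet> \<xi>))"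
    unfolding e set_integral_add(2)[OF i i] by simp
  then show ?thesis unfolding torus_cos by (auto simp: eq_neg_iff_add_eq_0 field_simps)
qed

text \<open>Bessel's inequality for the system of cosines. The functions for \<open>x\<close> and \<open>- x\<close> coincide, and
  the sum may contain both; this is compensated by their squared norm, which is only half of the
  volume of the torus for \<open>x \<noteq> 0\<close>.\<close>

lemma torus_bessel:
  fixes f :: "real ^ 'd \<Rightarrow> real"
  assumes f [measurable]: "f \<in> borel_measurable borel" and b: "\<And>\<xi>. \<bar>f \<xi>\<bar> \<le> B" and A: "finite A"
  defines "c \<equiv> \<lambda>x :: int ^ 'd. LINT \<xi>:torus|lborel. cos (real_vec x \<bullet> \<xi>) * f \<xi>"
  shows "(\<Sum>x\<in>A. (c x)\<^sup>2) \<le> torus_volume TYPE('d) * (LINT \<xi>:torus|lborel. (f \<xi>)\<^sup>2)"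
proof -
  let ?V = "torus_volume TYPE('d)"
  have V: "0 < ?V" by (rule torus_volume_pos)
  define S where "S \<xi> = (\<Sum>x\<in>A. c x * cos (real_vec x \<bullet> \<xi>))" for \<xi>
  have Sm [measurable]: "S \<in> borel_measurable borel" unfolding S_def by measurable
  have Sb: "\<bar>S \<xi>\<bar> \<le> (\<Sum>x\<in>A. \<bar>c x\<bar>)" for \<xi>
    unfolding S_def by (rule order_trans[OF sum_abs]) (auto intro!: sum_mono simp: abs_mult mult_left_le)
  have int: "set_integrable lborel torus (\<lambda>\<xi>. g \<xi> * k \<xi>)"
    if "g \<in> borel_measurable borel" "k \<in> borel_measurable borel" "\<And>\<xi>. \<bar>g \<xi>\<bar> \<le> X" "\<And>\<xi>. \<bar>k \<xi>\<bar> \<le> Y" for g k :: "real ^ 'd \<Rightarrow> real" and X Y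
  proof (rule torus_bounded_integrable[where B="X * Y"])
    show "\<bar>g \<xi> * k \<xi>\<bar> \<le> X * Y" for \<xi>
      unfolding abs_mult using that(3)[of \<xi>] that(4)[of \<xi>] by (intro mult_mono) auto
  qed (use that in measurable)
  have cosb: "\<bar>cos (real_vec x \<bullet> \<xi>)\<bar> \<le> 1" for x :: "int ^ 'd" and \<xi> by simp
  have iff: "set_integrable lborel torus (\<lambda>\<xi>. f \<xi> * f \<xi>)" by (rule int[OF f f b b])
  have iSf: "set_integrable lborel torus (\<lambda>\<xi>. S \<xi> * f \<xi>)" by (rule int[OF Sm f Sb b])
  have iSS: "set_integrable lborel torus (\<lambda>\<xi>. S \<xi> * S \<xi>)" by (rule int[OF Sm Sm Sb Sb])
  have lin: "(LINT \<xi>:torus|lborel. S \<xi> * g \<xi>) = (\<Sum>x\<in>A. c x * (LINT \<xi>:torus|lborel. cos (real_vec x \<bullet> \<xi>) * g \<xi>))"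
    if g: "g \<in> borel_measurable borel" "\<And>\<xi>. \<bar>g \<xi>\<bar> \<le> X" for g X
  proof -
    have i: "set_integrable lborel torus (\<lambda>\<xi>. cos (real_vec x \<bullet> \<xi>) * g \<xi>)" for x :: "int ^ 'd"
      by (rule int[OF kernel_measurable(1) g(1) cosb g(2)])
    have "(LINT \<xi>:torus|lborel. S \<xi> * g \<xi>) = (LINT \<xi>|lborel. (\<Sum>x\<in>A. c x * (indicator torus \<xi> *\<^sub>R (cos (real_vec x \<bullet> \<xi>) * g \<xi>))))"
      unfolding set_lebesgue_integral_def S_def by (simp add: sum_distrib_left sum_distrib_right mult_ac)
    also have "\<dots> = (\<Sum>x\<in>A. (LINT \<xi>|lborel. c x * (indicator torus \<xi> *\<^sub>R (cos (real_vec x \<bullet> \<xi>) * g \<xi>))))"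
      using i by (intro Bochner_Integration.integral_sum integrable_mult_right) (simp add: set_integrable_def)
    finally show ?thesis by (simp add: set_lebesgue_integral_def)
  qed
  have c_even: "c (- x) = c x" for x by (simp add: c_def)
  have Sf: "(LINT \<xi>:torus|lborel. S \<xi> * f \<xi>) = (\<Sum>x\<in>A. (c x)\<^sup>2)"
    unfolding lin[OF f b] by (simp add: c_def power2_eq_square)
  have SS: "(LINT \<xi>:torus|lborel. S \<xi> * S \<xi>) \<le> ?V * (\<Sum>x\<in>A. (c x)\<^sup>2)"
  proof -
    have val: "c x * (LINT \<xi>:torus|lborel. cos (real_vec x \<bullet> \<xi>) * S \<xi>) \<le> ?V * (c x)\<^sup>2" for x
    proof -
      have "(LINT \<xi>:torus|lborel. cos (real_vec x \<bullet> \<xi>) * S \<xi>) = (LINT \<xi>:torus|lborel. S \<xi> * cos (real_vec x \<bullet> \<xi>))"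
        by (simp add: mult.commute)
      also have "\<dots> = (\<Sum>y\<in>A. c y * (?V / 2 * ((if y = x then 1 else 0) + (if y = - x then 1 else 0))))"
        unfolding lin[OF kernel_measurable(1) cosb] torus_cos_cos ..
      also have "\<dots> = ?V / 2 * ((\<Sum>y\<in>A. if y = x then c y else 0) + (\<Sum>y\<in>A. if y = - x then c y else 0))"
      proof -
        have gen: "a * (v / 2 * ((if P then 1 else 0) + (if Q then 1 else 0))) =
            v / 2 * ((if P then a else 0) + (if Q then a else 0))" for a v :: real and P Q by simp
        show ?thesis unfolding sum.distrib[symmetric] sum_distrib_left by (rule sum.cong[OF refl]) (rule gen)
      qed
      also have "\<dots> = ?V / 2 * ((if x \<in> A then c x else 0) + (if - x \<in> A then c x else 0))"
        using A by (simp only: sum.delta c_even)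
      finally have L: "(LINT \<xi>:torus|lborel. cos (real_vec x \<bullet> \<xi>) * S \<xi>) = ?V / 2 * ((if x \<in> A then c x else 0) + (if - x \<in> A then c x else 0))" .
      have "c x * (LINT \<xi>:torus|lborel. cos (real_vec x \<bullet> \<xi>) * S \<xi>) =
          ?V / 2 * ((if x \<in> A then (c x)\<^sup>2 else 0) + (if - x \<in> A then (c x)\<^sup>2 else 0))"
        unfolding L by (cases "x \<in> A"; cases "- x \<in> A") (simp_all add: power2_eq_square)
      also have "\<dots> \<le> ?V / 2 * ((c x)\<^sup>2 + (c x)\<^sup>2)"
        using V by (intro mult_left_mono add_mono) auto
      finally show ?thesis by simp
    qed
    show ?thesis unfolding lin[OF Sm Sb] sum_distrib_left by (intro sum_mono val)
  qed
  have "0 \<le> (LINT \<xi>:torus|lborel. (?V * f \<xi> - S \<xi>)\<^sup>2)"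
    unfolding set_lebesgue_integral_def by (rule integral_nonneg_AE) simp
  also have "(LINT \<xi>:torus|lborel. (?V * f \<xi> - S \<xi>)\<^sup>2) =
     (LINT \<xi>:torus|lborel. ?V\<^sup>2 * (f \<xi> * f \<xi>) + ((- 2 * ?V) * (S \<xi> * f \<xi>) + S \<xi> * S \<xi>))"
    by (simp add: power2_eq_square algebra_simps)
  also have "\<dots> = ?V\<^sup>2 * (LINT \<xi>:torus|lborel. f \<xi> * f \<xi>) + ((- 2 * ?V) * (LINT \<xi>:torus|lborel. S \<xi> * f \<xi>) + (LINT \<xi>:torus|lborel. S \<xi> * S \<xi>))"
    by (simp only: set_integral_add(2) set_integral_mult_right set_integrable_mult_right iff iSf iSS set_integral_add(1))
  also have "\<dots> \<le> ?V\<^sup>2 * (LINT \<xi>:torus|lborel. f \<xi> * f \<xi>) + ((- 2 * ?V) * (\<Sum>x\<in>A. (c x)\<^sup>2) + ?V * (\<Sum>x\<in>A. (c x)\<^sup>2))"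
    unfolding Sf by (intro add_left_mono SS)
  also have "\<dots> = ?V * (?V * (LINT \<xi>:torus|lborel. f \<xi> * f \<xi>) - (\<Sum>x\<in>A. (c x)\<^sup>2))"
    by (simp add: power2_eq_square algebra_simps)
  finally have "0 \<le> ?V * (LINT \<xi>:torus|lborel. f \<xi> * f \<xi>) - (\<Sum>x\<in>A. (c x)\<^sup>2)"
    using V by (simp add: zero_le_mult_iff)
  then show ?thesis by (simp add: power2_eq_square)
qed

text \<open>Truncating \<open>f\<close> at a high level changes all coefficients by less than \<open>\<epsilon> / 2\<close>, and by Bessel's
  inequality only finitely many coefficients of the truncated function are at least \<open>\<epsilon> / 2\<close>.\<close>

lemma torus_riemann_lebesgue:
  fixes f :: "real ^ 'd \<Rightarrow> real"
  assumes fm [measurable]: "f \<in> borel_measurable borel" and nn: "\<And>\<xi>. 0 \<le> f \<xi>"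
    and int: "set_integrable lborel torus f" and \<epsilon>: "0 < \<epsilon>"
  shows "finite {x :: int ^ 'd. \<epsilon> \<le> \<bar>LINT \<xi>:torus|lborel. cos (real_vec x \<bullet> \<xi>) * f \<xi>\<bar>}"
proof -
  define g where "g N \<xi> = min (f \<xi>) (real N)" for N \<xi>
  have gm [measurable]: "g N \<in> borel_measurable borel" for N unfolding g_def by measurable
  have gb: "\<bar>g N \<xi>\<bar> \<le> real N" for N \<xi> using nn[of \<xi>] by (simp add: g_def)
  have "(\<lambda>N. LINT \<xi>|lborel. indicator torus \<xi> * (f \<xi> - g N \<xi>)) \<longlonglongrightarrow> (LINT \<xi> :: real ^ 'd|lborel. 0)"
  proof (rule integral_dominated_convergence[where w="\<lambda>\<xi>. indicator torus \<xi> * f \<xi>"])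
    show "AE \<xi> in lborel. (\<lambda>N. indicator torus \<xi> * (f \<xi> - g N \<xi>)) \<longlonglongrightarrow> 0"
    proof (intro always_eventually allI)
      fix \<xi> :: "real ^ 'd"
      obtain N0 :: nat where "f \<xi> \<le> real N0" using real_arch_simple by blast
      then have "g N \<xi> = f \<xi>" if "N0 \<le> N" for N using that by (simp add: g_def min_def)
      then have "\<forall>\<^sub>F N in sequentially. indicator torus \<xi> * (f \<xi> - g N \<xi>) = 0"
        unfolding eventually_sequentially by (intro exI[of _ N0]) auto
      then show "(\<lambda>N. indicator torus \<xi> * (f \<xi> - g N \<xi>)) \<longlonglongrightarrow> 0" by (rule tendsto_eventually)
    qed
    show "AE \<xi> in lborel. norm (indicator torus \<xi> * (f \<xi> - g N \<xi>)) \<le> indicator torus \<xi> * f \<xi>" for N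
      using nn by (intro always_eventually) (auto simp: g_def split: split_indicator)
  qed (use int in \<open>auto simp: set_integrable_def\<close>)
  then have "\<forall>\<^sub>F N in sequentially. (LINT \<xi>|lborel. indicator torus \<xi> * (f \<xi> - g N \<xi>)) < \<epsilon> / 2"
    using \<epsilon> by (intro order_tendstoD) auto
  then obtain N where N: "(LINT \<xi>|lborel. indicator torus \<xi> * (f \<xi> - g N \<xi>)) < \<epsilon> / 2"
    by (auto simp: eventually_sequentially)
  let ?c = "\<lambda>x :: int ^ 'd. LINT \<xi>:torus|lborel. cos (real_vec x \<bullet> \<xi>) * g N \<xi>"
  let ?f = "\<lambda>x :: int ^ 'd. LINT \<xi>:torus|lborel. cos (real_vec x \<bullet> \<xi>) * f \<xi>"
  have ig: "set_integrable lborel torus (g N)" by (rule torus_bounded_integrable[OF gm gb])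
  have icos: "integrable lborel (\<lambda>\<xi>. cos (real_vec x \<bullet> \<xi>) * k \<xi>)" if "integrable lborel k" for x :: "int ^ 'd" and k :: "real ^ 'd \<Rightarrow> real"
    by (rule Bochner_Integration.integrable_bound[OF that]) (use that in \<open>auto simp: abs_mult mult_left_le_one_le\<close>)
  have close: "\<bar>?f x\<bar> < \<bar>?c x\<bar> + \<epsilon> / 2" for x
  proof -
    have i1: "integrable lborel (\<lambda>\<xi>. cos (real_vec x \<bullet> \<xi>) * (indicator torus \<xi> * f \<xi>))"
      and i2: "integrable lborel (\<lambda>\<xi>. cos (real_vec x \<bullet> \<xi>) * (indicator torus \<xi> * g N \<xi>))"
      using int ig by (auto simp: set_integrable_def intro!: icos)
    have "?f x - ?c x = (LINT \<xi>|lborel. cos (real_vec x \<bullet> \<xi>) * (indicator torus \<xi> * f \<xi>) - cos (real_vec x \<bullet> \<xi>) * (indicator torus \<xi> * g N \<xi>))"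
      unfolding set_lebesgue_integral_def Bochner_Integration.integral_diff[OF i1 i2] by (simp add: mult_ac)
    also have "\<bar>\<dots>\<bar> \<le> (LINT \<xi>|lborel. indicator torus \<xi> * (f \<xi> - g N \<xi>))"
    proof (rule order_trans[OF integral_abs_bound], rule integral_mono)
      show "integrable lborel (\<lambda>\<xi>. \<bar>cos (real_vec x \<bullet> \<xi>) * (indicator torus \<xi> * f \<xi>) - cos (real_vec x \<bullet> \<xi>) * (indicator torus \<xi> * g N \<xi>)\<bar>)"
        by (intro integrable_abs Bochner_Integration.integrable_diff i1 i2)
      show "integrable lborel (\<lambda>\<xi>. indicator torus \<xi> * (f \<xi> - g N \<xi>))"
        using int ig by (simp add: set_integrable_def right_diff_distrib)
      fix \<xi> :: "real ^ 'd"
      have "0 \<le> f \<xi> - g N \<xi>" by (simp add: g_def)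
      then have "\<bar>cos (real_vec x \<bullet> \<xi>)\<bar> * (indicator torus \<xi> * (f \<xi> - g N \<xi>)) \<le> 1 * (indicator torus \<xi> * (f \<xi> - g N \<xi>))"
        by (intro mult_right_mono) auto
      moreover have "\<bar>cos (real_vec x \<bullet> \<xi>) * (indicator torus \<xi> * f \<xi>) - cos (real_vec x \<bullet> \<xi>) * (indicator torus \<xi> * g N \<xi>)\<bar>
          = \<bar>cos (real_vec x \<bullet> \<xi>)\<bar> * (indicator torus \<xi> * (f \<xi> - g N \<xi>))"
        using \<open>0 \<le> f \<xi> - g N \<xi>\<close> by (simp add: abs_mult flip: right_diff_distrib)
      ultimately show "\<bar>cos (real_vec x \<bullet> \<xi>) * (indicator torus \<xi> * f \<xi>) - cos (real_vec x \<bullet> \<xi>) * (indicator torus \<xi> * g N \<xi>)\<bar>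
          \<le> indicator torus \<xi> * (f \<xi> - g N \<xi>)" by simp
    qed
    finally show ?thesis using N by linarith
  qed
  define K where "K = torus_volume TYPE('d) * (LINT \<xi>:torus|lborel. (g N \<xi>)\<^sup>2)"
  have "finite {x. \<epsilon> / 2 \<le> \<bar>?c x\<bar>}"
  proof (rule finite_if_finite_subsets_card_bdd[THEN conjunct1])
    show "card A \<le> nat \<lfloor>K / (\<epsilon> / 2)\<^sup>2\<rfloor>" if A: "A \<subseteq> {x. \<epsilon> / 2 \<le> \<bar>?c x\<bar>}" "finite A" for A
    proof -
      have "real (card A) * (\<epsilon> / 2)\<^sup>2 = (\<Sum>x\<in>A. (\<epsilon> / 2)\<^sup>2)" by simp
      also have "\<dots> \<le> (\<Sum>x\<in>A. (?c x)\<^sup>2)"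
      proof (rule sum_mono)
        fix x assume "x \<in> A"
        then have "\<epsilon> / 2 \<le> \<bar>?c x\<bar>" using A by blast
        then have "(\<epsilon> / 2)\<^sup>2 \<le> \<bar>?c x\<bar>\<^sup>2" using \<epsilon> by (intro power_mono) auto
        then show "(\<epsilon> / 2)\<^sup>2 \<le> (?c x)\<^sup>2" by simp
      qed
      also have "\<dots> \<le> K" unfolding K_def by (rule torus_bessel[OF gm gb A(2)])
      finally have "real (card A) \<le> K / (\<epsilon> / 2)\<^sup>2" using \<epsilon> by (simp add: field_simps)
      then show "card A \<le> nat \<lfloor>K / (\<epsilon> / 2)\<^sup>2\<rfloor>" by (simp add: le_nat_floor)
    qed
  qed
  moreover have "{x. \<epsilon> \<le> \<bar>?f x\<bar>} \<subseteq> {x. \<epsilon> / 2 \<le> \<bar>?c x\<bar>}"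
  proof
    fix x assume "x \<in> {x. \<epsilon> \<le> \<bar>?f x\<bar>}"
    then show "x \<in> {x. \<epsilon> / 2 \<le> \<bar>?c x\<bar>}" using close[of x] by simp
  qed
  ultimately show ?thesis by (rule finite_subset[rotated])
qed

section \<open>The Green function\<close>

lemma lborel_reflect:
  fixes f :: "'a::euclidean_space \<Rightarrow> real"
  assumes "f \<in> borel_measurable borel"
  shows "(LINT x|lborel. f (- x)) = (LINT x|lborel. f x)"
proof -
  have "lborel = density (distr lborel borel (\<lambda>x::'a. 0 + (-1) *\<^sub>R x)) (\<lambda>_. ennreal (\<bar>-1\<bar> ^ DIM('a)))"
    by (rule lborel_affine) simp
  then have "lborel = distr lborel borel (\<lambda>x::'a. - x)" by (simp add: density_1)
  then have "(LINT x|lborel. f x) = (LINT x|distr lborel borel (\<lambda>x::'a. - x). f x)" by simp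
  also have "\<dots> = (LINT x|lborel. f (- x))" using assms by (intro integral_distr) auto
  finally show ?thesis ..
qed

lemma infinite_lattice: "infinite (UNIV :: (int ^ 'd) set)"
proof -
  have "inj (\<lambda>n :: int. (\<chi> i. n) :: int ^ 'd)" by (rule injI) (simp add: vec_eq_iff)
  then show ?thesis using finite_UNIV_inj_surj infinite_UNIV_int
    by (metis finite_imageD finite_subset subset_UNIV)
qed

context lattice_weight
begin

lemma laplacian_reindex:
  "((\<lambda>y. weight_graph \<mu> x y * (f x - f y)) has_sum s) UNIV \<longleftrightarrow> ((\<lambda>z. \<mu> z * (f x - f (x - z))) has_sum s) UNIV"
  by (rule has_sum_reindex_bij_witness[where i="\<lambda>z. x - z" and j="\<lambda>y. x - y"])
    (auto simp: weight_graph_def)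

sublocale graph: weighted_graph "weight_graph \<mu>"
proof
  fix x y :: "int ^ 'd"
  show "0 \<le> weight_graph \<mu> x y" by (simp add: weight_graph_def mu_nonneg)
  show "weight_graph \<mu> x y = weight_graph \<mu> y x"
    using mu_sym[of "x - y"] by (simp add: weight_graph_def)
  have "(\<lambda>y. \<mu> (x - y)) summable_on UNIV"
    using mu_summable by (subst summable_on_reindex_bij_witness[where i="\<lambda>z. x - z" and j="\<lambda>y. x - y" and T=UNIV and h=\<mu>]) auto
  then show "(\<lambda>y. weight_graph \<mu> x y) summable_on UNIV"
    by (rule summable_on_comparison_test) (auto simp: weight_graph_def mu_nonneg)
qed

text \<open>The displacements that connect every point with its translate form a subgroup containing the
  support of the weight.\<close>

lemma graph_connected: "(\<lambda>x y. 0 < weight_graph \<mu> x y)\<^sup>*\<^sup>* x y"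
proof -
  let ?R = "\<lambda>x y. 0 < weight_graph \<mu> x y"
  have sym: "?R\<^sup>*\<^sup>* y x" if "?R\<^sup>*\<^sup>* x y" for x y
    using that
  proof (induction rule: rtranclp_induct)
    case (step y z)
    then have "?R z y" using graph.b_sym[of y z] by simp
    then show ?case using step.IH by (rule converse_rtranclp_into_rtranclp)
  qed simp
  have "\<forall>x. ?R\<^sup>*\<^sup>* x (x + z)" for z :: "int ^ 'd"
  proof (rule group_closure_induct_sum[of z "{x. \<mu> x \<noteq> 0}"])
    show "z \<in> group_closure {x. \<mu> x \<noteq> 0}" by (simp add: mu_generates)
    fix s assume "s \<in> {x. \<mu> x \<noteq> 0}"
    then have s: "0 < \<mu> s" using mu_nonneg[of s] by simp
    show "\<forall>x. ?R\<^sup>*\<^sup>* x (x + s)"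
    proof
      fix x
      show "?R\<^sup>*\<^sup>* x (x + s)"
      proof (cases "s = 0")
        case False
        then have "?R x (x + s)" using s mu_sym[of s] by (simp add: weight_graph_def)
        then show ?thesis by (rule r_into_rtranclp)
      qed simp
    qed
  next
    fix s t :: "int ^ 'd"
    assume s: "\<forall>x. ?R\<^sup>*\<^sup>* x (x + s)" and t: "\<forall>x. ?R\<^sup>*\<^sup>* x (x + t)"
    show "\<forall>x. ?R\<^sup>*\<^sup>* x (x + (s - t))"
    proof
      fix x
      have "?R\<^sup>*\<^sup>* (x + s) (x + (s - t))" using sym[OF t[rule_format, of "x + (s - t)"]] by simp
      then show "?R\<^sup>*\<^sup>* x (x + (s - t))" using s[rule_format, of x] by (rule rtranclp_trans[rotated])
    qed
  qed simp
  from this[of "y - x"] show ?thesis by (metis add_diff_cancel_left' add.commute diff_add_cancel)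
qed

end

locale transient_weight = lattice_weight \<mu> for \<mu> :: "int ^ 'd::finite \<Rightarrow> real" +
  assumes card3: "3 \<le> CARD('d)"
begin

lemma Psi_pos_torus: "\<xi> \<in> torus \<Longrightarrow> \<xi> \<noteq> 0 \<Longrightarrow> 0 < Psi \<xi>"
proof -
  assume \<xi>: "\<xi> \<in> torus" "\<xi> \<noteq> 0"
  obtain c where c: "0 < c" "\<And>\<xi>. (\<forall>i. \<bar>\<xi> $ i\<bar> \<le> pi + 1) \<Longrightarrow> c * (norm \<xi>)\<^sup>2 \<le> Psi \<xi>"
    using Psi_elliptic by blast
  have "\<bar>\<xi> $ i\<bar> \<le> pi + 1" for i
    using \<xi>(1) unfolding torus_def by (simp add: abs_le_iff) (smt (verit))
  then have "c * (norm \<xi>)\<^sup>2 \<le> Psi \<xi>" by (intro c) auto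
  moreover have "0 < c * (norm \<xi>)\<^sup>2" using c(1) \<xi>(2) by simp
  ultimately show ?thesis by linarith
qed

text \<open>Near the origin \<open>1 / Psi\<close> is comparable to \<open>|\<xi>|\<^sup>-\<^sup>2\<close>, hence to \<open>exp (- q) / q\<close>, whose
  integrability is known.\<close>

lemma inverse_Psi_integrable: "set_integrable lborel torus (\<lambda>\<xi>. 1 / Psi \<xi>)"
proof -
  obtain c where c: "0 < c" "\<And>\<xi>. (\<forall>i. \<bar>\<xi> $ i\<bar> \<le> pi + 1) \<Longrightarrow> c * (norm \<xi>)\<^sup>2 \<le> Psi \<xi>"
    using Psi_elliptic by blast
  obtain C where C: "0 < C" "\<And>\<xi>. q \<xi> \<le> C * (norm \<xi>)\<^sup>2" using q_bounds(2) by blast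
  define R where "R = real CARD('d) * pi"
  define K where "K = C / c * exp (C * R\<^sup>2)"
  have "integrable lborel (\<lambda>\<xi>. K * regular_kernel \<xi>)"
    using regular_kernel_fourier(1)[OF card3] by simp
  then show ?thesis
    unfolding set_integrable_def
  proof (rule Bochner_Integration.integrable_bound)
    have "norm (indicator torus \<xi> *\<^sub>R (1 / Psi \<xi>)) \<le> norm (K * regular_kernel \<xi>)" if "\<xi> \<noteq> 0" for \<xi>
    proof (cases "\<xi> \<in> torus")
      case True
      have \<xi>i: "\<bar>\<xi> $ i\<bar> \<le> pi" for i
        using True unfolding torus_def by (simp add: abs_le_iff) (smt (verit))
      have "norm \<xi> \<le> (\<Sum>i\<in>UNIV. \<bar>\<xi> $ i\<bar>)" by (rule norm_le_l1_cart)
      also have "\<dots> \<le> R" unfolding R_def using sum_bounded_above[of UNIV "\<lambda>i. \<bar>\<xi> $ i\<bar>" pi] \<xi>i by simp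
      finally have nR: "(norm \<xi>)\<^sup>2 \<le> R\<^sup>2" by (intro power_mono) auto
      have q: "0 < q \<xi>" by (rule q_pos[OF that])
      have "q \<xi> \<le> C * R\<^sup>2" using order_trans[OF C(2) mult_left_mono[OF nR less_imp_le[OF C(1)]]] .
      then have e: "1 \<le> exp (C * R\<^sup>2) * exp (- q \<xi>)" by (simp flip: exp_add)
      have P: "c / C * q \<xi> \<le> Psi \<xi>"
      proof -
        have "c / C * q \<xi> \<le> c / C * (C * (norm \<xi>)\<^sup>2)" using c(1) C by (intro mult_left_mono) auto
        also have "\<dots> = c * (norm \<xi>)\<^sup>2" using C(1) by simp
        also have "\<dots> \<le> Psi \<xi>"
        proof (rule c(2), rule allI)
          show "\<bar>\<xi> $ i\<bar> \<le> pi + 1" for i using \<xi>i[of i] by linarith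
        qed
        finally show ?thesis .
      qed
      have cq: "0 < c / C * q \<xi>" using c(1) C(1) q by simp
      have "0 < Psi \<xi>" using P cq by linarith
      then have "1 / Psi \<xi> \<le> 1 / (c / C * q \<xi>)" using P cq by (intro divide_left_mono mult_pos_pos[of "Psi \<xi>"]) auto
      also have "\<dots> = C / c * 1 / q \<xi>" by simp
      also have "\<dots> \<le> C / c * (exp (C * R\<^sup>2) * exp (- q \<xi>)) / q \<xi>"
        using e c(1) C(1) q by (intro divide_right_mono mult_left_mono) auto
      also have "\<dots> = K * regular_kernel \<xi>" by (simp add: K_def regular_kernel_def)
      finally show ?thesis using True Psi_nonneg[of \<xi>] by simp
    qed simp
    then show "AE \<xi> in lborel. norm (indicator torus \<xi> *\<^sub>R (1 / Psi \<xi>)) \<le> norm (K * regular_kernel \<xi>)"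
      using AE_lborel_singleton[of "0 :: real ^ 'd"] by (auto elim!: eventually_mono)
  qed measurable
qed

lemma kernel_over_Psi_integrable:
  assumes "\<kappa> \<in> borel_measurable borel" "\<And>\<xi>. \<bar>\<kappa> \<xi>\<bar> \<le> B"
  shows "set_integrable lborel torus (\<lambda>\<xi>. \<kappa> \<xi> * (1 / Psi \<xi>))"
proof -
  have "integrable lborel (\<lambda>\<xi>. B * (indicator torus \<xi> * (1 / Psi \<xi>)))"
    using inverse_Psi_integrable unfolding set_integrable_def real_scaleR_def by (rule integrable_mult_right)
  then show ?thesis unfolding set_integrable_def
  proof (rule Bochner_Integration.integrable_bound)
    show "AE \<xi> in lborel. norm (indicator torus \<xi> *\<^sub>R (\<kappa> \<xi> * (1 / Psi \<xi>))) \<le> norm (B * (indicator torus \<xi> * (1 / Psi \<xi>)))"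
      using Psi_nonneg order_trans[OF assms(2) abs_ge_self]
      by (intro always_eventually) (auto simp: abs_mult intro!: divide_right_mono split: split_indicator)
  qed (use assms(1) in measurable)
qed

definition potential :: "int ^ 'd \<Rightarrow> real" where
  "potential x = (LINT \<xi>:torus|lborel. cos (real_vec x \<bullet> \<xi>) * (1 / Psi \<xi>))"

lemma green_facts:
  shows green_integrable: "set_integrable lborel fourier_cube (green_integrand \<mu> x)"
    and green_complex_eq: "green_complex \<mu> x = complex_of_real (M / torus_volume TYPE('d) * potential x)"
proof -
  let ?c = "\<lambda>\<xi>. cos (real_vec x \<bullet> \<xi>) * (1 / Psi \<xi>)" and ?s = "\<lambda>\<xi>. sin (real_vec x \<bullet> \<xi>) * (1 / Psi \<xi>)"
  have eq: "green_integrand \<mu> x \<xi> = complex_of_real M * (complex_of_real (?c \<xi>) - \<i> * complex_of_real (?s \<xi>))" for \<xi>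
  proof -
    have "exp (- (\<i> * complex_of_real t)) = complex_of_real (cos t) - \<i> * complex_of_real (sin t)" for t
      using exp_Euler[of "- complex_of_real t"] by (simp add: cos_of_real sin_of_real)
    note E = this[of "real_vec x \<bullet> \<xi>"]
    have "1 - complex_of_real (1 - Psi \<xi> / M) = complex_of_real (Psi \<xi>) / complex_of_real M" by simp
    then have "green_integrand \<mu> x \<xi> = complex_of_real M *
        ((complex_of_real (cos (real_vec x \<bullet> \<xi>)) - \<i> * complex_of_real (sin (real_vec x \<bullet> \<xi>))) / complex_of_real (Psi \<xi>))"
      unfolding green_integrand_def fourier_normalized E by simp
    then show ?thesis by (simp add: diff_divide_distrib)
  qed
  have ae: "AE \<xi> in lborel. indicator torus \<xi> = (indicator fourier_cube \<xi> :: real)"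
    by (rule eventually_mono[OF AE_torus_cube]) (auto split: split_indicator)
  have cube [measurable]: "fourier_cube \<in> sets (borel :: (real ^ 'd) measure)" by (simp add: fourier_cube_def)
  have int: "integrable lborel (\<lambda>\<xi>. indicator fourier_cube \<xi> * (\<kappa> \<xi> * (1 / Psi \<xi>)))"
    and val: "(LINT \<xi>|lborel. indicator fourier_cube \<xi> * (\<kappa> \<xi> * (1 / Psi \<xi>))) = (LINT \<xi>:torus|lborel. \<kappa> \<xi> * (1 / Psi \<xi>))"
    if [measurable]: "\<kappa> \<in> borel_measurable borel" and b: "\<And>\<xi>. \<bar>\<kappa> \<xi>\<bar> \<le> 1" for \<kappa>
  proof -
    have i: "integrable lborel (\<lambda>\<xi>. indicator torus \<xi> * (\<kappa> \<xi> * (1 / Psi \<xi>)))"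
      using kernel_over_Psi_integrable[OF that] by (simp add: set_integrable_def)
    show "integrable lborel (\<lambda>\<xi>. indicator fourier_cube \<xi> * (\<kappa> \<xi> * (1 / Psi \<xi>)))"
      by (rule integrable_cong_AE_imp[OF i]) (use ae in \<open>auto elim!: eventually_mono\<close>)
    show "(LINT \<xi>|lborel. indicator fourier_cube \<xi> * (\<kappa> \<xi> * (1 / Psi \<xi>))) = (LINT \<xi>:torus|lborel. \<kappa> \<xi> * (1 / Psi \<xi>))"
      unfolding set_lebesgue_integral_def real_scaleR_def
      by (rule integral_cong_AE) (use ae in \<open>auto elim!: eventually_mono\<close>)
  qed
  have ic: "integrable lborel (\<lambda>\<xi>. indicator fourier_cube \<xi> * ?c \<xi>)" by (rule int) auto
  have isn: "integrable lborel (\<lambda>\<xi>. indicator fourier_cube \<xi> * ?s \<xi>)" by (rule int) auto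
  have s0: "(LINT \<xi>|lborel. indicator fourier_cube \<xi> * ?s \<xi>) = 0"
  proof -
    have "(LINT \<xi>|lborel. indicator fourier_cube \<xi> * ?s \<xi>) = (LINT \<xi>|lborel. indicator fourier_cube (- \<xi>) * ?s (- \<xi>))"
      by (rule lborel_reflect[symmetric]) measurable
    also have "\<dots> = (LINT \<xi>|lborel. - (indicator fourier_cube \<xi> * ?s \<xi>))"
    proof (rule Bochner_Integration.integral_cong[OF refl])
      fix \<xi> :: "real ^ 'd"
      have "- \<xi> \<in> fourier_cube \<longleftrightarrow> \<xi> \<in> fourier_cube"
        by (auto simp: fourier_cube_def mem_box_cart) (metis minus_le_iff neg_le_iff_le)+
      then show "indicator fourier_cube (- \<xi>) * ?s (- \<xi>) = - (indicator fourier_cube \<xi> * ?s \<xi>)"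
        by (simp add: Psi_minus indicator_def)
    qed
    finally show ?thesis by simp
  qed
  have e2: "indicator fourier_cube \<xi> *\<^sub>R green_integrand \<mu> x \<xi> =
     complex_of_real M * (complex_of_real (indicator fourier_cube \<xi> * ?c \<xi>) - \<i> * complex_of_real (indicator fourier_cube \<xi> * ?s \<xi>))" for \<xi>
    unfolding eq by (auto split: split_indicator)
  have ioc: "integrable lborel (\<lambda>\<xi>. complex_of_real (indicator fourier_cube \<xi> * ?c \<xi>))"
    and ios: "integrable lborel (\<lambda>\<xi>. complex_of_real (indicator fourier_cube \<xi> * ?s \<xi>))"
    using ic isn by (auto simp only: integrable_of_real)
  show "set_integrable lborel fourier_cube (green_integrand \<mu> x)"
    unfolding set_integrable_def e2
    by (intro integrable_mult_right Bochner_Integration.integrable_diff ioc ios)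
  have "(LINT \<xi>:fourier_cube|lborel. green_integrand \<mu> x \<xi>) = complex_of_real M *
     (complex_of_real (LINT \<xi>|lborel. indicator fourier_cube \<xi> * ?c \<xi>) - \<i> * complex_of_real (LINT \<xi>|lborel. indicator fourier_cube \<xi> * ?s \<xi>))"
    unfolding set_lebesgue_integral_def e2
    by (simp only: integral_mult_right_zero Bochner_Integration.integral_diff[OF ioc integrable_mult_right[OF ios]] integral_complex_of_real)
  also have "(LINT \<xi>|lborel. indicator fourier_cube \<xi> * ?c \<xi>) = potential x"
    unfolding potential_def by (rule val) auto
  finally show "green_complex \<mu> x = complex_of_real (M / torus_volume TYPE('d) * potential x)"
    unfolding green_complex_def s0 by (simp add: torus_volume_def)
qed

lemma green_eq: "green \<mu> x = M / torus_volume TYPE('d) * potential x"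
  by (simp add: green_def green_complex_eq)

lemma has_sum_tail_bound:
  fixes f :: "int ^ 'd \<Rightarrow> real"
  assumes f: "(f has_sum s) UNIV" "\<And>z. \<bar>f z\<bar> \<le> 2 * \<mu> z" and F: "finite F"
  shows "\<bar>s - sum f F\<bar> \<le> 2 * (M - sum \<mu> F)"
proof -
  have "sum (\<lambda>z. 2 * \<mu> z + - f z) F \<le> 2 * M + - s"
    by (rule finite_sum_le_has_sum[OF has_sum_add[OF has_sum_cmult_right[OF M_has_sum] has_sum_uminusI[OF f(1)]]])
      (use f(2) F in \<open>auto simp: abs_le_iff\<close>)
  moreover have "sum (\<lambda>z. 2 * \<mu> z + f z) F \<le> 2 * M + s"
  proof (rule finite_sum_le_has_sum[OF has_sum_add[OF has_sum_cmult_right[OF M_has_sum] f(1)]])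
    show "0 \<le> 2 * \<mu> z + f z" for z using f(2)[of z] by (simp add: abs_le_iff)
  qed (use F in auto)
  ultimately have "2 * sum \<mu> F + - sum f F \<le> 2 * M + - s" "2 * sum \<mu> F + sum f F \<le> 2 * M + s"
    unfolding sum.distrib sum_negf sum_distrib_left[symmetric] by simp_all
  then show ?thesis by argo
qed

text \<open>On the Fourier side the Laplacian is multiplication by \<open>Psi\<close>, so it cancels the
  denominator. The sum is interchanged with the integral by estimating the remainder of a
  finite partial sum by a tail of the total mass.\<close>

lemma potential_laplacian:
  "((\<lambda>z. \<mu> z * (potential x - potential (x - z))) has_sum (if x = 0 then torus_volume TYPE('d) else 0)) UNIV"
proof -
  let ?c = "\<lambda>x \<xi>. cos (real_vec x \<bullet> \<xi>)"
  let ?d = "\<lambda>z \<xi>. \<mu> z * (?c x \<xi> - ?c (x - z) \<xi>)"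
  define P where "P = (LINT \<xi>:torus|lborel. 1 / Psi \<xi>)"
  have ip: "set_integrable lborel torus (\<lambda>\<xi>. ?c y \<xi> * (1 / Psi \<xi>))" for y :: "int ^ 'd"
    by (rule kernel_over_Psi_integrable[where B=1]) auto
  have pw: "((\<lambda>z. ?d z \<xi>) has_sum (?c x \<xi> * Psi \<xi>)) UNIV" for \<xi>
  proof -
    have "((\<lambda>z. ?c x \<xi> * (\<mu> z * (1 - ?c z \<xi>)) + - sin (real_vec x \<bullet> \<xi>) * (\<mu> z * sin (real_vec z \<bullet> \<xi>))) has_sum
       (?c x \<xi> * Psi \<xi> + - sin (real_vec x \<bullet> \<xi>) * 0)) UNIV"
      by (intro has_sum_add has_sum_cmult_right Psi_has_sum sin_has_sum)
    then show ?thesis by (simp add: inner_diff_left cos_diff algebra_simps)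
  qed
  have main: "\<bar>(if x = 0 then torus_volume TYPE('d) else 0) - (\<Sum>z\<in>F. \<mu> z * (potential x - potential (x - z)))\<bar> \<le> 2 * P * (M - sum \<mu> F)"
    if F: "finite F" for F
  proof -
    have i1: "set_integrable lborel torus (\<lambda>\<xi>. \<mu> z * (?c x \<xi> * (1 / Psi \<xi>) - ?c (x - z) \<xi> * (1 / Psi \<xi>)))" for z
      by (intro set_integrable_mult_right set_integral_diff(1) ip)
    have "(\<Sum>z\<in>F. \<mu> z * (potential x - potential (x - z))) =
       (\<Sum>z\<in>F. LINT \<xi>:torus|lborel. \<mu> z * (?c x \<xi> * (1 / Psi \<xi>) - ?c (x - z) \<xi> * (1 / Psi \<xi>)))"
      unfolding potential_def by (simp only: set_integral_mult_right set_integral_diff(2)[OF ip ip])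
    also have "\<dots> = (LINT \<xi>|lborel. (\<Sum>z\<in>F. indicator torus \<xi> *\<^sub>R (\<mu> z * (?c x \<xi> * (1 / Psi \<xi>) - ?c (x - z) \<xi> * (1 / Psi \<xi>)))))"
      unfolding set_lebesgue_integral_def
      by (rule Bochner_Integration.integral_sum[symmetric]) (use i1 in \<open>simp add: set_integrable_def\<close>)
    also have "\<dots> = (LINT \<xi>:torus|lborel. (\<Sum>z\<in>F. ?d z \<xi>) * (1 / Psi \<xi>))"
      unfolding set_lebesgue_integral_def
      by (rule Bochner_Integration.integral_cong[OF refl])
        (simp only: scaleR_sum_right[symmetric] sum_distrib_right left_diff_distrib[symmetric] mult.assoc)
    finally have e: "(\<Sum>z\<in>F. \<mu> z * (potential x - potential (x - z))) = (LINT \<xi>:torus|lborel. (\<Sum>z\<in>F. ?d z \<xi>) * (1 / Psi \<xi>))" .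
    have db: "\<bar>?d z \<xi>\<bar> \<le> 2 * \<mu> z" for z \<xi>
    proof -
      have "\<bar>?c x \<xi> - ?c (x - z) \<xi>\<bar> \<le> 2"
        using abs_cos_le_one[of "real_vec x \<bullet> \<xi>"] abs_cos_le_one[of "real_vec (x - z) \<bullet> \<xi>"] by linarith
      from mult_left_mono[OF this mu_nonneg[of z]] show ?thesis using mu_nonneg[of z] by (simp add: abs_mult mult.commute)
    qed
    have i2: "set_integrable lborel torus (\<lambda>\<xi>. (\<Sum>z\<in>F. ?d z \<xi>) * (1 / Psi \<xi>))"
    proof (rule kernel_over_Psi_integrable[where B="\<Sum>z\<in>F. 2 * \<mu> z"])
      show "\<bar>\<Sum>z\<in>F. ?d z \<xi>\<bar> \<le> (\<Sum>z\<in>F. 2 * \<mu> z)" for \<xi>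
        by (rule order_trans[OF sum_abs]) (intro sum_mono db)
    qed measurable
    have i3: "set_integrable lborel torus (\<lambda>\<xi>. ?c x \<xi>)" by (rule torus_bounded_integrable[where B=1]) auto
    have "(if x = 0 then torus_volume TYPE('d) else 0) - (\<Sum>z\<in>F. \<mu> z * (potential x - potential (x - z))) =
        (LINT \<xi>:torus|lborel. ?c x \<xi> - (\<Sum>z\<in>F. ?d z \<xi>) * (1 / Psi \<xi>))"
      unfolding e torus_cos[symmetric] by (rule set_integral_diff(2)[OF i3 i2, symmetric])
    also have "\<bar>\<dots>\<bar> \<le> (LINT \<xi>:torus|lborel. 2 * (M - sum \<mu> F) * (1 / Psi \<xi>))"
      unfolding set_lebesgue_integral_def
    proof (rule order_trans[OF integral_abs_bound], rule integral_mono_AE)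
      show "integrable lborel (\<lambda>\<xi>. \<bar>indicator torus \<xi> *\<^sub>R (?c x \<xi> - (\<Sum>z\<in>F. ?d z \<xi>) * (1 / Psi \<xi>))\<bar>)"
        using set_integral_diff(1)[OF i3 i2] by (simp add: set_integrable_def)
      show "integrable lborel (\<lambda>\<xi>. indicator torus \<xi> *\<^sub>R (2 * (M - sum \<mu> F) * (1 / Psi \<xi>)))"
        using set_integrable_mult_right[OF inverse_Psi_integrable, of "2 * (M - sum \<mu> F)"] by (simp add: set_integrable_def)
      show "AE \<xi> in lborel. \<bar>indicator torus \<xi> *\<^sub>R (?c x \<xi> - (\<Sum>z\<in>F. ?d z \<xi>) * (1 / Psi \<xi>))\<bar>
          \<le> indicator torus \<xi> *\<^sub>R (2 * (M - sum \<mu> F) * (1 / Psi \<xi>))"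
        using AE_lborel_singleton[of "0 :: real ^ 'd"]
      proof eventually_elim
        case (elim \<xi>)
        show ?case
        proof (cases "\<xi> \<in> torus")
          case True
          have P0: "0 < Psi \<xi>" by (rule Psi_pos_torus[OF True elim])
          have "\<bar>?c x \<xi> * Psi \<xi> - (\<Sum>z\<in>F. ?d z \<xi>)\<bar> \<le> 2 * (M - sum \<mu> F)"
            by (rule has_sum_tail_bound[OF pw db F])
          then have "\<bar>?c x \<xi> * Psi \<xi> - (\<Sum>z\<in>F. ?d z \<xi>)\<bar> / Psi \<xi> \<le> 2 * (M - sum \<mu> F) / Psi \<xi>"
            using P0 by (intro divide_right_mono) auto
          moreover have "?c x \<xi> - (\<Sum>z\<in>F. ?d z \<xi>) * (1 / Psi \<xi>) = (?c x \<xi> * Psi \<xi> - (\<Sum>z\<in>F. ?d z \<xi>)) / Psi \<xi>"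
            using P0 by (simp add: field_simps)
          ultimately show ?thesis using True P0 by (simp add: abs_divide)
        qed simp
      qed
    qed
    also have "\<dots> = 2 * P * (M - sum \<mu> F)" unfolding P_def set_integral_mult_right by simp
    finally show ?thesis .
  qed
  have "((\<lambda>F. (if x = 0 then torus_volume TYPE('d) else 0) - (\<Sum>z\<in>F. \<mu> z * (potential x - potential (x - z)))) \<longlongrightarrow> 0) (finite_subsets_at_top UNIV)"
  proof (rule Lim_null_comparison)
    show "\<forall>\<^sub>F F in finite_subsets_at_top UNIV. norm ((if x = 0 then torus_volume TYPE('d) else 0) - (\<Sum>z\<in>F. \<mu> z * (potential x - potential (x - z)))) \<le> 2 * P * (M - sum \<mu> F)"
      unfolding real_norm_def by (rule eventually_finite_subsets_at_top_weakI) (rule main)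
    have "((\<lambda>F. 2 * P * (M - sum \<mu> F)) \<longlongrightarrow> 2 * P * (M - M)) (finite_subsets_at_top UNIV)"
      using M_has_sum by (intro tendsto_intros) (simp add: has_sum_def)
    then show "((\<lambda>F. 2 * P * (M - sum \<mu> F)) \<longlongrightarrow> 0) (finite_subsets_at_top UNIV)" by simp
  qed
  from tendsto_diff[OF tendsto_const[of "if x = 0 then torus_volume TYPE('d) else 0"] this]
  show ?thesis by (simp add: has_sum_def)
qed

lemma green_laplacian_has_sum:
  "((\<lambda>y. weight_graph \<mu> x y * (green \<mu> x - green \<mu> y)) has_sum (if x = 0 then M else 0)) UNIV"
proof -
  have "((\<lambda>z. M / torus_volume TYPE('d) * (\<mu> z * (potential x - potential (x - z)))) has_sum M / torus_volume TYPE('d) * (if x = 0 then torus_volume TYPE('d) else 0)) UNIV"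
    by (intro has_sum_cmult_right potential_laplacian)
  moreover have "M / torus_volume TYPE('d) * (if x = 0 then torus_volume TYPE('d) else 0) = (if x = 0 then M else 0)"
    using torus_volume_pos[where 'd='d] by simp
  ultimately have "((\<lambda>z. \<mu> z * (green \<mu> x - green \<mu> (x - z))) has_sum (if x = 0 then M else 0)) UNIV"
    unfolding green_eq by (simp only: right_diff_distrib mult.left_commute)
  then show ?thesis by (subst laplacian_reindex[of x "green \<mu>"])
qed

lemma green_vanishes: "0 < \<epsilon> \<Longrightarrow> finite {x. \<epsilon> \<le> \<bar>green \<mu> x\<bar>}"
proof -
  assume "0 < \<epsilon>"
  then have "0 < \<epsilon> / (M / torus_volume TYPE('d))" using M_pos torus_volume_pos[where 'd='d] by simp
  then have "finite {x :: int ^ 'd. \<epsilon> / (M / torus_volume TYPE('d)) \<le> \<bar>potential x\<bar>}"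
    unfolding potential_def
    by (intro torus_riemann_lebesgue inverse_Psi_integrable) (auto simp: Psi_nonneg)
  moreover have "\<epsilon> / (M / torus_volume TYPE('d)) \<le> \<bar>potential x\<bar> \<longleftrightarrow> \<epsilon> \<le> \<bar>green \<mu> x\<bar>" for x
    using M_pos torus_volume_pos[where 'd='d] by (simp add: green_eq abs_mult field_simps)
  ultimately show ?thesis by simp
qed

lemma green_form_domain: "green \<mu> \<in> form_domain (weight_graph \<mu>)"
proof (rule graph.bounded_in_form_domain)
  show "\<bar>green \<mu> x\<bar> \<le> M / torus_volume TYPE('d) * (LINT \<xi>:torus|lborel. 1 / Psi \<xi>)" for x
  proof -
    have "\<bar>potential x\<bar> \<le> (LINT \<xi>:torus|lborel. 1 / Psi \<xi>)"
      unfolding potential_def set_lebesgue_integral_def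
    proof (rule order_trans[OF integral_abs_bound], rule integral_mono)
      show "integrable lborel (\<lambda>\<xi>. \<bar>indicator torus \<xi> *\<^sub>R (cos (real_vec x \<bullet> \<xi>) * (1 / Psi \<xi>))\<bar>)"
        by (rule integrable_abs)
          (use kernel_over_Psi_integrable[of "\<lambda>\<xi>. cos (real_vec x \<bullet> \<xi>)" 1] in \<open>simp add: set_integrable_def\<close>)
      show "integrable lborel (\<lambda>\<xi>. indicator torus \<xi> *\<^sub>R (1 / Psi \<xi>))"
        using inverse_Psi_integrable by (simp add: set_integrable_def)
      show "\<bar>indicator torus \<xi> *\<^sub>R (cos (real_vec x \<bullet> \<xi>) * (1 / Psi \<xi>))\<bar> \<le> indicator torus \<xi> *\<^sub>R (1 / Psi \<xi>)" for \<xi>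
        using Psi_nonneg[of \<xi>] by (auto simp: abs_mult intro!: divide_right_mono split: split_indicator)
    qed
    then show ?thesis
      using M_pos torus_volume_pos[where 'd='d] by (simp add: green_eq abs_mult mult_left_mono divide_right_mono)
  qed
qed

lemma laplacian_green: "laplacian (weight_graph \<mu>) (green \<mu>) x = (if x = 0 then M else 0)"
  unfolding laplacian_def by (rule infsumI[OF green_laplacian_has_sum])

lemma green_pos: "0 < green \<mu> x"
  by (rule graph.superharmonic_positive[OF green_form_domain green_vanishes _ _ graph_connected infinite_lattice, where o'=0])
    (use M_pos in \<open>auto simp: laplacian_green\<close>)

sublocale green_potential "weight_graph \<mu>" "green \<mu>" M 0
proof
  show "finite {x. \<epsilon> \<le> green \<mu> x}" if "0 < \<epsilon>" for \<epsilon>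
    by (rule finite_subset[OF _ green_vanishes[OF that]]) auto
qed (rule green_pos M_pos laplacian_green graph_connected)+

lemma green_hardy_eq: "green_hardy \<mu> = w"
  by (rule ext) (simp add: green_hardy_def w_def u_def[abs_def])

end

section \<open>Asymptotics of the Green function\<close>

text \<open>The derivative at a point of the region depends on the values near this point, so agreement on
  an open set is needed.\<close>

lemma symbol_cong_open:
  fixes e :: "'v::real_normed_vector"
  assumes f: "symbol e U k a f" and W: "open W" "U \<subseteq> W" and eq: "\<And>\<xi>. \<xi> \<in> W \<Longrightarrow> f \<xi> = g \<xi>"
  shows "symbol e U k a g"
proof (cases k)
  case 0
  from f[unfolded 0] obtain C where "\<forall>\<xi>\<in>U. \<bar>f \<xi>\<bar> \<le> C * norm \<xi> powr a" by auto
  then have "\<forall>\<xi>\<in>U. \<bar>g \<xi>\<bar> \<le> C * norm \<xi> powr a" using eq W(2) by (metis subsetD)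
  then show ?thesis unfolding 0 symbol.simps by blast
next
  case (Suc l)
  from f[unfolded Suc] obtain C f' where C: "\<forall>\<xi>\<in>U. \<bar>f \<xi>\<bar> \<le> C * norm \<xi> powr a"
    and d: "\<forall>\<xi>\<in>U. ((\<lambda>t. f (\<xi> + t *\<^sub>R e)) has_real_derivative f' \<xi>) (at 0)" and f': "symbol e U l (a - 1) f'"
    by auto
  show ?thesis unfolding Suc
  proof (rule symbol_SucI[OF _ _ f'])
    show "\<bar>g \<xi>\<bar> \<le> C * norm \<xi> powr a" if "\<xi> \<in> U" for \<xi> using C that eq W(2) by (metis subsetD)
    fix \<xi> assume \<xi>: "\<xi> \<in> U"
    have "open ((\<lambda>t. \<xi> + t *\<^sub>R e) -` W)" by (rule open_vimage[OF W(1)]) (intro continuous_intros)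
    moreover have "0 \<in> (\<lambda>t. \<xi> + t *\<^sub>R e) -` W" using \<xi> W(2) by auto
    ultimately have "\<forall>\<^sub>F t in nhds 0. f (\<xi> + t *\<^sub>R e) = g (\<xi> + t *\<^sub>R e)"
      unfolding eventually_nhds using eq by blast
    then show "((\<lambda>t. g (\<xi> + t *\<^sub>R e)) has_real_derivative f' \<xi>) (at 0)"
      using d \<xi> DERIV_cong_ev[of 0 0 "\<lambda>t. f (\<xi> + t *\<^sub>R e)" "\<lambda>t. g (\<xi> + t *\<^sub>R e)" "f' \<xi>"] by simp
  qed
qed

lemma cos_remainder_bounded: "2 \<le> k \<Longrightarrow> \<bar>cos_remainder k t\<bar> \<le> 2"
proof (cases "k = 2")
  case True
  then show ?thesis using cos_ge_minus_one[of t] cos_le_one[of t] by (simp add: numeral_2_eq_2)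
next
  case False
  assume "2 \<le> k"
  with False cos_remainder_le_1[of k t] show ?thesis by simp
qed

lemma cos_remainder_taylor:
  "\<bar>cos_remainder k (a + s) - cos_remainder k a - s * cos_remainder (Suc k) a\<bar> \<le> 2 * s\<^sup>2"
proof -
  define r' where "r' s = (cos_remainder (Suc k) (a + s) - cos_remainder (Suc k) a) / 2" for s
  define r where "r s = (cos_remainder k (a + s) - cos_remainder k a - s * cos_remainder (Suc k) a) / 2" for s
  have sh: "((\<lambda>s. cos_remainder k (a + s)) has_real_derivative cos_remainder (Suc k) (a + s)) (at s)" for k s
    using DERIV_shift[of "cos_remainder k" "cos_remainder (Suc k) (a + s)" s a] cos_remainder_deriv[of k "a + s"]
    by (simp add: add.commute)
  have d': "(r' has_real_derivative cos_remainder (Suc (Suc k)) (a + s) / 2) (at s)" for s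
    unfolding r'_def using sh[of "Suc k" s] by (auto intro!: derivative_eq_intros simp del: cos_remainder.simps)
  have b': "\<bar>r' s\<bar> \<le> \<bar>s\<bar> ^ Suc 0" for s
    by (rule abs_le_power_Suc_if_deriv[OF _ d']) (use cos_remainder_bounded[of "Suc (Suc k)"] in \<open>auto simp: r'_def simp del: cos_remainder.simps\<close>)
  have d: "(r has_real_derivative r' s) (at s)" for s
    unfolding r_def r'_def using sh[of k s] by (auto intro!: derivative_eq_intros simp del: cos_remainder.simps)
  have "\<bar>r s\<bar> \<le> \<bar>s\<bar> ^ Suc (Suc 0)"
    by (rule abs_le_power_Suc_if_deriv[OF _ d b']) (simp add: r_def del: cos_remainder.simps)
  then show ?thesis by (simp add: r_def abs_divide power2_eq_square del: cos_remainder.simps)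
qed

text \<open>Termwise differentiation; a quadratic Taylor bound that is summable suffices.\<close>

lemma has_real_derivative_has_sum:
  fixes f :: "'i \<Rightarrow> real \<Rightarrow> real"
  assumes F: "\<And>t. ((\<lambda>x. f x t) has_sum F t) A" and F': "(f' has_sum D) A" and c: "(c has_sum c0) A"
    and taylor: "\<And>x t. x \<in> A \<Longrightarrow> \<bar>f x t - f x 0 - t * f' x\<bar> \<le> c x * t\<^sup>2"
  shows "(F has_real_derivative D) (at 0)"
proof -
  have rem: "\<bar>F t - F 0 - t * D\<bar> \<le> c0 * t\<^sup>2" for t
  proof -
    have hs: "((\<lambda>x. f x t - f x 0 - t * f' x) has_sum (F t - F 0 - t * D)) A"
      using has_sum_add[OF has_sum_add[OF F[of t] has_sum_uminusI[OF F[of 0]]] has_sum_uminusI[OF has_sum_cmult_right[OF F', of t]]]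
      by simp
    have hc: "((\<lambda>x. c x * t\<^sup>2) has_sum c0 * t\<^sup>2) A" by (rule has_sum_cmult_left[OF c])
    have "F t - F 0 - t * D \<le> c0 * t\<^sup>2"
      by (rule has_sum_mono[OF hs hc]) (use taylor in \<open>auto simp: abs_le_iff\<close>)
    moreover have "- (F t - F 0 - t * D) \<le> c0 * t\<^sup>2"
      by (rule has_sum_mono[OF has_sum_uminusI[OF hs] hc]) (use taylor in \<open>auto simp: abs_le_iff\<close>)
    ultimately show ?thesis by (simp add: abs_le_iff)
  qed
  have "((\<lambda>h. (F (0 + h) - F 0) / h - D) \<longlongrightarrow> 0) (at 0)"
  proof (rule Lim_null_comparison)
    show "\<forall>\<^sub>F h in at 0. norm ((F (0 + h) - F 0) / h - D) \<le> c0 * \<bar>h\<bar>"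
      unfolding eventually_at_filter
    proof (intro always_eventually allI impI)
      fix h :: real assume h: "h \<noteq> 0"
      have "(F (0 + h) - F 0) / h - D = (F h - F 0 - h * D) / h" using h by (simp add: field_simps)
      then have "norm ((F (0 + h) - F 0) / h - D) = \<bar>F h - F 0 - h * D\<bar> / \<bar>h\<bar>" by simp
      also have "\<dots> \<le> c0 * h\<^sup>2 / \<bar>h\<bar>" by (intro divide_right_mono rem) simp
      also have "\<dots> = c0 * \<bar>h\<bar>" using h by (simp add: power2_eq_square field_simps abs_if)
      finally show "norm ((F (0 + h) - F 0) / h - D) \<le> c0 * \<bar>h\<bar>" .
    qed
    show "((\<lambda>h. c0 * \<bar>h\<bar>) \<longlongrightarrow> 0) (at 0)" by (auto intro!: tendsto_eq_intros)
  qed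
  then show ?thesis unfolding DERIV_def by (simp add: LIM_zero_iff)
qed

locale moment_weight = transient_weight \<mu> for \<mu> :: "int ^ 'd::finite \<Rightarrow> real" +
  assumes moment: "(\<lambda>x. \<mu> x * norm (real_vec x) ^ (CARD('d) + 3)) summable_on UNIV"
begin

lemma moment_le:
  assumes "0 < k" "k \<le> CARD('d) + 3"
  shows "(\<lambda>x. \<mu> x * norm (real_vec x) ^ k) summable_on UNIV"
proof (rule summable_on_comparison_test[OF moment])
  fix x :: "int ^ 'd"
  show "\<mu> x * norm (real_vec x) ^ k \<le> \<mu> x * norm (real_vec x) ^ (CARD('d) + 3)"
  proof (cases "x = 0")
    case False
    then show ?thesis
      using norm_real_vec_ge_1[OF False] assms(2) by (intro mult_left_mono power_increasing mu_nonneg)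
  qed (use assms in \<open>simp add: zero_power\<close>)
qed (auto intro!: mult_nonneg_nonneg mu_nonneg)

text \<open>The \<open>k\<close>-th derivative in direction \<open>j\<close> of \<open>q - Psi\<close>, which is the sum of the second order
  Taylor remainders of the cosine.\<close>

definition remainder :: "'d \<Rightarrow> nat \<Rightarrow> real ^ 'd \<Rightarrow> real" where
  "remainder j k \<xi> = (\<Sum>\<^sub>\<infinity>x. \<mu> x * (real_vec x $ j) ^ k * cos_remainder k (real_vec x \<bullet> \<xi>))"

lemma remainder_term_bound:
  "\<bar>\<mu> x * (real_vec x $ j) ^ k * cos_remainder k (real_vec x \<bullet> \<xi>)\<bar> \<le>
    (if k \<le> 4 then \<mu> x * norm (real_vec x) ^ 4 * norm \<xi> ^ (4 - k) else \<mu> x * norm (real_vec x) ^ k)"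
proof -
  let ?n = "norm (real_vec x)"
  have xj: "\<bar>real_vec x $ j\<bar> ^ k \<le> ?n ^ k" by (intro power_mono component_le_norm_cart) auto
  show ?thesis
  proof (cases "k \<le> 4")
    case True
    have "\<bar>cos_remainder k (real_vec x \<bullet> \<xi>)\<bar> \<le> (?n * norm \<xi>) ^ (4 - k)"
      by (rule order_trans[OF cos_remainder_bound[OF True]]) (intro power_mono Cauchy_Schwarz_ineq2, simp)
    then have "\<bar>real_vec x $ j\<bar> ^ k * \<bar>cos_remainder k (real_vec x \<bullet> \<xi>)\<bar> \<le> ?n ^ k * (?n * norm \<xi>) ^ (4 - k)"
      using xj by (intro mult_mono) auto
    also have "\<dots> = ?n ^ 4 * norm \<xi> ^ (4 - k)"
      using True by (simp add: power_mult_distrib mult.assoc[symmetric] flip: power_add)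
    finally have "\<mu> x * (\<bar>real_vec x $ j\<bar> ^ k * \<bar>cos_remainder k (real_vec x \<bullet> \<xi>)\<bar>) \<le> \<mu> x * (?n ^ 4 * norm \<xi> ^ (4 - k))"
      by (rule mult_left_mono[OF _ mu_nonneg])
    then show ?thesis using True mu_nonneg[of x] by (simp add: abs_mult power_abs mult.assoc del: real_vec_component)
  next
    case False
    then have "\<bar>cos_remainder k (real_vec x \<bullet> \<xi>)\<bar> \<le> 1" by (intro cos_remainder_le_1) simp
    then have "\<bar>real_vec x $ j\<bar> ^ k * \<bar>cos_remainder k (real_vec x \<bullet> \<xi>)\<bar> \<le> ?n ^ k * 1"
      using xj by (intro mult_mono) auto
    then have "\<mu> x * (\<bar>real_vec x $ j\<bar> ^ k * \<bar>cos_remainder k (real_vec x \<bullet> \<xi>)\<bar>) \<le> \<mu> x * (?n ^ k * 1)"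
      by (rule mult_left_mono[OF _ mu_nonneg])
    then show ?thesis using False mu_nonneg[of x] by (simp add: abs_mult power_abs mult.assoc del: real_vec_component)
  qed
qed

lemma remainder_bound_summable:
  assumes "k \<le> CARD('d) + 3"
  shows "(\<lambda>x. if k \<le> 4 then \<mu> x * norm (real_vec x) ^ 4 * norm \<xi> ^ (4 - k) else \<mu> x * norm (real_vec x) ^ k) summable_on UNIV"
proof (cases "k \<le> 4")
  case True
  then show ?thesis using summable_on_cmult_left[OF moment_le[of 4], of "norm \<xi> ^ (4 - k)"] card3 by simp
next
  case False
  then show ?thesis using moment_le[of k] assms by simp
qed

lemma remainder_has_sum:
  assumes "k \<le> CARD('d) + 3"
  shows "((\<lambda>x. \<mu> x * (real_vec x $ j) ^ k * cos_remainder k (real_vec x \<bullet> \<xi>)) has_sum remainder j k \<xi>) UNIV"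
proof -
  have "(\<lambda>x. \<mu> x * (real_vec x $ j) ^ k * cos_remainder k (real_vec x \<bullet> \<xi>)) summable_on UNIV"
    by (rule abs_summable_summable, rule Infinite_Sum.abs_summable_on_comparison_test'[OF remainder_bound_summable[OF assms, of \<xi>]])
      (simp only: real_norm_def remainder_term_bound)
  then show ?thesis by (simp only: remainder_def summable_iff_has_sum_infsum)
qed

lemma remainder_0: "remainder j 0 \<xi> = q \<xi> - Psi \<xi>"
proof -
  have "((\<lambda>x. (1 / 2) * (\<mu> x * (real_vec x \<bullet> \<xi>) * (real_vec x \<bullet> \<xi>)) + - (\<mu> x * (1 - cos (real_vec x \<bullet> \<xi>)))) has_sum
      (1 / 2) * (\<xi> \<bullet> (covariance \<mu> *v \<xi>)) + - Psi \<xi>) UNIV"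
    by (intro has_sum_add has_sum_cmult_right has_sum_uminusI covariance_bilinear_has_sum Psi_has_sum)
  moreover have "(1 / 2) * (\<mu> x * (real_vec x \<bullet> \<xi>) * (real_vec x \<bullet> \<xi>)) + - (\<mu> x * (1 - cos (real_vec x \<bullet> \<xi>)))
      = \<mu> x * (real_vec x $ j) ^ 0 * cos_remainder 0 (real_vec x \<bullet> \<xi>)" for x
    by (simp add: power2_eq_square algebra_simps)
  ultimately have "((\<lambda>x. \<mu> x * (real_vec x $ j) ^ 0 * cos_remainder 0 (real_vec x \<bullet> \<xi>)) has_sum q \<xi> - Psi \<xi>) UNIV"
    by (simp only: q_def) simp
  then show ?thesis using has_sum_unique[OF remainder_has_sum[of 0 j \<xi>]] by simp
qed

text \<open>Termwise differentiation costs one moment more than the derivative itself, because the Taylor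
  bound is quadratic; this limits the number of derivatives to \<open>d + 2\<close>.\<close>

lemma remainder_deriv:
  assumes k: "k \<le> CARD('d) + 1"
  shows "((\<lambda>t. remainder j k (\<xi> + t *\<^sub>R axis j 1)) has_real_derivative remainder j (Suc k) \<xi>) (at 0)"
proof (rule has_real_derivative_has_sum)
  let ?f = "\<lambda>x t. \<mu> x * (real_vec x $ j) ^ k * cos_remainder k (real_vec x \<bullet> (\<xi> + t *\<^sub>R axis j 1))"
  let ?f' = "\<lambda>x. \<mu> x * (real_vec x $ j) ^ Suc k * cos_remainder (Suc k) (real_vec x \<bullet> \<xi>)"
  show "((\<lambda>x. ?f x t) has_sum remainder j k (\<xi> + t *\<^sub>R axis j 1)) UNIV" for t
    by (rule remainder_has_sum) (use k in simp)
  show "(?f' has_sum remainder j (Suc k) \<xi>) UNIV" by (rule remainder_has_sum) (use k in simp)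
  have "(\<lambda>x. \<mu> x * norm (real_vec x) ^ (k + 2)) summable_on UNIV" by (rule moment_le) (use k in auto)
  then show "((\<lambda>x. 2 * (\<mu> x * norm (real_vec x) ^ (k + 2))) has_sum 2 * (\<Sum>\<^sub>\<infinity>x. \<mu> x * norm (real_vec x) ^ (k + 2))) UNIV"
    by (intro has_sum_cmult_right) simp
  fix x :: "int ^ 'd" and t :: real
  let ?y = "real_vec x $ j" and ?a = "real_vec x \<bullet> \<xi>"
  have s: "real_vec x \<bullet> (\<xi> + t *\<^sub>R axis j 1) = ?a + t * ?y"
    by (simp add: inner_add_right inner_axis)
  have "?f x t - ?f x 0 - t * ?f' x = \<mu> x * ?y ^ k * (cos_remainder k (?a + t * ?y) - cos_remainder k ?a - (t * ?y) * cos_remainder (Suc k) ?a)"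
    unfolding s by (simp add: algebra_simps del: cos_remainder.simps real_vec_component)
  then have "\<bar>?f x t - ?f x 0 - t * ?f' x\<bar> = \<mu> x * \<bar>?y\<bar> ^ k * \<bar>cos_remainder k (?a + t * ?y) - cos_remainder k ?a - (t * ?y) * cos_remainder (Suc k) ?a\<bar>"
    using mu_nonneg[of x] by (simp only: abs_mult power_abs abs_of_nonneg)
  also have "\<dots> \<le> \<mu> x * \<bar>?y\<bar> ^ k * (2 * (t * ?y)\<^sup>2)"
    using mu_nonneg[of x] by (intro mult_left_mono cos_remainder_taylor) auto
  also have "\<dots> = 2 * (\<mu> x * \<bar>?y\<bar> ^ (k + 2)) * t\<^sup>2"
    by (simp add: power_add power_mult_distrib power2_eq_square abs_mult_self_eq mult_ac del: real_vec_component)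
  also have "\<dots> \<le> 2 * (\<mu> x * norm (real_vec x) ^ (k + 2)) * t\<^sup>2"
    by (intro mult_right_mono mult_left_mono power_mono component_le_norm_cart mu_nonneg) auto
  finally show "\<bar>?f x t - ?f x 0 - t * ?f' x\<bar> \<le> 2 * (\<mu> x * norm (real_vec x) ^ (k + 2)) * t\<^sup>2" .
qed

definition punctured_cube :: "(real ^ 'd) set" where
  "punctured_cube = {\<xi>. \<xi> \<noteq> 0 \<and> (\<forall>i. \<bar>\<xi> $ i\<bar> \<le> pi + 1)}"

definition far_region :: "(real ^ 'd) set" where
  "far_region = {\<xi>. 1 \<le> norm \<xi>}"

lemma punctured_cube: "0 \<notin> punctured_cube" "\<xi> \<in> punctured_cube \<Longrightarrow> norm \<xi> \<le> (real CARD('d) * (pi + 1))"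
proof -
  show "0 \<notin> punctured_cube" by (simp add: punctured_cube_def)
  assume "\<xi> \<in> punctured_cube"
  then have "\<bar>\<xi> $ i\<bar> \<le> pi + 1" for i by (simp add: punctured_cube_def)
  then have "(\<Sum>i\<in>UNIV. \<bar>\<xi> $ i\<bar>) \<le> (real CARD('d) * (pi + 1))" using sum_bounded_above[of UNIV "\<lambda>i. \<bar>\<xi> $ i\<bar>" "pi + 1"] by simp
  then show "norm \<xi> \<le> (real CARD('d) * (pi + 1))" using norm_le_l1_cart[of \<xi>] by linarith
qed

text \<open>For \<open>k \<le> 4\<close> the \<open>k\<close>-th derivative vanishes at the origin to order \<open>4 - k\<close>. The higher ones are
  bounded, which suffices for a negative order on a bounded region.\<close>

lemma remainder_symbol:
  "k + l \<le> CARD('d) + 2 \<Longrightarrow> symbol (axis j 1) punctured_cube l (4 - real k) (remainder j k)"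
proof (induction l arbitrary: k)
  have bd: "\<exists>C. \<forall>\<xi>\<in>punctured_cube. \<bar>remainder j k \<xi>\<bar> \<le> C * norm \<xi> powr (4 - real k)" if k: "k \<le> CARD('d) + 3" for k
  proof -
    have le: "\<bar>remainder j k \<xi>\<bar> \<le> (\<Sum>\<^sub>\<infinity>x. if k \<le> 4 then \<mu> x * norm (real_vec x) ^ 4 * norm \<xi> ^ (4 - k) else \<mu> x * norm (real_vec x) ^ k)" for \<xi>
    proof -
      note hs = remainder_has_sum[OF k, of j \<xi>]
      note hb = has_sum_infsum[OF remainder_bound_summable[OF k, of \<xi>]]
      have "remainder j k \<xi> \<le> (\<Sum>\<^sub>\<infinity>x. if k \<le> 4 then \<mu> x * norm (real_vec x) ^ 4 * norm \<xi> ^ (4 - k) else \<mu> x * norm (real_vec x) ^ k)"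
        by (rule has_sum_mono[OF hs hb]) (rule order_trans[OF abs_ge_self remainder_term_bound])
      moreover have "- remainder j k \<xi> \<le> (\<Sum>\<^sub>\<infinity>x. if k \<le> 4 then \<mu> x * norm (real_vec x) ^ 4 * norm \<xi> ^ (4 - k) else \<mu> x * norm (real_vec x) ^ k)"
        by (rule has_sum_mono[OF has_sum_uminusI[OF hs] hb]) (rule order_trans[OF abs_ge_minus_self remainder_term_bound])
      ultimately show ?thesis by (simp add: abs_le_iff)
    qed
    show ?thesis
    proof (cases "k \<le> 4")
      case True
      define C where "C = (\<Sum>\<^sub>\<infinity>x. \<mu> x * norm (real_vec x) ^ 4)"
      have "\<bar>remainder j k \<xi>\<bar> \<le> C * norm \<xi> powr (4 - real k)" if "\<xi> \<in> punctured_cube" for \<xi>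
      proof -
        have "\<xi> \<noteq> 0" using that punctured_cube by blast
        then have "norm \<xi> powr (4 - real k) = norm \<xi> ^ (4 - k)"
          using True powr_realpow[of "norm \<xi>" "4 - k"] by (simp add: of_nat_diff)
        moreover have "(\<Sum>\<^sub>\<infinity>x. \<mu> x * norm (real_vec x) ^ 4 * norm \<xi> ^ (4 - k)) = C * norm \<xi> ^ (4 - k)"
          unfolding C_def by (rule infsum_cmult_left')
        ultimately show ?thesis using le[of \<xi>] True by simp
      qed
      then show ?thesis by blast
    next
      case False
      define C where "C = (\<Sum>\<^sub>\<infinity>x. \<mu> x * norm (real_vec x) ^ k)"
      have C0: "0 \<le> C" unfolding C_def by (rule infsum_nonneg) (simp add: mu_nonneg)
      have "\<bar>remainder j k \<xi>\<bar> \<le> (C * (real CARD('d) * (pi + 1)) powr (real k - 4)) * norm \<xi> powr (4 - real k)" if \<xi>: "\<xi> \<in> punctured_cube" for \<xi>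
      proof -
        have nz: "\<xi> \<noteq> 0" using \<xi> punctured_cube by blast
        have "1 = norm \<xi> powr (real k - 4) * norm \<xi> powr (4 - real k)" using nz by (simp flip: powr_add)
        also have "\<dots> \<le> (real CARD('d) * (pi + 1)) powr (real k - 4) * norm \<xi> powr (4 - real k)"
          using punctured_cube(2)[OF \<xi>] False by (intro mult_right_mono powr_mono2) auto
        finally have "C * 1 \<le> C * ((real CARD('d) * (pi + 1)) powr (real k - 4) * norm \<xi> powr (4 - real k))" by (rule mult_left_mono[OF _ C0])
        moreover have "\<bar>remainder j k \<xi>\<bar> \<le> C" using le[of \<xi>] False by (simp add: C_def)
        ultimately show ?thesis by simp
      qed
      then show ?thesis by blast
    qed
  qed
  {
    case 0
    then show ?case using bd[of k] by simp
  next
    case (Suc l)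
    show ?case
    proof (rule symbol_Suc_intro)
      show "\<exists>C. \<forall>\<xi>\<in>punctured_cube. \<bar>remainder j k \<xi>\<bar> \<le> C * norm \<xi> powr (4 - real k)" by (rule bd) (use Suc.prems in simp)
      show "\<forall>\<xi>\<in>punctured_cube. ((\<lambda>t. remainder j k (\<xi> + t *\<^sub>R axis j 1)) has_real_derivative remainder j (Suc k) \<xi>) (at 0)"
        using remainder_deriv[of k j] Suc.prems by simp
      have "4 - real k - 1 = 4 - real (Suc k)" by simp
      then show "symbol (axis j 1) punctured_cube l (4 - real k - 1) (remainder j (Suc k))"
        using Suc.IH[of "Suc k"] Suc.prems by (simp only:)
    qed
  }
qed

text \<open>The decomposition \<open>1 / Psi - exp (- q) / q = (q - Psi) / (Psi q) + (1 - exp (- q)) / q\<close> into two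
  symbols of order \<open>0\<close>. Since the weight is symmetric, \<open>q - Psi\<close> has order \<open>4\<close> and not only \<open>3\<close>.\<close>

lemma singularity_symbol:
  "symbol (axis j 1) punctured_cube (CARD('d) + 2) 0 (\<lambda>\<xi>. 1 / Psi \<xi> - regular_kernel \<xi>)"
proof -
  let ?s = "symbol (axis j 1) punctured_cube (CARD('d) + 2)"
  note U = punctured_cube
  have D: "?s 4 (\<lambda>\<xi>. q \<xi> - Psi \<xi>)"
    using remainder_symbol[of 0 "CARD('d) + 2" j] unfolding remainder_0[abs_def] by simp
  have D2: "?s 2 (\<lambda>\<xi>. q \<xi> - Psi \<xi>)"
  proof (rule symbol_weaken[OF D])
    fix \<xi> assume \<xi>: "\<xi> \<in> punctured_cube"
    show "norm \<xi> powr (4 - 2) \<le> (real CARD('d) * (pi + 1)) powr 2"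
      using punctured_cube(2)[OF \<xi>] by (simp add: powr_mono2)
  qed
  have "?s 2 (\<lambda>\<xi>. q \<xi> - (q \<xi> - Psi \<xi>))" by (intro symbol_diff symbol_q D2 U)
  then have Psi: "?s 2 Psi" by (rule symbol_cong) simp
  obtain c where c: "0 < c" "\<And>\<xi>. (\<forall>i. \<bar>\<xi> $ i\<bar> \<le> pi + 1) \<Longrightarrow> c * (norm \<xi>)\<^sup>2 \<le> Psi \<xi>"
    using Psi_elliptic by blast
  have ell: "c * (norm \<xi>)\<^sup>2 \<le> Psi \<xi>" if "\<xi> \<in> punctured_cube" for \<xi>
    using that by (intro c) (simp add: punctured_cube_def)
  have inv: "?s (- 2) (\<lambda>\<xi>. 1 / Psi \<xi>)"
  proof (rule symbol_inverse[OF Psi U(1) c(1)])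
    fix \<xi> assume \<xi>: "\<xi> \<in> punctured_cube"
    then have "\<xi> \<noteq> 0" using U by blast
    then show "c * norm \<xi> powr 2 \<le> \<bar>Psi \<xi>\<bar>" using ell[OF \<xi>] by simp
  qed
  have "?s (4 + (- 2 + - 2)) (\<lambda>\<xi>. (q \<xi> - Psi \<xi>) * (1 / Psi \<xi> * (1 / q \<xi>)))"
    by (intro symbol_mult D inv symbol_inverse_q U)
  then have 1: "?s 0 (\<lambda>\<xi>. (q \<xi> - Psi \<xi>) * (1 / Psi \<xi> * (1 / q \<xi>)))" by simp
  have 2: "?s 0 (\<lambda>\<xi>. (1 - exp (- q \<xi>)) / q \<xi>)" by (rule symbol_regularisation[OF U])
  show ?thesis
  proof (rule symbol_cong_open[OF symbol_add[OF 1 2]])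
    have "{\<xi>. Psi \<xi> \<noteq> 0} = Psi -` (- {0})" by auto
    then have "open {\<xi>. Psi \<xi> \<noteq> 0}" using open_vimage[OF open_Compl[OF closed_singleton] Psi_continuous] by simp
    then show "open ({\<xi>. Psi \<xi> \<noteq> 0} \<inter> - {0})" by (intro open_Int) auto
    show "punctured_cube \<subseteq> {\<xi>. Psi \<xi> \<noteq> 0} \<inter> - {0}"
    proof
      fix \<xi> assume \<xi>: "\<xi> \<in> punctured_cube"
      then have "\<xi> \<noteq> 0" using U by blast
      then have "0 < c * (norm \<xi>)\<^sup>2" using c(1) by simp
      then show "\<xi> \<in> {\<xi>. Psi \<xi> \<noteq> 0} \<inter> - {0}" using ell[OF \<xi>] \<open>\<xi> \<noteq> 0\<close> by auto
    qed
    fix \<xi> assume "\<xi> \<in> {\<xi>. Psi \<xi> \<noteq> 0} \<inter> - {0}"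
    then have "Psi \<xi> \<noteq> 0" "q \<xi> \<noteq> 0" using q_pos[of \<xi>] by auto
    then show "(q \<xi> - Psi \<xi>) * (1 / Psi \<xi> * (1 / q \<xi>)) + (1 - exp (- q \<xi>)) / q \<xi> = 1 / Psi \<xi> - regular_kernel \<xi>"
      by (simp add: regular_kernel_def field_simps)
  qed
qed

end

lemma max_component:
  fixes v :: "real ^ 'd"
  shows "\<exists>j. norm v \<le> real CARD('d) * \<bar>v $ j\<bar>"
proof -
  have "Max (range (\<lambda>i. \<bar>v $ i\<bar>)) \<in> range (\<lambda>i. \<bar>v $ i\<bar>)" by (rule Max_in) auto
  then obtain j where j': "Max (range (\<lambda>i. \<bar>v $ i\<bar>)) = \<bar>v $ j\<bar>" by blast
  have j: "\<bar>v $ i\<bar> \<le> \<bar>v $ j\<bar>" for i unfolding j'[symmetric] by (rule Max_ge) auto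
  have "norm v \<le> (\<Sum>i\<in>UNIV. \<bar>v $ i\<bar>)" by (rule norm_le_l1_cart)
  also have "\<dots> \<le> real CARD('d) * \<bar>v $ j\<bar>" using sum_bounded_above[of UNIV "\<lambda>i. \<bar>v $ i\<bar>" "\<bar>v $ j\<bar>"] j by simp
  finally show ?thesis by blast
qed

lemma le_sum_abs: "c i \<le> (\<Sum>j\<in>UNIV. \<bar>c j\<bar>)" for c :: "'d::finite \<Rightarrow> real"
  by (rule order_trans[OF abs_ge_self], rule member_le_sum) auto

text \<open>A path of unit steps from \<open>x\<close> to \<open>x + y\<close>, each of which decreases the modulus of one coordinate
  of the remaining displacement, does not enter the ball of radius \<open>r\<close>.\<close>

lemma lattice_path_bound:
  fixes T :: "int ^ 'd \<Rightarrow> real"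
  assumes step: "\<And>z i. r \<le> norm (real_vec z) \<Longrightarrow> \<bar>T (z + axis i 1) - T z\<bar> \<le> B"
    and y: "norm (real_vec y) + r \<le> norm (real_vec x)"
  shows "\<bar>T (x + y) - T x\<bar> \<le> (\<Sum>i\<in>UNIV. \<bar>real_vec y $ i\<bar>) * B"
  using y
proof (induction "nat (\<Sum>i\<in>UNIV. \<bar>y $ i\<bar>)" arbitrary: y)
  case 0
  then have "(\<Sum>i\<in>UNIV. \<bar>y $ i\<bar>) = 0" by (simp add: sum_nonneg order_antisym)
  then have "y = 0" by (simp add: sum_nonneg_eq_0_iff vec_eq_iff)
  then show ?case by simp
next
  case (Suc m)
  have "y \<noteq> 0" using Suc.hyps(2) by auto
  then obtain i where i: "y $ i \<noteq> 0" by (auto simp: vec_eq_iff)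
  define s where "s = sgn (y $ i)"
  define y' where "y' = y - axis i s"
  have s: "s = 1 \<or> s = -1" using i by (auto simp: s_def sgn_if)
  have y'i: "\<bar>y' $ k\<bar> = (if k = i then \<bar>y $ i\<bar> - 1 else \<bar>y $ k\<bar>)" for k
    using i by (auto simp: y'_def axis_def s_def sgn_if)
  have sum: "(\<Sum>k\<in>UNIV. \<bar>y' $ k\<bar>) = (\<Sum>k\<in>UNIV. \<bar>y $ k\<bar>) - 1"
  proof -
    have "(\<Sum>k\<in>UNIV. \<bar>y' $ k\<bar>) = (\<Sum>k\<in>UNIV. \<bar>y $ k\<bar> - (if k = i then 1 else 0))"
      by (rule sum.cong) (auto simp: y'i)
    then show ?thesis by (simp add: sum_subtractf)
  qed
  have norm': "norm (real_vec y') \<le> norm (real_vec y)"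
  proof (rule norm_le_componentwise_cart)
    fix k
    have "\<bar>y' $ k\<bar> \<le> \<bar>y $ k\<bar>" by (simp add: y'i)
    then show "norm (real_vec y' $ k) \<le> norm (real_vec y $ k)"
      by (simp del: of_int_abs flip: of_int_abs)
  qed
  have IH: "\<bar>T (x + y') - T x\<bar> \<le> (\<Sum>i\<in>UNIV. \<bar>real_vec y' $ i\<bar>) * B"
    by (rule Suc.hyps(1)) (use Suc.hyps(2) Suc.prems norm' sum in auto)
  have far: "r \<le> norm (real_vec (x + z))" if "norm (real_vec z) \<le> norm (real_vec y)" for z
  proof -
    have "norm (real_vec x) \<le> norm (real_vec (x + z)) + norm (real_vec z)"
      by (simp) (metis add_diff_cancel norm_triangle_ineq4)
    then show ?thesis using that Suc.prems by linarith
  qed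
  have "\<bar>T (x + y) - T (x + y')\<bar> \<le> B"
    using s
  proof
    assume "s = 1"
    then have "x + y = (x + y') + axis i 1" by (simp add: y'_def)
    then show ?thesis using step[OF far[OF norm'], of i] by (simp only:)
  next
    assume "s = -1"
    then have "x + y' = (x + y) + axis i 1" by (simp add: y'_def vec_eq_iff axis_def)
    then have "\<bar>T (x + y') - T (x + y)\<bar> \<le> B" using step[OF far[OF order_refl], of i] by (simp only:)
    then show ?thesis by (subst abs_minus_commute)
  qed
  moreover have "(\<Sum>i\<in>UNIV. \<bar>real_vec y $ i\<bar>) = (\<Sum>i\<in>UNIV. \<bar>real_vec y' $ i\<bar>) + 1"
  proof -
    have "(\<Sum>i\<in>UNIV. \<bar>real_vec z $ i\<bar>) = real_of_int (\<Sum>i\<in>UNIV. \<bar>z $ i\<bar>)" for z :: "int ^ 'd" by simp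
    then show ?thesis by (simp only: sum)
  qed
  ultimately show ?case using IH by (simp add: distrib_right)
qed

context moment_weight
begin

text \<open>The error in replacing \<open>1 / Psi\<close> on the torus by the model kernel on the whole space.\<close>

definition error :: "int ^ 'd \<Rightarrow> real" where
  "error x = potential x - (LINT \<xi>|lborel. cos (real_vec x \<bullet> \<xi>) * regular_kernel \<xi>)"

lemma kernel_times_regular_integrable:
  assumes [measurable]: "\<kappa> \<in> borel_measurable borel" and b: "\<And>\<xi>. \<bar>\<kappa> \<xi>\<bar> \<le> B"
  shows "integrable lborel (\<lambda>\<xi>. \<kappa> \<xi> * regular_kernel \<xi>)"
proof -
  note i = regular_kernel_fourier(1)[OF card3]
  have "integrable lborel (\<lambda>\<xi>. B * regular_kernel \<xi>)" using i by simp
  then show ?thesis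
    by (rule Bochner_Integration.integrable_bound)
      (use i order_trans[OF b abs_ge_self] in \<open>auto simp: abs_mult intro!: mult_right_mono borel_measurable_times\<close>)
qed

text \<open>For \<open>x\<close> with largest coordinate \<open>x\<^sub>j\<close>, the translation by \<open>\<pi> / |x\<^sub>j|\<close> in direction \<open>j\<close> flips the sign
  of the kernel, and its length is comparable to \<open>1 / |x|\<close>. The multiplier \<open>\<sigma>\<close> is \<open>1\<close> for the error
  itself; for its first differences it is \<open>cos \<xi>\<^sub>i - 1\<close> or \<open>sin \<xi>\<^sub>i\<close>, which gains one order.\<close>

lemma multiplier_decay:
  fixes \<sigma> :: "real ^ 'd \<Rightarrow> real" and s :: nat
  assumes [measurable]: "\<sigma> \<in> borel_measurable borel" and b: "\<And>\<xi>. \<bar>\<sigma> \<xi>\<bar> \<le> B"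
    and per: "\<And>\<xi> j. \<sigma> (\<xi> + (2 * pi) *\<^sub>R axis j 1) = \<sigma> \<xi>"
    and near: "\<And>j. symbol (axis j 1) punctured_cube (CARD('d) + 2) (real s) \<sigma>"
    and far: "\<And>j. symbol (axis j 1) far_region (CARD('d) + 2) (real (CARD('d) + 2)) \<sigma>"
    and s: "s \<le> 1"
  shows "\<exists>C. \<forall>x \<kappa>. real CARD('d) * (real (CARD('d) + 2) * pi) \<le> norm (real_vec x) \<longrightarrow>
     (\<kappa> = (\<lambda>\<xi>. cos (real_vec x \<bullet> \<xi>)) \<or> \<kappa> = (\<lambda>\<xi>. sin (real_vec x \<bullet> \<xi>))) \<longrightarrow>
     \<bar>(LINT \<xi>:torus|lborel. \<kappa> \<xi> * (\<sigma> \<xi> * (1 / Psi \<xi>))) - (LINT \<xi>|lborel. \<kappa> \<xi> * (\<sigma> \<xi> * regular_kernel \<xi>))\<bar>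
       \<le> C / norm (real_vec x) ^ (s + CARD('d))"
proof -
  let ?n = "CARD('d)"
  let ?f = "\<lambda>\<xi>. \<sigma> \<xi> * (1 / Psi \<xi>)" and ?g = "\<lambda>\<xi>. \<sigma> \<xi> * regular_kernel \<xi>"
  let ?P = "\<lambda>j C. \<forall>h \<kappa>. 0 < h \<longrightarrow> real (?n + 2) * h \<le> 1 \<longrightarrow> \<kappa> \<in> borel_measurable borel \<longrightarrow> (\<forall>\<xi>. \<bar>\<kappa> \<xi>\<bar> \<le> 1) \<longrightarrow>
     (\<forall>\<xi>. \<kappa> (\<xi> + h *\<^sub>R axis j 1) = - \<kappa> \<xi>) \<longrightarrow> (\<forall>\<xi>. \<kappa> (\<xi> + (2 * pi) *\<^sub>R axis j 1) = \<kappa> \<xi>) \<longrightarrow>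
     \<bar>(LINT \<xi>:torus|lborel. \<kappa> \<xi> * ?f \<xi>) - (LINT \<xi>|lborel. \<kappa> \<xi> * ?g \<xi>)\<bar> \<le> C * h powr (real s + real ?n)"
  have "\<forall>j. \<exists>C. ?P j C"
  proof
    fix j :: 'd
    show "\<exists>C. ?P j C"
    proof (rule oscillatory_decay[where c=0])
      show "?f (\<xi> + (2 * pi) *\<^sub>R axis j 1) = ?f \<xi>" for \<xi> by (simp add: per Psi_periodic)
      show "set_integrable lborel torus ?f" by (rule kernel_over_Psi_integrable[OF assms(1) b])
      show "integrable lborel ?g" by (rule kernel_times_regular_integrable[OF assms(1) b])
      have "symbol (axis j 1) punctured_cube (?n + 2) (real s + 0) (\<lambda>\<xi>. \<sigma> \<xi> * (1 / Psi \<xi> - regular_kernel \<xi>))"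
        by (intro symbol_mult near singularity_symbol)
      then show "symbol (axis j 1) {\<xi>. \<xi> \<noteq> 0 \<and> (\<forall>i. \<bar>\<xi> $ i\<bar> \<le> pi + 1)} (?n + 2) (real s) (\<lambda>\<xi>. ?f \<xi> - ?g \<xi>)"
        by (simp add: right_diff_distrib punctured_cube_def)
      have "symbol (axis j 1) far_region (?n + 2) (real (?n + 2) + - real (?n + 2)) ?g"
        by (intro symbol_mult far symbol_regular_kernel_far) (simp add: far_region_def)
      then show "symbol (axis j 1) {\<xi>. 1 \<le> norm \<xi>} (?n + 2) 0 ?g" by (simp add: far_region_def)
    qed (use s in auto)
  qed
  from choice[OF this] obtain C where C: "\<And>j. ?P j (C j)" by blast
  define C' where "C' = (\<Sum>j\<in>UNIV. \<bar>C j\<bar>)"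
  have CC': "C j \<le> C'" for j
    unfolding C'_def by (rule le_sum_abs)
  show ?thesis
  proof (intro exI[of _ "C' * (real ?n * pi) ^ (s + ?n)"] allI impI)
    fix x :: "int ^ 'd" and \<kappa> :: "real ^ 'd \<Rightarrow> real"
    assume x: "real ?n * (real (?n + 2) * pi) \<le> norm (real_vec x)"
      and \<kappa>: "\<kappa> = (\<lambda>\<xi>. cos (real_vec x \<bullet> \<xi>)) \<or> \<kappa> = (\<lambda>\<xi>. sin (real_vec x \<bullet> \<xi>))"
    obtain j where j: "norm (real_vec x) \<le> real ?n * \<bar>real_vec x $ j\<bar>" using max_component by blast
    have n0: "0 < real ?n" using card3 by simp
    have xj: "real (?n + 2) * pi \<le> \<bar>real_of_int (x $ j)\<bar>"
    proof -
      have "real ?n * (real (?n + 2) * pi) \<le> real ?n * \<bar>real_of_int (x $ j)\<bar>"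
        using order_trans[OF x j] by (simp only: real_vec_component)
      then show ?thesis by (rule mult_left_le_imp_le[OF _ n0])
    qed
    have p: "0 < real (?n + 2) * pi" by simp
    then have xj0: "0 < \<bar>real_of_int (x $ j)\<bar>" using xj by linarith
    then have xjn: "x $ j \<noteq> 0" by simp
    have "x \<noteq> 0" using xjn by auto
    then have xn: "0 < norm (real_vec x)" by simp
    define h where "h = pi / \<bar>real_of_int (x $ j)\<bar>"
    have h: "0 < h" "real (?n + 2) * h \<le> 1"
    proof -
      show "0 < h" unfolding h_def by (rule divide_pos_pos[OF pi_gt_zero xj0])
      have "real (?n + 2) * pi / \<bar>real_of_int (x $ j)\<bar> \<le> 1" using xj xj0 by (simp only: pos_divide_le_eq mult_1)
      then show "real (?n + 2) * h \<le> 1" unfolding h_def by (simp only: times_divide_eq_right)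
    qed
    have hx: "h \<le> real ?n * pi / norm (real_vec x)"
    proof -
      have "pi * norm (real_vec x) \<le> pi * (real ?n * \<bar>real_of_int (x $ j)\<bar>)" using j by (intro mult_left_mono) auto
      then have "pi * norm (real_vec x) \<le> real ?n * pi * \<bar>real_of_int (x $ j)\<bar>" by (simp only: mult_ac)
      then show ?thesis unfolding h_def pos_divide_le_eq[OF xj0] times_divide_eq_left pos_le_divide_eq[OF xn] .
    qed
    have "\<bar>(LINT \<xi>:torus|lborel. \<kappa> \<xi> * ?f \<xi>) - (LINT \<xi>|lborel. \<kappa> \<xi> * ?g \<xi>)\<bar> \<le> C j * h powr (real s + real ?n)"
    proof (rule C[rule_format, OF h])
      show "\<kappa> \<in> borel_measurable borel" using \<kappa> by (rule disjE) (simp_all only: kernel_measurable)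
      show "\<bar>\<kappa> \<xi>\<bar> \<le> 1" for \<xi> using \<kappa> by auto
      show "\<kappa> (\<xi> + h *\<^sub>R axis j 1) = - \<kappa> \<xi>" for \<xi>
        using \<kappa> by (rule disjE) (simp_all only: h_def kernel_antiperiodic[OF xjn])
      show "\<kappa> (\<xi> + (2 * pi) *\<^sub>R axis j 1) = \<kappa> \<xi>" for \<xi>
        using \<kappa> by (rule disjE) (simp_all only: kernel_periodic)
    qed
    also have "\<dots> \<le> C' * h powr (real s + real ?n)" by (intro mult_right_mono CC') auto
    also have "h powr (real s + real ?n) = h ^ (s + ?n)" using powr_realpow[OF h(1), of "s + ?n"] by simp
    also have "C' * h ^ (s + ?n) \<le> C' * (real ?n * pi / norm (real_vec x)) ^ (s + ?n)"
      using hx h(1) by (intro mult_left_mono power_mono) (auto simp: C'_def sum_nonneg)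
    finally show "\<bar>(LINT \<xi>:torus|lborel. \<kappa> \<xi> * ?f \<xi>) - (LINT \<xi>|lborel. \<kappa> \<xi> * ?g \<xi>)\<bar>
        \<le> C' * (real ?n * pi) ^ (s + ?n) / norm (real_vec x) ^ (s + ?n)"
      by (simp add: power_divide)
  qed
qed

lemma far_region: "0 \<notin> far_region" "\<xi> \<in> far_region \<Longrightarrow> 1 \<le> norm \<xi>"
  by (auto simp: far_region_def)

lemma error_bound: "\<exists>C R. \<forall>x. R \<le> norm (real_vec x) \<longrightarrow> \<bar>error x\<bar> \<le> C / norm (real_vec x) ^ CARD('d)"
proof -
  have "\<exists>C. \<forall>x \<kappa>. real CARD('d) * (real (CARD('d) + 2) * pi) \<le> norm (real_vec x) \<longrightarrow>
     (\<kappa> = (\<lambda>\<xi>. cos (real_vec x \<bullet> \<xi>)) \<or> \<kappa> = (\<lambda>\<xi>. sin (real_vec x \<bullet> \<xi>))) \<longrightarrow>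
     \<bar>(LINT \<xi>:torus|lborel. \<kappa> \<xi> * ((\<lambda>_. 1) \<xi> * (1 / Psi \<xi>))) - (LINT \<xi>|lborel. \<kappa> \<xi> * ((\<lambda>_. 1) \<xi> * regular_kernel \<xi>))\<bar>
       \<le> C / norm (real_vec x) ^ (0 + CARD('d))"
  proof (rule multiplier_decay)
    show "symbol (axis j 1) punctured_cube (CARD('d) + 2) (real 0) (\<lambda>_. 1)" for j
      using symbol_const[OF punctured_cube(1)] by (simp only: of_nat_0)
    show "symbol (axis j 1) far_region (CARD('d) + 2) (real (CARD('d) + 2)) (\<lambda>_. 1)" for j
    proof (rule symbol_weaken[OF symbol_const[OF far_region(1)]])
      fix \<xi> assume "\<xi> \<in> far_region"
      then have "1 \<le> norm \<xi>" by (rule far_region)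
      then have "norm \<xi> powr (0 - real (CARD('d) + 2)) \<le> norm \<xi> powr 0" by (intro powr_mono) auto
      then show "norm \<xi> powr (0 - real (CARD('d) + 2)) \<le> 1" using \<open>1 \<le> norm \<xi>\<close> by (auto split: if_splits)
    qed
  qed auto
  then obtain C where C: "\<And>x. real CARD('d) * (real (CARD('d) + 2) * pi) \<le> norm (real_vec x) \<Longrightarrow>
     \<bar>(LINT \<xi>:torus|lborel. cos (real_vec x \<bullet> \<xi>) * (1 * (1 / Psi \<xi>))) - (LINT \<xi>|lborel. cos (real_vec x \<bullet> \<xi>) * (1 * regular_kernel \<xi>))\<bar>
       \<le> C / norm (real_vec x) ^ (0 + CARD('d))" by blast
  show ?thesis
    by (rule exI[of _ C], rule exI[of _ "real CARD('d) * (real (CARD('d) + 2) * pi)"], intro allI impI)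
      (use C in \<open>simp add: error_def potential_def\<close>)
qed

lemma error_step_bound:
  "\<exists>C R. \<forall>x. R \<le> norm (real_vec x) \<longrightarrow> \<bar>error (x + axis i 1) - error x\<bar> \<le> C / norm (real_vec x) ^ (CARD('d) + 1)"
proof -
  let ?e = "axis i 1 :: int ^ 'd"
  let ?v = "real_vec ?e"
  let ?\<sigma> = "\<lambda>\<xi>. cos (?v \<bullet> \<xi>) - 1" and ?\<tau> = "\<lambda>\<xi>. sin (?v \<bullet> \<xi>)"
  let ?R = "real CARD('d) * (real (CARD('d) + 2) * pi)"
  have "\<exists>C. \<forall>x \<kappa>. ?R \<le> norm (real_vec x) \<longrightarrow>
     (\<kappa> = (\<lambda>\<xi>. cos (real_vec x \<bullet> \<xi>)) \<or> \<kappa> = (\<lambda>\<xi>. sin (real_vec x \<bullet> \<xi>))) \<longrightarrow>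
     \<bar>(LINT \<xi>:torus|lborel. \<kappa> \<xi> * (?\<sigma> \<xi> * (1 / Psi \<xi>))) - (LINT \<xi>|lborel. \<kappa> \<xi> * (?\<sigma> \<xi> * regular_kernel \<xi>))\<bar>
       \<le> C / norm (real_vec x) ^ (1 + CARD('d))"
  proof (rule multiplier_decay[where B=2])
    show "\<bar>?\<sigma> \<xi>\<bar> \<le> 2" for \<xi> using abs_cos_le_one[of "?v \<bullet> \<xi>"] by linarith
    show "symbol (axis j 1) punctured_cube (CARD('d) + 2) (real 1) ?\<sigma>" for j
      using symbol_trig_bounded(2)[OF punctured_cube, where e="axis j 1" and v="?v"] by (simp only: inner_commute[of _ ?v] of_nat_1)
    show "symbol (axis j 1) far_region (CARD('d) + 2) (real (CARD('d) + 2)) ?\<sigma>" for j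
      using symbol_trig_far(2)[OF far_region(2), where e="axis j 1" and v="?v"] by (simp only: inner_commute[of _ ?v])
  qed (auto simp: kernel_periodic)
  then obtain C1 where C1: "\<And>x. ?R \<le> norm (real_vec x) \<Longrightarrow>
     \<bar>(LINT \<xi>:torus|lborel. cos (real_vec x \<bullet> \<xi>) * (?\<sigma> \<xi> * (1 / Psi \<xi>))) - (LINT \<xi>|lborel. cos (real_vec x \<bullet> \<xi>) * (?\<sigma> \<xi> * regular_kernel \<xi>))\<bar>
       \<le> C1 / norm (real_vec x) ^ (1 + CARD('d))" by blast
  have "\<exists>C. \<forall>x \<kappa>. ?R \<le> norm (real_vec x) \<longrightarrow>
     (\<kappa> = (\<lambda>\<xi>. cos (real_vec x \<bullet> \<xi>)) \<or> \<kappa> = (\<lambda>\<xi>. sin (real_vec x \<bullet> \<xi>))) \<longrightarrow>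
     \<bar>(LINT \<xi>:torus|lborel. \<kappa> \<xi> * (?\<tau> \<xi> * (1 / Psi \<xi>))) - (LINT \<xi>|lborel. \<kappa> \<xi> * (?\<tau> \<xi> * regular_kernel \<xi>))\<bar>
       \<le> C / norm (real_vec x) ^ (1 + CARD('d))"
  proof (rule multiplier_decay[where B=1])
    show "symbol (axis j 1) punctured_cube (CARD('d) + 2) (real 1) ?\<tau>" for j
      using symbol_trig_bounded(1)[OF punctured_cube, where e="axis j 1" and v="?v"] by (simp only: inner_commute[of _ ?v] of_nat_1)
    show "symbol (axis j 1) far_region (CARD('d) + 2) (real (CARD('d) + 2)) ?\<tau>" for j
      using symbol_trig_far(1)[OF far_region(2), where e="axis j 1" and v="?v"] by (simp only: inner_commute[of _ ?v])
  qed (auto simp: kernel_periodic)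
  then obtain C2 where C2: "\<And>x. ?R \<le> norm (real_vec x) \<Longrightarrow>
     \<bar>(LINT \<xi>:torus|lborel. sin (real_vec x \<bullet> \<xi>) * (?\<tau> \<xi> * (1 / Psi \<xi>))) - (LINT \<xi>|lborel. sin (real_vec x \<bullet> \<xi>) * (?\<tau> \<xi> * regular_kernel \<xi>))\<bar>
       \<le> C2 / norm (real_vec x) ^ (1 + CARD('d))" by blast
  \<comment> \<open>the addition theorem for \<open>cos (\<langle>x, \<xi>\<rangle> + \<xi>\<^sub>i)\<close>\<close>
  have split: "error (x + ?e) - error x =
      ((LINT \<xi>:torus|lborel. cos (real_vec x \<bullet> \<xi>) * (?\<sigma> \<xi> * (1 / Psi \<xi>))) - (LINT \<xi>|lborel. cos (real_vec x \<bullet> \<xi>) * (?\<sigma> \<xi> * regular_kernel \<xi>)))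
      - ((LINT \<xi>:torus|lborel. sin (real_vec x \<bullet> \<xi>) * (?\<tau> \<xi> * (1 / Psi \<xi>))) - (LINT \<xi>|lborel. sin (real_vec x \<bullet> \<xi>) * (?\<tau> \<xi> * regular_kernel \<xi>)))" for x :: "int ^ 'd"
  proof -
    have trig: "cos (real_vec (x + ?e) \<bullet> \<xi>) * a = cos (real_vec x \<bullet> \<xi>) * a + (cos (real_vec x \<bullet> \<xi>) * (?\<sigma> \<xi> * a) - sin (real_vec x \<bullet> \<xi>) * (?\<tau> \<xi> * a))" for \<xi> a
      by (simp add: inner_add_left cos_add algebra_simps)
    have b1: "\<bar>cos (real_vec x \<bullet> \<xi>) * ?\<sigma> \<xi>\<bar> \<le> 1 * 2" for \<xi>
      unfolding abs_mult using abs_cos_le_one[of "?v \<bullet> \<xi>"] by (intro mult_mono) (auto intro: order_trans[OF abs_triangle_ineq4])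
    have b2: "\<bar>sin (real_vec x \<bullet> \<xi>) * ?\<tau> \<xi>\<bar> \<le> 1 * 1" for \<xi>
      unfolding abs_mult by (intro mult_mono) auto
    have m1: "(\<lambda>\<xi>. cos (real_vec x \<bullet> \<xi>) * ?\<sigma> \<xi>) \<in> borel_measurable borel" "(\<lambda>\<xi>. sin (real_vec x \<bullet> \<xi>) * ?\<tau> \<xi>) \<in> borel_measurable borel"
      by measurable
    have t: "set_integrable lborel torus (\<lambda>\<xi>. cos (real_vec x \<bullet> \<xi>) * (1 / Psi \<xi>))"
      "set_integrable lborel torus (\<lambda>\<xi>. cos (real_vec x \<bullet> \<xi>) * (?\<sigma> \<xi> * (1 / Psi \<xi>)))"
      "set_integrable lborel torus (\<lambda>\<xi>. sin (real_vec x \<bullet> \<xi>) * (?\<tau> \<xi> * (1 / Psi \<xi>)))"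
      using kernel_over_Psi_integrable[OF m1(1) b1] kernel_over_Psi_integrable[OF m1(2) b2]
        kernel_over_Psi_integrable[of "\<lambda>\<xi>. cos (real_vec x \<bullet> \<xi>)" 1]
      by (simp_all only: mult.assoc kernel_measurable abs_cos_le_one)
    have g: "integrable lborel (\<lambda>\<xi>. cos (real_vec x \<bullet> \<xi>) * regular_kernel \<xi>)"
      "integrable lborel (\<lambda>\<xi>. cos (real_vec x \<bullet> \<xi>) * (?\<sigma> \<xi> * regular_kernel \<xi>))"
      "integrable lborel (\<lambda>\<xi>. sin (real_vec x \<bullet> \<xi>) * (?\<tau> \<xi> * regular_kernel \<xi>))"
      using kernel_times_regular_integrable[OF m1(1) b1] kernel_times_regular_integrable[OF m1(2) b2]
        kernel_times_regular_integrable[of "\<lambda>\<xi>. cos (real_vec x \<bullet> \<xi>)" 1]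
      by (simp_all only: mult.assoc kernel_measurable abs_cos_le_one)
    show ?thesis
      unfolding error_def potential_def trig
        set_integral_add(2)[OF t(1) set_integral_diff(1)[OF t(2,3)]] set_integral_diff(2)[OF t(2,3)]
        Bochner_Integration.integral_add[OF g(1) Bochner_Integration.integrable_diff[OF g(2,3)]] Bochner_Integration.integral_diff[OF g(2,3)]
      by simp
  qed
  show ?thesis
  proof (rule exI[of _ "C1 + C2"], rule exI[of _ ?R], intro allI impI)
    fix x :: "int ^ 'd" assume x: "?R \<le> norm (real_vec x)"
    show "\<bar>error (x + ?e) - error x\<bar> \<le> (C1 + C2) / norm (real_vec x) ^ (CARD('d) + 1)"
      unfolding split using C1[OF x] C2[OF x] by (simp add: add_divide_distrib)
  qed
qed

text \<open>The displacement \<open>y\<close> is split into unit steps, along which the distance to the origin stays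
  at least \<open>|x| / 2\<close>.\<close>

lemma error_difference_bound:
  "\<exists>C R. \<forall>x y. R \<le> norm (real_vec x) \<longrightarrow> norm (real_vec y) \<le> norm (real_vec x) / 2 \<longrightarrow>
     \<bar>error (x + y) - error x\<bar> \<le> C * norm (real_vec y) / norm (real_vec x) ^ (CARD('d) + 1)"
proof -
  let ?n = "CARD('d)"
  obtain C R where CR: "\<And>i x. R i \<le> norm (real_vec x) \<Longrightarrow> \<bar>error (x + axis i 1) - error x\<bar> \<le> C i / norm (real_vec x) ^ (?n + 1)"
    using error_step_bound by metis
  define C' where "C' = (\<Sum>i\<in>UNIV. \<bar>C i\<bar>)"
  define R' where "R' = 1 + (\<Sum>i\<in>UNIV. \<bar>R i\<bar>)"
  have C': "C i \<le> C'" "0 \<le> C'" for i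
    unfolding C'_def by (rule le_sum_abs, simp add: sum_nonneg)
  have R': "R i \<le> R'" "1 \<le> R'" for i
    unfolding R'_def using le_sum_abs[of R i] by (linarith, simp add: sum_nonneg)
  show ?thesis
  proof (rule exI[of _ "C' * 2 ^ (?n + 1) * real ?n"], rule exI[of _ "2 * R'"], intro allI impI)
    fix x y :: "int ^ 'd"
    assume x: "2 * R' \<le> norm (real_vec x)" and y: "norm (real_vec y) \<le> norm (real_vec x) / 2"
    let ?r = "norm (real_vec x) / 2"
    let ?B = "C' / ?r ^ (?n + 1)"
    have r0: "0 < ?r" using x R'(2) by linarith
    have step: "\<bar>error (z + axis i 1) - error z\<bar> \<le> ?B" if z: "?r \<le> norm (real_vec z)" for z i
    proof -
      have "R i \<le> norm (real_vec z)" using x z R'(1)[of i] by linarith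
      then have "\<bar>error (z + axis i 1) - error z\<bar> \<le> C i / norm (real_vec z) ^ (?n + 1)" by (rule CR)
      also have "\<dots> \<le> C' / norm (real_vec z) ^ (?n + 1)" by (intro divide_right_mono C') simp
      also have "\<dots> \<le> ?B" using z r0 C'(2) by (intro divide_left_mono power_mono mult_pos_pos zero_less_power) auto
      finally show ?thesis .
    qed
    have "\<bar>error (x + y) - error x\<bar> \<le> (\<Sum>i\<in>UNIV. \<bar>real_vec y $ i\<bar>) * ?B"
      by (rule lattice_path_bound[where r="?r", OF step]) (use y in auto)
    also have "\<dots> \<le> (real ?n * norm (real_vec y)) * ?B"
    proof (intro mult_right_mono)
      show "(\<Sum>i\<in>UNIV. \<bar>real_vec y $ i\<bar>) \<le> real ?n * norm (real_vec y)"
        using sum_bounded_above[of UNIV "\<lambda>i. \<bar>real_vec y $ i\<bar>" "norm (real_vec y)"] component_le_norm_cart[of "real_vec y"] by simp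
      show "0 \<le> ?B" using C'(2) r0 by simp
    qed
    also have "\<dots> = C' * 2 ^ (?n + 1) * real ?n * norm (real_vec y) / norm (real_vec x) ^ (?n + 1)"
      by (simp add: power_divide mult_ac)
    finally show "\<bar>error (x + y) - error x\<bar> \<le> C' * 2 ^ (?n + 1) * real ?n * norm (real_vec y) / norm (real_vec x) ^ (?n + 1)" .
  qed
qed

end

section \<open>Expansion of the Hardy weight\<close>

lemma powr_taylor:
  fixes p :: real
  assumes p: "0 < p"
  shows "\<exists>C\<ge>0. \<forall>s. \<bar>s\<bar> \<le> 1 / 2 \<longrightarrow>
    \<bar>1 - (1 + s) powr (- p)\<bar> \<le> C * \<bar>s\<bar> \<and>
    \<bar>(1 - (1 + s) powr (- p)) - (p * s - p * (p + 1) / 2 * s\<^sup>2)\<bar> \<le> C * \<bar>s\<bar> ^ 3"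
proof -
  define d where "d m t = (\<Prod>i<m. - p - real i) * (1 + t) powr (- p - real m)" for m t
  have der: "(d m has_real_derivative d (Suc m) t) (at t)" if "\<bar>t\<bar> \<le> 1 / 2" for m t
  proof -
    have "0 < 1 + t" using that by linarith
    then have "((\<lambda>t. (1 + t) powr (- p - real m)) has_real_derivative (- p - real m) * (1 + t) powr (- p - real m - 1)) (at t)"
      by (auto intro!: derivative_eq_intros)
    from DERIV_cmult[OF this, of "\<Prod>i<m. - p - real i"]
    show ?thesis unfolding d_def by (simp add: algebra_simps)
  qed
  have bd: "\<bar>d m t\<bar> \<le> \<bar>\<Prod>i<m. - p - real i\<bar> * (1 / 2) powr (- p - real m)" if "\<bar>t\<bar> \<le> 1 / 2" for m t
    unfolding d_def abs_mult using that p by (intro mult_left_mono) (auto intro!: powr_mono2')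
  define B where "B m = \<bar>\<Prod>i<m. - p - real i\<bar> * (1 / 2) powr (- p - real m)" for m
  have B0: "0 \<le> B m" for m by (simp add: B_def)
  have tay: "\<exists>t. \<bar>t\<bar> \<le> \<bar>s\<bar> \<and> (1 + s) powr (- p) = (\<Sum>m<k. d m 0 / fact m * s ^ m) + d k t / fact k * s ^ k"
    if s: "\<bar>s\<bar> \<le> 1 / 2" and "0 < k" for s k
  proof -
    have "d 0 = (\<lambda>t. (1 + t) powr (- p))" by (rule ext) (simp add: d_def)
    then show ?thesis
      by (rule Maclaurin_bi_le) (use der s in auto)
  qed
  show ?thesis
  proof (intro exI[of _ "B 1 + B 3"] conjI allI impI)
    show "0 \<le> B 1 + B 3" using B0[of 1] B0[of 3] by simp
    fix s :: real assume s: "\<bar>s\<bar> \<le> 1 / 2"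
    obtain t where t: "\<bar>t\<bar> \<le> \<bar>s\<bar>" "(1 + s) powr (- p) = (\<Sum>m<1. d m 0 / fact m * s ^ m) + d 1 t / fact 1 * s ^ 1"
      using tay[OF s, of 1] by auto
    have "d 0 0 = 1" by (simp add: d_def)
    then have "\<bar>1 - (1 + s) powr (- p)\<bar> = \<bar>d 1 t\<bar> * \<bar>s\<bar>" unfolding t(2) by (simp add: abs_mult)
    also have "\<dots> \<le> B 1 * \<bar>s\<bar>" unfolding B_def using t s by (intro mult_right_mono bd) auto
    also have "\<dots> \<le> (B 1 + B 3) * \<bar>s\<bar>" using B0[of 3] by (intro mult_right_mono) auto
    finally show "\<bar>1 - (1 + s) powr (- p)\<bar> \<le> (B 1 + B 3) * \<bar>s\<bar>" .
    obtain t' where t': "\<bar>t'\<bar> \<le> \<bar>s\<bar>" "(1 + s) powr (- p) = (\<Sum>m<3. d m 0 / fact m * s ^ m) + d 3 t' / fact 3 * s ^ 3"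
      using tay[OF s, of 3] by auto
    have sum: "(\<Sum>m<3. d m 0 / fact m * s ^ m) = 1 - p * s + p * (p + 1) / 2 * s\<^sup>2"
      by (simp add: numeral_3_eq_3 d_def power2_eq_square fact_numeral algebra_simps)
    have "(1 - (1 + s) powr (- p)) - (p * s - p * (p + 1) / 2 * s\<^sup>2) = - (d 3 t' / fact 3 * s ^ 3)"
      unfolding t'(2) sum by simp
    then have "\<bar>(1 - (1 + s) powr (- p)) - (p * s - p * (p + 1) / 2 * s\<^sup>2)\<bar> = \<bar>d 3 t'\<bar> / fact 3 * \<bar>s\<bar> ^ 3"
      by (simp add: abs_mult power_abs)
    also have "\<dots> \<le> B 3 / 1 * \<bar>s\<bar> ^ 3"
      unfolding B_def using t' s by (intro mult_right_mono frac_le bd) (auto simp: fact_ge_1)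
    also have "\<dots> \<le> (B 1 + B 3) * \<bar>s\<bar> ^ 3" using B0[of 1] by (simp add: mult_right_mono)
    finally show "\<bar>(1 - (1 + s) powr (- p)) - (p * s - p * (p + 1) / 2 * s\<^sup>2)\<bar> \<le> (B 1 + B 3) * \<bar>s\<bar> ^ 3" .
  qed
qed

text \<open>For terms of first, second and third order in \<open>t\<close>, everything in the square is of fourth order
  except for two terms: the square of \<open>p \<alpha>\<close> and the mixed term \<open>2 p \<alpha> Q\<close> of third order.\<close>

lemma square_expansion:
  fixes p a c t \<alpha> Q e :: real
  assumes t: "0 \<le> t" "t \<le> 1" and \<alpha>: "\<bar>\<alpha>\<bar> \<le> a * t" and Q: "\<bar>Q\<bar> \<le> b * t\<^sup>2" and e: "\<bar>e\<bar> \<le> c * t ^ 3"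
    and nn: "0 \<le> p" "0 \<le> a" "0 \<le> b" "0 \<le> c"
  shows "\<bar>(p * \<alpha> + Q + e)\<^sup>2 - p\<^sup>2 * \<alpha>\<^sup>2 - 2 * p * \<alpha> * Q\<bar> \<le> (b\<^sup>2 + 2 * (p * a + b) * c + c\<^sup>2) * t ^ 4"
proof -
  have t34: "t ^ 5 \<le> t ^ 4" "t ^ 6 \<le> t ^ 4" using t by (auto intro: power_decreasing)
  have t2: "t\<^sup>2 \<le> t" using t by (simp add: power2_eq_square mult_left_le)
  have eq: "(p * \<alpha> + Q + e)\<^sup>2 - p\<^sup>2 * \<alpha>\<^sup>2 - 2 * p * \<alpha> * Q = Q * Q + 2 * ((p * \<alpha> + Q) * e) + e * e"
    by (simp add: power2_eq_square algebra_simps)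
  have 1: "\<bar>Q * Q\<bar> \<le> b\<^sup>2 * t ^ 4"
  proof -
    have "\<bar>Q\<bar> * \<bar>Q\<bar> \<le> (b * t\<^sup>2) * (b * t\<^sup>2)" using Q nn by (intro mult_mono) auto
    also have "\<dots> = b\<^sup>2 * t ^ 4" by (simp add: power2_eq_square eval_nat_numeral)
    finally show ?thesis by (simp add: abs_mult)
  qed
  have 2: "\<bar>(p * \<alpha> + Q) * e\<bar> \<le> (p * a + b) * c * t ^ 4"
  proof -
    have "\<bar>p * \<alpha> + Q\<bar> \<le> p * (a * t) + b * t\<^sup>2"
      by (rule order_trans[OF abs_triangle_ineq]) (use \<alpha> Q nn in \<open>auto simp: abs_mult intro!: add_mono mult_left_mono\<close>)
    also have "\<dots> \<le> p * (a * t) + b * t" using t2 nn by (intro add_left_mono mult_left_mono) auto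
    finally have "\<bar>p * \<alpha> + Q\<bar> \<le> (p * a + b) * t" by (simp add: algebra_simps)
    then have "\<bar>p * \<alpha> + Q\<bar> * \<bar>e\<bar> \<le> ((p * a + b) * t) * (c * t ^ 3)"
      using e nn t by (intro mult_mono) auto
    also have "\<dots> = (p * a + b) * c * t ^ 4" by (simp add: eval_nat_numeral)
    finally show ?thesis by (simp add: abs_mult)
  qed
  have 3: "\<bar>e * e\<bar> \<le> c\<^sup>2 * t ^ 4"
  proof -
    have "\<bar>e\<bar> * \<bar>e\<bar> \<le> (c * t ^ 3) * (c * t ^ 3)" using e nn t by (intro mult_mono) auto
    also have "\<dots> = c\<^sup>2 * t ^ 6" by (simp add: power2_eq_square eval_nat_numeral)
    also have "\<dots> \<le> c\<^sup>2 * t ^ 4" using t34 by (intro mult_left_mono) auto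
    finally show ?thesis by (simp add: abs_mult)
  qed
  have "\<bar>Q * Q + 2 * ((p * \<alpha> + Q) * e) + e * e\<bar> \<le> \<bar>Q * Q\<bar> + 2 * \<bar>(p * \<alpha> + Q) * e\<bar> + \<bar>e * e\<bar>" by linarith
  also have "\<dots> \<le> b\<^sup>2 * t ^ 4 + 2 * ((p * a + b) * c * t ^ 4) + c\<^sup>2 * t ^ 4"
    using 1 2 3 by linarith
  also have "\<dots> = (b\<^sup>2 + 2 * (p * a + b) * c + c\<^sup>2) * t ^ 4" by (simp add: algebra_simps)
  finally show ?thesis unfolding eq .
qed

lemma sqrt_diff_le:
  fixes a c d :: real
  assumes "0 \<le> a" "0 < d" "d \<le> c" 
  shows "\<bar>sqrt a - sqrt c\<bar> \<le> \<bar>a - c\<bar> / sqrt d"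
proof -
  have "(sqrt a - sqrt c) * (sqrt a + sqrt c) = a - c"
    using assms by (simp add: algebra_simps)
  then have "\<bar>sqrt a - sqrt c\<bar> * (sqrt a + sqrt c) = \<bar>a - c\<bar>"
    using assms by (metis abs_mult abs_of_nonneg add_nonneg_nonneg order_trans less_imp_le real_sqrt_ge_zero)
  moreover have "\<bar>sqrt a - sqrt c\<bar> * sqrt d \<le> \<bar>sqrt a - sqrt c\<bar> * (sqrt a + sqrt c)"
    using assms by (intro mult_left_mono) (auto intro: order_trans[of _ "sqrt c"])
  ultimately show ?thesis using assms by (simp add: pos_le_divide_eq)
qed

context moment_weight
begin

abbreviation N2 :: "int ^ 'd \<Rightarrow> real" where "N2 x \<equiv> dual_form (real_vec x)"

definition polar :: "int ^ 'd \<Rightarrow> int ^ 'd \<Rightarrow> real" where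
  "polar x y = (matrix_inv (covariance \<mu>) *v real_vec x) \<bullet> real_vec y"

lemma polar_minus: "polar x (- y) = - polar x y"
  by (simp add: polar_def)

lemma N2_minus: "N2 (- y) = N2 y"
  using linear_neg[OF matrix_vector_mul_linear, of "matrix_inv (covariance \<mu>)" "real_vec y"]
  by (simp add: dual_form_def)

lemma N2_add: "N2 (x + y) = N2 x + 2 * polar x y + N2 y"
  using symmetric_matrix_inner[OF inv_A_sym, of "real_vec x" "real_vec y"]
  by (simp add: dual_form_def polar_def matrix_vector_right_distrib inner_add_left inner_add_right inner_commute)

text \<open>The second moments of the weight form the covariance matrix, whose inverse defines both sides.\<close>

lemma polar_second_moment: "((\<lambda>y. \<mu> y * (polar x y)\<^sup>2) has_sum N2 x) UNIV"
proof -
  let ?v = "matrix_inv (covariance \<mu>) *v real_vec x"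
  have "?v \<bullet> (covariance \<mu> *v ?v) = N2 x" by (simp add: inv_A dual_form_def inner_commute)
  then show ?thesis
    using covariance_bilinear_has_sum[of ?v ?v] by (simp add: polar_def inner_commute power2_eq_square mult.assoc)
qed

text \<open>The Green function decays like \<open>N2 powr (- 2 * expo)\<close>, so its square root decays like
  \<open>N2 powr (- expo)\<close>.\<close>

definition expo :: real where "expo = (real CARD('d) - 2) / 4"

lemma expo_pos: "0 < expo"
  using card3 by (simp add: expo_def)

definition newton :: "real \<Rightarrow> int ^ 'd \<Rightarrow> real" where
  "newton J x = J * N2 x powr (- (2 * expo))"

lemma N2_bounds: "\<exists>c>0. \<exists>C>0. \<forall>x. c * (norm (real_vec x))\<^sup>2 \<le> N2 x \<and> N2 x \<le> C * (norm (real_vec x))\<^sup>2 \<and>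
    (\<forall>y. \<bar>polar x y\<bar> \<le> C * norm (real_vec x) * norm (real_vec y))"
proof -
  obtain c where c: "0 < c" "\<And>x. c * (norm x)\<^sup>2 \<le> dual_form x" using dual_form_bounds(1) by blast
  obtain C where C: "0 < C" "\<And>x. dual_form x \<le> C * (norm x)\<^sup>2" using dual_form_bounds(2) by blast
  obtain K where K: "0 < K" "\<And>x. norm (matrix_inv (covariance \<mu>) *v x) \<le> K * norm x" using matrix_bound by blast
  have "\<bar>polar x y\<bar> \<le> (C + K) * norm (real_vec x) * norm (real_vec y)" for x y
  proof -
    have "\<bar>polar x y\<bar> \<le> norm (matrix_inv (covariance \<mu>) *v real_vec x) * norm (real_vec y)"
      unfolding polar_def by (rule Cauchy_Schwarz_ineq2)
    also have "\<dots> \<le> (K * norm (real_vec x)) * norm (real_vec y)" by (intro mult_right_mono K) auto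
    also have "\<dots> \<le> ((C + K) * norm (real_vec x)) * norm (real_vec y)" using C(1) by (intro mult_right_mono) auto
    finally show ?thesis .
  qed
  moreover have "N2 x \<le> (C + K) * (norm (real_vec x))\<^sup>2" for x
    by (rule order_trans[OF C(2)]) (use K(1) in \<open>auto intro!: mult_right_mono\<close>)
  ultimately show ?thesis using c C(1) K(1) by (intro exI[of _ c] conjI exI[of _ "C + K"]) auto
qed

text \<open>The Fourier transform of the model kernel differs from the Newtonian kernel by \<open>O(|x|\<^sup>-\<^sup>2\<^sup>d)\<close>,
  so the triangle inequality suffices to bound its differences.\<close>

lemma potential_newton:
  "\<exists>J>0. \<exists>C\<ge>0. \<exists>R\<ge>1. \<forall>x. R \<le> norm (real_vec x) \<longrightarrow>
     \<bar>potential x - newton J x\<bar> \<le> C / norm (real_vec x) ^ CARD('d) \<and>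
     (\<forall>y. norm (real_vec y) \<le> norm (real_vec x) / 2 \<longrightarrow>
       \<bar>(potential (x + y) - newton J (x + y)) - (potential x - newton J x)\<bar>
         \<le> C * norm (real_vec y) / norm (real_vec x) ^ (CARD('d) + 1))"
proof -
  let ?n = "CARD('d)"
  obtain J C0 where J: "0 < J" and C0: "\<And>v. v \<noteq> 0 \<Longrightarrow>
    \<bar>(LINT \<xi>|lborel. cos (v \<bullet> \<xi>) * regular_kernel \<xi>) - J * dual_form v powr (1 - real ?n / 2)\<bar> \<le> C0 / dual_form v ^ ?n"
    using regular_kernel_asymptotics[OF card3 order_refl] by blast
  obtain C1 R1 where C1: "\<And>x. R1 \<le> norm (real_vec x) \<Longrightarrow> \<bar>error x\<bar> \<le> C1 / norm (real_vec x) ^ ?n"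
    using error_bound by blast
  obtain C2 R2 where C2: "\<And>x y. R2 \<le> norm (real_vec x) \<Longrightarrow> norm (real_vec y) \<le> norm (real_vec x) / 2 \<Longrightarrow>
     \<bar>error (x + y) - error x\<bar> \<le> C2 * norm (real_vec y) / norm (real_vec x) ^ (?n + 1)"
    using error_difference_bound by blast
  obtain c where c: "0 < c" "\<And>x. c * (norm x)\<^sup>2 \<le> dual_form x" using dual_form_bounds(1) by blast
  define f where "f x = (LINT \<xi>|lborel. cos (real_vec x \<bullet> \<xi>) * regular_kernel \<xi>) - newton J x" for x
  define C3 where "C3 = \<bar>C0\<bar> / c ^ ?n"
  have C3: "0 \<le> C3" using c(1) by (simp add: C3_def)
  have e: "1 - real ?n / 2 = - (2 * expo)" by (simp add: expo_def field_simps)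
  have f: "\<bar>f x\<bar> \<le> C3 / norm (real_vec x) ^ (2 * ?n)" if "x \<noteq> 0" for x
  proof -
    have nx: "0 < norm (real_vec x)" using that by simp
    have "\<bar>f x\<bar> \<le> C0 / N2 x ^ ?n" unfolding f_def newton_def e[symmetric] by (rule C0) (use that in simp)
    also have "\<dots> \<le> \<bar>C0\<bar> / (c * (norm (real_vec x))\<^sup>2) ^ ?n"
      using c nx by (intro frac_le power_mono zero_less_power) auto
    also have "\<dots> = C3 / norm (real_vec x) ^ (2 * ?n)" by (simp add: C3_def power_mult_distrib power_mult)
    finally show ?thesis .
  qed
  have pot: "potential x - newton J x = error x + f x" for x by (simp add: f_def error_def)
  define C where "C = \<bar>C1\<bar> + \<bar>C2\<bar> + C3 * 2 ^ (2 * ?n) + C3"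
  define R where "R = max 1 (max R1 R2)"
  show ?thesis
  proof (rule exI[of _ J], intro conjI J, rule exI[of _ C], intro conjI, goal_cases)
    case 1 then show ?case using C3 by (simp add: C_def)
  next
    case 2
    show ?case
    proof (rule exI[of _ R], intro conjI allI impI, goal_cases)
      case 1 then show ?case by (simp add: R_def)
    next
      case (2 x)
      then have X: "1 \<le> norm (real_vec x)" "R1 \<le> norm (real_vec x)" by (auto simp: R_def)
      then have x0: "x \<noteq> 0" by auto
      have p: "norm (real_vec x) ^ ?n \<le> norm (real_vec x) ^ (2 * ?n)" using X(1) by (intro power_increasing) auto
      have "\<bar>error x + f x\<bar> \<le> \<bar>C1\<bar> / norm (real_vec x) ^ ?n + C3 / norm (real_vec x) ^ ?n"
      proof (rule order_trans[OF abs_triangle_ineq], rule add_mono)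
        show "\<bar>error x\<bar> \<le> \<bar>C1\<bar> / norm (real_vec x) ^ ?n"
          by (rule order_trans[OF C1[OF X(2)]]) (auto intro!: divide_right_mono)
        show "\<bar>f x\<bar> \<le> C3 / norm (real_vec x) ^ ?n"
          by (rule order_trans[OF f[OF x0]]) (use p X(1) C3 in \<open>intro frac_le zero_less_power; linarith\<close>)
      qed
      also have "\<dots> \<le> C / norm (real_vec x) ^ ?n"
        unfolding add_divide_distrib[symmetric] using C3 by (intro divide_right_mono) (auto simp: C_def)
      finally show ?case unfolding pot .
    next
      case (3 x y)
      then have X: "1 \<le> norm (real_vec x)" "R2 \<le> norm (real_vec x)" by (auto simp: R_def)
      let ?X = "norm (real_vec x)" and ?Y = "norm (real_vec y)"
      show ?case
      proof (cases "y = 0")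
        case False
        have x0: "x \<noteq> 0" using X by auto
        have Y: "1 \<le> ?Y" by (rule norm_real_vec_ge_1[OF False])
        have "?X \<le> norm (real_vec (x + y)) + ?Y"
          by simp (metis add_diff_cancel norm_triangle_ineq4)
        then have XY: "?X / 2 \<le> norm (real_vec (x + y))" using 3 by linarith
        then have xy0: "x + y \<noteq> 0" using X(1) by (metis divide_pos_pos less_le_trans linorder_not_le norm_zero real_vec_simps(1) zero_less_numeral zero_less_one)
        have p: "?X ^ (?n + 1) \<le> ?X ^ (2 * ?n)" using X(1) card3 by (intro power_increasing) auto
        have pos: "0 < ?X ^ (?n + 1)" using X(1) by (intro zero_less_power) linarith
        have f1: "\<bar>f x\<bar> \<le> C3 * ?Y / ?X ^ (?n + 1)"
        proof -
          have "\<bar>f x\<bar> \<le> C3 / ?X ^ (2 * ?n)" by (rule f[OF x0])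
          also have "\<dots> \<le> (C3 * ?Y) / ?X ^ (?n + 1)"
            using p pos C3 Y mult_left_mono[OF Y C3] by (intro frac_le) auto
          finally show ?thesis .
        qed
        have f2: "\<bar>f (x + y)\<bar> \<le> C3 * 2 ^ (2 * ?n) * ?Y / ?X ^ (?n + 1)"
        proof -
          have "\<bar>f (x + y)\<bar> \<le> C3 / norm (real_vec (x + y)) ^ (2 * ?n)" by (rule f[OF xy0])
          also have "\<dots> \<le> C3 / (?X / 2) ^ (2 * ?n)"
            using XY X(1) C3 by (intro divide_left_mono power_mono mult_pos_pos zero_less_power) auto
          also have "\<dots> = C3 * 2 ^ (2 * ?n) / ?X ^ (2 * ?n)" by (simp add: power_divide)
          also have "\<dots> \<le> (C3 * 2 ^ (2 * ?n) * ?Y) / ?X ^ (?n + 1)"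
            using p pos C3 Y mult_left_mono[OF Y, of "C3 * 2 ^ (2 * ?n)"] by (intro frac_le) auto
          finally show ?thesis .
        qed
        have e1: "\<bar>error (x + y) - error x\<bar> \<le> \<bar>C2\<bar> * ?Y / ?X ^ (?n + 1)"
          by (rule order_trans[OF C2[OF X(2) 3(2)]]) (auto intro!: divide_right_mono mult_right_mono)
        have "\<bar>(error (x + y) + f (x + y)) - (error x + f x)\<bar> \<le> \<bar>error (x + y) - error x\<bar> + \<bar>f (x + y)\<bar> + \<bar>f x\<bar>" by linarith
        also have "\<dots> \<le> \<bar>C2\<bar> * ?Y / ?X ^ (?n + 1) + C3 * 2 ^ (2 * ?n) * ?Y / ?X ^ (?n + 1) + C3 * ?Y / ?X ^ (?n + 1)"
          by (intro add_mono e1 f1 f2)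
        also have "\<dots> = (\<bar>C2\<bar> + C3 * 2 ^ (2 * ?n) + C3) * ?Y / ?X ^ (?n + 1)"
          by (simp only: distrib_right add_divide_distrib)
        also have "\<dots> \<le> C * ?Y / ?X ^ (?n + 1)"
          using pos by (intro divide_right_mono mult_right_mono) (auto simp: C_def)
        finally show ?thesis unfolding pot .
      qed simp
    qed
  qed
qed

lemma N2_nonneg: "0 \<le> N2 x"
  by (simp flip: norm_S)

lemma potential_pos: "0 < potential x"
proof -
  have "0 < M / torus_volume TYPE('d)" using M_pos torus_volume_pos[where 'd='d] by simp
  then show ?thesis using green_pos[of x] unfolding green_eq by (simp only: zero_less_mult_pos)
qed

lemma potential_bounded: "\<exists>B>0. \<forall>x. potential x \<le> B"
proof -
  obtain C where C: "green \<mu> x \<le> C" for x using G_bounded by blast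
  define k where "k = M / torus_volume TYPE('d)"
  have k: "0 < k" using M_pos torus_volume_pos[where 'd='d] by (simp add: k_def)
  have "potential x \<le> \<bar>C\<bar> / k + 1" for x
  proof -
    have "k * potential x \<le> \<bar>C\<bar>" using C[of x] unfolding green_eq k_def by linarith
    then have "potential x \<le> \<bar>C\<bar> / k" using k by (simp add: pos_le_divide_eq mult.commute)
    then show ?thesis by simp
  qed
  moreover have "0 < \<bar>C\<bar> / k + 1" using k by (simp add: add_nonneg_pos)
  ultimately show ?thesis by blast
qed

lemma potential_lower:
  "\<exists>a>0. \<exists>R\<ge>1. \<forall>x. R \<le> norm (real_vec x) \<longrightarrow> a / norm (real_vec x) ^ (CARD('d) - 2) \<le> potential x"
proof -
  let ?n = "CARD('d)"
  obtain c C where C: "0 < C" "\<And>x. N2 x \<le> C * (norm (real_vec x))\<^sup>2" and c: "0 < c" "\<And>x. c * (norm (real_vec x))\<^sup>2 \<le> N2 x"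
    using N2_bounds by blast
  obtain J E R where J: "0 < J" and E: "0 \<le> E" and R: "1 \<le> R"
    and bd: "\<And>x. R \<le> norm (real_vec x) \<Longrightarrow> \<bar>potential x - newton J x\<bar> \<le> E / norm (real_vec x) ^ ?n"
    using potential_newton by metis
  define a where "a = J * C powr (- (2 * expo))"
  have a: "0 < a" using J C(1) by (simp add: a_def)
  define R' where "R' = max R (1 + 2 * E / a)"
  have "a / 2 / norm (real_vec x) ^ (?n - 2) \<le> potential x" if x: "R' \<le> norm (real_vec x)" for x
  proof -
    let ?X = "norm (real_vec x)"
    have X: "1 \<le> ?X" "R \<le> ?X" "1 + 2 * E / a \<le> ?X" using x R by (auto simp: R'_def)
    have N: "0 < N2 x" using c(1) X(1) by (intro less_le_trans[OF _ c(2)]) (auto intro!: mult_pos_pos simp flip: zero_less_norm_iff)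
    have e: "2 * expo = real (?n - 2) / 2" using card3 by (simp add: expo_def of_nat_diff)
    have "(?X\<^sup>2) powr (- (2 * expo)) = 1 / ?X ^ (?n - 2)"
    proof -
      have X0: "0 < ?X" using X(1) by linarith
      then have "(?X\<^sup>2) powr (- (2 * expo)) = (?X powr 2) powr (- (2 * expo))" by (simp add: powr_numeral)
      also have "\<dots> = ?X powr (- real (?n - 2))" unfolding powr_powr e by simp
      also have "\<dots> = 1 / ?X ^ (?n - 2)" unfolding powr_minus_divide powr_realpow[OF X0] ..
      finally show ?thesis .
    qed
    then have "a / ?X ^ (?n - 2) = J * (C * ?X\<^sup>2) powr (- (2 * expo))"
      using C(1) by (simp add: a_def powr_mult)
    also have "\<dots> \<le> newton J x"
      unfolding newton_def using J N C(2)[of x] expo_pos by (intro mult_left_mono powr_mono2') auto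
    finally have nw: "a / ?X ^ (?n - 2) \<le> newton J x" .
    have "?n = (?n - 2) + 2" using card3 by simp
    then have pw: "?X ^ ?n = ?X ^ (?n - 2) * ?X\<^sup>2" by (metis power_add)
    have "2 * E / a \<le> ?X\<^sup>2" using X(1,3) mult_right_mono[OF X(1), of ?X] by (simp add: power2_eq_square)
    then have "E \<le> a / 2 * ?X\<^sup>2" using a by (simp add: field_simps)
    then have "E / ?X ^ ?n \<le> (a / 2 * ?X\<^sup>2) / ?X ^ ?n" by (intro divide_right_mono) auto
    also have "\<dots> = a / 2 / ?X ^ (?n - 2)" unfolding pw using X(1) by auto
    finally have "\<bar>potential x - newton J x\<bar> \<le> a / 2 / ?X ^ (?n - 2)" using bd[OF X(2)] by linarith
    moreover have "a / ?X ^ (?n - 2) = a / 2 / ?X ^ (?n - 2) + a / 2 / ?X ^ (?n - 2)" by (simp add: field_simps)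
    ultimately show ?thesis using nw by linarith
  qed
  moreover have "1 \<le> R'" using R by (simp add: R'_def)
  ultimately show ?thesis using a by (intro exI[of _ "a / 2"] conjI exI[of _ R']) auto
qed

text \<open>Let \<open>E\<close> be the difference between the potential and the Newtonian kernel, and let \<open>\<rho>\<close> be the
  ratio of the Newtonian kernels at \<open>x + y\<close> and \<open>x\<close>. Then the ratio of the potentials differs from
  \<open>\<rho>\<close> by \<open>((E (x + y) - E x) + (1 - \<rho>) * E x) / potential x\<close>. The relative size of \<open>E\<close> is \<open>|x|\<^sup>-\<^sup>2\<close>, and
  each summand contributes a further factor \<open>|y| / |x|\<close>.\<close>

lemma sqrt_ratio:
  "\<exists>\<delta>>0. \<delta> \<le> 1 / 2 \<and> (\<exists>K\<ge>0. \<exists>R\<ge>1. \<forall>x y. R \<le> norm (real_vec x) \<longrightarrow> norm (real_vec y) \<le> \<delta> * norm (real_vec x) \<longrightarrow>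
     \<bar>(2 * polar x y + N2 y) / N2 x\<bar> \<le> 1 / 2 \<and>
     \<bar>(2 * polar x y + N2 y) / N2 x\<bar> \<le> K * (norm (real_vec y) / norm (real_vec x)) \<and>
     \<bar>sqrt (potential (x + y) / potential x) - (1 + (2 * polar x y + N2 y) / N2 x) powr (- expo)\<bar>
       \<le> K * (norm (real_vec y) / norm (real_vec x) ^ 3))"
proof -
  let ?n = "CARD('d)"
  obtain c C where C: "0 < C" "\<And>x. N2 x \<le> C * (norm (real_vec x))\<^sup>2" and c: "0 < c" "\<And>x. c * (norm (real_vec x))\<^sup>2 \<le> N2 x"
    and pol: "\<And>x y. \<bar>polar x y\<bar> \<le> C * norm (real_vec x) * norm (real_vec y)"
    using N2_bounds by blast
  obtain J E R1 where J: "0 < J" and E: "0 \<le> E" and R1: "1 \<le> R1"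
    and bd: "\<And>x. R1 \<le> norm (real_vec x) \<Longrightarrow> \<bar>potential x - newton J x\<bar> \<le> E / norm (real_vec x) ^ ?n"
    and bdd: "\<And>x y. R1 \<le> norm (real_vec x) \<Longrightarrow> norm (real_vec y) \<le> norm (real_vec x) / 2 \<Longrightarrow>
       \<bar>(potential (x + y) - newton J (x + y)) - (potential x - newton J x)\<bar> \<le> E * norm (real_vec y) / norm (real_vec x) ^ (?n + 1)"
    using potential_newton by metis
  obtain a R2 where a: "0 < a" and R2: "1 \<le> R2"
    and low: "\<And>x. R2 \<le> norm (real_vec x) \<Longrightarrow> a / norm (real_vec x) ^ (?n - 2) \<le> potential x"
    using potential_lower by metis
  have p2: "0 < 2 * expo" using expo_pos by simp
  obtain T where T: "0 \<le> T" "\<And>s. \<bar>s\<bar> \<le> 1 / 2 \<Longrightarrow> \<bar>1 - (1 + s) powr (- (2 * expo))\<bar> \<le> T * \<bar>s\<bar>"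
    using powr_taylor[OF p2] by blast
  define K1 where "K1 = 3 * C / c"
  have K1: "0 < K1" using c(1) C(1) by (simp add: K1_def)
  define \<delta> where "\<delta> = min (1 / 2) (1 / (2 * K1))"
  have \<delta>: "0 < \<delta>" "\<delta> \<le> 1 / 2" "K1 * \<delta> \<le> 1 / 2"
  proof -
    show "0 < \<delta>" "\<delta> \<le> 1 / 2" using K1 by (auto simp: \<delta>_def)
    have "K1 * \<delta> \<le> K1 * (1 / (2 * K1))" using K1 by (intro mult_left_mono) (auto simp: \<delta>_def)
    then show "K1 * \<delta> \<le> 1 / 2" using K1 by simp
  qed
  define d where "d = (3 / 2 :: real) powr (- (2 * expo))"
  have d: "0 < d" by (simp add: d_def)
  define K where "K = K1 + (E + T * K1 * E) / a / sqrt d"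
  have K: "K1 \<le> K" "(E + T * K1 * E) / a / sqrt d \<le> K" "0 \<le> K"
    using K1 E T(1) a d by (auto simp: K_def intro!: add_nonneg_nonneg divide_nonneg_pos mult_nonneg_nonneg)
  have main: "\<bar>(2 * polar x y + N2 y) / N2 x\<bar> \<le> 1 / 2 \<and>
     \<bar>(2 * polar x y + N2 y) / N2 x\<bar> \<le> K * (norm (real_vec y) / norm (real_vec x)) \<and>
     \<bar>sqrt (potential (x + y) / potential x) - (1 + (2 * polar x y + N2 y) / N2 x) powr (- expo)\<bar>
       \<le> K * (norm (real_vec y) / norm (real_vec x) ^ 3)"
    if x: "max R1 R2 \<le> norm (real_vec x)" and y: "norm (real_vec y) \<le> \<delta> * norm (real_vec x)" for x y
  proof -
    let ?X = "norm (real_vec x)" and ?Y = "norm (real_vec y)"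
    define s where "s = (2 * polar x y + N2 y) / N2 x"
    have X: "1 \<le> ?X" "R1 \<le> ?X" "R2 \<le> ?X" using x R1 by auto
    then have X0: "0 < ?X" by linarith
    have "\<delta> * ?X \<le> 1 / 2 * ?X" using \<delta>(2) by (intro mult_right_mono) auto
    then have Yh: "?Y \<le> ?X / 2" using y by linarith
    then have YX: "?Y \<le> ?X" using X0 by linarith
    have cX: "0 < c * ?X\<^sup>2" using c(1) X0 by simp
    then have N: "0 < N2 x" using c(2)[of x] by linarith
    have "\<bar>2 * polar x y + N2 y\<bar> \<le> 2 * (C * ?X * ?Y) + C * ?Y\<^sup>2"
      using pol[of x y] C(2)[of y] N2_nonneg[of y] unfolding abs_le_iff by linarith
    also have "C * ?Y\<^sup>2 \<le> C * (?X * ?Y)" using C(1) YX by (auto simp: power2_eq_square intro!: mult_left_mono mult_right_mono)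
    finally have "\<bar>2 * polar x y + N2 y\<bar> \<le> 3 * C * (?X * ?Y)" by (simp add: algebra_simps)
    then have "\<bar>s\<bar> \<le> 3 * C * (?X * ?Y) / (c * ?X\<^sup>2)"
      unfolding s_def abs_divide using cX c(2)[of x] N C(1) by (intro frac_le) auto
    also have "\<dots> = K1 * (?Y / ?X)" using X0 c(1) by (simp add: K1_def power2_eq_square)
    finally have s1: "\<bar>s\<bar> \<le> K1 * (?Y / ?X)" .
    have "?Y / ?X \<le> \<delta>" using y X0 by (simp add: pos_divide_le_eq)
    then have s2: "\<bar>s\<bar> \<le> 1 / 2"
      using s1 \<delta>(3) mult_left_mono[of "?Y / ?X" \<delta> K1] K1 by linarith
    then have s3: "0 < 1 + s" by linarith
    define \<rho> where "\<rho> = (1 + s) powr (- (2 * expo))"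
    have "N2 x * (1 + s) = N2 x + (2 * polar x y + N2 y)" 
      unfolding s_def distrib_left using N by simp
    then have "N2 (x + y) = N2 x * (1 + s)" using N2_add[of x y] by linarith
    then have nw: "newton J (x + y) = newton J x * \<rho>"
      using N s3 by (simp add: newton_def \<rho>_def powr_mult)
    have P: "0 < potential x" "0 \<le> potential (x + y)" using potential_pos[of x] potential_pos[of "x + y"] by auto
    have r: "potential (x + y) / potential x - \<rho> =
        (((potential (x + y) - newton J (x + y)) - (potential x - newton J x)) + (1 - \<rho>) * (potential x - newton J x)) / potential x"
      using P(1) unfolding nw by (simp add: field_simps)
    have "\<bar>potential (x + y) / potential x - \<rho>\<bar> \<le> (E * ?Y / ?X ^ (?n + 1) + (T * (K1 * (?Y / ?X))) * (E / ?X ^ ?n)) / (a / ?X ^ (?n - 2))"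
    proof -
      have "\<bar>1 - \<rho>\<bar> \<le> T * (K1 * (?Y / ?X))"
        unfolding \<rho>_def by (rule order_trans[OF T(2)[OF s2] mult_left_mono[OF s1 T(1)]])
      then have "\<bar>(1 - \<rho>) * (potential x - newton J x)\<bar> \<le> (T * (K1 * (?Y / ?X))) * (E / ?X ^ ?n)"
        unfolding abs_mult using T(1) K1 X0 by (intro mult_mono bd[OF X(2)]) auto
      then have "\<bar>((potential (x + y) - newton J (x + y)) - (potential x - newton J x)) + (1 - \<rho>) * (potential x - newton J x)\<bar>
          \<le> E * ?Y / ?X ^ (?n + 1) + (T * (K1 * (?Y / ?X))) * (E / ?X ^ ?n)"
        using bdd[OF X(2) Yh] by linarith
      moreover have "0 \<le> E * ?Y / ?X ^ (?n + 1) + (T * (K1 * (?Y / ?X))) * (E / ?X ^ ?n)"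
        using E T(1) K1 X0 by (intro add_nonneg_nonneg mult_nonneg_nonneg divide_nonneg_pos) auto
      moreover have "0 < a / ?X ^ (?n - 2)" using a X0 by simp
      ultimately show ?thesis
        unfolding r abs_divide using P(1) low[OF X(3)] by (intro frac_le) auto
    qed
    also have "\<dots> = (E + T * K1 * E) / a * (?Y / ?X ^ 3)"
    proof -
      obtain k where k: "?n = k + 2" using card3 by (intro that[of "?n - 2"]) simp
      show ?thesis unfolding k using X0 a by (simp add: field_simps eval_nat_numeral)
    qed
    finally have rr: "\<bar>potential (x + y) / potential x - \<rho>\<bar> \<le> (E + T * K1 * E) / a * (?Y / ?X ^ 3)" .
    have dr: "d \<le> \<rho>" unfolding d_def \<rho>_def using s2 expo_pos s3 by (intro powr_mono2') auto
    have sq: "sqrt \<rho> = (1 + s) powr (- expo)"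
    proof (rule real_sqrt_unique)
      show "((1 + s) powr (- expo))\<^sup>2 = \<rho>" using s3 by (simp add: \<rho>_def power2_eq_square powr_add[symmetric])
    qed simp
    have "\<bar>sqrt (potential (x + y) / potential x) - sqrt \<rho>\<bar> \<le> \<bar>potential (x + y) / potential x - \<rho>\<bar> / sqrt d"
      using P d dr by (intro sqrt_diff_le) auto
    also have "\<dots> \<le> (E + T * K1 * E) / a * (?Y / ?X ^ 3) / sqrt d" using d rr by (intro divide_right_mono) auto
    also have "\<dots> = (E + T * K1 * E) / a / sqrt d * (?Y / ?X ^ 3)" by simp
    also have "\<dots> \<le> K * (?Y / ?X ^ 3)" using K(2) by (intro mult_right_mono) auto
    finally have 3: "\<bar>sqrt (potential (x + y) / potential x) - (1 + s) powr (- expo)\<bar> \<le> K * (?Y / ?X ^ 3)" unfolding sq .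
    have "K1 * (?Y / ?X) \<le> K * (?Y / ?X)" using K(1) by (intro mult_right_mono) auto
    then show ?thesis using 3 s1 s2 unfolding s_def by auto
  qed
  have "1 \<le> max R1 R2" using R1 by simp
  then show ?thesis using \<delta>(1,2) K(3) main by blast
qed

definition increment :: "int ^ 'd \<Rightarrow> int ^ 'd \<Rightarrow> real" where
  "increment x y = 1 - sqrt (potential (x + y) / potential x)"

text \<open>In the expansion of \<open>increment x y\<close> in powers of \<open>|y| / |x|\<close>, the term of first order is
  \<open>expo * slope x y\<close>, and the term of second order is \<open>curvature x y\<close>. The former is odd in \<open>y\<close>, the
  latter even.\<close>

definition slope :: "int ^ 'd \<Rightarrow> int ^ 'd \<Rightarrow> real" where
  "slope x y = 2 * polar x y / N2 x"

definition curvature :: "int ^ 'd \<Rightarrow> int ^ 'd \<Rightarrow> real" where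
  "curvature x y = expo * (N2 y / N2 x) - expo * (expo + 1) / 2 * (slope x y)\<^sup>2"

lemma slope_curvature_bounds:
  "\<exists>K\<ge>0. \<forall>x y. x \<noteq> 0 \<longrightarrow>
     \<bar>slope x y\<bar> \<le> K * (norm (real_vec y) / norm (real_vec x)) \<and>
     \<bar>N2 y / N2 x\<bar> \<le> K * (norm (real_vec y) / norm (real_vec x))\<^sup>2 \<and>
     \<bar>curvature x y\<bar> \<le> (expo * K + expo * (expo + 1) / 2 * K\<^sup>2) * (norm (real_vec y) / norm (real_vec x))\<^sup>2"
proof -
  obtain c C where C: "0 < C" "\<And>x. N2 x \<le> C * (norm (real_vec x))\<^sup>2" and c: "0 < c" "\<And>x. c * (norm (real_vec x))\<^sup>2 \<le> N2 x"
    and pol: "\<And>x y. \<bar>polar x y\<bar> \<le> C * norm (real_vec x) * norm (real_vec y)"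
    using N2_bounds by blast
  define K where "K = 2 * C / c"
  have K: "0 \<le> K" using C(1) c(1) by (simp add: K_def)
  have "\<bar>slope x y\<bar> \<le> K * (norm (real_vec y) / norm (real_vec x)) \<and>
     \<bar>N2 y / N2 x\<bar> \<le> K * (norm (real_vec y) / norm (real_vec x))\<^sup>2 \<and>
     \<bar>curvature x y\<bar> \<le> (expo * K + expo * (expo + 1) / 2 * K\<^sup>2) * (norm (real_vec y) / norm (real_vec x))\<^sup>2"
    if "x \<noteq> 0" for x y
  proof -
    let ?X = "norm (real_vec x)" and ?Y = "norm (real_vec y)"
    have X: "0 < ?X" using that by simp
    have cX: "0 < c * ?X\<^sup>2" using c(1) X by simp
    then have N: "0 < N2 x" using c(2)[of x] by linarith
    have 1: "\<bar>slope x y\<bar> \<le> K * (?Y / ?X)"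
    proof -
      have "\<bar>slope x y\<bar> = 2 * \<bar>polar x y\<bar> / N2 x" using N by (simp add: slope_def abs_divide abs_mult)
      also have "\<dots> \<le> 2 * (C * ?X * ?Y) / (c * ?X\<^sup>2)" using cX c(2)[of x] C(1) pol[of x y] by (intro frac_le) auto
      also have "\<dots> = K * (?Y / ?X)" using X c(1) by (simp add: K_def power2_eq_square)
      finally show ?thesis .
    qed
    have 2: "\<bar>N2 y / N2 x\<bar> \<le> K * (?Y / ?X)\<^sup>2"
    proof -
      have "C * ?Y\<^sup>2 \<le> 2 * C * ?Y\<^sup>2" using C(1) by (intro mult_right_mono) auto
      then have "N2 y \<le> 2 * C * ?Y\<^sup>2" using C(2)[of y] by linarith
      then have "N2 y / N2 x \<le> 2 * C * ?Y\<^sup>2 / (c * ?X\<^sup>2)" using cX c(2)[of x] C(1) by (intro frac_le) auto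
      also have "\<dots> = K * (?Y / ?X)\<^sup>2" using X c(1) by (simp add: K_def power_divide)
      finally show ?thesis using N N2_nonneg[of y] by simp
    qed
    have "(slope x y)\<^sup>2 \<le> (K * (?Y / ?X))\<^sup>2" using 1 by (metis abs_ge_zero power2_abs power_mono)
    then have "\<bar>expo * (expo + 1) / 2 * (slope x y)\<^sup>2\<bar> \<le> expo * (expo + 1) / 2 * (K\<^sup>2 * (?Y / ?X)\<^sup>2)"
      using expo_pos by (simp only: abs_mult abs_of_nonneg power_mult_distrib) (simp add: mult_left_mono)
    moreover have "\<bar>expo * (N2 y / N2 x)\<bar> \<le> expo * (K * (?Y / ?X)\<^sup>2)"
      unfolding abs_mult using expo_pos mult_left_mono[OF 2, of expo] by (simp only: abs_of_pos less_imp_le)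
    ultimately have "\<bar>curvature x y\<bar> \<le> expo * (K * (?Y / ?X)\<^sup>2) + expo * (expo + 1) / 2 * (K\<^sup>2 * (?Y / ?X)\<^sup>2)"
      unfolding curvature_def by (rule order_trans[OF abs_triangle_ineq4 add_mono, rotated])
    then show ?thesis using 1 2 by (simp add: distrib_right)
  qed
  then show ?thesis using K by blast
qed

text \<open>The binomial expansion of \<open>(1 + s) powr (- expo)\<close> with \<open>s = slope x y + N2 y / N2 x\<close>. The error
  from \<open>sqrt_ratio\<close> is of third order in \<open>|y| / |x|\<close> because \<open>|y| \<ge> 1\<close>.\<close>

lemma increment_near:
  "\<exists>\<delta>>0. \<delta> \<le> 1 \<and> (\<exists>K\<ge>0. \<exists>R\<ge>1. \<forall>x y. R \<le> norm (real_vec x) \<longrightarrow> y \<noteq> 0 \<longrightarrow> norm (real_vec y) \<le> \<delta> * norm (real_vec x) \<longrightarrow>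
     \<bar>(increment x y)\<^sup>2 - expo\<^sup>2 * (slope x y)\<^sup>2 - 2 * expo * slope x y * curvature x y\<bar>
       \<le> K * (norm (real_vec y) / norm (real_vec x)) ^ 4)"
proof -
  obtain \<delta> K1 R where \<delta>: "0 < \<delta>" "\<delta> \<le> 1 / 2" and K1: "0 \<le> K1" and R: "1 \<le> R"
    and s_half: "\<And>x y. R \<le> norm (real_vec x) \<Longrightarrow> norm (real_vec y) \<le> \<delta> * norm (real_vec x) \<Longrightarrow> \<bar>(2 * polar x y + N2 y) / N2 x\<bar> \<le> 1 / 2"
    and s_le: "\<And>x y. R \<le> norm (real_vec x) \<Longrightarrow> norm (real_vec y) \<le> \<delta> * norm (real_vec x) \<Longrightarrow>
       \<bar>(2 * polar x y + N2 y) / N2 x\<bar> \<le> K1 * (norm (real_vec y) / norm (real_vec x))"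
    and rt: "\<And>x y. R \<le> norm (real_vec x) \<Longrightarrow> norm (real_vec y) \<le> \<delta> * norm (real_vec x) \<Longrightarrow>
       \<bar>sqrt (potential (x + y) / potential x) - (1 + (2 * polar x y + N2 y) / N2 x) powr (- expo)\<bar>
       \<le> K1 * (norm (real_vec y) / norm (real_vec x) ^ 3)"
    using sqrt_ratio by metis
  obtain T where T: "0 \<le> T" "\<And>s. \<bar>s\<bar> \<le> 1 / 2 \<Longrightarrow>
      \<bar>(1 - (1 + s) powr (- expo)) - (expo * s - expo * (expo + 1) / 2 * s\<^sup>2)\<bar> \<le> T * \<bar>s\<bar> ^ 3"
    using powr_taylor[OF expo_pos] by blast
  obtain K2 where K2: "0 \<le> K2"
    and sl: "\<And>x y. x \<noteq> 0 \<Longrightarrow> \<bar>slope x y\<bar> \<le> K2 * (norm (real_vec y) / norm (real_vec x))"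
    and nu: "\<And>x y. x \<noteq> 0 \<Longrightarrow> \<bar>N2 y / N2 x\<bar> \<le> K2 * (norm (real_vec y) / norm (real_vec x))\<^sup>2"
    and cu: "\<And>x y. x \<noteq> 0 \<Longrightarrow> \<bar>curvature x y\<bar> \<le> (expo * K2 + expo * (expo + 1) / 2 * K2\<^sup>2) * (norm (real_vec y) / norm (real_vec x))\<^sup>2"
    using slope_curvature_bounds by metis
  define e0 where "e0 = expo * (expo + 1) / 2"
  have e0: "0 \<le> e0" using expo_pos by (simp add: e0_def)
  define b where "b = expo * K2 + e0 * K2\<^sup>2"
  have b: "0 \<le> b" using expo_pos K2 e0 by (simp add: b_def)
  define c where "c = T * K1 ^ 3 + K1 + e0 * (3 * K2\<^sup>2)"
  have c: "0 \<le> c" using T(1) K1 e0 by (simp add: c_def)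
  define K where "K = b\<^sup>2 + 2 * (expo * K2 + b) * c + c\<^sup>2"
  have K: "0 \<le> K" using b c expo_pos K2 by (simp add: K_def)
  have main: "\<bar>(increment x y)\<^sup>2 - expo\<^sup>2 * (slope x y)\<^sup>2 - 2 * expo * slope x y * curvature x y\<bar>
       \<le> K * (norm (real_vec y) / norm (real_vec x)) ^ 4"
    if x: "R \<le> norm (real_vec x)" and y0: "y \<noteq> 0" and y: "norm (real_vec y) \<le> \<delta> * norm (real_vec x)" for x y
  proof -
    let ?X = "norm (real_vec x)" and ?Y = "norm (real_vec y)"
    define t where "t = ?Y / ?X"
    define s where "s = (2 * polar x y + N2 y) / N2 x"
    define \<nu> where "\<nu> = N2 y / N2 x"
    have X: "0 < ?X" using x R by linarith
    then have x0: "x \<noteq> 0" by auto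
    have Y: "1 \<le> ?Y" by (rule norm_real_vec_ge_1[OF y0])
    have "t \<le> \<delta>" using y X by (simp add: t_def pos_divide_le_eq)
    then have t: "0 \<le> t" "t \<le> 1" using \<delta>(2) by (auto simp: t_def)
    have sa: "s = slope x y + \<nu>" by (simp add: s_def slope_def \<nu>_def add_divide_distrib)
    have e1: "\<bar>(1 - (1 + s) powr (- expo)) - (expo * s - e0 * s\<^sup>2)\<bar> \<le> T * K1 ^ 3 * t ^ 3"
    proof -
      have "\<bar>(1 - (1 + s) powr (- expo)) - (expo * s - e0 * s\<^sup>2)\<bar> \<le> T * \<bar>s\<bar> ^ 3"
        unfolding e0_def s_def by (rule T(2)[OF s_half[OF x y]])
      also have "\<dots> \<le> T * (K1 * t) ^ 3" using s_le[OF x y] T(1) unfolding s_def t_def by (intro mult_left_mono power_mono) auto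
      finally show ?thesis by (simp add: power_mult_distrib)
    qed
    have e2: "\<bar>(1 + s) powr (- expo) - sqrt (potential (x + y) / potential x)\<bar> \<le> K1 * t ^ 3"
    proof -
      have "?Y \<le> ?Y ^ 3" using power_increasing[of 1 3 ?Y] Y by simp
      then have "?Y / ?X ^ 3 \<le> t ^ 3" unfolding t_def power_divide using X by (intro divide_right_mono) auto
      then have "K1 * (?Y / ?X ^ 3) \<le> K1 * t ^ 3" using K1 by (rule mult_left_mono)
      then show ?thesis using rt[OF x y] unfolding s_def by linarith
    qed
    have e3: "\<bar>e0 * (2 * (slope x y * \<nu>) + \<nu> * \<nu>)\<bar> \<le> e0 * (3 * K2\<^sup>2) * t ^ 3"
    proof -
      have n: "\<bar>\<nu>\<bar> \<le> K2 * t\<^sup>2" "\<bar>slope x y\<bar> \<le> K2 * t" unfolding \<nu>_def t_def using nu[OF x0] sl[OF x0] by auto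
      have "\<bar>slope x y\<bar> * \<bar>\<nu>\<bar> \<le> (K2 * t) * (K2 * t\<^sup>2)" using n K2 t by (intro mult_mono) auto
      then have n1: "\<bar>slope x y * \<nu>\<bar> \<le> K2\<^sup>2 * t ^ 3" by (simp add: abs_mult power2_eq_square eval_nat_numeral mult.assoc mult.left_commute)
      have t4: "t ^ 4 \<le> t ^ 3" using t by (intro power_decreasing) auto
      have "\<bar>\<nu>\<bar> * \<bar>\<nu>\<bar> \<le> (K2 * t\<^sup>2) * (K2 * t\<^sup>2)" using n K2 t by (intro mult_mono) auto
      also have "\<dots> = K2\<^sup>2 * t ^ 4" by (simp add: power2_eq_square eval_nat_numeral)
      also have "\<dots> \<le> K2\<^sup>2 * t ^ 3" using t4 by (intro mult_left_mono) auto
      finally have n2: "\<bar>\<nu> * \<nu>\<bar> \<le> K2\<^sup>2 * t ^ 3" by (simp add: abs_mult)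
      have "\<bar>2 * (slope x y * \<nu>) + \<nu> * \<nu>\<bar> \<le> 3 * K2\<^sup>2 * t ^ 3" using n1 n2 by linarith
      then have "e0 * \<bar>2 * (slope x y * \<nu>) + \<nu> * \<nu>\<bar> \<le> e0 * (3 * K2\<^sup>2 * t ^ 3)" using e0 by (rule mult_left_mono)
      then show ?thesis using e0 by (simp add: abs_mult mult.assoc)
    qed
    define e where "e = increment x y - (expo * slope x y + curvature x y)"
    have "e = ((1 - (1 + s) powr (- expo)) - (expo * s - e0 * s\<^sup>2)) + ((1 + s) powr (- expo) - sqrt (potential (x + y) / potential x))
        - e0 * (2 * (slope x y * \<nu>) + \<nu> * \<nu>)"
      unfolding e_def increment_def curvature_def e0_def[symmetric] \<nu>_def[symmetric] sa
      by (simp add: power2_eq_square algebra_simps)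
    then have "\<bar>e\<bar> \<le> T * K1 ^ 3 * t ^ 3 + K1 * t ^ 3 + e0 * (3 * K2\<^sup>2) * t ^ 3"
      using e1 e2 e3 by linarith
    also have "\<dots> = c * t ^ 3" by (simp add: c_def distrib_right)
    finally have e: "\<bar>e\<bar> \<le> c * t ^ 3" .
    have "increment x y = expo * slope x y + curvature x y + e" by (simp add: e_def)
    moreover have "\<bar>curvature x y\<bar> \<le> b * t\<^sup>2" using cu[OF x0] by (simp add: b_def e0_def t_def)
    moreover have "\<bar>slope x y\<bar> \<le> K2 * t" using sl[OF x0] by (simp add: t_def)
    ultimately show ?thesis
      unfolding K_def t_def[symmetric] using square_expansion[OF t _ _ e, of "slope x y" K2 "curvature x y" b expo] expo_pos K2 b c by simp
  qed
  have "\<delta> \<le> 1" using \<delta>(2) by linarith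
  then show ?thesis using \<delta>(1) K R main by blast
qed

text \<open>If \<open>|y|\<close> is not small compared to \<open>|x|\<close>, there is no expansion, and the increment may be as large
  as \<open>|x|\<^bsup>(d - 2) / 2\<^esup>\<close>. As \<open>|y| / |x|\<close> is bounded below there, high powers of it can be inserted,
  up to the order of the moment that is finite.\<close>

lemma increment_expansion:
  "\<exists>K\<ge>0. \<exists>R\<ge>1. \<forall>x y. R \<le> norm (real_vec x) \<longrightarrow>
     \<bar>(increment x y)\<^sup>2 - expo\<^sup>2 * (slope x y)\<^sup>2 - 2 * expo * slope x y * curvature x y\<bar>
       \<le> K * (norm (real_vec y) ^ (CARD('d) + 3) / norm (real_vec x) ^ 4)"
proof -
  let ?n = "CARD('d)"
  obtain \<delta> K1 R1 where \<delta>: "0 < \<delta>" "\<delta> \<le> 1" and K1: "0 \<le> K1" and R1: "1 \<le> R1"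
    and near: "\<And>x y. R1 \<le> norm (real_vec x) \<Longrightarrow> y \<noteq> 0 \<Longrightarrow> norm (real_vec y) \<le> \<delta> * norm (real_vec x) \<Longrightarrow>
     \<bar>(increment x y)\<^sup>2 - expo\<^sup>2 * (slope x y)\<^sup>2 - 2 * expo * slope x y * curvature x y\<bar>
       \<le> K1 * (norm (real_vec y) / norm (real_vec x)) ^ 4"
    using increment_near by metis
  obtain a R2 where a: "0 < a" and R2: "1 \<le> R2"
    and low: "\<And>x. R2 \<le> norm (real_vec x) \<Longrightarrow> a / norm (real_vec x) ^ (?n - 2) \<le> potential x"
    using potential_lower by metis
  obtain B where B: "0 < B" "\<And>x. potential x \<le> B" using potential_bounded by metis
  obtain K2 where K2: "0 \<le> K2"
    and sl: "\<And>x y. x \<noteq> 0 \<Longrightarrow> \<bar>slope x y\<bar> \<le> K2 * (norm (real_vec y) / norm (real_vec x))"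
    and cu: "\<And>x y. x \<noteq> 0 \<Longrightarrow> \<bar>curvature x y\<bar> \<le> (expo * K2 + expo * (expo + 1) / 2 * K2\<^sup>2) * (norm (real_vec y) / norm (real_vec x))\<^sup>2"
    using slope_curvature_bounds by metis
  define b where "b = expo * K2 + expo * (expo + 1) / 2 * K2\<^sup>2"
  have b: "0 \<le> b" using expo_pos K2 by (simp add: b_def)
  define D where "D = (1 / \<delta>) ^ (?n + 3)"
  have D: "0 \<le> D" using \<delta> by (simp add: D_def)
  define K3 where "K3 = (2 + 2 * (B / a) + expo\<^sup>2 * K2\<^sup>2 + 2 * expo * K2 * b) * D"
  have K3: "0 \<le> K3" using B(1) a expo_pos K2 b D by (simp add: K3_def)
  have main: "\<bar>(increment x y)\<^sup>2 - expo\<^sup>2 * (slope x y)\<^sup>2 - 2 * expo * slope x y * curvature x y\<bar>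
       \<le> (K1 + K3) * (norm (real_vec y) ^ (?n + 3) / norm (real_vec x) ^ 4)"
    if x: "max R1 R2 \<le> norm (real_vec x)" for x y
  proof -
    let ?X = "norm (real_vec x)" and ?Y = "norm (real_vec y)"
    let ?L = "\<bar>(increment x y)\<^sup>2 - expo\<^sup>2 * (slope x y)\<^sup>2 - 2 * expo * slope x y * curvature x y\<bar>"
    have X: "1 \<le> ?X" "R1 \<le> ?X" "R2 \<le> ?X" using x R1 by auto
    then have X0: "0 < ?X" by linarith
    then have x0: "x \<noteq> 0" by auto
    consider "y = 0" | "y \<noteq> 0" "?Y \<le> \<delta> * ?X" | "\<delta> * ?X < ?Y" by linarith
    then show ?thesis
    proof cases
      case 1
      then have "?L = 0" using potential_pos[of x] by (simp add: increment_def slope_def polar_def)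
      then show ?thesis using K1 K3 by simp
    next
      case 2
      have Y: "1 \<le> ?Y" by (rule norm_real_vec_ge_1[OF 2(1)])
      have "?L \<le> K1 * (?Y / ?X) ^ 4" by (rule near[OF X(2) 2])
      also have "\<dots> = K1 * (?Y ^ 4 / ?X ^ 4)" by (simp add: power_divide)
      also have "\<dots> \<le> K1 * (?Y ^ (?n + 3) / ?X ^ 4)"
        using K1 X0 Y card3 by (intro mult_left_mono divide_right_mono power_increasing) auto
      also have "\<dots> \<le> (K1 + K3) * (?Y ^ (?n + 3) / ?X ^ 4)" using K3 by (intro mult_right_mono) auto
      finally show ?thesis .
    next
      case 3
      define t where "t = ?Y / ?X"
      have t: "0 < \<delta>" "\<delta> \<le> t" "0 < t" using 3 X0 \<delta>(1) by (auto simp: t_def pos_le_divide_eq intro: less_le_trans)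
      define U where "U = D * t ^ (?n + 3)"
      have U: "t ^ k \<le> U" if "k \<le> ?n + 3" for k
      proof -
        have "1 \<le> (1 / \<delta>) ^ k" using \<delta> by (intro one_le_power) auto
        moreover have "1 \<le> (t / \<delta>) ^ (?n + 3 - k)" using t by (intro one_le_power) auto
        ultimately have "1 * 1 \<le> (1 / \<delta>) ^ k * (t / \<delta>) ^ (?n + 3 - k)" by (intro mult_mono) auto
        then have "t ^ k * 1 \<le> t ^ k * ((1 / \<delta>) ^ k * (t / \<delta>) ^ (?n + 3 - k))" using t by (intro mult_left_mono) auto
        also have "\<dots> = (t / \<delta>) ^ k * (t / \<delta>) ^ (?n + 3 - k)" by (simp add: power_divide)
        also have "\<dots> = (t / \<delta>) ^ (?n + 3)" using that by (simp flip: power_add)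
        finally show ?thesis by (simp add: U_def D_def power_divide)
      qed
      have U1: "1 \<le> U" using U[of 0] by simp
      have U2: "t\<^sup>2 \<le> U" "t ^ 3 \<le> U" by (intro U; simp)+
      define P where "P = ?X ^ (?n - 2)"
      have P: "1 \<le> P" using X(1) by (simp add: P_def one_le_power)
      have inc: "(increment x y)\<^sup>2 \<le> (2 + 2 * (B / a)) * P"
      proof -
        have pp: "0 < potential x" "0 < potential (x + y)" using potential_pos by auto
        define r where "r = potential (x + y) / potential x"
        have r: "0 \<le> r" using pp by (simp add: r_def)
        have "r \<le> B / (a / P)"
          unfolding r_def P_def using pp a B X0 low[OF X(3)] by (intro frac_le) auto
        also have "\<dots> = B / a * P" by simp
        finally have r2: "r \<le> B / a * P" .
        \<comment> \<open>the parallelogram identity for \<open>1\<close> and \<open>sqrt r\<close>\<close>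
        have "(increment x y)\<^sup>2 + (1 + sqrt r)\<^sup>2 = 2 + 2 * (sqrt r)\<^sup>2"
          by (simp add: increment_def r_def power2_eq_square algebra_simps)
        then have "(increment x y)\<^sup>2 \<le> 2 + 2 * r" 
          using r zero_le_power2[of "1 + sqrt r"] unfolding real_sqrt_pow2[OF r] by linarith
        also have "\<dots> \<le> 2 * P + 2 * (B / a * P)" using r2 P by linarith
        finally show ?thesis by (simp add: algebra_simps)
      qed
      have sl2: "expo\<^sup>2 * (slope x y)\<^sup>2 \<le> expo\<^sup>2 * K2\<^sup>2 * t\<^sup>2"
      proof -
        have "(slope x y)\<^sup>2 \<le> (K2 * t)\<^sup>2" using sl[OF x0, of y] unfolding t_def by (metis abs_ge_zero power2_abs power_mono)
        then have "expo\<^sup>2 * (slope x y)\<^sup>2 \<le> expo\<^sup>2 * (K2 * t)\<^sup>2" by (intro mult_left_mono) auto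
        then show ?thesis by (simp add: power_mult_distrib mult.assoc)
      qed
      have sc: "\<bar>2 * expo * slope x y * curvature x y\<bar> \<le> 2 * expo * K2 * b * t ^ 3"
      proof -
        have "\<bar>slope x y\<bar> * \<bar>curvature x y\<bar> \<le> (K2 * t) * (b * t\<^sup>2)"
          using sl[OF x0, of y] cu[OF x0, of y] K2 t b unfolding t_def b_def by (intro mult_mono) auto
        also have "\<dots> = K2 * b * t ^ 3" by (simp add: eval_nat_numeral)
        finally have "2 * expo * (\<bar>slope x y\<bar> * \<bar>curvature x y\<bar>) \<le> 2 * expo * (K2 * b * t ^ 3)" using expo_pos by (intro mult_left_mono) auto
        then show ?thesis using expo_pos by (simp add: abs_mult mult.assoc)
      qed
      have UP: "U \<le> U * P" "P \<le> U * P" using U1 P mult_left_mono[of 1 P U] mult_right_mono[of 1 U P] by auto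
      have "?L \<le> (2 + 2 * (B / a)) * P + expo\<^sup>2 * K2\<^sup>2 * t\<^sup>2 + 2 * expo * K2 * b * t ^ 3"
        using inc sl2 sc zero_le_power2[of "increment x y"] zero_le_power2[of "expo * slope x y"]
        unfolding abs_le_iff power_mult_distrib by linarith
      also have "\<dots> \<le> (2 + 2 * (B / a)) * (U * P) + expo\<^sup>2 * K2\<^sup>2 * (U * P) + 2 * expo * K2 * b * (U * P)"
        using UP U2 B(1) a expo_pos K2 b by (intro add_mono mult_left_mono) auto
      also have "\<dots> = K3 * (t ^ (?n + 3) * P)" by (simp add: K3_def U_def algebra_simps)
      also have "t ^ (?n + 3) * P = ?Y ^ (?n + 3) / ?X ^ 5"
      proof -
        have "?n + 3 = (?n - 2) + 5" using card3 by simp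
        then have "?X ^ (?n + 3) = P * ?X ^ 5" unfolding P_def by (metis power_add)
        then show ?thesis using P by (simp add: t_def power_divide)
      qed
      also have "K3 * (?Y ^ (?n + 3) / ?X ^ 5) \<le> K3 * (?Y ^ (?n + 3) / ?X ^ 4)"
      proof -
        have "?X ^ 4 \<le> ?X ^ 5" using X(1) by (intro power_increasing) auto
        then show ?thesis using K3 X0 by (intro mult_left_mono divide_left_mono) auto
      qed
      also have "\<dots> \<le> (K1 + K3) * (?Y ^ (?n + 3) / ?X ^ 4)" using K1 by (intro mult_right_mono) auto
      finally show ?thesis .
    qed
  qed
  show ?thesis
  proof (rule exI[of _ "K1 + K3"], intro conjI)
    show "0 \<le> K1 + K3" using K1 K3 by simp
    show "\<exists>R\<ge>1. \<forall>x y. R \<le> norm (real_vec x) \<longrightarrow>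
     \<bar>(increment x y)\<^sup>2 - expo\<^sup>2 * (slope x y)\<^sup>2 - 2 * expo * slope x y * curvature x y\<bar>
       \<le> (K1 + K3) * (norm (real_vec y) ^ (?n + 3) / norm (real_vec x) ^ 4)"
      using main R1 by (intro exI[of _ "max R1 R2"]) auto
  qed
qed

text \<open>\<open>gradient_has_sum\<close> divided by the Green function at \<open>x\<close>; away from the origin the
  Green function is harmonic.\<close>

lemma increment_has_sum:
  assumes x: "x \<noteq> 0"
  shows "((\<lambda>y. \<mu> y * (increment x y)\<^sup>2) has_sum 2 * w x) UNIV"
proof -
  have G: "0 < green \<mu> x" by (rule green_pos)
  have k: "0 < M / torus_volume TYPE('d)" using M_pos torus_volume_pos[where 'd='d] by simp
  have "((\<lambda>y. (1 / green \<mu> x) * (weight_graph \<mu> x y * (u x - u y)\<^sup>2)) has_sum (1 / green \<mu> x) * (2 * w x * green \<mu> x - laplacian (weight_graph \<mu>) (green \<mu>) x)) UNIV"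
    by (intro has_sum_cmult_right gradient_has_sum)
  moreover have "(1 / green \<mu> x) * (2 * w x * green \<mu> x - laplacian (weight_graph \<mu>) (green \<mu>) x) = 2 * w x"
    using G x by (simp add: laplacian_green)
  moreover have "(1 / green \<mu> x) * (weight_graph \<mu> x y * (u x - u y)\<^sup>2) = weight_graph \<mu> x y * (1 - sqrt (potential y / potential x))\<^sup>2" for y
  proof -
    have "potential y / potential x = green \<mu> y / green \<mu> x" 
      unfolding green_eq using k by (intro mult_divide_mult_cancel_left[symmetric] less_imp_neq[symmetric])
    then have "1 - sqrt (potential y / potential x) = (u x - u y) / sqrt (green \<mu> x)"
      using G by (simp add: u_def real_sqrt_divide diff_divide_distrib)
    then show ?thesis using G by (simp add: power_divide)
  qed
  ultimately have "((\<lambda>y. weight_graph \<mu> x y * (1 - sqrt (potential y / potential x))\<^sup>2) has_sum 2 * w x) UNIV" by (simp only:)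
  moreover have "((\<lambda>y. weight_graph \<mu> x y * (1 - sqrt (potential y / potential x))\<^sup>2) has_sum 2 * w x) UNIV
      \<longleftrightarrow> ((\<lambda>y. \<mu> y * (increment x y)\<^sup>2) has_sum 2 * w x) UNIV"
  proof (rule has_sum_reindex_bij_witness[where i="\<lambda>y. x + y" and j="\<lambda>y. y - x"])
    show "\<mu> (y - x) * (increment x (y - x))\<^sup>2 = weight_graph \<mu> x y * (1 - sqrt (potential y / potential x))\<^sup>2" for y
      using mu_sym[of "x - y"] potential_pos[of x] by (auto simp: weight_graph_def increment_def)
  qed auto
  ultimately show ?thesis by simp
qed

text \<open>Averaging over \<open>y\<close> and \<open>- y\<close> removes the term of third order, \<open>slope x y * curvature x y\<close>. The
  squares of the slopes sum up to \<open>4 / N2 x\<close>.\<close>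

lemma weight_expansion:
  "\<exists>K. \<exists>R\<ge>1. \<forall>x. R \<le> norm (real_vec x) \<longrightarrow> \<bar>w x - 2 * expo\<^sup>2 / N2 x\<bar> \<le> K / norm (real_vec x) ^ 4"
proof -
  let ?n = "CARD('d)"
  obtain K R where K: "0 \<le> K" and R: "1 \<le> R"
    and main: "\<And>x y. R \<le> norm (real_vec x) \<Longrightarrow>
     \<bar>(increment x y)\<^sup>2 - expo\<^sup>2 * (slope x y)\<^sup>2 - 2 * expo * slope x y * curvature x y\<bar>
       \<le> K * (norm (real_vec y) ^ (?n + 3) / norm (real_vec x) ^ 4)"
    using increment_expansion by metis
  define m where "m = (\<Sum>\<^sub>\<infinity>y. \<mu> y * norm (real_vec y) ^ (?n + 3))"
  have m: "((\<lambda>y. \<mu> y * norm (real_vec y) ^ (?n + 3)) has_sum m) UNIV"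
    unfolding m_def by (rule has_sum_infsum[OF moment])
  have "\<bar>w x - 2 * expo\<^sup>2 / N2 x\<bar> \<le> (K * m / 2) / norm (real_vec x) ^ 4" if x: "R \<le> norm (real_vec x)" for x
  proof -
    let ?X = "norm (real_vec x)"
    have X0: "0 < ?X" using x R by linarith
    then have x0: "x \<noteq> 0" by auto
    have N: "N2 x \<noteq> 0"
      using norm_S[of "real_vec x"] dual_form_bounds(1) X0 by (metis mult_pos_pos not_le zero_less_power)
    have h1: "((\<lambda>y. \<mu> y * (increment x y)\<^sup>2) has_sum 2 * w x) UNIV" by (rule increment_has_sum[OF x0])
    have h2: "((\<lambda>y. \<mu> y * (increment x (- y))\<^sup>2) has_sum 2 * w x) UNIV"
      using h1 by (subst has_sum_reindex_bij_witness[where i="\<lambda>y. - y" and j="\<lambda>y. - y" and T=UNIV and h="\<lambda>y. \<mu> y * (increment x y)\<^sup>2"])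
        (auto simp: mu_sym)
    have h3: "((\<lambda>y. (8 * expo\<^sup>2 / (N2 x)\<^sup>2) * (\<mu> y * (polar x y)\<^sup>2)) has_sum (8 * expo\<^sup>2 / (N2 x)\<^sup>2) * N2 x) UNIV"
      by (intro has_sum_cmult_right polar_second_moment)
    let ?f = "\<lambda>y. \<mu> y * (increment x y)\<^sup>2 + \<mu> y * (increment x (- y))\<^sup>2 + - ((8 * expo\<^sup>2 / (N2 x)\<^sup>2) * (\<mu> y * (polar x y)\<^sup>2))"
    let ?s = "2 * w x + 2 * w x + - ((8 * expo\<^sup>2 / (N2 x)\<^sup>2) * N2 x)"
    have h: "(?f has_sum ?s) UNIV"
      by (intro has_sum_add has_sum_uminusI h1 h2 h3)
    have b: "((\<lambda>y. (2 * K / ?X ^ 4) * (\<mu> y * norm (real_vec y) ^ (?n + 3))) has_sum (2 * K / ?X ^ 4) * m) UNIV"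
      by (intro has_sum_cmult_right m)
    have pw: "\<bar>?f y\<bar> \<le> (2 * K / ?X ^ 4) * (\<mu> y * norm (real_vec y) ^ (?n + 3))" for y
    proof -
      have sm: "slope x (- y) = - slope x y" "curvature x (- y) = curvature x y"
        using N2_minus[of y] by (auto simp: slope_def curvature_def polar_minus)
      have "expo\<^sup>2 * (slope x y)\<^sup>2 = 4 * expo\<^sup>2 / (N2 x)\<^sup>2 * (polar x y)\<^sup>2" by (simp add: slope_def power_divide power_mult_distrib)
      then have "?f y = \<mu> y * (((increment x y)\<^sup>2 - expo\<^sup>2 * (slope x y)\<^sup>2 - 2 * expo * slope x y * curvature x y)
          + ((increment x (- y))\<^sup>2 - expo\<^sup>2 * (slope x (- y))\<^sup>2 - 2 * expo * slope x (- y) * curvature x (- y)))"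
        unfolding sm by (simp add: algebra_simps)
      moreover have "\<bar>((increment x y)\<^sup>2 - expo\<^sup>2 * (slope x y)\<^sup>2 - 2 * expo * slope x y * curvature x y)
          + ((increment x (- y))\<^sup>2 - expo\<^sup>2 * (slope x (- y))\<^sup>2 - 2 * expo * slope x (- y) * curvature x (- y))\<bar>
          \<le> 2 * (K * (norm (real_vec y) ^ (?n + 3) / ?X ^ 4))"
        using main[OF x, of y] main[OF x, of "- y"] by simp
      ultimately have "\<bar>?f y\<bar> \<le> \<mu> y * (2 * (K * (norm (real_vec y) ^ (?n + 3) / ?X ^ 4)))"
        using mu_nonneg[of y] by (simp only: abs_mult abs_of_nonneg mult_left_mono)
      then show ?thesis by (simp add: mult_ac)
    qed
    have "?s \<le> (2 * K / ?X ^ 4) * m" by (rule has_sum_mono[OF h b]) (use pw in \<open>simp only: abs_le_iff\<close>)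
    moreover have "- ?s \<le> (2 * K / ?X ^ 4) * m" by (rule has_sum_mono[OF has_sum_uminusI[OF h] b]) (use pw in \<open>simp only: abs_le_iff\<close>)
    moreover have "?s = 4 * (w x - 2 * expo\<^sup>2 / N2 x)" using N by (simp add: power2_eq_square)
    moreover have "(2 * K / ?X ^ 4) * m = 4 * ((K * m / 2) / ?X ^ 4)" by simp
    ultimately have "4 * \<bar>w x - 2 * expo\<^sup>2 / N2 x\<bar> \<le> 4 * ((K * m / 2) / ?X ^ 4)" by (simp only: abs_if split: if_split) auto
    then show ?thesis by simp
  qed
  then show ?thesis using R by blast
qed

lemma scaled_norm_square:
  "(scaled_norm \<mu> v)\<^sup>2 = det (covariance \<mu>) powr (1 / real CARD('d)) * dual_form v"
proof -
  have "(scaled_norm \<mu> v)\<^sup>2 = (det (covariance \<mu>) powr (1 / (2 * real CARD('d))))\<^sup>2 * (norm (S *v v))\<^sup>2"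
    by (simp add: scaled_norm_def scaled_vec_def S_def power_mult_distrib)
  also have "(det (covariance \<mu>) powr (1 / (2 * real CARD('d))))\<^sup>2 = det (covariance \<mu>) powr (1 / real CARD('d))"
    by (simp add: power2_eq_square powr_add[symmetric])
  finally show ?thesis by (simp add: norm_S)
qed

lemma green_hardy_asymptotics:
  "(\<lambda>x. green_hardy \<mu> x -
     (real CARD('d) - 2)\<^sup>2 * det (covariance \<mu>) powr (1 / real CARD('d)) / (8 * (scaled_norm \<mu> (real_vec x))\<^sup>2))
   \<in> O[filtercomap (\<lambda>x. norm (real_vec x)) at_top](\<lambda>x. 1 / norm (real_vec x) ^ 4)"
proof -
  obtain K R where R: "1 \<le> R" and K: "\<And>x. R \<le> norm (real_vec x) \<Longrightarrow> \<bar>w x - 2 * expo\<^sup>2 / N2 x\<bar> \<le> K / norm (real_vec x) ^ 4"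
    using weight_expansion by metis
  have "det (covariance \<mu>) \<noteq> 0" using A_invertible by (simp add: invertible_det_nz)
  then have D: "0 < det (covariance \<mu>) powr (1 / real CARD('d))" by simp
  have eq: "green_hardy \<mu> x - (real CARD('d) - 2)\<^sup>2 * det (covariance \<mu>) powr (1 / real CARD('d)) / (8 * (scaled_norm \<mu> (real_vec x))\<^sup>2)
      = w x - 2 * expo\<^sup>2 / N2 x" for x
    using D by (simp add: green_hardy_eq scaled_norm_square expo_def power_divide)
  show ?thesis unfolding eq
  proof (rule bigoI[of _ K])
    show "\<forall>\<^sub>F x in filtercomap (\<lambda>x. norm (real_vec x)) at_top. norm (w x - 2 * expo\<^sup>2 / N2 x) \<le> K * norm (1 / norm (real_vec x) ^ 4)"
      unfolding eventually_filtercomap_at_top_linorder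
      by (intro exI[of _ R] allI impI) (use K in simp)
  qed
qed

end

theorem theorem4:
  fixes \<mu> :: "int ^ 'd \<Rightarrow> real"
  assumes "transition_weight \<mu>"
    and "CARD('d) \<ge> 3"
  shows "(\<forall>x. set_integrable lborel fourier_cube (green_integrand \<mu> x) \<and>
              green_complex \<mu> x = complex_of_real (green \<mu> x) \<and> 0 < green \<mu> x) \<and>
         (\<lambda>x. sqrt (green \<mu> x)) \<in> form_domain (weight_graph \<mu>) \<and>
         null_critical_hardy_weight (weight_graph \<mu>) (green_hardy \<mu>) \<and>
         ((\<lambda>x. \<mu> x * norm (real_vec x) ^ (CARD('d) + 3)) summable_on UNIV \<longrightarrow>
           (\<lambda>x. green_hardy \<mu> x -
                 (real CARD('d) - 2)\<^sup>2 * det (covariance \<mu>) powr (1 / real CARD('d)) /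
                   (8 * (scaled_norm \<mu> (real_vec x))\<^sup>2))
             \<in> O[filtercomap (\<lambda>x. norm (real_vec x)) at_top](\<lambda>x. 1 / norm (real_vec x) ^ 4))"
proof -
  interpret transient_weight \<mu>
    using assms by unfold_locales auto
  have u: "u = (\<lambda>x. sqrt (green \<mu> x))" by (rule ext) (simp add: u_def)
  show ?thesis
  proof (intro conjI allI impI)
    show "set_integrable lborel fourier_cube (green_integrand \<mu> x)" for x by (rule green_integrable)
    show "green_complex \<mu> x = complex_of_real (green \<mu> x)" for x by (simp add: green_complex_eq green_eq)
    show "0 < green \<mu> x" for x by (rule green_pos)
    show "(\<lambda>x. sqrt (green \<mu> x)) \<in> form_domain (weight_graph \<mu>)" using u_form_domain unfolding u .
    show "null_critical_hardy_weight (weight_graph \<mu>) (green_hardy \<mu>)" unfolding green_hardy_eq by (rule null_critical_w)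
    assume "(\<lambda>x. \<mu> x * norm (real_vec x) ^ (CARD('d) + 3)) summable_on UNIV"
    then interpret moment_weight \<mu> by unfold_locales
    show "(\<lambda>x. green_hardy \<mu> x -
                 (real CARD('d) - 2)\<^sup>2 * det (covariance \<mu>) powr (1 / real CARD('d)) /
                   (8 * (scaled_norm \<mu> (real_vec x))\<^sup>2))
             \<in> O[filtercomap (\<lambda>x. norm (real_vec x)) at_top](\<lambda>x. 1 / norm (real_vec x) ^ 4)"
      by (rule green_hardy_asymptotics)
  qed
qed

end
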